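(* Let $(\mathcal C,\otimes)$ be a $\otimes$-presentable symmetric monoidal $\infty$-category. Let $M$ be a conical manifold with enough good disks and let $\mathcal A$ be a $\mathcal C$-valued factorization algebra on $M$. Then $\mathcal A$ is constructible if and only if it is locally constructible, i.e. if and only if there is an open cover $\mathcal U$ of $M$ such that for each $U\in\mathcal U$ the restriction $\mathcal A|_U$ is a constructible factorization algebra on $U$.
   Context: **Target.** $\otimes$-presentable means: $\mathcal C$ is presentable (in particular has all small colimits) and $\otimes$ preserves small colimits in each variable. **Stratified spaces, cones.** A stratified space is a continuous surjection $X\to P$ from a topological space to a poset $P$ whose open sets are the upward-closed subsets; maps are commutative squares; open subsets inherit a stratification (replace $P$ by the image). The cone is $C(X)=\{0\}\amalg_{\{0\}\times X}([0,\infty)\times X)$, stratified over $\{-\infty\}\star P$ ($P$ with a new minimum): the cone point goes to $-\infty$, and $(s,x)$ with $s>0$ goes to the stratum of $x$. $C(\emptyset)$ is a point. **Conical manifolds** are defined by mutual induction with conical disks. A conical manifold is a second countable Hausdorff stratified space whose open subsets isomorphic (as stratified spaces) to conical disks form a basis of its topology; it has dimension $N$ (resp. $\le N$) if all embedded conical disks do, and $\emptyset$ is a conical manifold of dimension $-1$. A conical disk is a stratified space isomorphic to $C(Z)\times\mathbb R^n$ with $n\ge0$ and $Z$ a compact conical manifold; it has dimension $k+n+1$ (resp. $\le k+n+1$) if $Z$ has dimension $k$ (resp. $\le k$). $\mathrm{disk}(X)$ is the poset of open subsets of $X$ that are finite (possibly empty) disjoint unions of embedded conical disks. Two conical disks are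 abstractly isomorphic if they are isomorphic as stratified spaces. **Factorization algebras.** Let $X$ be Hausdorff and $\mathrm{open}(X)$ its poset of open subsets. The operad $\mathrm{open}(X)^\otimes$ has the open sets as colours; there is exactly one operation $(b_1,\dots,b_n)\to c$ if the $b_i$ are pairwise disjoint and contained in $c$, and none otherwise. A prefactorization algebra on $X$ is a map of $\infty$-operads $\mathcal A:\mathrm{open}(X)^\otimes\to\mathcal C^\otimes$. It is multiplicative if $\bigotimes_i\mathcal A(b_i)\to\mathcal A(b_1\sqcup\dots\sqcup b_n)$ is an equivalence for all pairwise disjoint $b_i$ ($n\ge0$). A set $\mathcal W$ of open subsets of $U$ is a Weiss cover of $U$ if every finite subset of $U$ is contained in some $W\in\mathcal W$. $\mathcal A$ is a Weiss cosheaf if for every open $U$ and every Weiss cover $\mathcal W$ of $U$ the map $\operatorname{colim}_{V:\ \exists W\in\mathcal W,\,V\subseteq W}\mathcal A(V)\to\mathcal A(U)$ is an equivalence. A factorization algebra is a multiplicative prefactorization algebra that is a Weiss cosheaf. It is constructible if $\mathcal A(D)\to\mathcal A(D')$ is an equivalence for every inclusion $D\subseteq D'$ of abstractly isomorphic embedded conical disks in $X$. $\mathcal A|_U$ is the restriction to open subsets of $U$. **Enough good disks.** $X$ has enough good disks if there is a subposet $\mathfrak B\subseteq\mathrm{disk}(X)$ which is a basis for the topology of $X$, contains $\emptyset$, and is closed under disjoint unions of pairs of disjoint members and under binary intersections. *)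

theory Defs
  imports "HOL-Analysis.Analysis"
begin

unbundle cardinal_syntax

section \<open>Simplicial sets\<close>

text \<open>
  The operator \<open>opr X m n t\<close> is the action \<open>X n \<rightarrow> X m\<close> of a monotone map \<open>t : [m] \<rightarrow> [n]\<close>.
  Such a map is given by a function on all of \<open>nat\<close>, of which only the values on \<open>{..m}\<close> matter.
\<close>

record 'a sset =
  cells :: "nat \<Rightarrow> 'a set"
  opr :: "nat \<Rightarrow> nat \<Rightarrow> (nat \<Rightarrow> nat) \<Rightarrow> 'a \<Rightarrow> 'a"

definition delta_map :: "nat \<Rightarrow> nat \<Rightarrow> (nat \<Rightarrow> nat) \<Rightarrow> bool" where
  "delta_map m n t \<longleftrightarrow> (\<forall>i\<le>m. t i \<le> n) \<and> (\<forall>i j. i \<le> j \<longrightarrow> j \<le> m \<longrightarrow> t i \<le> t j)"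

definition simplicial_set :: "'a sset \<Rightarrow> bool" where
  "simplicial_set X \<longleftrightarrow>
     (\<forall>m n t. delta_map m n t \<longrightarrow> (\<forall>x\<in>cells X n. opr X m n t x \<in> cells X m)) \<and>
     (\<forall>n. \<forall>x\<in>cells X n. opr X n n (\<lambda>i. i) x = x) \<and>
     (\<forall>k m n s t. delta_map k m s \<longrightarrow> delta_map m n t \<longrightarrow>
        (\<forall>x\<in>cells X n. opr X k m s (opr X m n t x) = opr X k n (t \<circ> s) x)) \<and>
     (\<forall>m n s t. delta_map m n s \<longrightarrow> (\<forall>i\<le>m. s i = t i) \<longrightarrow>
        (\<forall>x\<in>cells X n. opr X m n s x = opr X m n t x))"

text \<open>Maps are extensional, so that equality of maps is equality of functions.\<close>

definition sset_hom :: "'a sset \<Rightarrow> 'b sset \<Rightarrow> (nat \<Rightarrow> 'a \<Rightarrow> 'b) set" where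
  "sset_hom X Y = {f. (\<forall>n. f n \<in> cells X n \<rightarrow>\<^sub>E cells Y n) \<and>
     (\<forall>m n t. delta_map m n t \<longrightarrow> (\<forall>x\<in>cells X n. f m (opr X m n t x) = opr Y m n t (f n x)))}"

definition sset_id :: "'a sset \<Rightarrow> nat \<Rightarrow> 'a \<Rightarrow> 'a" where
  "sset_id X = (\<lambda>n. \<lambda>x\<in>cells X n. x)"

definition sset_comp :: "'a sset \<Rightarrow> (nat \<Rightarrow> 'b \<Rightarrow> 'c) \<Rightarrow> (nat \<Rightarrow> 'a \<Rightarrow> 'b) \<Rightarrow> nat \<Rightarrow> 'a \<Rightarrow> 'c" where
  "sset_comp X g f = (\<lambda>n. \<lambda>x\<in>cells X n. g n (f n x))"

definition vertex :: "'a sset \<Rightarrow> nat \<Rightarrow> nat \<Rightarrow> 'a \<Rightarrow> 'a" where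
  "vertex X n i = opr X 0 n (\<lambda>_. i)"

definition edge :: "'a sset \<Rightarrow> nat \<Rightarrow> nat \<Rightarrow> nat \<Rightarrow> 'a \<Rightarrow> 'a" where
  "edge X n i j = opr X 1 n (\<lambda>k. if k = 0 then i else j)"

abbreviation source :: "'a sset \<Rightarrow> 'a \<Rightarrow> 'a" where "source X \<equiv> vertex X 1 0"
abbreviation target :: "'a sset \<Rightarrow> 'a \<Rightarrow> 'a" where "target X \<equiv> vertex X 1 1"

definition const_cell :: "'a sset \<Rightarrow> nat \<Rightarrow> 'a \<Rightarrow> 'a" where
  "const_cell X n = opr X n 0 (\<lambda>_. 0)"

definition degenerate :: "'a sset \<Rightarrow> nat \<Rightarrow> 'a \<Rightarrow> bool" where
  "degenerate X n x \<longleftrightarrow> (\<exists>m<n. \<exists>y\<in>cells X m. \<exists>t. delta_map n m t \<and> x = opr X n m t y)"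

text \<open>The standard simplex, whose \<open>m\<close>-cells are the monotone maps \<open>[m] \<rightarrow> [n]\<close>.\<close>

definition std_simplex :: "nat \<Rightarrow> (nat \<Rightarrow> nat) sset" where
  "std_simplex n = \<lparr> cells = (\<lambda>m. {s \<in> extensional {..m}. delta_map m n s}),
                 opr = (\<lambda>m k t s. \<lambda>i\<in>{..m}. s (t i)) \<rparr>"

definition boundary :: "nat \<Rightarrow> (nat \<Rightarrow> nat) sset" where
  "boundary n = (std_simplex n)
     \<lparr> cells := (\<lambda>m. {s \<in> cells (std_simplex n) m. \<exists>i\<le>n. i \<notin> s ` {..m}}) \<rparr>"

definition horn :: "nat \<Rightarrow> nat \<Rightarrow> (nat \<Rightarrow> nat) sset" where
  "horn n k = (std_simplex n)
     \<lparr> cells := (\<lambda>m. {s \<in> cells (std_simplex n) m. \<exists>i\<le>n. i \<noteq> k \<and> i \<notin> s ` {..m}}) \<rparr>"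

definition prod_sset :: "'a sset \<Rightarrow> 'b sset \<Rightarrow> ('a \<times> 'b) sset" where
  "prod_sset X Y = \<lparr> cells = (\<lambda>n. cells X n \<times> cells Y n),
                     opr = (\<lambda>m n t (x, y). (opr X m n t x, opr Y m n t y)) \<rparr>"

definition power_sset :: "'i set \<Rightarrow> 'a sset \<Rightarrow> ('i \<Rightarrow> 'a) sset" where
  "power_sset I X = \<lparr> cells = (\<lambda>n. I \<rightarrow>\<^sub>E cells X n),
                      opr = (\<lambda>m n t x. \<lambda>i\<in>I. opr X m n t (x i)) \<rparr>"

definition fun_sset :: "'a sset \<Rightarrow> 'b sset \<Rightarrow> (nat \<Rightarrow> 'a \<times> (nat \<Rightarrow> nat) \<Rightarrow> 'b) sset" where
  "fun_sset X Y = \<lparr> cells = (\<lambda>n. sset_hom (prod_sset X (std_simplex n)) Y),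
     opr = (\<lambda>m n t f. \<lambda>k. \<lambda>(x, s)\<in>cells (prod_sset X (std_simplex m)) k. f k (x, \<lambda>i\<in>{..k}. t (s i))) \<rparr>"

definition fun_vertex :: "'a sset \<Rightarrow> (nat \<Rightarrow> 'a \<Rightarrow> 'b) \<Rightarrow> nat \<Rightarrow> 'a \<times> (nat \<Rightarrow> nat) \<Rightarrow> 'b" where
  "fun_vertex X f = (\<lambda>k. \<lambda>(x, s)\<in>cells (prod_sset X (std_simplex 0)) k. f k x)"

text \<open>
  A cell of dimension \<open>n\<close> of the join of \<open>K\<close> and \<open>L\<close> is a cell of \<open>K\<close>, a cell of \<open>L\<close>, or
  \<open>JBoth i x y\<close> with \<open>x\<close> of dimension \<open>i\<close> and \<open>y\<close> of dimension \<open>n - i - 1\<close>.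
\<close>

datatype ('a, 'b) join_cell = JLeft 'a | JRight 'b | JBoth nat 'a 'b

definition join_opr :: "'a sset \<Rightarrow> 'b sset \<Rightarrow> nat \<Rightarrow> nat \<Rightarrow> (nat \<Rightarrow> nat) \<Rightarrow>
    ('a, 'b) join_cell \<Rightarrow> ('a, 'b) join_cell" where
  "join_opr K L m n t z = (case z of
       JLeft x \<Rightarrow> JLeft (opr K m n t x)
     | JRight y \<Rightarrow> JRight (opr L m n t y)
     | JBoth i x y \<Rightarrow>
        (let a = card {k. k \<le> m \<and> t k \<le> i} in
         if a = 0 then JRight (opr L m (n - i - 1) (\<lambda>k. t k - (i + 1)) y)
         else if a = m + 1 then JLeft (opr K m i t x)
         else JBoth (a - 1) (opr K (a - 1) i t x)
                (opr L (m - a) (n - i - 1) (\<lambda>k. t (k + a) - (i + 1)) y)))"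

definition join :: "'a sset \<Rightarrow> 'b sset \<Rightarrow> ('a, 'b) join_cell sset" where
  "join K L = \<lparr> cells = (\<lambda>n. JLeft ` cells K n \<union> JRight ` cells L n \<union>
                   {JBoth i x y | i x y. i < n \<and> x \<in> cells K i \<and> y \<in> cells L (n - i - 1)}),
                opr = join_opr K L \<rparr>"

abbreviation right_cone :: "'a sset \<Rightarrow> ('a, nat \<Rightarrow> nat) join_cell sset" where
  "right_cone K \<equiv> join K (std_simplex 0)"

section \<open>Quasi-categories\<close>

text \<open>
  A cell \<open>s\<close> of \<open>horn n k\<close> is itself a monotone map into \<open>[n]\<close>, so the map from \<open>std_simplex n\<close> to \<open>C\<close>
  corresponding to \<open>x \<in> cells C n\<close> sends it to \<open>opr C m n s x\<close>.
\<close>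

definition quasicategory :: "'a sset \<Rightarrow> bool" where
  "quasicategory C \<longleftrightarrow> simplicial_set C \<and>
     (\<forall>n k. \<forall>h\<in>sset_hom (horn n k) C. 0 < k \<longrightarrow> k < n \<longrightarrow>
        (\<exists>x\<in>cells C n. \<forall>m. \<forall>s\<in>cells (horn n k) m. opr C m n s x = h m s))"

definition kan_complex :: "'a sset \<Rightarrow> bool" where
  "kan_complex C \<longleftrightarrow> simplicial_set C \<and>
     (\<forall>n k. \<forall>h\<in>sset_hom (horn n k) C. 1 \<le> n \<longrightarrow> k \<le> n \<longrightarrow>
        (\<exists>x\<in>cells C n. \<forall>m. \<forall>s\<in>cells (horn n k) m. opr C m n s x = h m s))"

definition equivalence_edge :: "'a sset \<Rightarrow> 'a \<Rightarrow> bool" where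
  "equivalence_edge C e \<longleftrightarrow> e \<in> cells C 1 \<and>
     (\<exists>g\<in>cells C 1. \<exists>u\<in>cells C 2. \<exists>v\<in>cells C 2.
        edge C 2 0 1 u = e \<and> edge C 2 1 2 u = g \<and> edge C 2 0 2 u = const_cell C 1 (source C e) \<and>
        edge C 2 0 1 v = g \<and> edge C 2 1 2 v = e \<and> edge C 2 0 2 v = const_cell C 1 (target C e))"

definition naturally_equivalent ::
    "'a sset \<Rightarrow> 'b sset \<Rightarrow> (nat \<Rightarrow> 'a \<Rightarrow> 'b) \<Rightarrow> (nat \<Rightarrow> 'a \<Rightarrow> 'b) \<Rightarrow> bool" where
  "naturally_equivalent C D F G \<longleftrightarrow>
     (\<exists>e. equivalence_edge (fun_sset C D) e \<and>
        source (fun_sset C D) e = fun_vertex C F \<and> target (fun_sset C D) e = fun_vertex C G)"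

definition categorical_equivalence :: "'a sset \<Rightarrow> 'b sset \<Rightarrow> (nat \<Rightarrow> 'a \<Rightarrow> 'b) \<Rightarrow> bool" where
  "categorical_equivalence C D F \<longleftrightarrow> F \<in> sset_hom C D \<and>
     (\<exists>G\<in>sset_hom D C. naturally_equivalent C C (sset_comp C G F) (sset_id C) \<and>
        naturally_equivalent D D (sset_comp D F G) (sset_id D))"

definition full_sub :: "'a sset \<Rightarrow> 'a set \<Rightarrow> 'a sset" where
  "full_sub C S = C \<lparr> cells := (\<lambda>n. {x \<in> cells C n. \<forall>i\<le>n. vertex C n i x \<in> S}) \<rparr>"

subsection \<open>Colimits\<close>

definition initial_object :: "'a sset \<Rightarrow> 'a \<Rightarrow> bool" where
  "initial_object C v \<longleftrightarrow> v \<in> cells C 0 \<and>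
     (\<forall>n\<ge>1. \<forall>h\<in>sset_hom (boundary n) C. h 0 (\<lambda>i\<in>{..0}. 0) = v \<longrightarrow>
        (\<exists>x\<in>cells C n. \<forall>m. \<forall>s\<in>cells (boundary n) m. opr C m n s x = h m s))"

definition join_map_right :: "(nat \<Rightarrow> nat) \<Rightarrow> nat \<Rightarrow>
    ('a, nat \<Rightarrow> nat) join_cell \<Rightarrow> ('a, nat \<Rightarrow> nat) join_cell" where
  "join_map_right t k z = (case z of
       JLeft x \<Rightarrow> JLeft x
     | JRight s \<Rightarrow> JRight (\<lambda>i\<in>{..k}. t (s i))
     | JBoth i x s \<Rightarrow> JBoth i x (\<lambda>j\<in>{..k - i - 1}. t (s j)))"

definition under :: "'c sset \<Rightarrow> 'k sset \<Rightarrow> (nat \<Rightarrow> 'k \<Rightarrow> 'c) \<Rightarrow>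
    (nat \<Rightarrow> ('k, nat \<Rightarrow> nat) join_cell \<Rightarrow> 'c) sset" where
  "under C K f = \<lparr>
     cells = (\<lambda>n. {g \<in> sset_hom (join K (std_simplex n)) C. \<forall>k. \<forall>x\<in>cells K k. g k (JLeft x) = f k x}),
     opr = (\<lambda>m n t g. \<lambda>k. \<lambda>z\<in>cells (join K (std_simplex m)) k. g k (join_map_right t k z)) \<rparr>"

definition cone_base :: "'k sset \<Rightarrow> (nat \<Rightarrow> ('k, nat \<Rightarrow> nat) join_cell \<Rightarrow> 'c) \<Rightarrow> nat \<Rightarrow> 'k \<Rightarrow> 'c" where
  "cone_base K q = (\<lambda>n. \<lambda>x\<in>cells K n. q n (JLeft x))"

definition cone_tip :: "(nat \<Rightarrow> ('k, nat \<Rightarrow> nat) join_cell \<Rightarrow> 'c) \<Rightarrow> 'c" where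
  "cone_tip q = q 0 (JRight (\<lambda>i\<in>{..0}. 0))"

definition colimit_cocone ::
    "'c sset \<Rightarrow> 'k sset \<Rightarrow> (nat \<Rightarrow> ('k, nat \<Rightarrow> nat) join_cell \<Rightarrow> 'c) \<Rightarrow> bool" where
  "colimit_cocone C K q \<longleftrightarrow>
     q \<in> sset_hom (right_cone K) C \<and> initial_object (under C K (cone_base K q)) q"

subsection \<open>Weak homotopy equivalences\<close>

definition homotopic_maps :: "'a sset \<Rightarrow> 'b sset \<Rightarrow> (nat \<Rightarrow> 'a \<Rightarrow> 'b) \<Rightarrow> (nat \<Rightarrow> 'a \<Rightarrow> 'b) \<Rightarrow> bool" where
  "homotopic_maps X Z f g \<longleftrightarrow>
     (\<exists>e\<in>cells (fun_sset X Z) 1.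
        source (fun_sset X Z) e = fun_vertex X f \<and> target (fun_sset X Z) e = fun_vertex X g)"

text \<open>
  Precomposition with \<open>f\<close> is a bijection on homotopy classes of maps into Kan complexes. It suffices
  to test on Kan complexes with cells in \<open>('a + 'b + nat) list\<close>: this type has room for fibrant
  replacements of \<open>X\<close> and \<open>Y\<close>, such as those obtained from Kan's functor \<open>Ex\<close>, whose
  cells in each dimension consist of finitely many cells of the given simplicial set.
\<close>

definition weak_homotopy_equivalence :: "'a sset \<Rightarrow> 'b sset \<Rightarrow> (nat \<Rightarrow> 'a \<Rightarrow> 'b) \<Rightarrow> bool" where
  "weak_homotopy_equivalence X Y f \<longleftrightarrow> f \<in> sset_hom X Y \<and>
     (\<forall>Z :: ('a + 'b + nat) list sset. kan_complex Z \<longrightarrow>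
        (\<forall>g\<in>sset_hom X Z. \<exists>h\<in>sset_hom Y Z. homotopic_maps X Z (sset_comp X h f) g) \<and>
        (\<forall>h\<in>sset_hom Y Z. \<forall>h'\<in>sset_hom Y Z.
           homotopic_maps X Z (sset_comp X h f) (sset_comp X h' f) \<longrightarrow> homotopic_maps Y Z h h'))"

section \<open>Presentability\<close>

text \<open>
  Smallness is relative to a universe, given by an uncountable strongly inaccessible cardinal \<open>r\<close>.
  Up to isomorphism every small simplicial set has its cells in the type \<open>'u\<close> underlying \<open>r\<close>.
\<close>

definition universe :: "'u rel \<Rightarrow> bool" where
  "universe r \<longleftrightarrow> Card_order r \<and> natLeq <o r \<and> regularCard r \<and>
     (\<forall>A :: 'u set. |A| <o r \<longrightarrow> |Pow A| <o r)"

definition small_sset :: "'u rel \<Rightarrow> 'a sset \<Rightarrow> bool" where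
  "small_sset \<kappa> K \<longleftrightarrow> |{(n, x). x \<in> cells K n \<and> \<not> degenerate K n x}| <o \<kappa>"

definition has_small_colimits :: "'u rel \<Rightarrow> 'c sset \<Rightarrow> bool" where
  "has_small_colimits r C \<longleftrightarrow>
     (\<forall>K :: 'u sset. \<forall>f\<in>sset_hom K C. simplicial_set K \<longrightarrow> small_sset r K \<longrightarrow>
        (\<exists>q. colimit_cocone C K q \<and> cone_base K q = f))"

definition preserves_small_colimits :: "'u rel \<Rightarrow> 'c sset \<Rightarrow> 'd sset \<Rightarrow> (nat \<Rightarrow> 'c \<Rightarrow> 'd) \<Rightarrow> bool" where
  "preserves_small_colimits r C D F \<longleftrightarrow>
     (\<forall>K :: 'u sset. \<forall>q. simplicial_set K \<longrightarrow> small_sset r K \<longrightarrow> colimit_cocone C K q \<longrightarrow>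
        colimit_cocone D K (sset_comp (right_cone K) F q))"

definition essentially_small :: "'u rel \<Rightarrow> 'c sset \<Rightarrow> bool" where
  "essentially_small r C \<longleftrightarrow>
     (\<exists>(K :: 'u sset) F. quasicategory K \<and> small_sset r K \<and> categorical_equivalence K C F)"

definition filtered :: "'u rel \<Rightarrow> 'k sset \<Rightarrow> bool" where
  "filtered \<kappa> K \<longleftrightarrow> quasicategory K \<and>
     (\<forall>L :: 'u sset. \<forall>f\<in>sset_hom L K. simplicial_set L \<longrightarrow> small_sset \<kappa> L \<longrightarrow>
        (\<exists>g\<in>sset_hom (right_cone L) K. cone_base L g = f))"

text \<open>The left fibration from the slice of \<open>C\<close> under an object \<open>x\<close> to \<open>C\<close>.\<close>

definition coslice :: "'c sset \<Rightarrow> 'c \<Rightarrow> 'c sset" where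
  "coslice C x = \<lparr> cells = (\<lambda>n. {y \<in> cells C (n + 1). vertex C (n + 1) 0 y = x}),
     opr = (\<lambda>m n t. opr C (m + 1) (n + 1) (\<lambda>k. if k = 0 then 0 else t (k - 1) + 1)) \<rparr>"

definition coslice_proj :: "'c sset \<Rightarrow> nat \<Rightarrow> 'c \<Rightarrow> 'c" where
  "coslice_proj C n = opr C n (n + 1) (\<lambda>k. k + 1)"

definition coslice_pullback :: "'c sset \<Rightarrow> 'c \<Rightarrow> 'k sset \<Rightarrow> (nat \<Rightarrow> 'k \<Rightarrow> 'c) \<Rightarrow> ('c \<times> 'k) sset" where
  "coslice_pullback C x K f = (prod_sset (coslice C x) K)
     \<lparr> cells := (\<lambda>n. {(y, z). y \<in> cells (coslice C x) n \<and> z \<in> cells K n \<and> coslice_proj C n y = f n z}) \<rparr>"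

text \<open>
  The object \<open>x\<close> is compact if the functor corepresented by \<open>x\<close> preserves \<open>\<kappa>\<close>-filtered colimits.
  That functor is classified by \<open>coslice C x \<rightarrow> C\<close>, and the colimit of a diagram of spaces is the
  total space of the left fibration classifying it; a cocone of spaces on \<open>K\<close> is therefore a colimit
  if and only if the restriction to \<open>K\<close> of the left fibration classifying it has the same weak
  homotopy type as the whole.
\<close>

definition compact_object :: "'u rel \<Rightarrow> 'u rel \<Rightarrow> 'c sset \<Rightarrow> 'c \<Rightarrow> bool" where
  "compact_object r \<kappa> C x \<longleftrightarrow> x \<in> cells C 0 \<and>
     (\<forall>K :: 'u sset. \<forall>q. small_sset r K \<longrightarrow> filtered \<kappa> K \<longrightarrow> colimit_cocone C K q \<longrightarrow>
        weak_homotopy_equivalence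
          (coslice_pullback C x K (cone_base K q)) (coslice_pullback C x (right_cone K) q)
          (\<lambda>n. \<lambda>(y, z)\<in>cells (coslice_pullback C x K (cone_base K q)) n. (y, JLeft z)))"

definition accessible :: "'u rel \<Rightarrow> 'c sset \<Rightarrow> bool" where
  "accessible r C \<longleftrightarrow> quasicategory C \<and>
     (\<exists>\<kappa> :: 'u rel. Card_order \<kappa> \<and> natLeq \<le>o \<kappa> \<and> regularCard \<kappa> \<and> \<kappa> <o r \<and>
        (\<forall>K :: 'u sset. \<forall>f\<in>sset_hom K C. small_sset r K \<longrightarrow> filtered \<kappa> K \<longrightarrow>
           (\<exists>q. colimit_cocone C K q \<and> cone_base K q = f)) \<and>
        (\<exists>S. essentially_small r (full_sub C S) \<and> (\<forall>x\<in>S. compact_object r \<kappa> C x) \<and>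
           (\<forall>y\<in>cells C 0. \<exists>(K :: 'u sset) q. small_sset r K \<and> filtered \<kappa> K \<and>
              colimit_cocone C K q \<and> cone_tip q = y \<and> (\<forall>z\<in>cells K 0. q 0 (JLeft z) \<in> S))))"

definition presentable :: "'u rel \<Rightarrow> 'c sset \<Rightarrow> bool" where
  "presentable r C \<longleftrightarrow> accessible r C \<and> has_small_colimits r C"

section \<open>Nerves and finite pointed sets\<close>

record ('o, 'm) cat =
  obj :: "'o set"
  hom :: "'o \<Rightarrow> 'o \<Rightarrow> 'm set"
  comp :: "'m \<Rightarrow> 'm \<Rightarrow> 'm"
  ident :: "'o \<Rightarrow> 'm"

text \<open>
  A cell \<open>(x, f)\<close> of dimension \<open>n\<close> is a functor \<open>[n] \<rightarrow> K\<close>, with objects \<open>x i\<close> and with morphisms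
  \<open>f i j\<close> for \<open>i \<le> j \<le> n\<close>.
\<close>

type_synonym ('o, 'm) nerve_cell = "(nat \<Rightarrow> 'o) \<times> (nat \<Rightarrow> nat \<Rightarrow> 'm)"

definition arrows :: "nat \<Rightarrow> (nat \<Rightarrow> nat \<Rightarrow> 'm) \<Rightarrow> nat \<Rightarrow> nat \<Rightarrow> 'm" where
  "arrows n f = (\<lambda>i j. if i \<le> j \<and> j \<le> n then f i j else undefined)"

definition nerve :: "('o, 'm) cat \<Rightarrow> ('o, 'm) nerve_cell sset" where
  "nerve K = \<lparr>
     cells = (\<lambda>n. {(x, f). x \<in> {..n} \<rightarrow>\<^sub>E obj K \<and> f = arrows n f \<and>
        (\<forall>i j. i \<le> j \<longrightarrow> j \<le> n \<longrightarrow> f i j \<in> hom K (x i) (x j)) \<and>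
        (\<forall>i\<le>n. f i i = ident K (x i)) \<and>
        (\<forall>i j k. i \<le> j \<longrightarrow> j \<le> k \<longrightarrow> k \<le> n \<longrightarrow> f i k = comp K (f j k) (f i j))}),
     opr = (\<lambda>m n t (x, f). (\<lambda>i\<in>{..m}. x (t i), arrows m (\<lambda>i j. f (t i) (t j)))) \<rparr>"

definition nerve_vertex :: "('o, 'm) cat \<Rightarrow> 'o \<Rightarrow> ('o, 'm) nerve_cell" where
  "nerve_vertex K a = (\<lambda>i\<in>{..0}. a, arrows 0 (\<lambda>i j. ident K a))"

definition nerve_edge :: "('o, 'm) cat \<Rightarrow> 'o \<Rightarrow> 'o \<Rightarrow> 'm \<Rightarrow> ('o, 'm) nerve_cell" where
  "nerve_edge K a b f =
     (\<lambda>i\<in>{..1}. if i = 0 then a else b,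
      arrows 1 (\<lambda>i j. if i < j then f else ident K (if i = 0 then a else b)))"

text \<open>
  The finite pointed set \<open>{0..n}\<close> with base point \<open>0\<close> is represented by \<open>n\<close>. A pointed map is
  extended by \<open>0\<close>, so that composition of pointed maps is composition of functions.
\<close>

definition pointed_maps :: "nat \<Rightarrow> nat \<Rightarrow> (nat \<Rightarrow> nat) set" where
  "pointed_maps m n = {\<alpha>. \<alpha> 0 = 0 \<and> (\<forall>i\<le>m. \<alpha> i \<le> n) \<and> (\<forall>i>m. \<alpha> i = 0)}"

definition pointed_id :: "nat \<Rightarrow> nat \<Rightarrow> nat" where
  "pointed_id n = (\<lambda>i. if i \<le> n then i else 0)"

definition fin_cat :: "(nat, nat \<Rightarrow> nat) cat" where
  "fin_cat = \<lparr> obj = UNIV, hom = pointed_maps, comp = (\<circ>), ident = pointed_id \<rparr>"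

type_synonym fin_cell = "(nat, nat \<Rightarrow> nat) nerve_cell"

abbreviation NFin :: "fin_cell sset" where "NFin \<equiv> nerve fin_cat"

definition inert :: "nat \<Rightarrow> nat \<Rightarrow> (nat \<Rightarrow> nat) \<Rightarrow> bool" where
  "inert m n \<alpha> \<longleftrightarrow> \<alpha> \<in> pointed_maps m n \<and> (\<forall>j\<in>{1..n}. \<exists>!i. i \<in> {1..m} \<and> \<alpha> i = j)"

text \<open>The inert map from \<open>{0..n}\<close> to \<open>{0..1}\<close> selecting \<open>i\<close>, and the active map.\<close>

definition select_map :: "nat \<Rightarrow> nat \<Rightarrow> nat" where
  "select_map i = (\<lambda>j. if j = i then 1 else 0)"

definition mult_map :: "nat \<Rightarrow> nat \<Rightarrow> nat" where
  "mult_map n = (\<lambda>j. if 1 \<le> j \<and> j \<le> n then 1 else 0)"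

section \<open>Symmetric monoidal infinity-categories\<close>

definition inner_fibration :: "'e sset \<Rightarrow> 'b sset \<Rightarrow> (nat \<Rightarrow> 'e \<Rightarrow> 'b) \<Rightarrow> bool" where
  "inner_fibration E B p \<longleftrightarrow> simplicial_set E \<and> simplicial_set B \<and> p \<in> sset_hom E B \<and>
     (\<forall>n k. \<forall>h\<in>sset_hom (horn n k) E. \<forall>b\<in>cells B n. 0 < k \<longrightarrow> k < n \<longrightarrow>
        (\<forall>m. \<forall>s\<in>cells (horn n k) m. p m (h m s) = opr B m n s b) \<longrightarrow>
        (\<exists>x\<in>cells E n. p n x = b \<and> (\<forall>m. \<forall>s\<in>cells (horn n k) m. opr E m n s x = h m s)))"

definition cocartesian_edge :: "'e sset \<Rightarrow> 'b sset \<Rightarrow> (nat \<Rightarrow> 'e \<Rightarrow> 'b) \<Rightarrow> 'e \<Rightarrow> bool" where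
  "cocartesian_edge E B p e \<longleftrightarrow> e \<in> cells E 1 \<and>
     (\<forall>n\<ge>2. \<forall>h\<in>sset_hom (horn n 0) E. \<forall>b\<in>cells B n. h 1 (\<lambda>i\<in>{..1}. i) = e \<longrightarrow>
        (\<forall>m. \<forall>s\<in>cells (horn n 0) m. p m (h m s) = opr B m n s b) \<longrightarrow>
        (\<exists>x\<in>cells E n. p n x = b \<and> (\<forall>m. \<forall>s\<in>cells (horn n 0) m. opr E m n s x = h m s)))"

definition cocartesian_fibration :: "'e sset \<Rightarrow> 'b sset \<Rightarrow> (nat \<Rightarrow> 'e \<Rightarrow> 'b) \<Rightarrow> bool" where
  "cocartesian_fibration E B p \<longleftrightarrow> inner_fibration E B p \<and>
     (\<forall>f\<in>cells B 1. \<forall>x\<in>cells E 0. p 0 x = source B f \<longrightarrow>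
        (\<exists>e. cocartesian_edge E B p e \<and> p 1 e = f \<and> source E e = x))"

definition fibre :: "'e sset \<Rightarrow> 'b sset \<Rightarrow> (nat \<Rightarrow> 'e \<Rightarrow> 'b) \<Rightarrow> 'b \<Rightarrow> 'e sset" where
  "fibre E B p b = E \<lparr> cells := (\<lambda>n. {x \<in> cells E n. p n x = const_cell B n b}) \<rparr>"

text \<open>
  The functor \<open>F\<close> between fibres is a cocartesian pushforward along the edge \<open>f\<close> of \<open>B\<close>. A cell
  \<open>s\<close> of \<open>std_simplex 1\<close> is an operator, and \<open>opr B n 1 s f\<close> is its image under the map classifying \<open>f\<close>.
\<close>

definition pushforward :: "'e sset \<Rightarrow> 'b sset \<Rightarrow> (nat \<Rightarrow> 'e \<Rightarrow> 'b) \<Rightarrow> 'b \<Rightarrow> (nat \<Rightarrow> 'e \<Rightarrow> 'e) \<Rightarrow> bool" where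
  "pushforward E B p f F \<longleftrightarrow>
     (let Ea = fibre E B p (source B f); Eb = fibre E B p (target B f) in
      F \<in> sset_hom Ea Eb \<and>
      (\<exists>H\<in>sset_hom (prod_sset Ea (std_simplex 1)) E.
         (\<forall>n. \<forall>(x, s)\<in>cells (prod_sset Ea (std_simplex 1)) n. p n (H n (x, s)) = opr B n 1 s f) \<and>
         (\<forall>n. \<forall>x\<in>cells Ea n. H n (x, \<lambda>i\<in>{..n}. 0) = x \<and> H n (x, \<lambda>i\<in>{..n}. 1) = F n x) \<and>
         (\<forall>x\<in>cells Ea 0. cocartesian_edge E B p (H 1 (const_cell Ea 1 x, \<lambda>i\<in>{..1}. i)))))"

text \<open>
  A symmetric monoidal infinity-category is given by its total space \<open>C\<close> and its projection \<open>p\<close> to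
  the nerve of finite pointed sets; the underlying infinity-category is \<open>tensor_fibre C p 1\<close>.
\<close>

abbreviation tensor_fibre :: "'c sset \<Rightarrow> (nat \<Rightarrow> 'c \<Rightarrow> fin_cell) \<Rightarrow> nat \<Rightarrow> 'c sset" where
  "tensor_fibre C p n \<equiv> fibre C NFin p (nerve_vertex fin_cat n)"

definition symmetric_monoidal :: "'c sset \<Rightarrow> (nat \<Rightarrow> 'c \<Rightarrow> fin_cell) \<Rightarrow> bool" where
  "symmetric_monoidal C p \<longleftrightarrow> cocartesian_fibration C NFin p \<and>
     (\<forall>n. \<exists>F. (\<forall>i\<in>{1..n}. pushforward C NFin p (nerve_edge fin_cat n 1 (select_map i)) (F i)) \<and>
        categorical_equivalence (tensor_fibre C p n) (power_sset {1..n} (tensor_fibre C p 1))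
          (\<lambda>k. \<lambda>x\<in>cells (tensor_fibre C p n) k. \<lambda>i\<in>{1..n}. F i k x))"

definition tensor_functor :: "'c sset \<Rightarrow> (nat \<Rightarrow> 'c \<Rightarrow> fin_cell) \<Rightarrow> (nat \<Rightarrow> 'c \<times> 'c \<Rightarrow> 'c) \<Rightarrow> bool" where
  "tensor_functor C p T \<longleftrightarrow>
     T \<in> sset_hom (prod_sset (tensor_fibre C p 1) (tensor_fibre C p 1)) (tensor_fibre C p 1) \<and>
     (\<exists>F1 F2 G. pushforward C NFin p (nerve_edge fin_cat 2 1 (select_map 1)) F1 \<and>
        pushforward C NFin p (nerve_edge fin_cat 2 1 (select_map 2)) F2 \<and>
        pushforward C NFin p (nerve_edge fin_cat 2 1 (mult_map 2)) G \<and>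
        naturally_equivalent (tensor_fibre C p 2) (tensor_fibre C p 1)
          (\<lambda>n. \<lambda>x\<in>cells (tensor_fibre C p 2) n. T n (F1 n x, F2 n x)) G)"

definition tensor_presentable :: "'u rel \<Rightarrow> 'c sset \<Rightarrow> (nat \<Rightarrow> 'c \<Rightarrow> fin_cell) \<Rightarrow> bool" where
  "tensor_presentable r C p \<longleftrightarrow>
     (let C1 = tensor_fibre C p 1 in presentable r C1 \<and>
        (\<exists>T. tensor_functor C p T \<and> (\<forall>x\<in>cells C1 0.
           preserves_small_colimits r C1 C1 (\<lambda>n. \<lambda>y\<in>cells C1 n. T n (const_cell C1 n x, y)) \<and>
           preserves_small_colimits r C1 C1 (\<lambda>n. \<lambda>y\<in>cells C1 n. T n (y, const_cell C1 n x)))))"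

section \<open>Factorization algebras\<close>

text \<open>
  The category of operators of the operad of open subsets. The list \<open>bs\<close> stands for the tuple of
  colours \<open>bs ! 0, bs ! 1, \<dots>\<close>, where \<open>bs ! (i - 1)\<close> belongs to the element \<open>i\<close> of
  \<open>{1..length bs}\<close>. As there is at most one operation in each arity, a morphism over \<open>\<alpha>\<close> is
  determined by \<open>\<alpha>\<close>.
\<close>

definition open_hom :: "'a set list \<Rightarrow> 'a set list \<Rightarrow> (nat \<Rightarrow> nat) set" where
  "open_hom bs cs = {\<alpha> \<in> pointed_maps (length bs) (length cs).
     (\<forall>i\<in>{1..length bs}. \<alpha> i \<noteq> 0 \<longrightarrow> bs ! (i - 1) \<subseteq> cs ! (\<alpha> i - 1)) \<and>
     (\<forall>i\<in>{1..length bs}. \<forall>j\<in>{1..length bs}. i \<noteq> j \<longrightarrow> \<alpha> i = \<alpha> j \<longrightarrow> \<alpha> i \<noteq> 0 \<longrightarrow>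
        bs ! (i - 1) \<inter> bs ! (j - 1) = {})}"

definition open_cat :: "'a topology \<Rightarrow> ('a set list, nat \<Rightarrow> nat) cat" where
  "open_cat X = \<lparr> obj = lists {U. openin X U}, hom = open_hom, comp = (\<circ>),
                  ident = (\<lambda>bs. pointed_id (length bs)) \<rparr>"

type_synonym 'a open_cell = "('a set list, nat \<Rightarrow> nat) nerve_cell"

abbreviation open_operad :: "'a topology \<Rightarrow> 'a open_cell sset" where
  "open_operad X \<equiv> nerve (open_cat X)"

definition open_proj :: "'a topology \<Rightarrow> nat \<Rightarrow> 'a open_cell \<Rightarrow> fin_cell" where
  "open_proj X = (\<lambda>n. \<lambda>(x, f)\<in>cells (open_operad X) n. (\<lambda>i\<in>{..n}. length (x i), f))"

definition inert_edge :: "'e sset \<Rightarrow> (nat \<Rightarrow> 'e \<Rightarrow> fin_cell) \<Rightarrow> 'e \<Rightarrow> bool" where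
  "inert_edge E p e \<longleftrightarrow> cocartesian_edge E NFin p e \<and>
     (\<exists>m n \<alpha>. inert m n \<alpha> \<and> p 1 e = nerve_edge fin_cat m n \<alpha>)"

definition operad_map :: "'d sset \<Rightarrow> (nat \<Rightarrow> 'd \<Rightarrow> fin_cell) \<Rightarrow>
    'e sset \<Rightarrow> (nat \<Rightarrow> 'e \<Rightarrow> fin_cell) \<Rightarrow> (nat \<Rightarrow> 'd \<Rightarrow> 'e) \<Rightarrow> bool" where
  "operad_map D q E p A \<longleftrightarrow> A \<in> sset_hom D E \<and>
     (\<forall>n. \<forall>x\<in>cells D n. p n (A n x) = q n x) \<and>
     (\<forall>e. inert_edge D q e \<longrightarrow> inert_edge E p (A 1 e))"

type_synonym ('a, 'c) prefact = "nat \<Rightarrow> 'a open_cell \<Rightarrow> 'c"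

definition prefactorization_algebra ::
    "'c sset \<Rightarrow> (nat \<Rightarrow> 'c \<Rightarrow> fin_cell) \<Rightarrow> 'a topology \<Rightarrow> ('a, 'c) prefact \<Rightarrow> bool" where
  "prefactorization_algebra C p X A \<longleftrightarrow> operad_map (open_operad X) (open_proj X) C p A"

definition restrict_prefact :: "'a topology \<Rightarrow> 'a set \<Rightarrow> ('a, 'c) prefact \<Rightarrow> ('a, 'c) prefact" where
  "restrict_prefact X U A = (\<lambda>n. restrict (A n) (cells (open_operad (subtopology X U)) n))"

text \<open>
  For a cocartesian edge \<open>edge C 2 0 1 u\<close> over the active map, its target is the tensor product of
  the \<open>A b\<^sub>i\<close>, and \<open>edge C 2 1 2 u\<close> is the comparison map to the value of \<open>A\<close> on the union.
\<close>

definition multiplicative ::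
    "'c sset \<Rightarrow> (nat \<Rightarrow> 'c \<Rightarrow> fin_cell) \<Rightarrow> 'a topology \<Rightarrow> ('a, 'c) prefact \<Rightarrow> bool" where
  "multiplicative C p X A \<longleftrightarrow>
     (\<forall>bs. set bs \<subseteq> {U. openin X U} \<longrightarrow>
        (\<forall>i<length bs. \<forall>j<length bs. i \<noteq> j \<longrightarrow> bs ! i \<inter> bs ! j = {}) \<longrightarrow>
        (\<exists>u\<in>cells C 2. cocartesian_edge C NFin p (edge C 2 0 1 u) \<and>
           edge C 2 0 2 u = A 1 (nerve_edge (open_cat X) bs [\<Union> (set bs)] (mult_map (length bs))) \<and>
           equivalence_edge (tensor_fibre C p 1) (edge C 2 1 2 u)))"

definition inclusion_nerve :: "'a set set \<Rightarrow> (nat \<Rightarrow> 'a set) sset" where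
  "inclusion_nerve P = \<lparr>
     cells = (\<lambda>n. {x \<in> {..n} \<rightarrow>\<^sub>E P. \<forall>i j. i \<le> j \<longrightarrow> j \<le> n \<longrightarrow> x i \<subseteq> x j}),
     opr = (\<lambda>m n t x. \<lambda>i\<in>{..m}. x (t i)) \<rparr>"

definition unary_cell :: "nat \<Rightarrow> (nat \<Rightarrow> 'a set) \<Rightarrow> 'a open_cell" where
  "unary_cell n x = (\<lambda>i\<in>{..n}. [x i], arrows n (\<lambda>i j. pointed_id 1))"

text \<open>The functor \<open>U \<mapsto> A(U)\<close> from the poset of open subsets to \<open>tensor_fibre C p 1\<close>.\<close>

definition values_functor :: "'a topology \<Rightarrow> ('a, 'c) prefact \<Rightarrow> nat \<Rightarrow> (nat \<Rightarrow> 'a set) \<Rightarrow> 'c" where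
  "values_functor X A =
     (\<lambda>n. \<lambda>x\<in>cells (inclusion_nerve {U. openin X U}) n. A n (unary_cell n x))"

definition extension_map :: "'a topology \<Rightarrow> ('a, 'c) prefact \<Rightarrow> 'a set \<Rightarrow> 'a set \<Rightarrow> 'c" where
  "extension_map X A V U = values_functor X A 1 (\<lambda>i\<in>{..1}. if i = 0 then V else U)"

definition weiss_cover :: "'a topology \<Rightarrow> 'a set \<Rightarrow> 'a set set \<Rightarrow> bool" where
  "weiss_cover X U \<W> \<longleftrightarrow> (\<forall>W\<in>\<W>. openin X W \<and> W \<subseteq> U) \<and>
     (\<forall>S. finite S \<longrightarrow> S \<subseteq> U \<longrightarrow> (\<exists>W\<in>\<W>. S \<subseteq> W))"

text \<open>Adjoining an upper bound \<open>U\<close> as the cone point to chains of sets.\<close>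

definition cocone_cell :: "'a set \<Rightarrow> nat \<Rightarrow> (nat \<Rightarrow> 'a set, nat \<Rightarrow> nat) join_cell \<Rightarrow> nat \<Rightarrow> 'a set" where
  "cocone_cell U n z = (case z of
       JLeft x \<Rightarrow> x
     | JRight s \<Rightarrow> (\<lambda>k\<in>{..n}. U)
     | JBoth i x s \<Rightarrow> (\<lambda>k\<in>{..n}. if k \<le> i then x k else U))"

definition weiss_cosheaf ::
    "'c sset \<Rightarrow> (nat \<Rightarrow> 'c \<Rightarrow> fin_cell) \<Rightarrow> 'a topology \<Rightarrow> ('a, 'c) prefact \<Rightarrow> bool" where
  "weiss_cosheaf C p X A \<longleftrightarrow>
     (\<forall>U \<W>. openin X U \<longrightarrow> weiss_cover X U \<W> \<longrightarrow>
        (let P = inclusion_nerve {V. openin X V \<and> (\<exists>W\<in>\<W>. V \<subseteq> W)} in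
         colimit_cocone (tensor_fibre C p 1) P
           (\<lambda>n. \<lambda>z\<in>cells (right_cone P) n. values_functor X A n (cocone_cell U n z))))"

definition factorization_algebra ::
    "'c sset \<Rightarrow> (nat \<Rightarrow> 'c \<Rightarrow> fin_cell) \<Rightarrow> 'a topology \<Rightarrow> ('a, 'c) prefact \<Rightarrow> bool" where
  "factorization_algebra C p X A \<longleftrightarrow>
     prefactorization_algebra C p X A \<and> multiplicative C p X A \<and> weiss_cosheaf C p X A"

section \<open>Conical manifolds\<close>

record ('a, 's) strat_space =
  pts :: "'a topology"
  strata :: "'s set"
  sle :: "'s \<Rightarrow> 's \<Rightarrow> bool"
  strat :: "'a \<Rightarrow> 's"

definition alexandrov :: "'s set \<Rightarrow> ('s \<Rightarrow> 's \<Rightarrow> bool) \<Rightarrow> 's topology" where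
  "alexandrov P le = topology (\<lambda>V. V \<subseteq> P \<and> (\<forall>a\<in>V. \<forall>b\<in>P. le a b \<longrightarrow> b \<in> V))"

lemma openin_alexandrov:
  "openin (alexandrov P le) V \<longleftrightarrow> V \<subseteq> P \<and> (\<forall>a\<in>V. \<forall>b\<in>P. le a b \<longrightarrow> b \<in> V)"
proof -
  have "istopology (\<lambda>V. V \<subseteq> P \<and> (\<forall>a\<in>V. \<forall>b\<in>P. le a b \<longrightarrow> b \<in> V))"
    unfolding istopology_def by blast
  then show ?thesis
    by (simp add: alexandrov_def)
qed

definition stratified_space :: "('a, 's) strat_space \<Rightarrow> bool" where
  "stratified_space X \<longleftrightarrow>
     reflp_on (strata X) (sle X) \<and> transp_on (strata X) (sle X) \<and> antisymp_on (strata X) (sle X) \<and>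
     continuous_map (pts X) (alexandrov (strata X) (sle X)) (strat X) \<and>
     strat X ` topspace (pts X) = strata X"

definition strat_iso :: "('a, 's) strat_space \<Rightarrow> ('b, 't) strat_space \<Rightarrow> bool" where
  "strat_iso X Y \<longleftrightarrow>
     (\<exists>f g. homeomorphic_map (pts X) (pts Y) f \<and> bij_betw g (strata X) (strata Y) \<and>
        (\<forall>a\<in>strata X. \<forall>b\<in>strata X. sle X a b \<longleftrightarrow> sle Y (g a) (g b)) \<and>
        (\<forall>x\<in>topspace (pts X). strat Y (f x) = g (strat X x)))"

definition strat_restrict :: "('a, 's) strat_space \<Rightarrow> 'a set \<Rightarrow> ('a, 's) strat_space" where
  "strat_restrict X U = X \<lparr> pts := subtopology (pts X) U, strata := strat X ` (topspace (pts X) \<inter> U) \<rparr>"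

text \<open>The cone point is \<open>None\<close>; \<open>cone_quot\<close> is the map from \<open>[0,\<infinity>) \<times> X\<close> to the pushout.\<close>

definition cone_quot :: "real \<times> 'a \<Rightarrow> (real \<times> 'a) option" where
  "cone_quot z = (if fst z = 0 then None else Some z)"

definition cone_topology :: "'a topology \<Rightarrow> (real \<times> 'a) option topology" where
  "cone_topology X = topology (\<lambda>V. V \<subseteq> insert None (Some ` ({0<..} \<times> topspace X)) \<and>
     openin (prod_topology (top_of_set {0..}) X) {z \<in> {0..} \<times> topspace X. cone_quot z \<in> V})"

lemma openin_cone_topology:
  "openin (cone_topology X) V \<longleftrightarrow> V \<subseteq> insert None (Some ` ({0<..} \<times> topspace X)) \<and>
     openin (prod_topology (top_of_set {0..}) X) {z \<in> {0..} \<times> topspace X. cone_quot z \<in> V}"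
proof -
  let ?T = "prod_topology (top_of_set {0..}) X"
  let ?E = "{0::real..} \<times> topspace X"
  have int: "{z \<in> ?E. cone_quot z \<in> V \<inter> W} = {z \<in> ?E. cone_quot z \<in> V} \<inter> {z \<in> ?E. cone_quot z \<in> W}"
    for V W by auto
  have un: "{z \<in> ?E. cone_quot z \<in> \<Union>\<V>} = (\<Union>V\<in>\<V>. {z \<in> ?E. cone_quot z \<in> V})" for \<V>
    by auto
  have "istopology (\<lambda>V. V \<subseteq> insert None (Some ` ({0<..} \<times> topspace X)) \<and>
     openin ?T {z \<in> ?E. cone_quot z \<in> V})"
    unfolding istopology_def int un by (auto intro!: openin_Int openin_Union)
  then show ?thesis
    by (simp add: cone_topology_def)
qed

definition cone :: "('a, 's) strat_space \<Rightarrow> ((real \<times> 'a) option, 's option) strat_space" where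
  "cone X = \<lparr> pts = cone_topology (pts X), strata = insert None (Some ` strata X),
     sle = (\<lambda>a b. case a of None \<Rightarrow> True | Some a' \<Rightarrow>
                 (case b of None \<Rightarrow> False | Some b' \<Rightarrow> sle X a' b')),
     strat = map_option (\<lambda>z. strat X (snd z)) \<rparr>"

definition times_euclidean :: "('a, 's) strat_space \<Rightarrow> nat \<Rightarrow> ('a \<times> (nat \<Rightarrow> real), 's) strat_space" where
  "times_euclidean X n = \<lparr> pts = prod_topology (pts X) (Euclidean_space n), strata = strata X,
     sle = sle X, strat = strat X \<circ> fst \<rparr>"

text \<open>
  The mutual induction needs a fixed type of points and a fixed type of strata. Every second
  countable Hausdorff space has at most continuum many points, hence at most continuum many
  nonempty strata, so every conical manifold is isomorphic to one whose points and strata are reals.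
\<close>

inductive conical_manifold_real :: "(real, real) strat_space \<Rightarrow> bool"
  and conical_disk_real :: "(real, real) strat_space \<Rightarrow> bool" where
  manifold: "stratified_space M \<Longrightarrow> second_countable (pts M) \<Longrightarrow> Hausdorff_space (pts M) \<Longrightarrow>
    (\<forall>U x. openin (pts M) U \<longrightarrow> x \<in> U \<longrightarrow>
       (\<exists>D. openin (pts M) D \<and> x \<in> D \<and> D \<subseteq> U \<and> conical_disk_real (strat_restrict M D))) \<Longrightarrow>
    conical_manifold_real M"
| disk: "stratified_space D \<Longrightarrow> conical_manifold_real Z \<Longrightarrow> compact_space (pts Z) \<Longrightarrow>
    strat_iso D (times_euclidean (cone Z) n) \<Longrightarrow> conical_disk_real D"

definition conical_disk :: "('a, 's) strat_space \<Rightarrow> bool" where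
  "conical_disk D \<longleftrightarrow> stratified_space D \<and>
     (\<exists>Z n. conical_manifold_real Z \<and> compact_space (pts Z) \<and>
        strat_iso D (times_euclidean (cone Z) n))"

definition embedded_disk :: "('a, 's) strat_space \<Rightarrow> 'a set \<Rightarrow> bool" where
  "embedded_disk X D \<longleftrightarrow> openin (pts X) D \<and> conical_disk (strat_restrict X D)"

definition open_basis :: "'a topology \<Rightarrow> 'a set set \<Rightarrow> bool" where
  "open_basis X \<B> \<longleftrightarrow> (\<forall>B\<in>\<B>. openin X B) \<and>
     (\<forall>U x. openin X U \<longrightarrow> x \<in> U \<longrightarrow> (\<exists>B\<in>\<B>. x \<in> B \<and> B \<subseteq> U))"

definition conical_manifold :: "('a, 's) strat_space \<Rightarrow> bool" where
  "conical_manifold M \<longleftrightarrow> stratified_space M \<and> second_countable (pts M) \<and> Hausdorff_space (pts M) \<and>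
     open_basis (pts M) {D. embedded_disk M D}"

lemma conical_disk_real_iff: "conical_disk_real D \<longleftrightarrow> conical_disk D"
  by (auto simp: conical_disk_real.simps[of D] conical_disk_def)

lemma conical_manifold_real_iff: "conical_manifold_real M \<longleftrightarrow> conical_manifold M"
  by (auto simp: conical_manifold_real.simps[of M] conical_manifold_def open_basis_def
      embedded_disk_def conical_disk_real_iff) metis+

definition disks :: "('a, 's) strat_space \<Rightarrow> 'a set set" where
  "disks X = {\<Union>\<F> |\<F>. finite \<F> \<and> disjoint \<F> \<and> (\<forall>D\<in>\<F>. embedded_disk X D)}"

definition enough_good_disks :: "('a, 's) strat_space \<Rightarrow> bool" where
  "enough_good_disks X \<longleftrightarrow>
     (\<exists>\<B> \<subseteq> disks X. open_basis (pts X) \<B> \<and> {} \<in> \<B> \<and>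
        (\<forall>U\<in>\<B>. \<forall>V\<in>\<B>. U \<inter> V = {} \<longrightarrow> U \<union> V \<in> \<B>) \<and> (\<forall>U\<in>\<B>. \<forall>V\<in>\<B>. U \<inter> V \<in> \<B>))"

section \<open>Constructibility\<close>

definition constructible ::
    "'c sset \<Rightarrow> (nat \<Rightarrow> 'c \<Rightarrow> fin_cell) \<Rightarrow> ('a, 's) strat_space \<Rightarrow> ('a, 'c) prefact \<Rightarrow> bool" where
  "constructible C p X A \<longleftrightarrow>
     (\<forall>D D'. embedded_disk X D \<longrightarrow> embedded_disk X D' \<longrightarrow> D \<subseteq> D' \<longrightarrow>
        strat_iso (strat_restrict X D) (strat_restrict X D') \<longrightarrow>
        equivalence_edge (tensor_fibre C p 1) (extension_map (pts X) A D D'))"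

definition constructible_factorization_algebra ::
    "'c sset \<Rightarrow> (nat \<Rightarrow> 'c \<Rightarrow> fin_cell) \<Rightarrow> ('a, 's) strat_space \<Rightarrow> ('a, 'c) prefact \<Rightarrow> bool" where
  "constructible_factorization_algebra C p X A \<longleftrightarrow>
     factorization_algebra C p (pts X) A \<and> constructible C p X A"

definition locally_constructible ::
    "'c sset \<Rightarrow> (nat \<Rightarrow> 'c \<Rightarrow> fin_cell) \<Rightarrow> ('a, 's) strat_space \<Rightarrow> ('a, 'c) prefact \<Rightarrow> bool" where
  "locally_constructible C p X A \<longleftrightarrow>
     (\<exists>\<U>. (\<forall>U\<in>\<U>. openin (pts X) U) \<and> \<Union>\<U> = topspace (pts X) \<and>
        (\<forall>U\<in>\<U>. constructible_factorization_algebra C p (strat_restrict X U)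
                  (restrict_prefact (pts X) U A)))"

end

theory Submission
  imports Defs
begin

text \<open>
  Call an inclusion of open sets an equivalence when \<open>A\<close> sends it to one. These inclusions contain
  the identities, satisfy two-out-of-six, are stable under disjoint unions because \<open>A\<close> is
  multiplicative, and satisfy descent along Weiss covers closed under finite intersections because
  the Cech diagram of such a cover is cofinal in the diagram of the Weiss cosheaf condition.
  The rest is geometry. Removing single levels of a function gives Weiss covers by disjoint unions of
  thin slabs, so an equivalence that holds locally over the levels holds globally. By induction on the
  depth of the links, which are met away from the cone point, this compares a disk with its smaller
  concentric copies. For an inclusion of isomorphic disks the cone strata match; nesting
  boxes of both charts around a point of the cone stratum, two-out-of-six concludes.
\<close>

text \<open>Colimits are compared through extension problems: an inclusion of diagrams is harmless
  if every cocone under the smaller one extends to the larger one relative to the boundary of a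
  simplex, that is, if restriction of cocones is a trivial fibration. Such inclusions compose and
  cancel, and each is obtained by filling horns. Finite intersections are vertices of their own so
  that they lie above the sets of a sieve and never below one. A Weiss cover puts every finite set
  into a single member, so an ordinary cover by overlapping slabs is not enough; what is left after
  deleting finitely many levels falls into disjoint pieces, and these suit the axiom on disjoint
  unions. The logarithm of the radius makes a cone without its tip a product of the link with a
  line. A chart of the link has a cone of smaller depth but adds Euclidean coordinates, so the
  inductive claim concerns all dimensions and all admissible relations \<open>E\<close>. Only
  closure properties of equivalences enter there, hence the abstract \<open>weiss_system\<close>,
  which is transported along open embeddings.\<close>

abbreviation "eqe == equivalence_edge"
abbreviation "dmap == delta_map"
abbreviation "kc == const_cell"
abbreviation "pt X == topspace (pts X)"
abbreviation rs :: "nat => (nat => 'z) => nat => 'z" where "rs n f == restrict f {..n}"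
abbreviation (input) iffa (infixr "<->" 25) where "P <-> Q == P = (Q :: bool)"
abbreviation "eur == euclideanreal"
abbreviation "ES == Euclidean_space"
abbreviation "sst == simplicial_set"
lemmas dmd = delta_map_def

section \<open>Finite chains and compatible families of cells\<close>

definition fchain :: "'v::order set => bool" where
 "fchain sg <-> finite sg & sg~={} & (ALL x:sg. ALL y:sg. x <= y | y <= x)"

definition pos :: "'v::order set => 'v => nat" where
 "pos sg x = card {y:sg. y < x}"

definition enum :: "'v::order set => nat => 'v" where
 "enum sg = inv_into sg (pos sg)"

abbreviation dm :: "'v set => nat" where "dm sg == card sg - 1"

lemma fchain_subset: "fchain sg ==> ta <= sg ==> ta~={} ==> fchain ta" unfolding fchain_def by (meson finite_subset subsetD)

lemma fchain_card: "fchain sg ==> card sg > 0" by (simp add: fchain_def card_gt_0_iff)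

lemma fchain_image:
 assumes "!!i j. i <= m ==> j <= m ==> i <= j ==> w i <= w (j::nat)"
 shows "fchain (w ` {..m})" unfolding fchain_def using assms by (auto) (metis nat_le_linear)

lemma pos_mono: "fchain sg ==> x <= y ==> pos sg x <= pos sg y" unfolding pos_def fchain_def by (intro card_mono) auto

lemma pos_less: "fchain sg ==> x:sg ==> x < y ==> pos sg x < pos sg y" unfolding pos_def fchain_def by (intro psubset_card_mono) auto

lemma pos_less_iff:
 assumes "fchain sg" "x:sg" "y:sg" shows "pos sg x < pos sg y <-> x < y" using assms pos_less[of sg x y] pos_mono[of sg y x] unfolding fchain_def
 by (metis not_less order.strict_iff_order)

lemma pos_le_iff:
 assumes "fchain sg" "x:sg" "y:sg" shows "pos sg x <= pos sg y <-> x <= y" using pos_less_iff[OF assms(1,3,2)] assms unfolding fchain_def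
 by (metis linorder_not_le order.strict_iff_order less_le_not_le)

lemma pos_inj: "fchain sg ==> inj_on (pos sg) sg" by (rule inj_onI) (metis pos_le_iff order.antisym order.refl)

lemma pos_bound: "fchain sg ==> x:sg ==> pos sg x < card sg" unfolding pos_def fchain_def by (intro psubset_card_mono) auto

lemma pos_bij: assumes "fchain sg" shows "pos sg ` sg = {..<card sg}"
proof -
 have "pos sg ` sg <= {..<card sg}" using pos_bound[OF assms] by auto
 moreover have "card (pos sg ` sg) = card {..<card sg}" using pos_inj[OF assms] by (simp add: card_image)
 ultimately show ?thesis by (metis card_subset_eq finite_lessThan)
qed

lemma enum_pos [simp]: "fchain sg ==> x:sg ==> enum sg (pos sg x) = x" unfolding enum_def by (simp add: pos_inj)

lemma enum_in: "fchain sg ==> i < card sg ==> enum sg i:sg" unfolding enum_def by (metis inv_into_into lessThan_iff pos_bij)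

lemma pos_enum [simp]: "fchain sg ==> i < card sg ==> pos sg (enum sg i) = i" unfolding enum_def by (metis f_inv_into_f lessThan_iff pos_bij)

lemma enum_in': "fchain sg ==> i <= dm sg ==> enum sg i:sg" by (metis One_nat_def Suc_pred enum_in fchain_card le_imp_less_Suc)

lemma pos_enum' [simp]: "fchain sg ==> i <= dm sg ==> pos sg (enum sg i) = i" by (metis One_nat_def Suc_pred pos_enum fchain_card le_imp_less_Suc)

lemma pos_dm: "fchain sg ==> x:sg ==> pos sg x <= dm sg" using pos_bound by fastforce

lemma enum_mono: "fchain sg ==> i <= j ==> j <= dm sg ==> enum sg i <= enum sg j" by (metis enum_in' le_trans pos_enum' pos_le_iff)

lemma enum_image: "fchain sg ==> enum sg ` {..dm sg} = sg"
proof -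
 assume a: "fchain sg"
 have "sg <= enum sg ` {..dm sg}" using a pos_dm enum_pos by (metis atMost_iff image_eqI subsetI)
 thus ?thesis using enum_in'[OF a] by auto
qed

lemma enum_unique:
 assumes "!!i j. i < j ==> j <= m ==> w i < w j" "i <= m"
 shows "enum (w ` {..m}) i = w (i::nat)"
proof -
 have mono: "i <= j ==> j <= m ==> w i <= w j" for i j using assms(1) by (cases "i = j") (auto intro: order.strict_implies_order)
 have ch: "fchain (w ` {..m})" by (intro fchain_image) (simp add: mono)
 have "{y:w ` {..m}. y < w i} = w ` {..<i}"
 proof -
 have "j < i" if "j <= m" "w j < w i" for j using mono[of i j] that by (metis leD linorder_not_less)
 thus ?thesis using assms by auto
 qed
 moreover have "inj_on w {..<i}" using assms by (intro linorder_inj_onI) (auto, metis order.irrefl less_imp_le order.trans)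
 ultimately have "pos (w ` {..m}) (w i) = i" by (simp add: pos_def card_image)
 thus ?thesis using enum_pos[OF ch, of "w i"] assms(2) by auto
qed

section \<open>Families of cells on a complex of chains\<close>

definition cface :: "'v::order set => 'v set => nat => nat" where
 "cface ta sg = (%i. pos sg (enum ta i))"

abbreviation "rst X ta sg == opr X (dm ta) (dm sg) (cface ta sg)"

lemma delta_cface: "fchain sg ==> ta <= sg ==> ta~={} ==> dmap (dm ta) (dm sg) (cface ta sg)" unfolding dmd cface_def
 using fchain_subset[of sg ta] enum_in'[of ta] pos_dm[of sg] enum_mono[of ta] pos_mono[of sg] by (meson subsetD)

text \<open>A simplicial map from the ordered complex \<open>K\<close> to \<open>X\<close>, recorded
  on nondegenerate simplices only. Faces of a chain are chains again, so no degeneracies have to be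
  listed.\<close>

definition cmap :: "'c sset => 'v::order set set => ('v set => 'c) => bool" where
 "cmap X K f <-> (ALL sg:K. f sg:cells X (dm sg)) &
 (ALL sg:K. ALL ta. ta <= sg --> ta~={} --> f ta = rst X ta sg (f sg))"

definition chain_complex :: "'v::order set set => bool" where
 "chain_complex K <-> (ALL sg:K. fchain sg & (ALL ta. ta <= sg --> ta~={} --> ta:K))"

lemma chain_complexD: "chain_complex K ==> sg:K ==> fchain sg"
 "chain_complex K ==> sg:K ==> ta <= sg ==> ta~={} ==> ta:K" unfolding chain_complex_def by auto

lemma cmapD: "cmap X K f ==> sg:K ==> f sg:cells X (dm sg)"
 "cmap X K f ==> sg:K ==> ta <= sg ==> ta~={} ==> f ta = rst X ta sg (f sg)" unfolding cmap_def by auto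

lemma cmap_subset: "cmap X K f ==> L <= K ==> cmap X L f" unfolding cmap_def by blast

lemma cmap_cong:
 assumes "cmap X K f" "chain_complex K" "!!sg. sg:K ==> g sg = f sg"
 shows "cmap X K g"
proof -
 have "g ta = f ta" if "sg:K" "ta <= sg" "ta~={}" for sg ta using that assms chain_complexD by metis
 thus ?thesis using assms unfolding cmap_def by (metis)
qed

lemma cmap_union: "cmap X K f ==> cmap X L f ==> cmap X (K Un L) f" unfolding cmap_def by (metis UnE)

section \<open>Degenerate simplices as words, and pullback along monotone maps of vertices\<close>

definition word :: "nat => (nat => 'v::order) => bool" where
 "word m w <-> (ALL i j. i <= j --> j <= m --> w i <= w j)"

lemma word_fchain: "word m w ==> fchain (w ` {..m})" unfolding word_def by (intro fchain_image) auto

lemma word_enum: "fchain sg ==> word (dm sg) (enum sg)" unfolding word_def by (simp add: enum_mono)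

lemma word_comp: "word m w ==> dmap k m t ==> word k (w o t)" unfolding word_def dmd by auto

text \<open>The value on a possibly degenerate simplex: a weakly increasing word is the chain of its
  entries followed by the surjection that repeats them.\<close>

definition ev :: "'c sset => ('v::order set => 'c) => nat => (nat => 'v) => 'c" where
 "ev X f m w = opr X m (dm (w ` {..m})) (%i. pos (w ` {..m}) (w i)) (f (w ` {..m}))"

lemma delta_word: "word m w ==> dmap m (dm (w ` {..m})) (%i. pos (w ` {..m}) (w i))"
 unfolding dmd using word_fchain[of m w] pos_dm[of "w ` {..m}"] pos_mono[of "w ` {..m}"] by (auto simp: word_def)

lemma sset_opr_in:
 "sst X ==> dmap m n t ==> x:cells X n ==> opr X m n t x:cells X m" unfolding simplicial_set_def by blast

lemma sset_opr_opr: "sst X ==> dmap k m s ==> dmap m n t ==> x:cells X n ==>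
 opr X k m s (opr X m n t x) = opr X k n (t o s) x" unfolding simplicial_set_def by blast

lemma sset_opr_cong: "sst X ==> dmap m n s ==> (!!i. i <= m ==> s i = t i) ==>
 x:cells X n ==> opr X m n s x = opr X m n t x" unfolding simplicial_set_def by blast

lemma sset_opr_ident: assumes "sst X" "x:cells X n" "!!i. i <= n ==> t i = i"
 shows "opr X n n t x = x"
proof -
 have "opr X n n (%i. i) x = opr X n n t x" using assms by (intro sset_opr_cong) (auto simp: dmd)
 moreover have "opr X n n (%i. i) x = x" using assms unfolding simplicial_set_def by blast
 ultimately show ?thesis by simp
qed

lemma delta_comp: "dmap k m s ==> dmap m n t ==> dmap k n (t o s)" unfolding dmd by auto

lemma ev_in: "sst X ==> cmap X K f ==> word m w ==> w ` {..m}:K ==> ev X f m w:cells X m" unfolding ev_def by (intro sset_opr_in delta_word cmapD)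

text \<open>An operator may shrink the chain of entries. Compatibility of \<open>f\<close> on this
  face and the composition law express both sides as one operator applied to the value at the larger
  chain.\<close>

lemma ev_opr:
 assumes X: "sst X" and f: "cmap X K f" and w: "word m w" "w ` {..m}:K"
 and t: "dmap k m t"
 shows "opr X k m t (ev X f m w) = ev X f k (w o t)"
proof -
 let ?S = "w ` {..m}" and ?T = "(w o t) ` {..k}"
 have sub: "?T <= ?S" using t unfolding dmd by auto
 have ne: "?T~={}" by auto
 have ch: "fchain ?S" "fchain ?T" using w t word_fchain word_comp by blast+
 have fS: "f ?S:cells X (dm ?S)" using f w cmapD by blast
 have fT: "f ?T = opr X (dm ?T) (dm ?S) (cface ?T ?S) (f ?S)" using f w cmapD sub ne by blast
 have "ev X f k (w o t) = opr X k (dm ?S) (cface ?T ?S o (%i. pos ?T ((w o t) i))) (f ?S)" unfolding ev_def fT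
 by (intro sset_opr_opr[OF X] delta_word delta_cface ch sub ne fS word_comp[OF w(1) t])
 also have "... = opr X k (dm ?S) ((%i. pos ?S (w i)) o t) (f ?S)"
 by (intro sset_opr_cong[OF X] fS delta_comp[OF delta_word delta_cface] ch sub ne word_comp[OF w(1) t])
 (use enum_pos[OF ch(2)] in "auto simp: cface_def")
 also have "... = opr X k m t (ev X f m w)" unfolding ev_def by (intro sset_opr_opr[OF X, symmetric] delta_word w t fS)
 finally show ?thesis by simp
qed

lemma ev_cong: assumes "sst X" "cmap X K f" "word m w" "w ` {..m}:K" "!!i. i <= m ==> w i = w' i"
 shows "ev X f m w = ev X f m w'"
proof -
 have e: "w ` {..m} = w' ` {..m}" using assms(5) by auto
 show ?thesis unfolding ev_def e[symmetric] using assms by (intro sset_opr_cong delta_word cmapD) auto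
qed

lemma ev_enum: assumes "sst X" "cmap X K f" "fchain sg" "sg:K"
 shows "ev X f (dm sg) (enum sg) = f sg" unfolding ev_def enum_image[OF assms(3)] using assms by (intro sset_opr_ident cmapD) auto

text \<open>Functors are naturally known on all words, degenerate ones included; their values at the
  enumerations of chains already form a compatible family.\<close>

lemma cmap_of_words:
 assumes X: "sst X" and K: "chain_complex K"
 and c: "!!sg. sg:K ==> g (dm sg) (enum sg):cells X (dm sg)"
 and o: "!!sg k t. sg:K ==> dmap k (dm sg) t ==>
 opr X k (dm sg) t (g (dm sg) (enum sg)) = g k (enum sg o t)"
 and e: "!!m w w'. (!!i. i <= m ==> w i = w' i) ==> word m w ==> w ` {..m}:K ==> g m w = g m w'"
 shows "cmap X K (%sg. g (dm sg) (enum sg))" unfolding cmap_def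
proof (intro conjI ballI allI impI)
 fix sg assume "sg:K" thus "g (dm sg) (enum sg):cells X (dm sg)" by (rule c)
next
 fix sg ta assume a: "sg:K" "ta <= sg" "ta~={}"
 have s: "fchain sg" "fchain ta" "ta:K" using a K chain_complexD by blast+
 have "enum ta i = (enum sg o cface ta sg) i" if "i <= dm ta" for i using that s a enum_in'[OF s(2)] unfolding cface_def by (simp add: subsetD)
 hence "g (dm ta) (enum ta) = g (dm ta) (enum sg o cface ta sg)" using s word_enum enum_image[OF s(2)] by (intro e) (auto simp del: One_nat_def)
 thus "g (dm ta) (enum ta) = rst X ta sg (g (dm sg) (enum sg))" using o[OF a(1) delta_cface[OF s(1) a(2,3)]] by simp
qed

text \<open>Precomposition with the map of complexes induced by \<open>pj\<close>. Since
  \<open>pj\<close> may identify vertices, the image of a chain is a word with repetitions, hence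
  the use of \<open>ev\<close>.\<close>

definition pull :: "'c sset => ('w::order set => 'c) => ('v::order => 'w) => 'v set => 'c" where
 "pull X f pj sg = ev X f (dm sg) (pj o enum sg)"

lemma mono_word: assumes "word m w" "!!x y. x:w ` {..m} ==> y:w ` {..m} ==> x <= y ==> pj x <= pj y"
 shows "word m (pj o w)" using assms unfolding word_def by auto

lemma pull_cmap:
 assumes X: "sst X" and f: "cmap X K f" and L: "chain_complex L"
 and m: "!!sg x y. sg:L ==> x:sg ==> y:sg ==> x <= y ==> pj x <= pj y"
 and i: "!!sg. sg:L ==> pj ` sg:K"
 shows "cmap X L (pull X f pj)" unfolding pull_def
proof (rule cmap_of_words[where g = "%m w. ev X f m (pj o w)", OF X L])
 have *: "word m (pj o w)" "(pj o w) ` {..m}:K" if "word m w" "w ` {..m}:L" for m w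
 using mono_word[OF that(1)] m[OF that(2)] i[OF that(2)] by (auto simp: image_comp)
 have **: "word (dm sg) (pj o enum sg)" "(pj o enum sg) ` {..dm sg}:K" if "sg:L" for sg by (rule *; metis that chain_complexD(1)[OF L] word_enum enum_image)+
 show "ev X f (dm sg) (pj o enum sg):cells X (dm sg)" if "sg:L" for sg using **[OF that] by (rule ev_in[OF X f])
 show "opr X k (dm sg) t (ev X f (dm sg) (pj o enum sg)) = ev X f k (pj o (enum sg o t))"
 if "sg:L" "dmap k (dm sg) t" for sg k t using ev_opr[OF X f **[OF that(1)] that(2)] by (simp add: comp_assoc)
 show "ev X f m (pj o w) = ev X f m (pj o w')"
 if "!!i. i <= m ==> w i = w' i" "word m w" "w ` {..m}:L" for m w w' using *[OF that(2,3)] that by (intro ev_cong[OF X f]) auto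
qed

lemma pull_id:
 assumes "sst X" "cmap X K f" "chain_complex K" "sg:K" "!!x. x:sg ==> pj x = x"
 shows "pull X f pj sg = f sg"
proof -
 have s: "fchain sg" using assms chain_complexD by blast
 have "ev X f (dm sg) (enum sg) = ev X f (dm sg) (pj o enum sg)"
 using assms s word_enum enum_image[OF s] enum_in'[OF s] by (intro ev_cong[OF assms(1,2)]) (auto simp del: One_nat_def)
 thus ?thesis unfolding pull_def using ev_enum[OF assms(1,2) s assms(4)] by simp
qed

lemma pull_inj:
 assumes X: "sst X" "cmap X K f" and s: "fchain sg" "pj ` sg:K"
 and m: "!!x y. x:sg ==> y:sg ==> x < y ==> pj x < pj y"
 shows "pull X f pj sg = f (pj ` sg)"
proof -
 have st: "(pj o enum sg) i < (pj o enum sg) j" if "i < j" "j <= dm sg" for i j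
 proof -
 have "pos sg (enum sg i) < pos sg (enum sg j)" using s(1) that by simp
 hence "enum sg i < enum sg j" using pos_less_iff s(1) enum_in' that by (metis less_imp_le order.trans)
 thus ?thesis using m enum_in'[OF s(1)] that by auto
 qed
 have im: "(pj o enum sg) ` {..dm sg} = pj ` sg" by (metis enum_image image_comp s(1))
 have inj: "inj_on pj sg" using m s(1) unfolding inj_on_def fchain_def by (metis order.irrefl order.strict_iff_order)
 have c: "dm (pj ` sg) = dm sg" by (simp add: card_image inj)
 have ch: "fchain (pj ` sg)" unfolding im[symmetric] by (intro fchain_image) (metis nat_less_le order.refl order.strict_implies_order st)
 have p: "pos (pj ` sg) ((pj o enum sg) i) = i" if "i <= dm sg" for i
 using enum_unique[of "dm sg" "pj o enum sg", OF st that] pos_enum'[OF ch] that unfolding im c by metis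
 show ?thesis unfolding pull_def ev_def im c using p cmapD(1)[OF X(2) s(2)] c by (intro sset_opr_ident X(1)) auto
qed

section \<open>Faces of a simplex, horns and inner fillers\<close>

lemma cface_comp:
 assumes X: "sst X" and s: "fchain sg" "rh <= sg" "ta <= rh" "ta~={}" and x: "x:cells X (dm sg)"
 shows "rst X ta rh (rst X rh sg x) =
 rst X ta sg x"
proof -
 have r: "fchain rh" "rh~={}" "fchain ta" using s fchain_subset by blast+
 have "rst X ta rh (rst X rh sg x) =
 opr X (dm ta) (dm sg) (cface rh sg o cface ta rh) x" using s r x by (intro sset_opr_opr[OF X] delta_cface)
 also have "... = rst X ta sg x"
 proof (intro sset_opr_cong[OF X] x)
 show "dmap (dm ta) (dm sg) (cface rh sg o cface ta rh)" using delta_comp delta_cface s r by blast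
 show "(cface rh sg o cface ta rh) i = cface ta sg i" if "i <= dm ta" for i using s(3) r(1) enum_in'[OF r(3) that] by (simp add: cface_def subsetD)
 qed
 finally show ?thesis .
qed

lemma cface_self: assumes "sst X" "fchain sg" "x:cells X (dm sg)"
 shows "rst X sg sg x = x" using assms by (intro sset_opr_ident) (auto simp: cface_def)

text \<open>The horn of \<open>sg\<close> whose omitted face is the one opposite to
  \<open>v\<close>.\<close>

definition hornc :: "'v::order set => 'v => 'v set set" where
 "hornc sg v = {ta. ta <= sg & ta~={} & (EX x:sg. x~=v & x~:ta)}"

lemma chain_complex_hornc: "fchain sg ==> chain_complex (hornc sg v)" unfolding chain_complex_def hornc_def by (blast intro: fchain_subset)

definition horn_hom :: "'c sset => ('v::order set => 'c) => 'v set => 'v => nat => (nat => nat) => 'c" where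
 "horn_hom X f sg v = (%m. \<lambda>s\<in>cells (horn (dm sg) (pos sg v)) m. ev X f m (enum sg o s))"

lemma horn_cells: "s:cells (horn n k) m <->
 s:extensional {..m} & dmap m n s & (EX i<=n. i~=k & i~:s ` {..m})" by (simp add: horn_def std_simplex_def)

lemma horn_opr: "opr (horn n k) m k' t s = (rs m (%i. s (t i)))" by (simp add: horn_def std_simplex_def)

lemma horn_cells_opr:
 assumes "s:cells (horn n k) m" "dmap l m t" shows "(rs l (%i. s (t i))):cells (horn n k) l" using assms unfolding horn_cells dmd by auto

lemma horn_word:
 assumes "fchain sg" "v:sg" "s:cells (horn (dm sg) (pos sg v)) m"
 shows "word m (enum sg o s)" "(enum sg o s) ` {..m}:hornc sg v"
proof -
 have d: "dmap m (dm sg) s" using assms horn_cells by blast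
 show "word m (enum sg o s)" using word_comp[OF word_enum d] assms by blast
 obtain i where i: "i <= dm sg" "i~=pos sg v" "i~:s ` {..m}" using assms(3) horn_cells by blast
 have "enum sg i~:(enum sg o s) ` {..m}"
 proof
 assume "enum sg i:(enum sg o s) ` {..m}"
 then obtain j where j: "j <= m" "enum sg i = enum sg (s j)" by auto
 hence "i = s j" using i(1) d pos_enum'[OF assms(1)] unfolding dmd by metis
 thus False using i j by auto
 qed
 moreover have "enum sg i~=v" using i pos_enum'[OF assms(1)] by metis
 moreover have "enum sg (s j):sg" if "j <= m" for j using d that enum_in'[OF assms(1)] unfolding dmd by blast
 ultimately show "(enum sg o s) ` {..m}:hornc sg v" unfolding hornc_def using enum_in'[OF assms(1) i(1)] by auto
qed

lemma horn_hom_in: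
 assumes X: "sst X" and s: "fchain sg" "v:sg" and f: "cmap X (hornc sg v) f"
 shows "horn_hom X f sg v:sset_hom (horn (dm sg) (pos sg v)) X" unfolding sset_hom_def
proof (intro CollectI conjI allI impI ballI)
 fix m
 show "horn_hom X f sg v m:cells (horn (dm sg) (pos sg v)) m \<rightarrow>\<^sub>E cells X m"
 unfolding horn_hom_def using horn_word[OF s] ev_in[OF X f] by (auto simp del: One_nat_def)
next
 fix m n t x assume t: "dmap m n t" and x: "x:cells (horn (dm sg) (pos sg v)) n"
 let ?y = "\<lambda>i\<in>{..m}. x (t i)"
 have y: "?y:cells (horn (dm sg) (pos sg v)) m" using horn_cells_opr[OF x t] .
 have "opr X m n t (ev X f n (enum sg o x)) = ev X f m (enum sg o x o t)" by (rule ev_opr[OF X f horn_word[OF s x] t])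
 also have "... = ev X f m (enum sg o ?y)" by (rule ev_cong[OF X f, symmetric]) (use horn_word[OF s y] in auto)
 finally show "horn_hom X f sg v m (opr (horn (dm sg) (pos sg v)) m n t x) = opr X m n t (horn_hom X f sg v n x)"
 using x y by (simp add: horn_hom_def horn_opr)
qed

lemma horn_hom_fill:
 assumes X: "sst X" and s: "fchain sg" "v:sg" and f: "cmap X (hornc sg v) f"
 and x: "x:cells X (dm sg)"
 "ALL m. ALL s:cells (horn (dm sg) (pos sg v)) m. opr X m (dm sg) s x = horn_hom X f sg v m s"
 and t: "ta:hornc sg v"
 shows "rst X ta sg x = f ta"
proof -
 let ?s = "restrict (cface ta sg) {..dm ta}"
 have ta: "ta <= sg" "ta~={}" "fchain ta" using t s fchain_subset unfolding hornc_def by blast+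
 have d: "dmap (dm ta) (dm sg) (cface ta sg)" by (rule delta_cface[OF s(1) ta(1,2)])
 have d': "dmap (dm ta) (dm sg) ?s" using d unfolding dmd by auto
 have "?s:cells (horn (dm sg) (pos sg v)) (dm ta)"
 proof -
 obtain y where y: "y:sg" "y~=v" "y~:ta" using t unfolding hornc_def by blast
 have "pos sg y~=pos sg v" using y s pos_inj by (metis inj_onD)
 moreover have "pos sg y~=cface ta sg i" if "i <= dm ta" for i using y enum_in'[OF ta(3) that] ta(1) s(1) unfolding cface_def by (metis enum_pos subsetD)
 ultimately show ?thesis using d' pos_dm[OF s(1) y(1)] unfolding horn_cells by (auto simp del: One_nat_def)
 qed
 hence "opr X (dm ta) (dm sg) ?s x = ev X f (dm ta) (enum sg o ?s)" using x(2) by (simp add: horn_hom_def)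
 moreover have "opr X (dm ta) (dm sg) ?s x = rst X ta sg x" using d' x by (intro sset_opr_cong[OF X]) auto
 moreover have "ev X f (dm ta) (enum ta) = ev X f (dm ta) (enum sg o ?s)" using enum_in'[OF ta(3)] ta s t word_enum[OF ta(3)] enum_image[OF ta(3)]
 by (intro ev_cong[OF X f]) (auto simp: cface_def subsetD simp del: One_nat_def)
 moreover have "ev X f (dm ta) (enum ta) = f ta" using ev_enum[OF X f ta(3) t] .
 ultimately show ?thesis by simp
qed

text \<open>For lifting problems over \<open>B\<close>: it is enough to check on nondegenerate faces
  that the horn lies over the simplex \<open>b\<close>.\<close>

lemma horn_hom_proj:
 assumes X: "sst X" and B: "sst B" and p: "p:sset_hom X B"
 and s: "fchain sg" "v:sg" and f: "cmap X (hornc sg v) f" and b: "b:cells B (dm sg)"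
 and pf: "!!ta. ta:hornc sg v ==> p (dm ta) (f ta) = rst B ta sg b"
 and x: "x:cells (horn (dm sg) (pos sg v)) m"
 shows "p m (horn_hom X f sg v m x) = opr B m (dm sg) x b"
proof -
 let ?w = "enum sg o x" let ?T = "?w ` {..m}" let ?r = "%i. pos ?T (?w i)"
 have w: "word m ?w" "?T:hornc sg v" using horn_word[OF s x] by auto
 have T: "fchain ?T" "?T <= sg" "?T~={}" using word_fchain[OF w(1)] w(2) unfolding hornc_def by blast+
 have d: "dmap m (dm ?T) ?r" by (rule delta_word[OF w(1)])
 have dx: "dmap m (dm sg) x" using x horn_cells by blast
 have "p m (horn_hom X f sg v m x) = p m (opr X m (dm ?T) ?r (f ?T))" using x by (simp add: horn_hom_def ev_def)
 also have "... = opr B m (dm ?T) ?r (p (dm ?T) (f ?T))" using p d cmapD(1)[OF f w(2)] unfolding sset_hom_def by blast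
 also have "... = opr B m (dm sg) (cface ?T sg o ?r) b" unfolding pf[OF w(2)] by (intro sset_opr_opr[OF B] d delta_cface s T b)
 also have "... = opr B m (dm sg) x b"
 proof (intro sset_opr_cong[OF B] delta_comp[OF d] delta_cface s T b)
 fix i assume i: "i <= m"
 have "enum ?T (pos ?T (?w i)) = ?w i" using i by (intro enum_pos[OF T(1)]) auto
 thus "(cface ?T sg o ?r) i = x i" using i dx s(1) unfolding cface_def dmd by simp
 qed
 finally show ?thesis .
qed

lemma quasicategory_sset: "quasicategory C ==> sst C" unfolding quasicategory_def by blast

lemma inner_fill:
 assumes C: "quasicategory C" and s: "fchain sg" "v:sg" "a:sg" "a < v" "b:sg" "v < b"
 and f: "cmap C (hornc sg v) f"
 shows "EX x:cells C (dm sg). ALL ta:hornc sg v. rst C ta sg x = f ta"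
proof -
 have k: "0 < pos sg v" "pos sg v < dm sg" using pos_less[OF s(1) s(3,4)] pos_less[OF s(1) s(2,6)] pos_dm[OF s(1) s(5)] by linarith+
 then obtain x where x: "x:cells C (dm sg)"
 "ALL m. ALL s:cells (horn (dm sg) (pos sg v)) m. opr C m (dm sg) s x = horn_hom C f sg v m s"
 using C horn_hom_in[OF quasicategory_sset[OF C] s(1,2) f] unfolding quasicategory_def by blast
 thus ?thesis using horn_hom_fill[OF quasicategory_sset[OF C] s(1,2) f] by blast
qed

subsection \<open>Extension along pairings of chains\<close>

text \<open>An acyclic matching. The simplices of \<open>L\<close> outside \<open>K\<close> come in
  pairs that differ by the vertex \<open>v\<close>, and each pair consists of the interior and the
  omitted face of a horn. The rank ensures that all other faces of that horn are present earlier, so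
  \<open>L\<close> arises from \<open>K\<close> by filling horns.\<close>

locale pairing =
 fixes L K :: "'v::order set set" and v :: "'v set => 'v" and r :: "'v set => nat"
 assumes L: "chain_complex L" and K: "chain_complex K" and KL: "K <= L"
 and ins: "!!sg. sg:L - K ==> insert (v sg) sg:L"
 and del: "!!sg. sg:L - K ==> sg - {v sg}:L - K"
 and vins: "!!sg. sg:L - K ==> v (insert (v sg) sg) = v sg"
 and vdel: "!!sg. sg:L - K ==> v (sg - {v sg}) = v sg"
 and rins: "!!sg. sg:L - K ==> r (insert (v sg) sg) = r sg"
 and rank: "!!sg x. sg:L - K ==> v sg:sg ==> x:sg ==> x~=v sg ==> sg - {x}:L - K ==> r (sg - {x}) < r sg"
begin

lemma up: "sg:L - K ==> sg <= ta ==> ta:L ==> ta:L - K" using chain_complexD(2)[OF K, of ta sg] chain_complexD(1)[OF L, of sg] unfolding fchain_def by blast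

lemma ins': "sg:L - K ==> insert (v sg) sg:L - K" using up ins by blast

lemma rdel: assumes "sg:L - K" shows "r (sg - {v sg}) = r sg"
proof -
 have "r (insert (v (sg - {v sg})) (sg - {v sg})) = r (sg - {v sg})" using rins[OF del[OF assms]] .
 thus ?thesis using vdel[OF assms] rins[OF assms] by simp
qed

text \<open>A face that omits a vertex other than \<open>v rh\<close> lies in a codimension one face
  of smaller rank; the only other faces are the two members of the pair, which have equal
  rank.\<close>

lemma rank_le: "rh:L - K ==> ta <= rh ==> ta:L - K ==> r ta <= r rh"
proof (induction "r rh" arbitrary: rh rule: less_induct)
 case less
 let ?s = "insert (v rh) rh"
 have s: "?s:L - K" "v ?s = v rh" "r ?s = r rh" using ins' vins rins less.prems by blast+
 show ?case
 proof (cases "EX x:rh. x~=v rh & x~:ta")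
 case True
 then obtain x where x: "x:rh" "x~=v rh" "x~:ta" by blast
 have sub: "ta <= ?s - {x}" "ta~={}" using less.prems x chain_complexD(1)[OF L, of ta] unfolding fchain_def by blast+
 have "?s - {x}:L" using chain_complexD(2)[OF L, of ?s "?s - {x}"] s sub by blast
 hence N: "?s - {x}:L - K" using up[OF less.prems(3) sub(1)] by blast
 hence "r (?s - {x}) < r rh" using rank[OF s(1), of x] s x by auto
 thus ?thesis using less.hyps[OF _ N sub(1) less.prems(3)] by simp
 next
 case False
 hence "rh - {v rh} <= ta" by blast
 hence "ta = rh | ta = rh - {v rh}" using less.prems(2) by blast
 thus ?thesis using rdel[OF less.prems(1)] by auto
 qed
qed

definition stage :: "nat => 'v set set" where "stage n = K Un {sg:L - K. r sg < n}"

lemma stage_complex: "chain_complex (stage n)" unfolding chain_complex_def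
proof (intro ballI conjI allI impI)
 fix sg assume s: "sg:stage n"
 thus "fchain sg" using L KL chain_complexD unfolding stage_def by blast
 fix ta assume t: "ta <= sg" "ta~={}"
 show "ta:stage n"
 proof (cases "ta:K")
 case False
 hence "sg:L - K" using s t chain_complexD(2)[OF K] unfolding stage_def by blast
 thus ?thesis using rank_le[of sg ta] t False chain_complexD(2)[OF L, of sg ta] s unfolding stage_def by auto
 qed (simp add: stage_def)
qed

lemma hornc_stage:
 assumes "sg:L - K" "v sg:sg" shows "hornc sg (v sg) <= stage (r sg)"
proof
 fix ta assume "ta:hornc sg (v sg)"
 then obtain x where x: "x:sg" "x~=v sg" "ta <= sg - {x}" "ta~={}" unfolding hornc_def by blast
 have "sg - {x}:L" using chain_complexD(2)[OF L, of sg "sg - {x}"] assms x by blast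
 hence "sg - {x}:stage (r sg)" using rank[OF assms x(1,2)] unfolding stage_def by blast
 thus "ta:stage (r sg)" using chain_complexD(2)[OF stage_complex] x by blast
qed

text \<open>All pairs of rank \<open>n\<close> can be filled at once: their horns lie in the
  previous stage, and the two new simplices of a pair belong to no other pair.\<close>

lemma stage_step:
 assumes X: "sst X" and g: "cmap X (stage n) g"
 and fill: "!!sg. sg:L - K ==> v sg:sg ==> cmap X (hornc sg (v sg)) g ==>
 EX x:cells X (dm sg). ALL ta:hornc sg (v sg). rst X ta sg x = g ta"
 shows "EX g'. cmap X (stage (Suc n)) g' & (ALL sg:stage n. g' sg = g sg)"
proof -
 let ?P = "%sg x. x:cells X (dm sg) & (ALL ta:hornc sg (v sg). rst X ta sg x = g ta)"
 have "EX x. ?P sg x" if "sg:L - K" "v sg:sg" "r sg = n" for sg using fill[OF that(1,2) cmap_subset[OF g]] hornc_stage[OF that(1,2)] that(3) by blast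
 then obtain c where c: "!!sg. sg:L - K ==> v sg:sg ==> r sg = n ==> ?P sg (c sg)" by metis
 let ?u = "%sg. insert (v sg) sg"
 \<comment> \<open>Both members of a pair are read off from one filler, chosen for the member that
   contains the paired vertex.\<close>
 define g' where "g' = (%sg. if sg:L - K & r sg = n
 then opr X (dm sg) (dm (?u sg)) (cface sg (?u sg)) (c (?u sg)) else g sg)"
 have old: "g' sg = g sg" if "sg:stage n" for sg using that unfolding g'_def stage_def by auto
 have cells: "c (?u sg):cells X (dm (?u sg))" "?P (?u sg) (c (?u sg))" "fchain (?u sg)"
 if "sg:L - K" "r sg = n" for sg using c[of "?u sg"] ins'[OF that(1)] vins[OF that(1)] rins[OF that(1)] that(2) chain_complexD(1)[OF L] by auto
 have "cmap X (stage (Suc n)) g'" unfolding cmap_def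
 proof (intro conjI ballI allI impI)
 fix rh assume r: "rh:stage (Suc n)"
 have ch: "fchain rh" using r stage_complex chain_complexD by blast
 show "g' rh:cells X (dm rh)"
 proof (cases "rh:L - K & r rh = n")
 case True
 have "dmap (dm rh) (dm (?u rh)) (cface rh (?u rh))" using cells(3)[of rh] True ch by (intro delta_cface) (auto simp: fchain_def)
 thus ?thesis unfolding g'_def using True cells(1)[of rh] sset_opr_in[OF X] by auto
 next
 case False
 hence "rh:stage n" using r unfolding stage_def by auto
 thus ?thesis using old cmapD(1)[OF g] by auto
 qed
 fix ta assume t: "ta <= rh" "ta~={}"
 show "g' ta = rst X ta rh (g' rh)"
 proof (cases "rh:L - K & r rh = n")
 case True
 let ?s = "?u rh"
 have s: "?s:L - K" "v ?s = v rh" "r ?s = n" using ins' vins rins True by blast+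
 have e: "rst X ta rh (g' rh) = opr X (dm ta) (dm ?s) (cface ta ?s) (c ?s)"
 using True cface_comp[OF X cells(3)[of rh] _ t cells(1)[of rh]] unfolding g'_def by auto
 show ?thesis
 proof (cases "ta:hornc ?s (v rh)")
 case True
 hence "ta:stage n" using hornc_stage[OF s(1)] s by auto
 thus ?thesis using old e cells(2)[of rh] True \<open>rh:L - K & r rh = n\<close> s(2) by metis
 next
 case False
 hence "?s - {v rh} <= ta" using t unfolding hornc_def by blast
 hence or: "ta = ?s | ta = ?s - {v ?s}" using t s(2) by auto
 hence "ta:L - K" "v ta = v rh" "r ta = n" using s del[OF s(1)] vdel[OF s(1)] rdel[OF s(1)] by auto
 moreover have "?u ta = ?s" using calculation or s(2) by auto
 ultimately have "g' ta = opr X (dm ta) (dm ?s) (cface ta ?s) (c ?s)" unfolding g'_def by simp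
 thus ?thesis using e by simp
 qed
 next
 case False
 hence "rh:stage n" using r unfolding stage_def by auto
 thus ?thesis using old cmapD(2)[OF g _ t] chain_complexD(2)[OF stage_complex _ t] by auto
 qed
 qed
 thus ?thesis using old by blast
qed

theorem extend:
 assumes X: "sst X" and f: "cmap X K f"
 and fill: "!!sg g. sg:L - K ==> v sg:sg ==> cmap X (hornc sg (v sg)) g ==> (!!ta. ta:K ==> g ta = f ta) ==>
 EX x:cells X (dm sg). ALL ta:hornc sg (v sg). rst X ta sg x = g ta"
 obtains f' where "cmap X L f'" "!!sg. sg:K ==> f' sg = f sg"
proof -
 let ?Q = "%n g. cmap X (stage n) g & (ALL sg:K. g sg = f sg)"
 have "EX g. ALL n. ?Q n (g n) & (ALL sg:stage n. g (Suc n) sg = g n sg)"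
 proof (rule dependent_nat_choice)
 show "EX g. ?Q 0 g" using f by (auto simp: stage_def)
 fix g n assume g: "?Q n g"
 have "EX g'. cmap X (stage (Suc n)) g' & (ALL sg:stage n. g' sg = g sg)" by (rule stage_step[OF X]) (use g fill in blast)+
 thus "EX g'. ?Q (Suc n) g' & (ALL sg:stage n. g' sg = g sg)" using g unfolding stage_def by auto
 qed
 then obtain g where g: "!!n. ?Q n (g n)" "!!n sg. sg:stage n ==> g (Suc n) sg = g n sg" by blast
 have mono: "stage n <= stage m" if "n <= m" for n m using that unfolding stage_def by auto
 have stab: "g (n + k) sg = g n sg" if "sg:stage n" for n k sg
 proof (induction k)
 case (Suc k) thus ?case using g(2)[of sg "n + k"] mono[of n "n + k"] that by auto
 qed simp
 \<comment> \<open>A chain of rank \<open>n\<close> appears at stage \<open>Suc n\<close> at the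
   latest and keeps its value from then on.\<close>
 define f' where "f' sg = g (Suc (r sg)) sg" for sg
 have f': "f' sg = g n sg" if "sg:stage n" for n sg
 proof -
 have m: "sg:stage (Suc (r sg))" using that unfolding stage_def by auto
 show ?thesis using stab[OF m, of n] stab[OF that, of "Suc (r sg)"] unfolding f'_def by (simp add: add.commute)
 qed
 have "cmap X (stage n) f'" for n by (rule cmap_cong[OF _ stage_complex]) (use g(1) f' in blast)+
 hence "cmap X (\<Union>n. stage n) f'" unfolding cmap_def by (metis (no_types, lifting) UN_iff)
 moreover have "(\<Union>n. stage n) = L" using KL unfolding stage_def by auto
 moreover have "f' sg = f sg" if "sg:K" for sg using f'[of sg 0] g(1)[of 0] that unfolding stage_def by auto
 ultimately show ?thesis using that by auto
qed

end

section \<open>Gluing of families and families given by a single simplex\<close>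

lemma ev_pull:
 assumes X: "sst X" and f: "cmap X K f" and w: "word m w"
 and pj: "word m (pj o w)" "pj ` w ` {..m}:K"
 shows "ev X (pull X f pj) m w = ev X f m (pj o w)"
proof -
 let ?T = "w ` {..m}"
 have T: "fchain ?T" by (rule word_fchain[OF w])
 have e: "(pj o enum ?T) ` {..dm ?T} = pj ` ?T" using enum_image[OF T] by (simp only: image_comp[symmetric])
 have mono: "pj x <= pj y" if "x:?T" "y:?T" "x <= y" for x y
 proof -
 obtain i j where ij: "i <= m" "j <= m" "x = w i" "y = w j" using \<open>x:?T\<close> \<open>y:?T\<close> by auto
 show ?thesis
 proof (cases "i <= j")
 case True thus ?thesis using pj(1) ij unfolding word_def by auto
 next
 case False
 hence "y <= x" using w ij unfolding word_def by auto
 thus ?thesis using that by simp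
 qed
 qed
 have w1: "word (dm ?T) (pj o enum ?T)" by (rule mono_word[OF word_enum[OF T]]) (simp add: mono enum_image[OF T] del: One_nat_def)
 have "ev X (pull X f pj) m w = ev X f m ((pj o enum ?T) o (%i. pos ?T (w i)))" unfolding ev_def[of X "pull X f pj"] pull_def
 by (rule ev_opr[OF X f w1 _ delta_word[OF w]]) (simp only: e pj)
 also have "... = ev X f m (pj o w)" by (rule ev_cong[OF X f pj(1), symmetric]) (use pj(2) T in "auto simp: image_comp")
 finally show ?thesis .
qed

lemma ev_agree: "f (w ` {..m}) = g (w ` {..m}) ==> ev X f m w = ev X g m w" unfolding ev_def by simp

lemma cmap_glue:
 assumes "cmap X K f" "cmap X L g" "chain_complex K" "chain_complex L"
 "!!sg. sg:K ==> sg:L ==> f sg = g sg"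
 shows "cmap X (K Un L) (%sg. if sg:K then f sg else g sg)"
proof (rule cmap_union)
 show "cmap X K (%sg. if sg:K then f sg else g sg)" by (rule cmap_cong[OF assms(1,3)]) auto
 show "cmap X L (%sg. if sg:K then f sg else g sg)" by (rule cmap_cong[OF assms(2,4)]) (use assms(5) in auto)
qed

lemma cmap_simplex:
 assumes X: "sst X" and s: "fchain sg" "x:cells X (dm sg)"
 shows "cmap X {ta. ta <= sg & ta~={}} (%ta. rst X ta sg x)" unfolding cmap_def
proof (intro conjI ballI allI impI; elim CollectE conjE)
 show "rst X ta sg x:cells X (dm ta)" if "ta <= sg" "ta~={}" for ta by (rule sset_opr_in[OF X delta_cface[OF s(1) that] s(2)])
 show "rst X ta sg x =
 rst X ta rh (rst X rh sg x)"
 if "ta <= rh" "ta~={}" "rh <= sg" for ta rh by (rule cface_comp[OF X s(1) that(3,1,2) s(2), symmetric])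
qed

lemma chain_complex_Pow: "fchain sg ==> chain_complex {ta. ta <= sg & ta~={}}" unfolding chain_complex_def using fchain_subset[of sg] by auto

lemma cmap_agree: "cmap X K f ==> cmap X L g ==> rh:K ==> rh:L ==> f rh = g rh ==> ta <= rh ==> ta~={} ==> f ta = g ta" using cmapD(2) by metis

lemma fchain_nat: "fchain (sg :: nat set) <-> finite sg & sg~={}" unfolding fchain_def by auto

lemma (in pairing) extend_inner:
 assumes C: "quasicategory C" and f: "cmap C K f"
 and inner: "!!sg. sg:L - K ==> v sg:sg ==> (EX a:sg. a < v sg) & (EX b:sg. v sg < b)"
 obtains f' where "cmap C L f'" "!!sg. sg:K ==> f' sg = f sg"
proof (rule extend[OF quasicategory_sset[OF C] f])
 fix sg g assume s: "sg:L - K" "v sg:sg" "cmap C (hornc sg (v sg)) g"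
 show "EX x:cells C (dm sg). ALL ta:hornc sg (v sg). rst C ta sg x = g ta"
 using inner[OF s(1,2)] inner_fill[OF C _ s(2) _ _ _ _ s(3)] chain_complexD(1)[OF L] s(1) by blast
qed (use that in blast)

section \<open>Outer horns whose leading edge is an equivalence\<close>

lemma enum_list:
 assumes "sorted_wrt (<) xs" "i < length xs"
 shows "enum (set xs) i = xs ! i"
proof -
 have "set xs = (!) xs ` {..length xs - 1}"
 proof -
 have "{..length xs - 1} = {..<length xs}" using assms(2) by auto
 thus ?thesis by (metis list.set_map map_nth set_upt atLeast0LessThan)
 qed
 moreover have "enum ((!) xs ` {..length xs - 1}) i = xs ! i" using assms by (intro enum_unique) (auto simp: sorted_wrt_iff_nth_less)
 ultimately show ?thesis by simp
qed

lemma pos_list: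
 assumes "sorted_wrt (<) xs" "i < length xs"
 shows "pos (set xs) (xs ! i) = i"
proof -
 have m: "j < i" if "xs ! j < xs ! i" "j < length xs" for j using assms that by (metis linorder_neqE_nat less_asym less_irrefl sorted_wrt_iff_nth_less)
 have "{y:set xs. y < xs ! i} = (!) xs ` {..<i}"
 using assms m by (auto simp: in_set_conv_nth sorted_wrt_iff_nth_less intro!: exI less_trans[of _ i "length xs"])
 moreover have "inj_on ((!) xs) {..<i}" using assms by (intro linorder_inj_onI) (auto simp: sorted_wrt_iff_nth_less, metis less_irrefl order.strict_trans)
 ultimately show ?thesis by (simp add: pos_def card_image)
qed

lemma cmap_edge:
 assumes X: "sst X" and f: "cmap X K f" and s: "fchain sg" "sg:K" "ta <= sg" "card ta = 2"
 shows "f ta = edge X (dm sg) (cface ta sg 0) (cface ta sg 1) (f sg)"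
proof -
 have t: "ta~={}" using s(4) by auto
 have "f ta = opr X 1 (dm sg) (cface ta sg) (f sg)" using cmapD(2)[OF f s(2,3) t] s(4) by simp
 also have "... = edge X (dm sg) (cface ta sg 0) (cface ta sg 1) (f sg)" unfolding edge_def using delta_cface[OF s(1,3) t] s(4) cmapD(1)[OF f s(2)]
 by (intro sset_opr_cong[OF X]) (auto simp: le_Suc_eq numeral_2_eq_2)
 finally show ?thesis .
qed

text \<open>Joyal's special outer horn. Between 0 and 3 two vertices 1 and 2 are inserted so that
  the edge, its inverse and the edge again run along 0, 1, 2, 3; the missing simplex is then reached
  through inner horns only. The gap in the numbering leaves room for the new vertices.\<close>

lemma equivalence_edge_horn_aux:
 fixes T :: "nat set"
 assumes C: "quasicategory C" and T: "finite T" "T~={}" "!!t. t:T ==> 4 <= t"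
 and f: "cmap C (hornc ({0,3} Un T) 0) f" and e: "eqe C (f {0,3})"
 shows "EX x:cells C (dm ({0,3} Un T)). ALL ta:hornc ({0,3} Un T) 0.
 opr C (dm ta) (dm ({0,3} Un T)) (cface ta ({0,3} Un T)) x = f ta"
proof -
 let ?S = "{0,3} Un T"
 have X: "sst C" by (rule quasicategory_sset[OF C])
 have nT: "0~:T" "1~:T" "2~:T" "3~:T" "Suc 0~:T" using T(3) by fastforce+
 obtain t0 where t0: "t0:T" using T by blast
 \<comment> \<open>0 and 2 stand for the source of the edge, 1 and 3 for its target.\<close>
 define a where "a = (%j::nat. if j = 1 then 3 else if j = 2 then 0 else j)"
 \<comment> \<open>On these chains \<open>a\<close> is monotone and takes values in the given horn,
   so the horn determines their cells.\<close>
 define K' where "K' = {ta. ta~={} & (ta <= {0,2,3} Un T | ta <= {1,3} Un T) & (~T <= ta | 3~:ta & 1~:ta)}"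
 have fin: "finite ({0,2,3} Un T)" "finite ({1,3} Un T)" using T by auto
 have K': "chain_complex K'" unfolding chain_complex_def fchain_nat K'_def using fin by (auto intro: finite_subset)
 have aS: "a ` ta:hornc ?S 0" if "ta:K'" for ta
 proof -
 have sub: "a ` ta <= ?S" "a ` ta~={}" using that nT unfolding K'_def a_def by auto
 have "EX x:?S. x~=0 & x~:a ` ta"
 proof (cases "T <= ta")
 case False
 then obtain t where "t:T" "t~:ta" by blast
 moreover have "t~=0" "t~=1" "t~=2" "t~=3" using T(3)[of t] \<open>t:T\<close> by auto
 ultimately show ?thesis unfolding a_def by (intro bexI[of _ t]) auto
 next
 case True
 hence "3~:a ` ta" using that unfolding K'_def a_def by auto
 thus ?thesis by auto
 qed
 thus ?thesis using sub unfolding hornc_def by auto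
 qed
 have amono: "a x <= a y" if "ta:K'" "x:ta" "y:ta" "x <= y" for ta x y
 proof -
 have "x:{0,2,3} Un T & y:{0,2,3} Un T | x:{1,3} Un T & y:{1,3} Un T" using that unfolding K'_def by blast
 moreover have "x:T ==> 4 <= x" "y:T ==> 4 <= y" using T(3) by auto
 ultimately show ?thesis using that(4) unfolding a_def by auto
 qed
 define fp where "fp = pull C f a"
 have fp: "cmap C K' fp" unfolding fp_def by (rule pull_cmap[OF X f K' amono aS])
 have f03: "{0,3}:hornc ?S 0" unfolding hornc_def using t0 T(3)[OF t0] by (auto intro!: bexI[of _ t0])
 have f0: "{0}:hornc ?S 0" "{3}:hornc ?S 0" unfolding hornc_def using t0 T(3)[OF t0] by (auto intro!: bexI[of _ t0])
 obtain g u v where guv: "g:cells C 1" "u:cells C 2" "v:cells C 2"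
 "edge C 2 0 1 u = f {0,3}" "edge C 2 1 2 u = g" "edge C 2 0 2 u = kc C 1 (source C (f {0,3}))"
 "edge C 2 0 1 v = g" "edge C 2 1 2 v = f {0,3}" "edge C 2 0 2 v = kc C 1 (target C (f {0,3}))" using e unfolding equivalence_edge_def by blast
 have "dm {0::nat,1,2} = 2" "dm {1::nat,2,3} = 2" by auto
 hence c2: "u:cells C (dm {0::nat,1,2})" "v:cells C (dm {1::nat,2,3})" using guv by metis+
 have c3: "fchain {0::nat,1,2}" "fchain {1::nat,2,3}" by (auto simp: fchain_nat)
 define F1 where "F1 = (%ta :: nat set. opr C (dm ta) (dm {0::nat,1,2}) (cface ta {0,1,2}) u)"
 define F2 where "F2 = (%ta :: nat set. opr C (dm ta) (dm {1::nat,2,3}) (cface ta {1,2,3}) v)"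
 have F1: "cmap C {ta. ta <= {0,1,2} & ta~={}} F1" "F1 {0,1,2} = u" unfolding F1_def by (rule cmap_simplex[OF X c3(1) c2(1)] cface_self[OF X c3(1) c2(1)])+
 have F2: "cmap C {ta. ta <= {1,2,3} & ta~={}} F2" "F2 {1,2,3} = v" unfolding F2_def by (rule cmap_simplex[OF X c3(2) c2(2)] cface_self[OF X c3(2) c2(2)])+
 have cf: "cface {x,y} {p,q,r} 0 = pos {p,q,r} x" "cface {x,y} {p,q,r} 1 = pos {p,q,r} y" if "x < y" for x y p q r :: nat
 using enum_list[of "[x,y]" 0] enum_list[of "[x,y]" 1] that unfolding cface_def by simp_all
 have ps: "pos {p,q,r} p = 0" "pos {p,q,r} q = 1" "pos {p,q,r} r = 2" if "p < q" "q < r" for p q r :: nat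
 using pos_list[of "[p,q,r]" 0] pos_list[of "[p,q,r]" 1] pos_list[of "[p,q,r]" 2] that by (simp_all add: numeral_2_eq_2)
 have F1e: "F1 {0,1} = f {0,3}" "F1 {1,2} = g" "F1 {0,2} = kc C 1 (source C (f {0,3}))"
 using cmap_edge[OF X F1(1) _ _ , of "{0,1,2}" "{0,1}"] cmap_edge[OF X F1(1) _ _ , of "{0,1,2}" "{1,2}"]
 cmap_edge[OF X F1(1) _ _ , of "{0,1,2}" "{0,2}"] guv cf ps[of 0 1 2] F1(2) by (auto simp: fchain_nat numeral_2_eq_2)
 have F2e: "F2 {1,2} = g" "F2 {2,3} = f {0,3}" "F2 {1,3} = kc C 1 (target C (f {0,3}))"
 using cmap_edge[OF X F2(1) _ _ , of "{1,2,3}" "{1,2}"] cmap_edge[OF X F2(1) _ _ , of "{1,2,3}" "{2,3}"]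
 cmap_edge[OF X F2(1) _ _ , of "{1,2,3}" "{1,3}"] guv cf ps[of 1 2 3] F2(2) by (auto simp: fchain_nat numeral_2_eq_2)
 have vs: "f {0} = source C (f {0,3})" "f {3} = target C (f {0,3})"
 proof -
 have fc: "fchain {0::nat,3}" by (simp add: fchain_nat)
 have "f {x} = vertex C 1 (cface {x} {0,3} 0) (f {0,3})" if "x:{0,3}" for x
 proof -
 have "f {x} = opr C 0 1 (cface {x} {0,3}) (f {0,3})" using cmapD(2)[OF f f03, of "{x}"] that by simp
 also have "... = vertex C 1 (cface {x} {0,3} 0) (f {0,3})" unfolding vertex_def using delta_cface[OF fc, of "{x}"] that cmapD(1)[OF f f03]
 by (intro sset_opr_cong[OF X]) auto
 finally show ?thesis .
 qed
 moreover have "cface {0::nat} {0,3} 0 = 0" "cface {3::nat} {0,3} 0 = (1::nat)"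
 using enum_list[of "[0::nat]" 0] enum_list[of "[3::nat]" 0] pos_list[of "[0::nat,3]" 0] pos_list[of "[0::nat,3]" 1] unfolding cface_def by simp_all
 ultimately show "f {0} = source C (f {0,3})" "f {3} = target C (f {0,3})" by auto
 qed
 have fpe: "fp ta = kc C 1 (f {z})" if "ta = {x,y}" "x < y" "a x = z" "a y = z" "{z}:hornc ?S 0" for ta x y z
 proof -
 have "a (enum {x,y} i) = z" if "i <= 1" for i
 using enum_list[of "[x,y]" i] that \<open>x < y\<close> \<open>a x = z\<close> \<open>a y = z\<close> by (cases i) auto
 hence 1: "(a o enum {x,y}) ` {..Suc 0} = {z}" by (auto simp: image_iff)
 have "fp ta = opr C 1 0 (%i. pos {z} (a (enum {x,y} i))) (f {z})" using that(1,2) 1 unfolding fp_def pull_def ev_def by simp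
 also have "... = kc C 1 (f {z})" unfolding const_cell_def using cmapD(1)[OF f that(5)] by (intro sset_opr_cong[OF X]) (auto simp: pos_def dmd less_le
 \<open>!!i. i <= 1 ==> a (enum {x,y} i) = z\<close>)
 finally show ?thesis .
 qed
 have fp02: "fp {0,2} = F1 {0,2}" using fpe[of "{0,2}" 0 2 0] F1e vs f0 by (simp add: a_def)
 have fp13: "fp {1,3} = F2 {1,3}" using fpe[of "{1,3}" 1 3 3] F2e vs f0 by (simp add: a_def)
 have K'T: "ta:K' <-> ta~={}" if "ta <= {0,2,3} | ta <= {1,3}" for ta using that nT t0 unfolding K'_def by auto
 have fpS: "fp ta = f ta" if "ta:hornc ?S 0" for ta unfolding fp_def
 proof (rule pull_id[OF X f chain_complex_hornc that])
 show "fchain ?S" using T by (simp add: fchain_nat)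
 show "a x = x" if "x:ta" for x using that \<open>ta:hornc ?S 0\<close> nT unfolding hornc_def a_def by auto
 qed
 have fp23: "fp {2,3} = F2 {2,3}"
 proof -
 have "a ` {2,3} = {0,3}" by (auto simp: a_def)
 moreover have "fp {2,3} = f (a ` {2,3})" unfolding fp_def by (rule pull_inj[OF X f]) (auto simp: a_def fchain_nat f03[simplified] insert_commute)
 ultimately show ?thesis using F2e by simp
 qed
 text \<open>The 3-simplex on the vertices 0, 1, 2, 3 has \<open>f {0,3}\<close> from 0 to 1 and from 2 to 3, and its inverse from 1 to 2.\<close>
 let ?P = "%sg. {ta. ta <= sg & ta~={}} :: nat set set"
 have cc: "chain_complex (?P sg)" if "finite sg" "sg~={}" for sg using that by (intro chain_complex_Pow) (simp add: fchain_nat)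
 define G1 where "G1 = (%sg. if sg:?P {0,1,2} then F1 sg else F2 sg)"
 have G1: "cmap C (?P {0,1,2} Un ?P {1,2,3}) G1" unfolding G1_def
 proof (intro cmap_glue F1 F2 cc)
 fix sg assume s: "sg:?P {0,1,2}" "sg:?P {1,2,3}"
 hence "sg <= {1,2}" "sg~={}" by auto
 thus "F1 sg = F2 sg" by (rule cmap_agree[OF F1(1) F2(1), rotated 3]) (auto simp: F1e F2e simp del: One_nat_def)
 qed auto
 have ccu: "chain_complex (K Un L)" if "chain_complex K" "chain_complex L" for K L :: "nat set set"
 using that unfolding chain_complex_def by (metis UnE UnI1 UnI2)
 let ?D = "{0,1,2,3} :: nat set"
 have KD: "sg:K' <-> sg~={} & (1~:sg | 0~:sg & 2~:sg)" if "sg <= ?D" for sg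
 proof -
 have d: "sg Int T = {}" using that nT by auto
 hence "~T <= sg" using t0 by auto
 moreover have "sg <= {0,2,3} Un T <-> 1~:sg" "sg <= {1,3} Un T <-> 0~:sg & 2~:sg" using d that nT by auto
 ultimately show ?thesis unfolding K'_def by simp
 qed
 have PD: "sg:?P {0,1,2} Un ?P {1,2,3} <-> sg <= ?D & sg~={} & (3~:sg | 0~:sg)" for sg by auto
 have KP: "sg <= {0,2} | sg <= {2,3} | sg <= {1,3}" "sg~={}"
 if s: "sg:?P {0,1,2} Un ?P {1,2,3}" "sg:K'" for sg
 proof -
 have d: "sg <= ?D" "sg~={}" "3~:sg | 0~:sg" using s(1) unfolding PD by auto
 have "sg <= {0,2} <-> 1~:sg & 3~:sg" "sg <= {2,3} <-> 0~:sg & 1~:sg"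
 "sg <= {1,3} <-> 0~:sg & 2~:sg" using d(1) by auto
 thus "sg <= {0,2} | sg <= {2,3} | sg <= {1,3}" "sg~={}" using KD[OF d(1)] s(2) d by blast+
 qed
 define G2 where "G2 = (%sg. if sg:?P {0,1,2} Un ?P {1,2,3} then G1 sg else fp sg)"
 have G2: "cmap C (?P {0,1,2} Un ?P {1,2,3} Un K') G2" unfolding G2_def
 proof (intro cmap_glue G1 fp ccu cc K')
 fix sg assume s: "sg:?P {0,1,2} Un ?P {1,2,3}" "sg:K'"
 note KP[OF s]
 moreover have "G1 {0,2} = fp {0,2}" "G1 {2,3} = fp {2,3}" "G1 {1,3} = fp {1,3}" using fp02 fp13 fp23 by (auto simp: G1_def)
 moreover have "{0,2}:K'" "{2,3}:K'" "{1,3}:K'" by (simp_all add: K'T)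
 ultimately show "G1 sg = fp sg" using cmap_agree[OF G1 fp, of "{0,2}" sg] cmap_agree[OF G1 fp, of "{2,3}" sg] cmap_agree[OF G1 fp, of "{1,3}" sg] by auto
 qed auto
 define K0 where "K0 = ?P {0,1,2} Un ?P {1,2,3} Un K'"
 have K0: "chain_complex K0" unfolding K0_def by (intro ccu cc K') auto
 have finD: "finite (?D Un T)" using T by simp
 have sub_cc: "chain_complex {ta. ta~={} & ta <= ?D Un T & Q ta}" if "!!sg ta. ta <= sg ==> Q sg ==> Q ta" for Q
 using that finite_subset[OF _ finD] unfolding chain_complex_def fchain_nat by blast
 define K1 where "K1 = K0 Un ?P ?D"
 have K1: "chain_complex K1" unfolding K1_def by (intro ccu cc K0) auto
 have N1: "sg:K1 - K0 <-> sg <= ?D & {0,1,3} <= sg" for sg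
 proof (cases "sg <= ?D & sg~={}")
 case True
 hence "sg:K1" unfolding K1_def by blast
 moreover have "sg:K0 <-> 3~:sg | 0~:sg | 1~:sg" using True PD[of sg] KD[of sg] unfolding K0_def by blast
 ultimately show ?thesis using True by blast
 qed (auto simp: K1_def)
 \<comment> \<open>The faces 012, 123 and 023 are known. The face 013 and the 3-simplex itself are
   the two members of a pair: the inner horn at 2.\<close>
 interpret p1: pairing K1 K0 "%_. 2" "%_. 0"
 proof
 fix sg x assume s: "sg:K1 - K0" "2:sg" "x:sg" "x~=2" "sg - {x}:K1 - K0"
 thus "(0::nat) < 0" unfolding N1 by auto
 next
 show "sg:K1 - K0 ==> insert 2 sg:K1" for sg unfolding N1 by (auto simp: K1_def)
 show "sg:K1 - K0 ==> sg - {2}:K1 - K0" for sg unfolding N1 by auto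
 qed (use K1 K0 in "auto simp: K1_def")
 obtain H1 where H1: "cmap C K1 H1" "!!sg. sg:K0 ==> H1 sg = G2 sg"
 proof (rule p1.extend_inner[OF C G2[folded K0_def]])
 fix sg assume "sg:K1 - K0"
 hence "0:sg" "3:sg" unfolding N1 by auto
 thus "(EX a:sg. a < 2) & (EX b:sg. 2 < b)" by (auto intro: bexI[of _ 0] bexI[of _ 3])
 qed blast
 have SUB: "sg <= {0,2,3} Un T <-> 1~:sg" "sg <= {1,3} Un T <-> 0~:sg & 2~:sg"
 "sg <= {0,2} Un T <-> 1~:sg & 3~:sg" "sg <= {0,1,2} Un T <-> 3~:sg"
 "sg <= {0,1,3} Un T <-> 2~:sg" "sg <= {0,1} Un T <-> 2~:sg & 3~:sg"
 "sg <= ?D <-> sg Int T = {}"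
 if "sg <= ?D Un T" for sg using that nT by auto
 have K1D: "sg:K1 <-> sg <= ?D Un T & sg~={} & (sg Int T = {} |
 (1~:sg | 0~:sg & 2~:sg) & (~T <= sg | 3~:sg & 1~:sg))" for sg
 proof (cases "sg <= ?D Un T")
 case True
 have "sg:K' <-> sg~={} & (1~:sg | 0~:sg & 2~:sg) & (~T <= sg | 3~:sg & 1~:sg)" unfolding K'_def using SUB[OF True] by simp
 moreover have "sg:K1 <-> sg:K' | sg <= ?D & sg~={}" unfolding K1_def K0_def by auto
 ultimately show ?thesis using SUB(7)[OF True] True by blast
 next
 case False
 hence "~ sg <= ?D" "~ sg <= {0,2,3} Un T" "~ sg <= {1,3} Un T" "~ sg <= {0,1,2}" "~ sg <= {1,2,3}" by auto
 thus ?thesis using False unfolding K1_def K0_def K'_def by simp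
 qed
 define K2 where "K2 = {ta. ta~={} & ta <= ?D Un T & (~T <= ta | ta <= {0,2} Un T)}"
 have K2: "chain_complex K2" unfolding K2_def by (rule sub_cc) auto
 have K2D: "sg:K2 <-> sg <= ?D Un T & sg~={} & (~T <= sg | 1~:sg & 3~:sg)" for sg unfolding K2_def mem_Collect_eq using SUB(3)[of sg] by satx
 have K12: "K1 <= K2" using t0 unfolding subset_iff[of K1] K1D K2D by blast
 have N2: "sg:K2 - K1 <-> sg <= ?D Un T & ~T <= sg & sg Int T~={} & 1:sg & (0:sg | 2:sg)" for sg unfolding Diff_iff K1D K2D using t0 by blast
 \<comment> \<open>The new chains contain 1 and a part of \<open>T\<close>, so 2 and 3 both lie
   strictly inside. Next to 0 the vertex 2 is used; without 0 the vertex 2 is present anyway and 3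
   is used.\<close>
 let ?v2 = "%sg. if (0::nat):sg then 2 else (3::nat)"
 let ?r2 = "%sg. 3 * card (sg Int T) + (if 0~:sg then 0 else if 3~:sg then 1 else (2::nat))"
 interpret p2: pairing K2 K1 ?v2 ?r2
 proof
 fix sg x assume s: "sg:K2 - K1" "?v2 sg:sg" "x:sg" "x~=?v2 sg" "sg - {x}:K2 - K1"
 show "?r2 (sg - {x}) < ?r2 sg"
 proof (cases "x:T")
 case True
 hence "card ((sg - {x}) Int T) < card (sg Int T)" using s T by (intro psubset_card_mono) auto
 thus ?thesis by auto
 next
 case False
 hence e: "(sg - {x}) Int T = sg Int T" by auto
 have "x = 0 | x = 1 | x = 2 | x = 3" using s(1,3) False unfolding N2 by blast
 moreover have "1:sg - {x}" "0:sg - {x} | 2:sg - {x}" using s(5) unfolding N2 by blast+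
 ultimately have "x = 0 | x = 3 & 0:sg" using s(4) by (auto split: if_splits)
 thus ?thesis using s(3) unfolding e by auto
 qed
 next
 fix sg assume s: "sg:K2 - K1"
 show "insert (?v2 sg) sg:K2"
 proof -
 have "?v2 sg~:T" "?v2 sg:?D" using nT by auto
 hence "insert (?v2 sg) sg <= ?D Un T & ~T <= insert (?v2 sg) sg" using s nT(3,4) unfolding N2 by (simp add: subset_insert)
 thus ?thesis unfolding K2D by simp
 qed
 show "sg - {?v2 sg}:K2 - K1" unfolding N2
 proof (intro conjI)
 note s' = s[unfolded N2]
 show "sg - {?v2 sg} <= ?D Un T" "~T <= sg - {?v2 sg}" using s' by blast+
 have "(sg - {?v2 sg}) Int T = sg Int T" using nT by auto
 thus "(sg - {?v2 sg}) Int T~={}" using s' by simp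
 show "1:sg - {?v2 sg}" using s' by simp
 show "0:sg - {?v2 sg} | 2:sg - {?v2 sg}" using s' by (cases "0:sg") simp_all
 qed
 show "?r2 (insert (?v2 sg) sg) = ?r2 sg" using nT by auto
 qed (simp_all add: K1 K2 K12)
 obtain H2 where H2: "cmap C K2 H2" "!!sg. sg:K1 ==> H2 sg = H1 sg"
 proof (rule p2.extend_inner[OF C H1(1)])
 fix sg assume s: "sg:K2 - K1" "?v2 sg:sg"
 then obtain t where t: "t:sg" "t:T" unfolding N2 by blast
 hence "4 <= t" "1:sg" using T(3) s unfolding N2 by auto
 thus "(EX a:sg. a < ?v2 sg) & (EX b:sg. ?v2 sg < b)" using t by (auto intro: bexI[of _ 1] bexI[of _ t])
 qed blast
 define K3 where "K3 = {ta. ta~={} & ta <= ?D Un T & (~T <= ta | ta <= {0,1,2} Un T)}"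
 have K3: "chain_complex K3" unfolding K3_def by (rule sub_cc) auto
 have K23: "K2 <= K3" unfolding K2_def K3_def by auto
 have K3D: "sg:K3 <-> sg <= ?D Un T & sg~={} & (~T <= sg | 3~:sg)" for sg unfolding K3_def mem_Collect_eq using SUB(4)[of sg] by satx
 have N3: "sg:K3 - K2 <-> sg <= ?D Un T & 3~:sg & T <= sg & 1:sg" for sg unfolding Diff_iff K3D K2D using t0 by blast
 \<comment> \<open>Now all of \<open>T\<close> is present and 3 is absent; the vertex 2 lies between
   1 and \<open>T\<close>.\<close>
 interpret p3: pairing K3 K2 "%_. 2" "%sg. if 0:sg then 1 else 0"
 proof
 fix sg x assume s: "sg:K3 - K2" "2:sg" "x:sg" "x~=2" "sg - {x}:K3 - K2"
 hence "x = 0" unfolding N3 by auto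
 thus "(if 0:sg - {x} then 1 else 0) < (if 0:sg then 1 else (0::nat))" using s by auto
 next
 fix sg assume s: "sg:K3 - K2"
 show "insert 2 sg:K3" using s unfolding N3 K3D by auto
 show "sg - {2}:K3 - K2" using s nT unfolding N3 by auto
 qed (simp_all add: K3 K2 K23)
 obtain H3 where H3: "cmap C K3 H3" "!!sg. sg:K2 ==> H3 sg = H2 sg"
 proof (rule p3.extend_inner[OF C H2(1)])
 fix sg :: "nat set" assume s: "sg:K3 - K2" "2:sg"
 hence "1:sg" "t0:sg" "4 <= t0" using T(3) t0 unfolding N3 by auto
 thus "(EX a:sg. a < 2) & (EX b:sg. 2 < b)" by (auto intro: bexI[of _ 1] bexI[of _ t0])
 qed blast
 have H3fp: "H3 ta = fp ta" if "ta:K'" for ta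
 proof -
 have "ta:K0" using that unfolding K0_def by blast
 hence "H3 ta = G2 ta" using H1(2) H2(2) H3(2) K12 unfolding K1_def by auto
 moreover have "G2 ta = fp ta"
 proof (cases "ta:?P {0,1,2} Un ?P {1,2,3}")
 case True
 note KP[OF True that]
 moreover have "G1 {0,2} = fp {0,2}" "G1 {2,3} = fp {2,3}" "G1 {1,3} = fp {1,3}" using fp02 fp13 fp23 by (auto simp: G1_def)
 moreover have "{0,2}:K'" "{2,3}:K'" "{1,3}:K'" by (simp_all add: K'T)
 ultimately have "G1 ta = fp ta" using cmap_agree[OF G1 fp, of "{0,2}" ta] cmap_agree[OF G1 fp, of "{2,3}" ta] cmap_agree[OF G1 fp, of "{1,3}" ta] by auto
 thus ?thesis using True unfolding G2_def by simp
 next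
 case False
 thus ?thesis unfolding G2_def by (rule if_not_P)
 qed
 ultimately show ?thesis by simp
 qed
 \<comment> \<open>The edge from 1 to 3 is the degenerate one at the target, so the faces on 1, 3
   and \<open>T\<close> may be obtained by collapsing 3 to 1.\<close>
 define b where "b = (%j::nat. if j = 3 then 1 else j)"
 define A where "A = {ta. ta~={} & ta <= ?D Un T & (ta <= {0,1,3} Un T & (~T <= ta | ta <= {0,1} Un T))}"
 define B where "B = {ta. ta~={} & ta <= ?D Un T & ta <= {1,3} Un T}"
 have A: "chain_complex A" and B: "chain_complex B" unfolding A_def B_def by (rule sub_cc; auto)+
 have A3: "A <= K3" unfolding A_def K3_def by auto
 have bB: "b ` ta:K3" "!!x y. x:ta ==> y:ta ==> x <= y ==> b x <= b y" if "ta:B" for ta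
 proof -
 show "b ` ta:K3" using that nT unfolding B_def K3_def b_def by auto
 show "b x <= b y" if "x:ta" "y:ta" "x <= y" for x y using that \<open>ta:B\<close> T(3)[of x] T(3)[of y] unfolding B_def b_def by auto
 qed
 have PB: "cmap C B (pull C H3 b)" by (rule pull_cmap[OF X H3(1) B bB(2) bB(1)])
 have AB: "H3 ta = pull C H3 b ta" if t: "ta:A" "ta:B" for ta
 proof (cases "3:ta")
 case False
 hence "pull C H3 b ta = H3 ta" using t A3 by (intro pull_id[OF X H3(1) K3]) (auto simp: b_def)
 thus ?thesis by simp
 next
 case True
 hence nTt: "~T <= ta" using t nT unfolding A_def by auto
 have tK: "ta:K'" using t nTt unfolding B_def K'_def by auto
 have ch: "fchain ta" using tK K' chain_complexD by blast
 have w: "word (dm ta) (b o enum ta)" by (rule mono_word[OF word_enum[OF ch]]) (use bB(2)[OF t(2)] enum_image[OF ch] in auto)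
 have im: "(b o enum ta) ` {..dm ta} = b ` ta" using enum_image[OF ch] by (simp only: image_comp[symmetric])
 have bt: "b ` ta:K'" using tK True nTt t nT unfolding K'_def B_def b_def by auto
 have ab: "a (b x) = a x" if "x:ta" for x using that t nT unfolding a_def b_def B_def by auto
 have w': "word (dm ta) (a o enum ta)" by (rule mono_word[OF word_enum[OF ch]]) (use amono[OF tK] enum_image[OF ch] in auto)
 have wab: "word (dm ta) (a o (b o enum ta))" using w' ab enum_in'[OF ch] unfolding word_def by (auto simp del: One_nat_def)
 have "pull C H3 b ta = ev C fp (dm ta) (b o enum ta)" unfolding pull_def by (rule ev_agree) (simp only: im H3fp[OF bt])
 also have "... = ev C f (dm ta) (a o (b o enum ta))" unfolding fp_def using aS[OF bt] by (intro ev_pull[OF X f w wab]) (simp only: im)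
 also have "... = ev C f (dm ta) (a o enum ta)"
 proof (rule ev_cong[OF X f wab])
 have "(a o (b o enum ta)) ` {..dm ta} = a ` b ` ta" unfolding im[symmetric] by (rule image_comp[symmetric])
 thus "(a o (b o enum ta)) ` {..dm ta}:hornc ?S 0" using aS[OF bt] by simp
 show "(a o (b o enum ta)) i = (a o enum ta) i" if "i <= dm ta" for i using ab enum_in'[OF ch that] by simp
 qed
 also have "... = H3 ta" unfolding H3fp[OF tK] fp_def pull_def ..
 finally show ?thesis by simp
 qed
 define G4 where "G4 = (%sg. if sg:A then H3 sg else pull C H3 b sg)"
 have G4: "cmap C (A Un B) G4" unfolding G4_def by (rule cmap_glue[OF cmap_subset[OF H3(1) A3] PB A B AB])
 define K5 where "K5 = {ta. ta~={} & ta <= ?D Un T & ta <= {0,1,3} Un T}"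
 have K5: "chain_complex K5" unfolding K5_def by (rule sub_cc) auto
 have N5: "sg:K5 - (A Un B) <-> sg <= ?D Un T & 2~:sg & T <= sg & 0:sg & 3:sg" for sg
 proof -
 have "0:sg --> sg~={}" by blast
 thus ?thesis unfolding K5_def A_def B_def Diff_iff Un_iff mem_Collect_eq using SUB(2,5,6)[of sg] by satx
 qed
 \<comment> \<open>The last horns are at 1, between 0 and 3. The complex filled in this way contains
   the simplex on 0, 3 and \<open>T\<close> that was sought.\<close>
 interpret p5: pairing K5 "A Un B" "%_. 1" "%_. 0"
 proof
 fix sg x assume s: "sg:K5 - (A Un B)" "1:sg" "x:sg" "x~=1" "sg - {x}:K5 - (A Un B)"
 thus "(0::nat) < 0" unfolding N5 by auto
 next
 show "sg:K5 - (A Un B) ==> insert 1 sg:K5" for sg unfolding N5 using nT by (auto simp: K5_def)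
 show "sg:K5 - (A Un B) ==> sg - {1}:K5 - (A Un B)" for sg unfolding N5 using nT by auto
 show "chain_complex (A Un B)" by (rule ccu[OF A B])
 show "A Un B <= K5" unfolding A_def B_def K5_def by auto
 qed (simp_all add: K5)
 obtain H5 where H5: "cmap C K5 H5" "!!sg. sg:A Un B ==> H5 sg = G4 sg"
 proof (rule p5.extend_inner[OF C G4])
 fix sg :: "nat set" assume "sg:K5 - (A Un B)" "1:sg"
 hence "0:sg" "3:sg" unfolding N5 by auto
 thus "(EX a:sg. a < 1) & (EX b:sg. 1 < b)" by (auto intro: bexI[of _ 0] bexI[of _ 3])
 qed blast
 have S5: "?S:K5" unfolding K5_def by auto
 show ?thesis
 proof (intro bexI ballI)
 show "H5 ?S:cells C (dm ?S)" by (rule cmapD(1)[OF H5(1) S5])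
 fix ta assume t: "ta:hornc ?S 0"
 hence t': "ta <= ?S" "ta~={}" "~T <= ta | 3~:ta" unfolding hornc_def by auto
 have "ta:A" using t' unfolding A_def by auto
 moreover have "ta:K'" using t' nT unfolding K'_def by auto
 ultimately have "H5 ta = f ta" using H5(2) G4_def H3fp fpS t by auto
 thus "opr C (dm ta) (dm ?S) (cface ta ?S) (H5 ?S) = f ta" using cmapD(2)[OF H5(1) S5 t'(1,2)] by simp
 qed
qed

lemma fchain_total: "fchain sg ==> x:sg ==> y:sg ==> x <= y | y <= x" unfolding fchain_def by blast

lemma strict_image:
 assumes S: "fchain S" and m: "!!x y. x:S ==> y:S ==> x < y ==> io x < io y"
 shows "fchain (io ` S)" "inj_on io S" "!!x. x:S ==> pos (io ` S) (io x) = pos S x"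
 "!!i. i <= dm S ==> enum (io ` S) i = io (enum S i)"
proof -
 have le: "x < y | x = y | y < x" if "x:S" "y:S" for x y using fchain_total[OF S that] by (auto simp: le_less)
 show inj: "inj_on io S" unfolding inj_on_def using le m by (metis less_irrefl)
 show ch: "fchain (io ` S)" unfolding fchain_def
 proof (intro conjI ballI)
 show "finite (io ` S)" "io ` S~={}" using S unfolding fchain_def by auto
 fix a b assume "a:io ` S" "b:io ` S"
 thus "a <= b | b <= a" using le m by (metis imageE le_less)
 qed
 show p: "pos (io ` S) (io x) = pos S x" if x: "x:S" for x
 proof -
 have "y < x" if "y:S" "io y < io x" for y using le[OF that(1) x] m[OF x that(1)] that(2) by (metis less_asym less_irrefl)
 hence "{y:io ` S. y < io x} = io ` {y:S. y < x}" using m x by auto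
 moreover have "inj_on io {y:S. y < x}" using inj by (rule inj_on_subset) auto
 ultimately show ?thesis unfolding pos_def by (simp add: card_image)
 qed
 show "enum (io ` S) i = io (enum S i)" if "i <= dm S" for i
 using enum_pos[OF ch, of "io (enum S i)"] p[OF enum_in'[OF S that]] pos_enum'[OF S that] enum_in'[OF S that] by simp
qed

text \<open>The chain is renumbered as 0, 3, 4, 5 and so on, its two least vertices becoming 0 and
  3, and the filler is carried back along this order isomorphism.\<close>

lemma outer_fill:
 assumes C: "quasicategory C" and s: "fchain sg" "v:sg" "w:sg" "v < w" "!!x. x:sg ==> x~=v ==> w <= x"
 and c: "3 <= card sg" and f: "cmap C (hornc sg v) f" and e: "eqe C (f {v,w})"
 shows "EX x:cells C (dm sg). ALL ta:hornc sg v. rst C ta sg x = f ta"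
proof -
 have X: "sst C" by (rule quasicategory_sset[OF C])
 define T where "T = {4..<card sg + 2}"
 define S where "S = {0,3} Un T"
 \<comment> \<open>Closes the gap at 1 and 2: the numbers 0, 3, 4, ... become the positions 0, 1, 2,
   ....\<close>
 define ep where "ep = (%j::nat. if j = 0 then 0 else j - 2)"
 define io where "io = enum sg o ep"
 have S: "fchain S" unfolding S_def T_def by (simp add: fchain_nat)
 have epS: "ep ` S = {..<card sg}"
 proof -
 have "i:ep ` S" if "i < card sg" for i
 proof (cases "i = 0")
 case True thus ?thesis unfolding S_def ep_def by (intro image_eqI[of _ _ 0]) auto
 next
 case False thus ?thesis using that unfolding S_def T_def ep_def by (intro image_eqI[of _ _ "i + 2"]) auto
 qed
 thus ?thesis using c unfolding S_def T_def ep_def by auto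
 qed
 have epm: "ep x < ep y" if "x:S" "y:S" "x < y" for x y using that unfolding S_def T_def ep_def by auto
 have e_less: "enum sg i < enum sg j" if "i < j" "j < card sg" for i j using pos_less_iff[OF s(1) enum_in[OF s(1)] enum_in[OF s(1)], of i j] that s(1) by auto
 have m: "io x < io y" if "x:S" "y:S" "x < y" for x y unfolding io_def using e_less[OF epm[OF that]] epS that by auto
 have iS: "io ` S = sg"
 proof -
 have "{..<card sg} = {..dm sg}" using fchain_card[OF s(1)] by auto
 thus ?thesis unfolding io_def image_comp[symmetric] epS using enum_image[OF s(1)] by simp
 qed
 note si = strict_image[where io = io, OF S m]
 have cS: "card S = card sg" using card_image[OF si(2)] iS by simp
 have pv: "pos sg v = 0"
 proof -
 have "{y:sg. y < v} = {}" using s(4,5) by (auto dest: leD less_trans)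
 thus ?thesis unfolding pos_def by (simp only: card.empty)
 qed
 have pw: "pos sg w = 1"
 proof -
 have "{y:sg. y < w} = {v}" using s by (auto dest: leD)
 thus ?thesis unfolding pos_def by (simp only: card.empty card.insert finite.emptyI) simp
 qed
 have i03: "io 0 = v" "io 3 = w" using enum_pos[OF s(1,2)] enum_pos[OF s(1,3)] unfolding io_def ep_def pv pw by simp_all
 have inS: "0:S" "3:S" unfolding S_def by auto
 have hh: "io ` ta:hornc sg v" if t: "ta:hornc S 0" for ta
 proof -
 obtain x where x: "x:S" "x~=0" "x~:ta" and t': "ta <= S" "ta~={}" using t unfolding hornc_def by blast
 have "io x~:io ` ta" using x t' si(2) by (auto dest: inj_onD)
 moreover have "io x~=v" using x inS si(2) i03 by (metis inj_onD)
 moreover have "io x:sg" "io ` ta <= sg" using x t' iS by auto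
 ultimately show ?thesis using t' unfolding hornc_def by blast
 qed
 have ch: "fchain ta" "ta <= S" if "ta:hornc S 0" for ta using that fchain_subset[OF S] unfolding hornc_def by blast+
 define f0 where "f0 = pull C f io"
 have f0: "f0 ta = f (io ` ta)" if "ta:hornc S 0" for ta unfolding f0_def using ch[OF that] by (intro pull_inj[OF X f _ hh[OF that]] m) auto
 have cf0: "cmap C (hornc S 0) f0" unfolding f0_def
 proof (rule pull_cmap[OF X f chain_complex_hornc[OF S] _ hh])
 show "io x <= io y" if "ta:hornc S 0" "x:ta" "y:ta" "x <= y" for ta x y using m[of x y] that ch by (cases "x = y") (auto intro: less_imp_le)
 qed
 have T: "finite T" "T~={}" "!!t. t:T ==> 4 <= t" using c unfolding T_def by auto
 have 4: "4:T" using c unfolding T_def by auto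
 have h03: "{0,3}:hornc S 0" unfolding hornc_def S_def using 4 by (auto intro!: bexI[of _ 4])
 have "eqe C (f0 {0,3})" using f0[OF h03] i03 e by simp
 then obtain x where x: "x:cells C (dm S)" "!!ta. ta:hornc S 0 ==> rst C ta S x = f0 ta"
 using equivalence_edge_horn_aux[OF C T cf0[unfolded S_def]] unfolding S_def by blast
 show ?thesis
 proof (intro bexI ballI)
 show xc: "x:cells C (dm sg)" using x(1) cS by simp
 fix ta assume t: "ta:hornc sg v"
 define ta' where "ta' = {x:S. io x:ta}"
 have tsub: "ta <= sg" "ta~={}" using t unfolding hornc_def by auto
 have im: "io ` ta' = ta" using tsub iS unfolding ta'_def by auto
 obtain y where y: "y:sg" "y~=v" "y~:ta" using t unfolding hornc_def by blast
 then obtain z where z: "z:S" "io z = y" using iS by auto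
 have t': "ta':hornc S 0" unfolding hornc_def using z y i03 im tsub by (auto simp: ta'_def intro!: bexI[of _ z])
 have mt: "io x < io y" if "x:ta'" "y:ta'" "x < y" for x y using m that ch(2)[OF t'] by blast
 note st = strict_image[where io = io, OF ch(1)[OF t'] mt, unfolded im]
 have ct: "card ta' = card ta" using card_image[OF st(2)] ch(2)[OF t'] im by auto
 have "rst C ta sg x = opr C (dm ta) (dm sg) (cface ta' S) x"
 proof (rule sset_opr_cong[OF X delta_cface[OF s(1) tsub] _ xc])
 fix i assume i: "i <= dm ta"
 hence "enum ta i = io (enum ta' i)" "enum ta' i:S" using st(4)[of i] ct ch[OF t'] enum_in'[OF ch(1)[OF t'], of i] by auto
 thus "cface ta sg i = cface ta' S i" using si(3)[of "enum ta' i"] iS unfolding cface_def by simp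
 qed
 thus "rst C ta sg x = f ta" using x(2)[OF t'] f0[OF t'] im ct cS by simp
 qed
qed

section \<open>Diagrams over open sets\<close>

text \<open>
 \<open>Ch T\<close> stands for the intersection of the finite family \<open>T\<close>, as an object separate from
 that open set, and \<open>Ex i\<close> for the vertices of the simplex joined to a diagram.
\<close>

datatype 'a vtx = Op "'a set" | Ch "'a set set" | Ex nat

instantiation vtx :: (type) order
begin

fun less_eq_vtx :: "'a vtx => 'a vtx => bool" where
 "Op x <= Op y <-> x <= y"
| "Op x <= Ch T <-> x <= \<Inter>T"
| "Op x <= Ex i <-> True"
| "Ch S <= Op y <-> False"
| "Ch S <= Ch T <-> T <= S"
| "Ch S <= Ex i <-> True"
| "Ex i <= Op y <-> False"
| "Ex i <= Ch T <-> False"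
| "Ex i <= Ex j <-> i <= j"

definition less_vtx :: "'a vtx => 'a vtx => bool" where
 "less_vtx x y <-> x <= y & ~y <= x"

instance
proof
 fix x y z :: "'a vtx"
 show "(x < y) = (x <= y & ~y <= x)" by (rule less_vtx_def)
 show "x <= x" by (cases x) auto
 show "x <= y ==> y <= z ==> x <= z" by (cases x; cases y; cases z) (simp_all, blast+)
 show "x <= y ==> y <= x ==> x = y" by (cases x; cases y) auto
qed

end

section \<open>Joins with extra vertices and relative extension of cocones\<close>

definition exs :: "'a vtx set => nat set" where "exs sg = {i. Ex i:sg}"

text \<open>The join of the poset \<open>S\<close> with the simplicial complex \<open>Av\<close> on
  the extra vertices. Chains without extra vertices are always included, even if \<open>Av\<close>
  is empty.\<close>

definition jn :: "'a vtx set => nat set set => 'a vtx set set" where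
 "jn S Av = {sg. fchain sg & sg <= S Un range Ex & (exs sg = {} | exs sg:Av)}"

abbreviation pbd :: "nat set => nat set set" where "pbd ka == Pow ka - {ka}"

definition downc :: "nat set set => bool" where "downc Av <-> (ALL ka:Av. ALL mu. mu <= ka --> mu:Av)"

lemma exs_mono: "ta <= sg ==> exs ta <= exs sg" unfolding exs_def by auto

lemma jn_complex: "downc Av ==> chain_complex (jn S Av)" unfolding chain_complex_def
proof (intro ballI conjI allI impI)
 fix sg ta assume a: "downc Av" "sg:jn S Av" "ta <= sg" "ta~={}"
 hence "fchain ta" "ta <= S Un range Ex" unfolding jn_def by (auto intro: fchain_subset)
 moreover have "exs ta = {} | exs ta:Av" using a exs_mono[OF a(3)] unfolding jn_def downc_def by blast
 ultimately show "ta:jn S Av" unfolding jn_def by blast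
qed (auto simp: jn_def)

lemma downc_Pow [simp]: "downc (Pow ka)" "downc (pbd ka)" "downc {}" unfolding downc_def by auto

lemma jn_mono: "S <= T ==> Av <= Bv ==> jn S Av <= jn T Bv" unfolding jn_def by blast

text \<open>The domain of a relative extension problem: over \<open>T\<close> only the boundary of
  the simplex \<open>ka\<close> is joined, over \<open>S\<close> the whole simplex.\<close>

definition bdc :: "'a vtx set => 'a vtx set => nat set => 'a vtx set set" where
 "bdc S T ka = jn T (pbd ka) Un jn S (Pow ka)"

text \<open>Restriction of cocones under \<open>F\<close> from \<open>T\<close> to \<open>S\<close>
  is a trivial fibration; in other words, the cocones on the two diagrams are the same up to
  contractible choice.\<close>

definition good :: "'c sset => ('a vtx set => 'c) => 'a vtx set => 'a vtx set => bool" where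
 "good C F S T <-> S <= T & T Int range Ex = {} &
 (ALL ka f. finite ka --> ka~={} --> cmap C (bdc S T ka) f --> (ALL sg:jn T {}. f sg = F sg) -->
 (EX f'. cmap C (jn T (Pow ka)) f' & (ALL sg:bdc S T ka. f' sg = f sg)))"

lemma chain_complex_Un: "chain_complex K ==> chain_complex L ==> chain_complex (K Un L)" unfolding chain_complex_def by (metis UnE UnI1 UnI2)

lemma bdc_complex: "chain_complex (bdc S T ka)" unfolding bdc_def by (intro chain_complex_Un jn_complex) auto

lemma goodD: assumes "good C F S T" "finite ka" "ka~={}" "cmap C (bdc S T ka) f" "!!sg. sg:jn T {} ==> f sg = F sg"
 obtains f' where "cmap C (jn T (Pow ka)) f'" "!!sg. sg:bdc S T ka ==> f' sg = f sg"
proof -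
 note * = assms(1)[unfolded good_def, THEN conjunct2, THEN conjunct2, rule_format]
 show ?thesis using *[OF assms(2-5)] that by blast
qed

lemma jn_empty: "S <= T ==> jn S {} <= jn T Av" by (rule jn_mono) auto

lemma good_refl: "S Int range Ex = {} ==> good C F S S" unfolding good_def
proof (intro conjI allI impI)
 fix ka f assume f: "cmap C (bdc S S ka) f"
 have "jn S (pbd ka) <= jn S (Pow ka)" by (rule jn_mono) auto
 hence "bdc S S ka = jn S (Pow ka)" unfolding bdc_def by blast
 thus "EX f'. cmap C (jn S (Pow ka)) f' & (ALL sg:bdc S S ka. f' sg = f sg)" using f by (intro exI[of _ f]) simp
qed simp_all

lemma good_trans:
 assumes ST: "good C F S T" and TR: "good C F T R"
 shows "good C F S R" unfolding good_def
proof (intro conjI allI impI)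
 show sub: "S <= R" "R Int range Ex = {}" using ST TR unfolding good_def by auto
 have s2: "S <= T" "T <= R" "T Int range Ex = {}" "S Int range Ex = {}" using ST TR unfolding good_def by auto
 fix ka f assume k: "finite ka" "ka~={}" and f: "cmap C (bdc S R ka) f" and F: "ALL sg:jn R {}. f sg = F sg"
 have "bdc S T ka <= bdc S R ka" unfolding bdc_def using jn_mono[OF s2(2)] by blast
 then obtain g where g: "cmap C (jn T (Pow ka)) g" "!!sg. sg:bdc S T ka ==> g sg = f sg"
 using goodD[OF ST k, of f] cmap_subset[OF f] F jn_empty[OF s2(2), of "{}"] by blast
 define h where "h = (%sg. if sg:jn T (Pow ka) then g sg else f sg)"
 have fK: "cmap C (jn R (pbd ka)) f" using f by (rule cmap_subset) (auto simp: bdc_def)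
 have h: "cmap C (jn T (Pow ka) Un jn R (pbd ka)) h" unfolding h_def
 proof (rule cmap_glue[OF g(1) fK])
 fix sg assume "sg:jn T (Pow ka)" "sg:jn R (pbd ka)"
 hence "sg:bdc S T ka" unfolding bdc_def jn_def by blast
 thus "g sg = f sg" by (rule g)
 qed (auto intro: jn_complex)
 have hf: "h sg = f sg" if "sg:bdc S R ka" for sg
 proof (cases "sg:jn T (Pow ka)")
 case True
 hence "sg:bdc S T ka" using that unfolding bdc_def jn_def by blast
 thus ?thesis using g True unfolding h_def by simp
 qed (simp add: h_def)
 have "cmap C (bdc T R ka) h" using h unfolding bdc_def by (simp add: Un_commute)
 moreover have "jn R {} <= bdc S R ka" unfolding bdc_def using jn_empty[of R R "pbd ka"] by blast
 ultimately obtain f' where f': "cmap C (jn R (Pow ka)) f'" "!!sg. sg:bdc T R ka ==> f' sg = h sg" using goodD[OF TR k, of h] hf F by (metis subset_iff)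
 have "bdc S R ka <= bdc T R ka" unfolding bdc_def using jn_mono[OF s2(1)] by blast
 thus "EX f'. cmap C (jn R (Pow ka)) f' & (ALL sg:bdc S R ka. f' sg = f sg)" using f' hf by (metis subset_iff)
qed

text \<open>A trivial fibration lifts over every finite complex, not only over a simplex: a maximal
  member of \<open>Av\<close> is split off, and its boundary is already treated by
  induction.\<close>

lemma good_extend:
 assumes TR: "good C F T R" and F: "cmap C (jn R {}) F"
 and A: "finite Av" "downc Av" "!!ka. ka:Av ==> finite ka"
 and f: "cmap C (jn T Av) f" and fF: "!!sg. sg:jn T {} ==> f sg = F sg"
 shows "EX g. cmap C (jn R Av) g & (ALL sg:jn T Av. g sg = f sg) & (ALL sg:jn R {}. g sg = F sg)" using A f
proof (induction "card Av" arbitrary: Av)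
 have s2: "T <= R" "R Int range Ex = {}" "T Int range Ex = {}" using TR unfolding good_def by auto
 case 0
 hence "jn T Av = jn T {}" "jn R Av = jn R {}" by simp_all
 thus ?case using F fF jn_empty[OF s2(1), of "{}"] by auto
next
 have s2: "T <= R" "R Int range Ex = {}" "T Int range Ex = {}" using TR unfolding good_def by auto
 case (Suc n)
 hence ne: "Av~={}" by auto
 obtain ka where ka: "ka:Av" "!!mu. mu:Av ==> ~ ka \<subset> mu" using finite_has_maximal[OF Suc.prems(1) ne] by (metis psubset_imp_subset psubset_eq)
 let ?B = "Av - {ka}"
 have dB: "downc ?B" unfolding downc_def
 proof (intro ballI allI impI)
 fix mu nu assume a: "mu:?B" "nu <= mu"
 hence "nu:Av" using Suc.prems(2) unfolding downc_def by blast
 moreover have "nu~=ka" using ka(2)[of mu] a by blast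
 ultimately show "nu:?B" by blast
 qed
 have "EX g. cmap C (jn R ?B) g & (ALL sg:jn T ?B. g sg = f sg) & (ALL sg:jn R {}. g sg = F sg)"
 proof (rule Suc.hyps(1)[OF _ _ dB])
 show "n = card ?B" using Suc.hyps(2) ka(1) Suc.prems(1) by simp
 show "cmap C (jn T ?B) f" by (rule cmap_subset[OF Suc.prems(4)]) (rule jn_mono, auto)
 qed (use Suc.prems in auto)
 then obtain g where g: "cmap C (jn R ?B) g" "!!sg. sg:jn T ?B ==> g sg = f sg" "!!sg. sg:jn R {} ==> g sg = F sg" by blast
 show ?case
 proof (cases "ka = {}")
 case True
 have "jn S Av = jn S ?B" for S :: "'b vtx set" unfolding jn_def True by auto
 thus ?thesis using g by metis
 next
 case False
 have pb: "pbd ka <= ?B" "Pow ka <= Av" using Suc.prems(2) ka(1) unfolding downc_def by auto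
 define h where "h = (%sg. if sg:jn R ?B then g sg else f sg)"
 have h: "cmap C (jn R ?B Un jn T Av) h" unfolding h_def
 proof (rule cmap_glue[OF g(1) Suc.prems(4)])
 fix sg assume "sg:jn R ?B" "sg:jn T Av"
 hence "sg:jn T ?B" unfolding jn_def by blast
 thus "g sg = f sg" by (rule g)
 qed (use dB Suc.prems in "auto intro: jn_complex")
 have hF: "h sg = F sg" if "sg:jn R {}" for sg using that g(3) jn_empty[of R R ?B] unfolding h_def by auto
 have sub: "bdc T R ka <= jn R ?B Un jn T Av" unfolding bdc_def using jn_mono[OF order.refl pb(1), of R] jn_mono[OF order.refl pb(2), of T] by blast
 obtain h' where h': "cmap C (jn R (Pow ka)) h'" "!!sg. sg:bdc T R ka ==> h' sg = h sg"
 using goodD[OF TR Suc.prems(3)[OF ka(1)] False cmap_subset[OF h sub] hF] by blast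
 define k where "k = (%sg. if sg:jn R ?B then g sg else h' sg)"
 have ov: "g sg = h' sg" if "sg:jn R ?B" "sg:jn R (Pow ka)" for sg
 proof -
 have "sg:bdc T R ka" using that unfolding bdc_def jn_def by blast
 thus ?thesis using h' that(1) unfolding h_def by simp
 qed
 have k: "cmap C (jn R ?B Un jn R (Pow ka)) k" unfolding k_def by (rule cmap_glue[OF g(1) h'(1) _ _ ov]) (use dB in "auto intro: jn_complex")
 have "jn R Av <= jn R ?B Un jn R (Pow ka)" unfolding jn_def by auto
 hence "cmap C (jn R Av) k" by (rule cmap_subset[OF k])
 moreover have "k sg = f sg" if s: "sg:jn T Av" for sg
 proof (cases "sg:jn R ?B")
 case True
 hence "sg:jn T ?B" using s unfolding jn_def by blast
 thus ?thesis using g True unfolding k_def by simp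
 next
 case F: False
 have "sg:jn T (Pow ka)" using s F s2 unfolding jn_def by auto
 thus ?thesis using h'(2)[of sg] F unfolding k_def h_def bdc_def by simp
 qed
 moreover have "k sg = F sg" if "sg:jn R {}" for sg using that g(3) jn_empty[of R R ?B] unfolding k_def by auto
 ultimately show ?thesis by blast
 qed
qed

text \<open>Cancellation for trivial fibrations: the boundary data over \<open>T\<close> are first
  lifted to \<open>R\<close>, the problem is solved there, and the solution is restricted to
  \<open>T\<close>.\<close>

lemma good_cancel:
 assumes SR: "good C F S R" and TR: "good C F T R" and sub: "S <= T" and F: "cmap C (jn R {}) F"
 shows "good C F S T" unfolding good_def
proof (intro conjI allI impI)
 have s2: "T <= R" "R Int range Ex = {}" using TR unfolding good_def by auto
 show "S <= T" "T Int range Ex = {}" using sub s2 by auto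
 fix ka f assume k: "finite ka" "ka~={}" and f: "cmap C (bdc S T ka) f" and fF: "ALL sg:jn T {}. f sg = F sg"
 have "EX g. cmap C (jn R (pbd ka)) g & (ALL sg:jn T (pbd ka). g sg = f sg) & (ALL sg:jn R {}. g sg = F sg)"
 by (rule good_extend[OF TR F]) (use k f fF in "auto simp: bdc_def intro: finite_subset cmap_subset")
 then obtain g where g: "cmap C (jn R (pbd ka)) g" "!!sg. sg:jn T (pbd ka) ==> g sg = f sg" "!!sg. sg:jn R {} ==> g sg = F sg" by blast
 define h where "h = (%sg. if sg:jn R (pbd ka) then g sg else f sg)"
 have h: "cmap C (jn R (pbd ka) Un jn S (Pow ka)) h" unfolding h_def
 proof (rule cmap_glue[OF g(1) cmap_subset[OF f]])
 fix sg assume "sg:jn R (pbd ka)" "sg:jn S (Pow ka)"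
 hence "sg:jn T (pbd ka)" using sub unfolding jn_def by blast
 thus "g sg = f sg" by (rule g)
 qed (auto intro: jn_complex simp: bdc_def)
 have "h sg = F sg" if "sg:jn R {}" for sg using that g(3) jn_empty[of R R "pbd ka"] unfolding h_def by auto
 then obtain h' where h': "cmap C (jn R (Pow ka)) h'" "!!sg. sg:bdc S R ka ==> h' sg = h sg" using goodD[OF SR k h[folded bdc_def]] by blast
 have "cmap C (jn T (Pow ka)) h'" by (rule cmap_subset[OF h'(1)]) (rule jn_mono[OF s2(1)], auto)
 moreover have "h' sg = f sg" if s: "sg:bdc S T ka" for sg
 proof -
 have "sg:bdc S R ka" using s jn_mono[OF s2(1)] unfolding bdc_def by blast
 hence "h' sg = h sg" by (rule h')
 also have "h sg = f sg"
 proof (cases "sg:jn R (pbd ka)")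
 case True
 hence "sg:jn T (pbd ka)" using s sub unfolding bdc_def jn_def by blast
 thus ?thesis using g True unfolding h_def by simp
 qed (simp add: h_def)
 finally show ?thesis .
 qed
 ultimately show "EX f'. cmap C (jn T (Pow ka)) f' & (ALL sg:bdc S T ka. f' sg = f sg)" by blast
qed

section \<open>Inclusions of diagrams that do not change cocones\<close>

lemma enum_least: "fchain A ==> enum A 0:A" "fchain A ==> x:A ==> enum A 0 <= x" using enum_in'[of A 0] pos_le_iff[of A "enum A 0" x] by auto

lemma enum_greatest: "fchain A ==> enum A (dm A):A" "fchain A ==> x:A ==> x <= enum A (dm A)"
 using enum_in'[of A "dm A"] pos_le_iff[of A x "enum A (dm A)"] pos_dm[of A x] by auto

lemma le_Ex [simp]: "x~:range Ex ==> x <= Ex i" by (cases x) auto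

lemma Ex_le [simp]: "Ex i <= x ==> x:range Ex" by (cases x) auto

lemma less_Ex [simp]: "x~:range Ex ==> x < Ex i" using le_Ex[of x i] by (auto simp: less_le)

lemma bd_compl:
 assumes "T Int range Ex = {}"
 shows "sg:jn T (Pow ka) - bdc S T ka <->
 fchain sg & sg <= T Un range Ex & exs sg = ka & ka~={} & ~ sg <= S Un range Ex" unfolding bdc_def jn_def by auto

lemma fchain_insertI:
 assumes "fchain sg" "!!x. x:sg ==> x <= v | v <= x" shows "fchain (insert v sg)" using assms unfolding fchain_def by auto

lemma exs_insert: "v~:range Ex ==> exs (insert v sg) = exs sg" "v~:range Ex ==> exs (sg - {v}) = exs sg" unfolding exs_def by auto

text \<open>On chains without extra vertices the family agrees with \<open>F\<close>. Hence a horn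
  at the least vertex is admissible as soon as its leading edge is an equivalence under
  \<open>F\<close>; all other horns have to be inner.\<close>

lemma good_pairing:
 assumes C: "quasicategory C" and ST: "S <= T" "T Int range Ex = {}"
 and pr: "!!ka. finite ka ==> ka~={} ==> pairing (jn T (Pow ka)) (bdc S T ka) v r"
 and fl: "!!ka sg. finite ka ==> ka~={} ==> sg:jn T (Pow ka) - bdc S T ka ==> v sg:sg ==>
 (EX a:sg. a < v sg) & (EX b:sg. v sg < b) |
 (EX w:sg. v sg < w & (ALL x:sg. x~=v sg --> w <= x) & 3 <= card sg & {v sg, w}:jn T {} &
 eqe C (F {v sg, w}))"
 shows "good C F S T" unfolding good_def
proof (intro conjI allI impI ST)
 fix ka f assume k: "finite ka" "ka~={}" and f: "cmap C (bdc S T ka) f" and F: "ALL sg:jn T {}. f sg = F sg"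
 interpret pairing "jn T (Pow ka)" "bdc S T ka" v r by (rule pr[OF k])
 obtain f' where "cmap C (jn T (Pow ka)) f'" "!!sg. sg:bdc S T ka ==> f' sg = f sg"
 proof (rule extend[OF quasicategory_sset[OF C] f])
 fix sg g assume s: "sg:jn T (Pow ka) - bdc S T ka" "v sg:sg" and g: "cmap C (hornc sg (v sg)) g"
 and gf: "!!ta. ta:bdc S T ka ==> g ta = f ta"
 have ch: "fchain sg" using s(1) unfolding jn_def by blast
 from fl[OF k s] show "EX x:cells C (dm sg). ALL ta:hornc sg (v sg). rst C ta sg x = g ta"
 proof (elim disjE conjE bexE)
 fix a b assume "a:sg" "a < v sg" "b:sg" "v sg < b"
 thus ?thesis using inner_fill[OF C ch s(2) _ _ _ _ g] by blast
 next
 fix w assume w: "w:sg" "v sg < w" "ALL x:sg. x~=v sg --> w <= x" "3 <= card sg"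
 "{v sg, w}:jn T {}" "eqe C (F {v sg, w})"
 have "{v sg, w}:bdc S T ka" using w(5) jn_mono[of T T "{}" "pbd ka"] unfolding bdc_def by blast
 hence "eqe C (g {v sg, w})" using gf F w by simp
 thus ?thesis using outer_fill[OF C ch s(2) w(1,2) _ w(4) g] w(3) by blast
 qed
 qed blast
 thus "EX f'. cmap C (jn T (Pow ka)) f' & (ALL sg:bdc S T ka. f' sg = f sg)" by blast
qed

text \<open>A greatest vertex alone controls the cocones. Missing chains are paired by
  \<open>V\<close>, and the horn is inner: such a chain has an element outside \<open>S\<close>,
  which lies below \<open>V\<close>, and an extra vertex, which lies above.\<close>

lemma good_top:
 assumes C: "quasicategory C" and ST: "S <= T" "T Int range Ex = {}" and V: "V:S" "!!t. t:T ==> t <= V"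
 shows "good C F S T"
proof (rule good_pairing[OF C ST, where v = "%_. V" and r = "%sg. card (insert V sg)"])
 have VE: "V~:range Ex" using V ST by auto
 note N = bd_compl[OF ST(2)]
 fix ka :: "nat set" assume k: "finite ka" "ka~={}"
 show "pairing (jn T (Pow ka)) (bdc S T ka) (%_. V) (%sg. card (insert V sg))"
 proof
 fix sg assume s: "sg:jn T (Pow ka) - bdc S T ka"
 note s' = s[unfolded N]
 have cmp: "x <= V | V <= x" if "x:sg" for x using s' that V(2) VE by (cases "x:range Ex") auto
 have "fchain (insert V sg)" using fchain_insertI[of sg V] cmp s' by blast
 thus "insert V sg:jn T (Pow ka)" using s' V ST exs_insert[OF VE, of sg] unfolding jn_def by auto
 have "~ sg - {V} <= S Un range Ex" using s' V by blast
 moreover from this have "fchain (sg - {V})" using s' fchain_subset[of sg "sg - {V}"] by blast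
 ultimately show "sg - {V}:jn T (Pow ka) - bdc S T ka" using s' exs_insert[OF VE, of sg] unfolding N by blast
 fix x assume x: "V:sg" "x:sg" "x~=V"
 have "finite sg" using s' unfolding fchain_def by blast
 thus "card (insert V (sg - {x})) < card (insert V sg)" using x by (intro psubset_card_mono) auto
 next
 show "bdc S T ka <= jn T (Pow ka)" unfolding bdc_def using jn_mono[OF ST(1), of "Pow ka" "Pow ka"] jn_mono[of T T "pbd ka" "Pow ka"] by blast
 qed (auto intro: jn_complex bdc_complex)
 fix sg assume s: "sg:jn T (Pow ka) - bdc S T ka" "V:sg"
 note s' = s(1)[unfolded N]
 obtain t where t: "t:sg" "t:T" "t~:S" using s' by blast
 obtain i where i: "i:ka" using k by blast
 hence "Ex i:sg" using s' unfolding exs_def by blast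
 moreover have "t < V" using V t by (auto simp: less_le)
 ultimately show "(EX a:sg. a < V) & (EX b:sg. V < b) |
 (EX w:sg. V < w & (ALL x:sg. x~=V --> w <= x) & 3 <= card sg & {V, w}:jn T {} &
 eqe C (F {V, w}))" using less_Ex[OF VE] t(1) by blast
qed

text \<open>Below \<open>i\<close> the poset \<open>S\<close> has the greatest element
  \<open>y i\<close>, so the equivalences from \<open>y i\<close> to \<open>i\<close> make
  \<open>F\<close> a left Kan extension from \<open>S\<close>. The paired vertex is \<open>y\<close>
  of the least member of \<open>I\<close> in the chain; every member of the chain is comparable with
  it.\<close>

lemma good_kan:
 assumes C: "quasicategory C" and E: "S Int range Ex = {}" "I Int range Ex = {}" "S Int I = {}"
 and IS: "!!i s. i:I ==> s:S ==> ~i <= s"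
 and y: "!!i. i:I ==> y i:S" "!!i. i:I ==> y i <= i" "!!i s. i:I ==> s:S ==> s <= i ==> s <= y i"
 and eq: "!!i. i:I ==> eqe C (F {y i, i})"
 shows "good C F S (S Un I)"
proof -
 define m where "m = (%sg. enum (sg Int I) 0)"
 define v where "v = (%sg. y (m sg))"
 \<comment> \<open>Deleting a member of \<open>I\<close> may change the paired vertex, but then the
   first summand drops; otherwise the paired vertex stays and the second summand drops.\<close>
 define r where "r = (%sg. 2 * card (sg Int I) + card (insert (v sg) sg))"
 have ST: "S <= S Un I" "(S Un I) Int range Ex = {}" using E by auto
 note N = bd_compl[OF ST(2)]
 have N': "sg:jn (S Un I) (Pow ka) - bdc S (S Un I) ka <->
 fchain sg & sg <= S Un I Un range Ex & exs sg = ka & ka~={} & sg Int I~={}" for sg ka unfolding N using E by blast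
 have mI: "m sg:sg" "m sg:I" "!!x. x:sg ==> x:I ==> m sg <= x" if "fchain sg" "sg Int I~={}" for sg
 using enum_least[of "sg Int I"] fchain_subset[OF that(1) _ that(2)] unfolding m_def by auto
 show ?thesis
 proof (rule good_pairing[OF C ST, where v = v and r = r])
 fix ka :: "nat set" assume k: "finite ka" "ka~={}"
 have *: "v sg:S" "v sg~:I" "v sg~:range Ex" "v sg < m sg" "m sg:sg" "m sg:I"
 "!!x. x:sg ==> x:S & x <= v sg | m sg <= x"
 if s: "sg:jn (S Un I) (Pow ka) - bdc S (S Un I) ka" for sg
 proof -
 note s' = s[unfolded N']
 have mm: "m sg:sg" "m sg:I" "!!x. x:sg ==> x:I ==> m sg <= x" using mI s' by blast+
 show "v sg:S" "m sg:sg" "m sg:I" using mm y(1) unfolding v_def by blast+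
 thus "v sg~:I" "v sg~:range Ex" using E by blast+
 show "v sg < m sg" using y(2)[OF mm(2)] \<open>v sg~:I\<close> mm(2) unfolding v_def by (auto simp: less_le)
 show "x:S & x <= v sg | m sg <= x" if "x:sg" for x
 proof (cases "x:S")
 case True
 have "x <= m sg" using fchain_total[of sg x "m sg"] s' that mm IS[OF mm(2) True] by blast
 thus ?thesis using y(3)[OF mm(2) True] True unfolding v_def by blast
 next
 case False
 have "m sg~:range Ex" using mm E by blast
 moreover have "x:I | x:range Ex" using that s' False by blast
 ultimately show ?thesis using that mm le_Ex by blast
 qed
 qed
 show "pairing (jn (S Un I) (Pow ka)) (bdc S (S Un I) ka) v r"
 proof
 fix sg assume s: "sg:jn (S Un I) (Pow ka) - bdc S (S Un I) ka"
 note s' = s[unfolded N'] and s2 = *[OF s]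
 have i: "insert (v sg) sg Int I = sg Int I" "(sg - {v sg}) Int I = sg Int I" using s2(2) by auto
 have "x <= v sg | v sg <= x" if "x:sg" for x using s2(7)[OF that] s2(4) by (meson less_imp_le order.trans)
 hence "fchain (insert (v sg) sg)" using fchain_insertI[of sg "v sg"] s' by blast
 thus "insert (v sg) sg:jn (S Un I) (Pow ka)" using s' s2 exs_insert[OF s2(3), of sg] unfolding jn_def by auto
 have "fchain (sg - {v sg})" using s' s2 fchain_subset[of sg "sg - {v sg}"] by blast
 thus "sg - {v sg}:jn (S Un I) (Pow ka) - bdc S (S Un I) ka" using s' exs_insert[OF s2(3), of sg] i unfolding N' by auto
 have vm: "v rh = y (m rh)" for rh unfolding v_def ..
 have mi: "m (insert (v sg) sg) = m sg" "m (sg - {v sg}) = m sg" unfolding m_def i by (rule refl)+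
 show "v (sg - {v sg}) = v sg" using vm[of "sg - {v sg}"] vm[of sg] mi by simp
 show "v (insert (v sg) sg) = v sg" using vm[of "insert (v sg) sg"] vm[of sg] mi by simp
 thus "r (insert (v sg) sg) = r sg" unfolding r_def i by simp
 fix x assume x: "v sg:sg" "x:sg" "x~=v sg"
 have fin: "finite sg" using s' unfolding fchain_def by blast
 have c1: "card (insert (v sg) sg) = card sg" using x by (simp add: insert_absorb)
 show "r (sg - {x}) < r sg"
 proof (cases "x:I")
 case True
 have "card ((sg - {x}) Int I) < card (sg Int I)" using True x fin by (intro psubset_card_mono) auto
 moreover have "card (insert (v (sg - {x})) (sg - {x})) <= card sg"
 using card_insert_le_m1[of "card sg" "sg - {x}"] x fin by (simp add: card_gt_0_iff) (metis card_gt_0_iff empty_iff)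
 ultimately show ?thesis unfolding r_def c1 by linarith
 next
 case False
 hence "(sg - {x}) Int I = sg Int I" by auto
 moreover from this have "v (sg - {x}) = v sg" unfolding v_def m_def by simp
 moreover have "card (insert (v sg) (sg - {x})) < card (insert (v sg) sg)" using x fin by (intro psubset_card_mono) auto
 ultimately show ?thesis unfolding r_def by simp
 qed
 next
 show "bdc S (S Un I) ka <= jn (S Un I) (Pow ka)" unfolding bdc_def
 using jn_mono[OF ST(1), of "Pow ka" "Pow ka"] jn_mono[of "S Un I" "S Un I" "pbd ka" "Pow ka"] by blast
 qed (auto intro: jn_complex bdc_complex)
 fix sg assume s: "sg:jn (S Un I) (Pow ka) - bdc S (S Un I) ka" and vs: "v sg:sg"
 note s' = s[unfolded N'] and s2 = *[OF s]
 show "(EX a:sg. a < v sg) & (EX b:sg. v sg < b) |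
 (EX w:sg. v sg < w & (ALL x:sg. x~=v sg --> w <= x) & 3 <= card sg & {v sg, w}:jn (S Un I) {} &
 eqe C (F {v sg, w}))"
 \<comment> \<open>If nothing lies below the paired vertex, the next vertex is the least member of
   \<open>I\<close>, and the leading edge is one of the given equivalences.\<close>
 proof (cases "EX a:sg. a < v sg")
 case True
 thus ?thesis using s2 by blast
 next
 case False
 have "m sg <= x" if "x:sg" "x~=v sg" for x using s2(7)[OF that(1)] False that by (auto simp: less_le)
 moreover have "3 <= card sg"
 proof -
 obtain i where i: "i:ka" using k by blast
 hence "{v sg, m sg, Ex i} <= sg" using s' s2 vs unfolding exs_def by blast
 moreover have "v sg~=m sg" "v sg~=Ex i" "m sg~=Ex i" using s2(3,4,6) E by auto
 hence "card {v sg, m sg, Ex i} = 3" by simp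
 moreover have "finite sg" using s' unfolding fchain_def by blast
 ultimately show ?thesis using card_mono by metis
 qed
 moreover have "m sg~:range Ex" using s2(6) E by blast
 hence "exs {v sg, m sg} = {}" using s2(3) unfolding exs_def by auto (metis rangeI)+
 moreover from this have "{v sg, m sg}:jn (S Un I) {}" unfolding jn_def using s' s2(1,5,6) vs fchain_subset[of sg "{v sg, m sg}"] by simp
 moreover have "eqe C (F {v sg, m sg})" unfolding v_def by (rule eq[OF s2(6)])
 ultimately show ?thesis using s2 by blast
 qed
 qed
qed

lemma rank_arith: "a' < a ==> b' < a ==> a' * a' + b' < a * a + (b::nat)"
proof -
 assume a: "a' < a" "b' < a"
 then obtain k where k: "a = Suc k" by (cases a) auto
 hence "a' * a' <= k * k" using a by (intro mult_mono) auto
 thus ?thesis using a k by simp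
qed

text \<open>
 Cofinality of the Cech diagram: above an element of \<open>Q\<close> the finite families form a contractible
 poset, contracted by adjoining a fixed member \<open>t\<close> and then comparing with the family \<open>{t}\<close>.
\<close>

lemma good_cech:
 assumes C: "quasicategory C" and PQ: "P <= Q" "Q <= range Op"
 and I: "I = Ch ` {T. finite T & T~={} & T <= Wv}"
 and sieve: "!!p q. p:P ==> q:Q ==> q <= p ==> q:P"
 and cov: "!!x. Op x:Q ==> EX W:Wv. x <= W"
 shows "good C F (P Un I) (Q Un I)"
proof -
 obtain t where t: "!!q. q:Q ==> t q:Wv & q <= Ch {t q}"
 proof -
 have "ALL q:Q. EX W. W:Wv & q <= Ch {W}" using cov PQ(2) by (force simp: image_iff subset_iff)
 thus ?thesis using that by metis
 qed
 \<comment> \<open>The fixed member \<open>t\<close> is chosen according to the greatest vertex in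
   \<open>Q\<close>, so it is unaffected by deleting other vertices.\<close>
 define q where "q = (%sg. enum (sg Int Q) (dm (sg Int Q)))"
 define bad where "bad = (%sg. {x:sg. EX T. x = Ch T & t (q sg)~:T})"
 \<comment> \<open>The order on families is reversed inclusion, so the least bad vertex is the
   largest family without \<open>t\<close>. Adding \<open>t\<close> to it gives a vertex just below
   the bad ones and above the families that contain \<open>t\<close>; if none is bad, the single
   family of \<open>t\<close> takes this place.\<close>
 define v where "v = (%sg. if bad sg = {} then Ch {t (q sg)}
 else case enum (bad sg) 0 of Ch T => Ch (insert (t (q sg)) T))"
 define a where "a = (%sg. card (sg Int Q) + card (insert (v sg) sg))"
 \<comment> \<open>Deleting a vertex of \<open>Q\<close> may change \<open>t\<close> and create bad
   vertices. Their number stays below the old value of \<open>a\<close>, and squaring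
   \<open>a\<close> absorbs it.\<close>
 define r where "r = (%sg. a sg * a sg + card (bad sg))"
 have E: "Q Int range Ex = {}" "I Int range Ex = {}" "Q Int I = {}" using PQ(2) unfolding I by auto
 have ST: "P Un I <= Q Un I" "(Q Un I) Int range Ex = {}" using PQ E by auto
 note N = bd_compl[OF ST(2)]
 have QI: "~i <= s" if "i:I" "s:Q" for i s using that PQ(2) unfolding I by auto
 show ?thesis
 proof (rule good_pairing[OF C ST, where v = v and r = r])
 fix ka :: "nat set" assume k: "finite ka" "ka~={}"
 let ?N = "jn (Q Un I) (Pow ka) - bdc (P Un I) (Q Un I) ka"
 have qs: "q sg:sg" "q sg:Q" "!!x. x:sg ==> x:Q ==> x <= q sg" "q sg~:P"
 if s: "sg:?N" for sg
 proof -
 note s' = s[unfolded N]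
 have ne: "sg Int Q~={}" using s' by blast
 hence "fchain (sg Int Q)" using fchain_subset[of sg] s' by blast
 thus 1: "q sg:sg" "q sg:Q" "!!x. x:sg ==> x:Q ==> x <= q sg" using enum_greatest[of "sg Int Q"] unfolding q_def by blast+
 obtain z where z: "z:sg" "z:Q" "z~:P" using s' by blast
 thus "q sg~:P" using 1(3)[OF z(1,2)] sieve[of "q sg" z] by blast
 qed
 have bads: "enum (bad sg) 0:bad sg" "!!x. x:bad sg ==> enum (bad sg) 0 <= x"
 if "sg:?N" "bad sg~={}" for sg
 proof -
 have "fchain (bad sg)" using that fchain_subset[of sg "bad sg"] unfolding N bad_def by blast
 thus "enum (bad sg) 0:bad sg" "!!x. x:bad sg ==> enum (bad sg) 0 <= x" using enum_least by blast+
 qed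
 have vT: "EX T. v sg = Ch T & v sg:I & t (q sg):T" if s: "sg:?N" for sg
 proof (cases "bad sg = {}")
 case True
 thus ?thesis using t[OF qs(2)[OF s]] unfolding v_def I by auto
 next
 case False
 obtain T where T: "enum (bad sg) 0 = Ch T" "Ch T:sg" using bads(1)[OF s False] unfolding bad_def by auto
 hence "Ch T:I" using s PQ(2) unfolding N by auto
 hence "finite T & T <= Wv" unfolding I by auto
 thus ?thesis using False T t[OF qs(2)[OF s]] unfolding v_def I by auto
 qed
 have cmp: "x <= v sg | v sg <= x" if s: "sg:?N" and x: "x:sg" for x sg
 proof -
 note s' = s[unfolded N]
 have "x:Q | x:I | x:range Ex" using x s' by blast
 moreover have ?thesis if "x:range Ex" using that vT[OF s] by auto
 moreover have ?thesis if xI: "x:I"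
 proof -
 obtain X where X: "x = Ch X" "X~={}" using xI unfolding I by auto
 show ?thesis
 proof (cases "bad sg = {}")
 case True
 hence "t (q sg):X" using X x unfolding bad_def by blast
 thus ?thesis using True X unfolding v_def by auto
 next
 case False
 obtain T where T: "enum (bad sg) 0 = Ch T" "Ch T:sg" "t (q sg)~:T" using bads(1)[OF s False] unfolding bad_def by auto
 have v: "v sg = Ch (insert (t (q sg)) T)" using False T unfolding v_def by simp
 show ?thesis
 proof (cases "t (q sg):X")
 case True
 have "Ch T <= Ch X | Ch X <= Ch T" using fchain_total[of sg] s' T x X by blast
 hence "T <= X" using True T by auto
 thus ?thesis using True v X by auto
 next
 case False
 hence "x:bad sg" using x X unfolding bad_def by blast
 thus ?thesis using bads(2)[OF s] T v X by force
 qed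
 qed
 qed
 moreover have ?thesis if xQ: "x:Q"
 proof -
 have 1: "x <= Ch {t (q sg)}" using qs[OF s] t x xQ by (meson order.trans)
 show ?thesis
 proof (cases "bad sg = {}")
 case True thus ?thesis using 1 unfolding v_def by simp
 next
 case False
 obtain T where T: "enum (bad sg) 0 = Ch T" "Ch T:sg" using bads(1)[OF s False] unfolding bad_def by auto
 obtain X where X: "x = Op X" using xQ PQ(2) by auto
 have "Ch T <= x | x <= Ch T" using fchain_total[of sg] s' T x by blast
 hence "x <= Ch T" using X by auto
 thus ?thesis using 1 False T X unfolding v_def by auto
 qed
 qed
 ultimately show ?thesis by blast
 qed
 have inv: "v rh = v sg & bad rh = bad sg & rh Int Q = sg Int Q"
 if s: "sg:?N" and r: "rh Int Q = sg Int Q" "!!T. t (q sg)~:T ==> Ch T:rh <-> Ch T:sg" for sg rh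
 proof -
 have q: "q rh = q sg" unfolding q_def r(1) ..
 have "bad rh = bad sg" unfolding bad_def q using r(2) by blast
 thus ?thesis using r(1) unfolding v_def q by simp
 qed
 show "pairing (jn (Q Un I) (Pow ka)) (bdc (P Un I) (Q Un I) ka) v r"
 proof
 fix sg assume s: "sg:?N"
 note s' = s[unfolded N]
 obtain T where T: "v sg = Ch T" "v sg:I" "t (q sg):T" using vT[OF s] by blast
 hence vE: "v sg~:range Ex" by auto
 have "fchain (insert (v sg) sg)" using fchain_insertI[of sg "v sg"] s' cmp[OF s] by blast
 thus "insert (v sg) sg:jn (Q Un I) (Pow ka)" using s' T exs_insert[OF vE, of sg] unfolding jn_def by auto
 have n: "~ sg - {v sg} <= P Un I Un range Ex" using s' T by blast
 hence "fchain (sg - {v sg})" using s' fchain_subset[of sg "sg - {v sg}"] by blast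
 thus "sg - {v sg}:?N" using n s' exs_insert[OF vE, of sg] unfolding N by blast
 have vQ: "v sg~:Q" using T E by blast
 have i: "v (insert (v sg) sg) = v sg & bad (insert (v sg) sg) = bad sg & insert (v sg) sg Int Q = sg Int Q" by (rule inv[OF s]) (use T vQ in auto)
 have d: "v (sg - {v sg}) = v sg & bad (sg - {v sg}) = bad sg & (sg - {v sg}) Int Q = sg Int Q" by (rule inv[OF s]) (use T vQ in auto)
 show "v (insert (v sg) sg) = v sg" "v (sg - {v sg}) = v sg" using i d by blast+
 show "r (insert (v sg) sg) = r sg" unfolding r_def a_def using i by simp
 fix x assume x: "v sg:sg" "x:sg" "x~=v sg" and sx: "sg - {x}:?N"
 have fin: "finite sg" using s' unfolding fchain_def by blast
 have c1: "card (insert (v sg) sg) = card sg" using x by (simp add: insert_absorb)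
 have c2: "card (insert (v (sg - {x})) (sg - {x})) <= card sg"
 using card_Suc_Diff1[OF fin x(2)] card_insert_le_m1[of "card sg" "sg - {x}" "v (sg - {x})"] by simp
 have xE: "x~:range Ex" using x(2) sx s' unfolding N exs_def by blast
 show "r (sg - {x}) < r sg"
 proof (cases "x:Q")
 case True
 have "card ((sg - {x}) Int Q) < card (sg Int Q)" using True x fin by (intro psubset_card_mono) auto
 hence "a (sg - {x}) < a sg" using c2 unfolding a_def c1 by linarith
 moreover have "card (bad (sg - {x})) <= card (sg - {x})" using fin unfolding bad_def by (intro card_mono) auto
 hence "card (bad (sg - {x})) < a sg" using card_Suc_Diff1[OF fin x(2)] unfolding a_def c1 by linarith
 ultimately show ?thesis unfolding r_def by (rule rank_arith)
 next
 case False
 hence Qx: "(sg - {x}) Int Q = sg Int Q" by auto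
 hence qx: "q (sg - {x}) = q sg" unfolding q_def by simp
 hence bx: "bad (sg - {x}) = bad sg - {x}" unfolding bad_def by auto
 show ?thesis
 proof (cases "x:bad sg")
 case True
 have "finite (bad sg)" using fin unfolding bad_def by simp
 hence "card (bad (sg - {x})) < card (bad sg)" unfolding bx using True by (intro psubset_card_mono) auto
 moreover have "a (sg - {x}) <= a sg" unfolding a_def c1 Qx using c2 by simp
 hence "a (sg - {x}) * a (sg - {x}) <= a sg * a sg" by (intro mult_mono) auto
 ultimately show ?thesis unfolding r_def by linarith
 next
 case False
 hence b: "bad (sg - {x}) = bad sg" using bx by simp
 hence v: "v (sg - {x}) = v sg" unfolding v_def qx by simp
 have "card (insert (v sg) (sg - {x})) < card (insert (v sg) sg)" using x fin by (intro psubset_card_mono) auto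
 hence "a (sg - {x}) < a sg" unfolding a_def Qx v by simp
 hence "a (sg - {x}) * a (sg - {x}) < a sg * a sg" by (intro mult_strict_mono) auto
 thus ?thesis unfolding r_def b by simp
 qed
 qed
 next
 show "bdc (P Un I) (Q Un I) ka <= jn (Q Un I) (Pow ka)" unfolding bdc_def
 using jn_mono[OF ST(1), of "Pow ka" "Pow ka"] jn_mono[of "Q Un I" "Q Un I" "pbd ka" "Pow ka"] by blast
 qed (auto intro: jn_complex bdc_complex)
 fix sg assume s: "sg:?N" and vs: "v sg:sg"
 note s' = s[unfolded N]
 obtain T where T: "v sg = Ch T" using vT[OF s] by blast
 have "q sg < v sg" using qs[OF s] PQ(2) T cmp[OF s qs(1)[OF s]] QI[of "v sg" "q sg"] by (cases "q sg") (auto simp: less_le)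
 moreover obtain i where "i:ka" using k by blast
 hence "Ex i:sg" using s' unfolding exs_def by blast
 moreover have "v sg < Ex i" using T by (intro less_Ex) auto
 ultimately show "(EX a:sg. a < v sg) & (EX b:sg. v sg < b) |
 (EX w:sg. v sg < w & (ALL x:sg. x~=v sg --> w <= x) & 3 <= card sg & {v sg, w}:jn (Q Un I) {} &
 eqe C (F {v sg, w}))" using qs(1)[OF s] by blast
 qed
qed

section \<open>From functors on inclusion nerves to families on chains\<close>

fun opn :: "'a vtx => 'a set" where
 "opn (Op x) = x" | "opn (Ch T) = \<Inter>T" | "opn (Ex i) = {}"

lemma opn_mono: "x~:range Ex ==> y~:range Ex ==> x <= y ==> opn x <= opn y" by (cases x; cases y) auto

lemma incl_cells: "x:cells (inclusion_nerve X) n <->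
 x:{..n} \<rightarrow>\<^sub>E X & (ALL i j. i <= j --> j <= n --> x i <= x j)" by (simp add: inclusion_nerve_def)

lemma incl_opr: "opr (inclusion_nerve X) m n t x = (rs m (%i. x (t i)))" by (simp add: inclusion_nerve_def)

lemma std_cells: "s:cells (std_simplex n) m <-> s:extensional {..m} & dmap m n s" by (simp add: std_simplex_def)

lemma std_opr: "opr (std_simplex n) m k t s = (rs m (%i. s (t i)))" by (simp add: std_simplex_def)

lemma boundary_cells: "s:cells (boundary n) m <->
 s:extensional {..m} & dmap m n s & (EX i<=n. i~:s ` {..m})" by (simp add: boundary_def std_simplex_def)

lemma boundary_opr: "opr (boundary n) m k t s = (rs m (%i. s (t i)))" by (simp add: boundary_def std_simplex_def)

lemma sset_homD: "f:sset_hom X Y ==> x:cells X n ==> f n x:cells Y n"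
 "f:sset_hom X Y ==> dmap m n t ==> x:cells X n ==> f m (opr X m n t x) = opr Y m n t (f n x)"
 "f:sset_hom X Y ==> f n:extensional (cells X n)" unfolding sset_hom_def by (auto simp: PiE_def)

lemma sset_homI:
 assumes "!!n. f n:extensional (cells X n)" "!!n x. x:cells X n ==> f n x:cells Y n"
 "!!m n t x. dmap m n t ==> x:cells X n ==> f m (opr X m n t x) = opr Y m n t (f n x)"
 shows "f:sset_hom X Y" unfolding sset_hom_def using assms by (auto simp: PiE_def)

lemma join_cells: "z:cells (join K L) n <-> (EX x:cells K n. z = JLeft x) | (EX y:cells L n. z = JRight y) |
 (EX i x y. z = JBoth i x y & i < n & x:cells K i & y:cells L (n - i - 1))" unfolding join_def by auto

lemma join_opr_eq: "opr (join K L) = join_opr K L" by (simp add: join_def)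

lemma delta_initial:
 assumes "dmap m n t" shows "{k. k <= m & t k <= i} = {..<card {k. k <= m & t k <= i}}"
proof -
 let ?A = "{k. k <= m & t k <= i}"
 have fin: "finite ?A" by simp
 have dn: "l:?A" if "k:?A" "l <= k" for k l using that assms unfolding dmd by (auto intro: order.trans)
 have "k < card ?A" if "k:?A" for k
 proof -
 have "{..k} <= ?A" using dn[OF that] by auto
 from card_mono[OF fin this] show ?thesis by simp
 qed
 moreover have "k:?A" if "k < card ?A" for k
 proof (rule ccontr)
 assume "k~:?A"
 hence "?A <= {..<k}" using dn by (meson lessThan_iff linorder_not_le subsetI)
 thus False using card_mono[of "{..<k}" ?A] that by simp
 qed
 ultimately show ?thesis by blast
qed

locale diagram =
 fixes C :: "'c sset" and Ov :: "'a set set" and VF :: "nat => (nat => 'a set) => 'c"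
 assumes C: "quasicategory C" and VF: "VF:sset_hom (inclusion_nerve Ov) C"
begin

lemma XC: "sst C" by (rule quasicategory_sset[OF C])

text \<open>Open sets and formal intersections may be mixed in a chain; both are read as open sets
  before the functor is applied.\<close>

definition Fd :: "'a vtx set => 'c" where
 "Fd sg = VF (dm sg) (rs (dm sg) (%i. opn (enum sg i)))"

definition base :: "'a vtx set set" where
 "base = {sg. fchain sg & sg Int range Ex = {} & opn ` sg <= Ov}"

lemma base_complex: "chain_complex base" unfolding chain_complex_def base_def by (auto intro: fchain_subset)

lemma base_cell:
 assumes "word m w" "w ` {..m}:base"
 shows "(rs m (%i. opn (w i))):cells (inclusion_nerve Ov) m"
proof -
 have "opn (w i) <= opn (w j)" if "i <= j" "j <= m" for i j
 proof (rule opn_mono)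
 have "w ` {..m} Int range Ex = {}" using assms(2) unfolding base_def by blast
 moreover have "w i:w ` {..m}" "w j:w ` {..m}" using that by auto
 ultimately show "w i~:range Ex" "w j~:range Ex" by blast+
 show "w i <= w j" using assms(1) that unfolding word_def by blast
 qed
 moreover have "opn (w i):Ov" if "i <= m" for i using that assms unfolding base_def by auto
 ultimately show ?thesis unfolding incl_cells by auto
qed

lemma VF_opr:
 assumes "word m w" "w ` {..m}:base" "dmap k m t"
 shows "opr C k m t (VF m (rs m (%i. opn (w i)))) = VF k (rs k (%i. opn (w (t i))))"
proof -
 have "(rs k (%i. (rs m (%i. opn (w i))) (t i))) = (rs k (%i. opn (w (t i))))" using assms(3) unfolding dmd by (intro restrict_ext) simp
 thus ?thesis using sset_homD(2)[OF VF assms(3) base_cell[OF assms(1,2)]] by (simp add: incl_opr)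
qed

lemma Fd_cmap: "cmap C base Fd" unfolding Fd_def
proof (rule cmap_of_words[where g = "%m w. VF m (rs m (%i. opn (w i)))", OF XC base_complex])
 fix sg assume s: "sg:base"
 have w: "word (dm sg) (enum sg)" "enum sg ` {..dm sg}:base" using s word_enum[of sg] enum_image[of sg] unfolding base_def by auto
 show "VF (dm sg) (rs (dm sg) (%i. opn (enum sg i))):cells C (dm sg)" by (rule sset_homD(1)[OF VF base_cell[OF w]])
 show "opr C k (dm sg) t (VF (dm sg) (rs (dm sg) (%i. opn (enum sg i)))) = VF k (rs k (%i. opn ((enum sg o t) i)))"
 if "dmap k (dm sg) t" for k t using VF_opr[OF w that] by simp
next
 fix m :: nat and w w' :: "nat => 'a vtx" assume "!!i. i <= m ==> w i = w' i"
 hence "(rs m (%i. opn (w i))) = (rs m (%i. opn (w' i)))" by (intro restrict_ext) simp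
 thus "VF m (rs m (%i. opn (w i))) = VF m (rs m (%i. opn (w' i)))" by simp
qed

lemma ev_Fd: assumes "word m w" "w ` {..m}:base" shows "ev C Fd m w = VF m (rs m (%i. opn (w i)))"
proof -
 let ?T = "w ` {..m}"
 have T: "fchain ?T" by (rule word_fchain[OF assms(1)])
 have w: "word (dm ?T) (enum ?T)" "enum ?T ` {..dm ?T}:base" using T word_enum[OF T] enum_image[OF T] assms(2) by auto
 have "(rs m (%i. opn (enum ?T (pos ?T (w i))))) = (rs m (%i. opn (w i)))" using T by (intro restrict_ext) simp
 thus ?thesis unfolding ev_def Fd_def using VF_opr[OF w delta_word[OF assms(1)]] by simp
qed

end

text \<open>Translates initiality in the slice under the diagram into extension of families on
  chains. The tip and the extra vertices form a simplex of dimension \<open>m\<close>, with the tip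
  as vertex 0. As \<open>V\<close> is not in \<open>X\<close>, a word shows where its part in the
  diagram ends.\<close>

locale weiss_colimit = diagram C Ov VF
 for C :: "'c sset" and Ov :: "'a set set" and VF :: "nat => (nat => 'a set) => 'c" +
 fixes X :: "'a set set" and V :: "'a set" and ka :: "nat set"
 assumes X: "X <= Ov" "!!x. x:X ==> x <= V" "V~:X" and V: "V:Ov" and ka: "finite ka" "ka~={}"
begin

abbreviation "K == inclusion_nerve X"
abbreviation "P == Op ` X"
abbreviation "T == insert (Op V) P"
definition "m = card ka"

lemma m: "1 <= m" unfolding m_def using ka by (simp add: Suc_le_eq card_gt_0_iff)

lemma kac: "fchain ka" using ka by (simp add: fchain_nat)

definition vt :: "nat => 'a vtx" where "vt j = (if j = 0 then Op V else Ex (enum ka (j - 1)))"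

definition tv :: "'a vtx => nat" where "tv x = (case x of Ex i => Suc (pos ka i) | _ => 0)"

lemma vt_mono: "i <= j ==> j <= m ==> vt i <= vt j" unfolding vt_def m_def using enum_mono[OF kac, of "i - 1" "j - 1"] by auto

lemma tv_vt: "j <= m ==> tv (vt j) = j" unfolding tv_def vt_def m_def using pos_enum[OF kac, of "j - 1"] by auto

lemma vt_tv: "x:insert (Op V) (Ex ` ka) ==> vt (tv x) = x" unfolding tv_def vt_def using enum_pos[OF kac] by auto

lemma tv_le: "x:insert (Op V) (Ex ` ka) ==> tv x <= m" unfolding tv_def m_def using pos_bound[OF kac] by (auto simp: Suc_le_eq)

lemma tv_mono: "x:insert (Op V) (Ex ` ka) ==> y:insert (Op V) (Ex ` ka) ==> x <= y ==> tv x <= tv y" unfolding tv_def using pos_mono[OF kac] by auto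

lemma vt_in: "j <= m ==> vt j:insert (Op V) (Ex ` ka)" unfolding vt_def m_def using enum_in[OF kac, of "j - 1"] by auto

lemma vt_P: "vt j~:P" unfolding vt_def using X(3) by auto

text \<open>The vertices of a simplex of the join, read among the diagram, the tip and the extra
  vertices. The map \<open>s\<close> selects a simplex of the \<open>m\<close>-simplex formed by the
  latter two.\<close>

definition wd :: "(nat => nat) => (nat => 'a set, nat => nat) join_cell => nat => 'a vtx" where
 "wd s z = (%l. case z of JLeft x => Op (x l) | JRight r => vt (s (r l))
 | JBoth i x r => if l <= i then Op (x l) else vt (s (r (l - i - 1))))"

abbreviation "J k == join K (std_simplex k)"

lemma wd_opr:
 assumes z: "z:cells (J k) n" and t: "dmap n' n t" and l: "l <= n'"
 shows "wd s (join_opr K (std_simplex k) n' n t z) l = wd s z (t l)"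
proof (cases z)
 case (JBoth i x r)
 define a where "a = card {k. k <= n' & t k <= i}"
 have a: "{k. k <= n' & t k <= i} = {..<a}" unfolding a_def by (rule delta_initial[OF t])
 have la: "l < a <-> t l <= i" using a l by blast
 have o: "join_opr K (std_simplex k) n' n t z = (if a = 0 then JRight (rs n' (%l. r (t l - (i + 1))))
 else if a = n' + 1 then JLeft (rs n' (%l. x (t l)))
 else JBoth (a - 1) (rs (a - 1) (%l. x (t l))) (rs (n' - a) (%l. r (t (l + a) - (i + 1)))))"
 unfolding join_opr_def JBoth join_cell.case Let_def a_def[symmetric] incl_opr std_opr by (rule refl)
 show ?thesis
 proof (cases "a = 0 | a = n' + 1")
 case True
 thus ?thesis unfolding JBoth o[unfolded JBoth] wd_def using la l by auto
 next
 case False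
 hence "l <= a - 1 <-> t l <= i" using la by auto
 moreover have "l - (a - 1) - 1 = l - a" "l - a + a = l | l < a" using False by auto
 ultimately show ?thesis unfolding JBoth o[unfolded JBoth] wd_def using False la l by auto
 qed
qed (use l in "auto simp: wd_def join_opr_def incl_opr std_opr")

lemma wd_map_right:
 assumes "z:cells (J k) n" "l <= n" shows "wd s (join_map_right t n z) l = wd (s o t) z l"
 using assms(2) unfolding wd_def join_map_right_def by (cases z) auto

lemma map_right_cells:
 assumes z: "z:cells (J k') n" and t: "dmap k' k t"
 shows "join_map_right t n z:cells (J k) n"
proof -
 have "(rs n (%i. t (s i))):cells (std_simplex k) n" if "s:cells (std_simplex k') n" for s n using that t unfolding std_cells dmd by auto
 thus ?thesis using z unfolding join_cells join_map_right_def by auto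
qed

lemma opr_cells:
 assumes z: "z:cells (J k) n" and t: "dmap n' n t"
 shows "join_opr K (std_simplex k) n' n t z:cells (J k) n'"
proof -
 have K: "(rs n' (%l. x (t l))):cells K n'" if "x:cells K n" "dmap n' n t" for n' n x t using that unfolding incl_cells dmd by (auto simp: PiE_iff)
 have S: "(rs n' (%l. x (t l))):cells (std_simplex k) n'" if "x:cells (std_simplex k) n" "dmap n' n t" for n' n x t using that unfolding std_cells dmd by auto
 show ?thesis
 proof (cases z)
 case (JBoth i x r)
 have z': "i < n" "x:cells K i" "r:cells (std_simplex k) (n - i - 1)" using z unfolding JBoth join_cells by auto
 define a where "a = card {k. k <= n' & t k <= i}"
 have a: "{k. k <= n' & t k <= i} = {..<a}" unfolding a_def by (rule delta_initial[OF t])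
 have an: "a <= n' + 1" using card_mono[of "{..n'}" "{k. k <= n' & t k <= i}"] unfolding a_def by auto
 have la: "l < a <-> l <= n' & t l <= i" for l using a by blast
 have tn: "t l <= n" if "l <= n'" for l using that t unfolding dmd by auto
 have tm: "t l <= t l'" "t l' <= n" if "l <= l'" "l' <= n'" for l l' using that t unfolding dmd by auto
 have o: "join_opr K (std_simplex k) n' n t z = (if a = 0 then JRight (rs n' (%l. r (t l - (i + 1))))
 else if a = n' + 1 then JLeft (rs n' (%l. x (t l)))
 else JBoth (a - 1) (rs (a - 1) (%l. x (t l))) (rs (n' - a) (%l. r (t (l + a) - (i + 1)))))"
 unfolding join_opr_def JBoth join_cell.case Let_def a_def[symmetric] incl_opr std_opr by (rule refl)
 consider "a = 0" | "a = n' + 1" | "a~=0" "a <= n'" using an by linarith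
 thus ?thesis
 proof cases
 case 1
 have "dmap n' (n - i - 1) (%l. t l - (i + 1))" using tm tn unfolding dmd by (auto intro!: diff_le_mono)
 thus ?thesis unfolding o join_cells using 1 S[OF z'(3)] by simp
 next
 case 2
 have "t l <= i" if "l <= n'" for l using la[of l] 2 that by auto
 hence "dmap n' i t" using tm unfolding dmd by auto
 thus ?thesis unfolding o join_cells using 2 K[OF z'(2)] by simp
 next
 case 3
 have "t l <= i" if "l <= a - 1" for l using la[of l] 3 that by auto
 hence "dmap (a - 1) i t" using tm 3 unfolding dmd by auto
 moreover have "dmap (n' - a) (n - i - 1) (%l. t (l + a) - (i + 1))" using tm tn 3 unfolding dmd by (auto intro!: diff_le_mono)
 moreover have "n' - (a - 1) - 1 = n' - a" "a - 1 < n'" using 3 by auto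
 ultimately show ?thesis unfolding o join_cells using 3 S[OF z'(3)] K[OF z'(2)] by simp
 qed
 qed (use z K[OF _ t] S[OF _ t] in "auto simp: join_opr_def incl_opr std_opr join_cells")
qed

lemma wd_props:
 assumes z: "z:cells (J k) n" and s: "dmap k m s"
 shows "word n (wd s z)" "wd s z ` {..n} <= P Un vt ` s ` {..k}"
proof -
 have sk: "s i <= s j" "s j <= m" if "i <= j" "j <= k" for i j using that s unfolding dmd by auto
 have PV: "Op x <= vt j" if "x:X" for x j using that X(2) unfolding vt_def by auto
 have SV: "vt (s i) <= vt (s j)" if "i <= j" "j <= k" for i j using that sk vt_mono by auto
 have SV2: "vt (s j):vt ` s ` {..k}" if "j <= k" for j using that by auto
 have K: "x l:X" "x l <= x l'" if "x:cells K n" "l <= l'" "l' <= n" for x l l' n using that unfolding incl_cells by auto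
 have S: "r l <= r l'" "r l' <= k" if "r:cells (std_simplex k) n" "l <= l'" "l' <= n" for r l l' n using that unfolding std_cells dmd by auto
 consider x where "z = JLeft x" "x:cells K n" | r where "z = JRight r" "r:cells (std_simplex k) n"
 | i x r where "z = JBoth i x r" "i < n" "x:cells K i" "r:cells (std_simplex k) (n - i - 1)" using z unfolding join_cells by blast
 hence "(ALL l l'. l <= l' --> l' <= n --> wd s z l <= wd s z l') & (ALL l<=n. wd s z l:P Un vt ` s ` {..k})"
 proof cases
 case 1
 thus ?thesis unfolding wd_def using K[OF 1(2)] by auto
 next
 case 2
 have "vt (s (r l)):vt ` s ` {..k}" if "l <= n" for l using S(2)[OF 2(2), of l l] that by (intro SV2) auto
 thus ?thesis unfolding wd_def using 2(1) S[OF 2(2)] SV by auto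
 next
 case 3
 have "l - i - 1 <= n - i - 1" if "l <= n" for l using that by auto
 moreover have "r (l - i - 1) <= r (l' - i - 1)" "r (l' - i - 1) <= k" if "l <= l'" "l' <= n" for l l' by (rule S[OF 3(4)]; use that in auto)+
 moreover from this have "vt (s (r (l - i - 1))):vt ` s ` {..k}" if "l <= n" for l using that by (intro SV2) blast
 ultimately show ?thesis unfolding wd_def using 3(1) K[OF 3(3)] SV PV by auto
 qed
 thus "word n (wd s z)" "wd s z ` {..n} <= P Un vt ` s ` {..k}" unfolding word_def by auto
qed

text \<open>A simplex of the boundary misses some vertex. If this is vertex 0 the tip is absent and
  the chain lies over \<open>P\<close>; otherwise a member of \<open>ka\<close> is absent.\<close>

lemma wd_bdc:
 assumes z: "z:cells (J k) n" and s: "s:cells (boundary m) k"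
 shows "wd s z ` {..n}:bdc P T ka"
proof -
 have d: "dmap k m s" using s unfolding boundary_cells by blast
 obtain i where i: "i <= m" "i~:s ` {..k}" using s unfolding boundary_cells by blast
 define W where "W = wd s z ` {..n}"
 have ch: "fchain W" unfolding W_def by (rule word_fchain[OF wd_props(1)[OF z d]])
 have sub: "W <= P Un vt ` s ` {..k}" unfolding W_def by (rule wd_props(2)[OF z d])
 have sm: "s j <= m" if "j <= k" for j using d that unfolding dmd by auto
 have vti: "vt i~:vt ` s ` {..k}" 
 proof
 assume "vt i:vt ` s ` {..k}"
 then obtain j where "j <= k" "vt i = vt (s j)" by auto
 hence "i = s j" using tv_vt[OF i(1)] tv_vt[OF sm] by metis
 thus False using i(2) \<open>j <= k\<close> by auto
 qed
 have "vt (s j):T Un Ex ` ka" if "j <= k" for j using vt_in[OF sm[OF that]] by blast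
 hence "vt ` s ` {..k} <= T Un Ex ` ka" by auto
 hence T: "W <= T Un Ex ` ka" using sub by blast
 have ex: "exs W <= ka"
 proof
 fix j assume "j:exs W"
 hence "Ex j:T Un Ex ` ka" using T unfolding exs_def by blast
 thus "j:ka" by auto
 qed
 have "W:bdc P T ka"
 proof (cases "i = 0")
 case True
 hence "vt 0~:W" using vti sub vt_P by blast
 hence "Op V~:W" unfolding vt_def by simp
 hence "W <= P Un range Ex" using T by blast
 thus ?thesis using ch ex unfolding bdc_def jn_def by blast
 next
 case False
 have "vt i~:W" using vti sub vt_P by blast
 hence "Ex (enum ka (i - 1))~:W" using False unfolding vt_def by simp
 moreover have "enum ka (i - 1):ka" using i False by (intro enum_in[OF kac]) (auto simp: m_def)
 ultimately have "exs W:pbd ka" using ex unfolding exs_def by blast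
 thus ?thesis using ch T unfolding bdc_def jn_def by blast
 qed
 thus ?thesis unfolding W_def .
qed

text \<open>The entries in \<open>P\<close> form an initial segment, because the tip and the extra
  vertices are not below any of them. The word therefore splits into a simplex of the diagram and
  one of the simplex on \<open>A\<close>.\<close>

lemma wd_exists:
 assumes w: "word n w" "w ` {..n} <= P Un vt ` A" and A: "A <= {..m}" "A~={}"
 shows "EX z:cells (J (card A - 1)) n. ALL l<=n. wd (enum A) z l = w l"
proof -
 let ?k = "card A - 1"
 have Ac: "fchain A" using A finite_subset[OF A(1)] by (simp add: fchain_nat)
 define g where "g = (%l. pos A (tv (w l)))"
 have PV: "~y <= x" if xy: "x:P" "y~:P" "y:P Un vt ` A" for x y
 proof
 assume "y <= x"
 obtain x' where x': "x = Op x'" "x':X" using xy(1) by blast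
 obtain j where j: "y = vt j" using xy(2,3) by blast
 show False
 proof (cases "j = 0")
 case True
 hence "V <= x'" using \<open>y <= x\<close> j x' unfolding vt_def by simp
 hence "x' = V" using X(2)[OF x'(2)] by blast
 thus False using X(3) x'(2) by simp
 next
 case False
 thus False using \<open>y <= x\<close> j x' unfolding vt_def by simp
 qed
 qed
 define a where "a = card {l. l <= n & w l:P}"
 have "{l. l <= n & w l:P} = {..<a}"
 proof -
 let ?t = "%l. if w l:P then 0 else (1::nat)"
 have "dmap n 1 ?t" unfolding dmd
 proof (intro conjI allI impI)
 fix i j assume ij: "i <= j" "j <= n"
 have "w i:P" if "w j:P"

 proof (rule ccontr)
 assume "w i~:P"
 moreover have "w i:P Un vt ` A" using w(2) ij by (meson atMost_iff image_subset_iff le_trans)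
 moreover have "w i <= w j" using w(1) ij unfolding word_def by blast
 ultimately show False using PV[OF that] by blast
 qed
 thus "?t i <= ?t j" by auto
 qed auto
 moreover have e: "{k. k <= n & ?t k <= 0} = {l. l <= n & w l:P}" by auto
 ultimately show ?thesis using delta_initial[of n 1 ?t 0] unfolding a_def e by blast
 qed
 hence a: "l < a <-> l <= n & w l:P" for l by blast
 have an: "a <= n + 1" using a[of "n + 1"] by simp
 have gA: "tv (w l):A" "vt (tv (w l)) = w l" if "l <= n" "~l < a" for l
 proof -
 have "w l:vt ` A" using that w(2) a[of l] by blast
 then obtain j where "j:A" "w l = vt j" by blast
 thus "tv (w l):A" "vt (tv (w l)) = w l" using tv_vt[of j] A(1) by auto
 qed
 have ge: "vt (enum A (g l)) = w l" if "l <= n" "~l < a" for l unfolding g_def using enum_pos[OF Ac gA(1)[OF that]] gA(2)[OF that] by simp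
 have gm: "g l <= g l'" "g l' <= ?k" if "l <= l'" "l' <= n" "~l < a" for l l'
 proof -
 have "w l <= w l'" using w that unfolding word_def by blast
 moreover have "w x:insert (Op V) (Ex ` ka)" if "x <= n" "~x < a" for x using gA[OF that] vt_in[of "tv (w x)"] A by auto
 ultimately have "tv (w l) <= tv (w l')" using that by (intro tv_mono) auto
 thus "g l <= g l'" unfolding g_def by (rule pos_mono[OF Ac])
 show "g l' <= ?k" unfolding g_def using that by (intro pos_dm[OF Ac] gA) auto
 qed
 have gk: "g l <= ?k" if "l <= n" "~l < a" for l using gm(2)[of l l] that by simp
 have Kc: "(rs b (%l. opn (w l))):cells K b" if "!!l. l <= b ==> l < a" for b unfolding incl_cells
 proof (intro conjI allI impI)
 have "EX x:X. w l = Op x" if "l <= b" for l using a[of l] \<open>!!l. l <= b ==> l < a\<close>[OF that] by auto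
 thus "(rs b (%l. opn (w l))):{..b} \<rightarrow>\<^sub>E X" by fastforce
 fix i j assume ij: "i <= j" "j <= b"
 have "j <= n" "w i:P" "w j:P" using a that[of i] that[of j] ij by auto
 moreover have "w i <= w j" using w ij \<open>j <= n\<close> unfolding word_def by blast
 ultimately show "(rs b (%l. opn (w l))) i <= (rs b (%l. opn (w l))) j" using ij by auto
 qed
 consider "a = 0" | "a = n + 1" | "a~=0" "a <= n" using an by linarith
 thus ?thesis
 proof cases
 case 1
 have "(rs n (%l. g l)):cells (std_simplex ?k) n" unfolding std_cells dmd using gm(1) gk 1 by auto
 thus ?thesis using 1 ge by (intro bexI[of _ "JRight (rs n (%l. g l))"]) (auto simp: wd_def join_cells)
 next
 case 2
 have "Op (opn (w l)) = w l" if "l <= n" for l using a[of l] 2 that by auto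
 thus ?thesis using 2 Kc[of n] by (intro bexI[of _ "JLeft (rs n (%l. opn (w l)))"]) (auto simp: wd_def join_cells)
 next
 case 3
 let ?z = "JBoth (a - 1) (rs (a - 1) (%l. opn (w l))) (rs (n - a) (%l. g (l + a)))"
 have "(rs (n - a) (%l. g (l + a))):cells (std_simplex ?k) (n - a)" unfolding std_cells dmd using gm(1) gk 3 by auto
 moreover have "n - (a - 1) - 1 = n - a" "a - 1 < n" using 3 by auto
 ultimately have "?z:cells (J ?k) n" unfolding join_cells using Kc[of "a - 1"] 3 by simp
 moreover have "wd (enum A) ?z l = w l" if l: "l <= n" for l
 proof (cases "l < a")
 case True
 thus ?thesis using a[of l] by (auto simp: wd_def)
 next
 case False
 hence "l - (a - 1) - 1 = l - a" "l - a + a = l" "~l <= a - 1" using 3 by auto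
 thus ?thesis using ge[OF l False] l by (simp add: wd_def diff_le_mono)
 qed
 ultimately show ?thesis by blast
 qed
qed

lemma wd_unique:
 assumes z: "z:cells (J m) n" "z':cells (J m) n" and e: "!!l. l <= n ==> wd (%i. i) z l = wd (%i. i) z' l"
 shows "z = z'"
proof -
 have S: "r l <= m" if "r:cells (std_simplex m) n" "l <= n" for r l n using that unfolding std_cells dmd by auto
 have Se: "r = r'" if "r:cells (std_simplex m) n" "r':cells (std_simplex m) n" "!!l. l <= n ==> vt (r l) = vt (r' l)" for r r' n
 using that S tv_vt unfolding std_cells by (metis atMost_iff extensionalityI)
 have Ke: "x = x'" if "x:cells K n" "x':cells K n" "!!l. l <= n ==> x l = x' l" for x x' n
 using that unfolding incl_cells PiE_def by (metis IntE atMost_iff extensionalityI)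
 have KX: "Op (x l):P" if "x:cells K n" "l <= n" for x n l using that unfolding incl_cells by auto
 have ne: "Op (x l)~=vt j" "vt j~=Op (x l)" if "x:cells K n" "l <= n" for x n l j using KX[OF that] vt_P by metis+
 from z[unfolded join_cells] show ?thesis
 proof (elim disjE bexE exE conjE)
 fix x x' assume b: "z = JLeft x" "x:cells K n" "z' = JLeft x'" "x':cells K n"
 have "x = x'" by (rule Ke[OF b(2,4)]) (use e b in "simp add: wd_def")
 thus ?thesis using b by simp
 next
 fix x r assume "z = JLeft x" "x:cells K n" "z' = JRight r" "r:cells (std_simplex m) n"
 thus ?thesis using e[of 0] ne[of x n 0] by (simp add: wd_def)
 next
 fix x i x' r assume "z = JLeft x" "x:cells K n" "z' = JBoth i x' r" "i < n"
 thus ?thesis using e[of n] ne[of x n n] by (simp add: wd_def)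
 next
 fix x r assume "z' = JLeft x" "x:cells K n" "z = JRight r" "r:cells (std_simplex m) n"
 thus ?thesis using e[of 0] ne[of x n 0] by (simp add: wd_def)
 next
 fix r r' assume b: "z = JRight r" "r:cells (std_simplex m) n" "z' = JRight r'" "r':cells (std_simplex m) n"
 have "r = r'" by (rule Se[OF b(2,4)]) (use e b in "simp add: wd_def")
 thus ?thesis using b by simp
 next
 fix r i x r' assume "z = JRight r" "z' = JBoth i x r'" "x:cells K i"
 thus ?thesis using e[of 0] ne[of x i 0] by (simp add: wd_def)
 next
 fix x i x' r assume "z' = JLeft x" "x:cells K n" "z = JBoth i x' r" "i < n"
 thus ?thesis using e[of n] ne[of x n n] by (simp add: wd_def)
 next
 fix r i x r' assume "z' = JRight r" "z = JBoth i x r'" "x:cells K i"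
 thus ?thesis using e[of 0] ne[of x i 0] by (simp add: wd_def)
 next
 fix i x r i' x' r'
 assume b: "z = JBoth i x r" "i < n" "x:cells K i" "r:cells (std_simplex m) (n - i - 1)"
 "z' = JBoth i' x' r'" "i' < n" "x':cells K i'" "r':cells (std_simplex m) (n - i' - 1)"
 have "~i < i'"
 proof
 assume "i < i'"
 hence "wd (%i. i) z i' = vt (r (i' - i - 1))" "wd (%i. i) z' i' = Op (x' i')" by (simp_all add: b wd_def)
 thus False using e[of i'] b(6) ne(2)[OF b(7), of i'] by auto
 qed
 moreover have "~i' < i"
 proof
 assume "i' < i"
 hence "wd (%i. i) z' i = vt (r' (i - i' - 1))" "wd (%i. i) z i = Op (x i)" by (simp_all add: b wd_def)
 thus False using e[of i] b(2) ne(2)[OF b(3), of i] by auto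
 qed
 ultimately have i: "i' = i" by simp
 have "x = x'"
 proof (rule Ke[OF b(3)])
 show "x':cells K i" using b i by simp
 show "x l = x' l" if "l <= i" for l using e[of l] that b(1,2,5) i by (simp add: wd_def)
 qed
 moreover have "r = r'"
 proof (rule Se[OF b(4)])
 show "r':cells (std_simplex m) (n - i - 1)" using b i by simp
 show "vt (r l) = vt (r' l)" if "l <= n - i - 1" for l using e[of "l + i + 1"] that b(1,2,5) i by (simp add: wd_def)
 qed
 ultimately show ?thesis using b i by simp
 qed
qed

end

context weiss_colimit begin

lemma base_mem: "sg:base" if "fchain sg" "sg <= T" for sg
proof -
 have "sg Int range Ex = {}" using that(2) by blast
 moreover have "opn x:Ov" if "x:T" for x using that X(1) V by auto
 hence "opn ` sg <= Ov" using that(2) by blast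
 ultimately show ?thesis using that(1) unfolding base_def by blast
qed

text \<open>The given family amounts to a map from the boundary of the \<open>m\<close>-simplex to
  the slice, with the colimit cocone at vertex 0. Initiality of that cocone fills the boundary, and
  the filler is read back as a family on chains.\<close>

theorem colimit_extend:
 assumes q: "colimit_cocone C K (%n. \<lambda>z\<in>cells (right_cone K) n. VF n (cocone_cell V n z))" (is "colimit_cocone C K ?q")
 and f: "cmap C (bdc P T ka) f" and fF: "!!sg. sg:jn T {} ==> f sg = Fd sg"
 shows "EX f'. cmap C (jn T (Pow ka)) f' & (ALL sg:bdc P T ka. f' sg = f sg)"
proof -
 define h where "h = (%k. \<lambda>s\<in>cells (boundary m) k. %j. \<lambda>z\<in>cells (J k) j. ev C f j (wd s z))"
 have evF: "ev C f j w = VF j (rs j (%i. opn (w i)))" if "word j w" "w ` {..j} <= T" for j w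
 proof -
 have ch: "fchain (w ` {..j})" by (rule word_fchain[OF that(1)])
 have "exs (w ` {..j}) = {}" using that(2) unfolding exs_def by blast
 hence "w ` {..j}:jn T {}" using ch that(2) unfolding jn_def by blast
 hence "ev C f j w = ev C Fd j w" by (intro ev_agree fF)
 thus ?thesis using ev_Fd[OF that(1) base_mem[OF ch that(2)]] by simp
 qed
 have sd: "dmap k m s" if "s:cells (boundary m) k" for s k using that unfolding boundary_cells by blast
 have hw: "word j (wd s z)" "wd s z ` {..j}:bdc P T ka" if "z:cells (J k) j" "s:cells (boundary m) k" for z k j s
 using wd_props(1)[OF that(1) sd[OF that(2)]] wd_bdc[OF that] by blast+
 let ?b = "cone_base K ?q"
 have cb: "?b j x = VF j x" if "x:cells K j" for j x using that by (simp add: cone_base_def join_cells cocone_cell_def)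
 have hJL: "ev C f j (wd s (JLeft x)) = ?b j x" if x: "x:cells K j" for j x s
 proof -
 have xX: "x l:X" "x l <= x l'" if "l <= l'" "l' <= j" for l l' using x that unfolding incl_cells by auto
 have w: "wd s (JLeft x) = (%l. Op (x l))" unfolding wd_def by simp
 have "word j (%l. Op (x l))" unfolding word_def using xX by simp
 moreover have "(%l. Op (x l)) ` {..j} <= T" using xX(1)[of _ j] by auto
 moreover have "(rs j (%i. opn (Op (x i)))) = x" using x extensional_restrict[of x "{..j}"] unfolding incl_cells PiE_def by simp
 ultimately show ?thesis unfolding w using evF[of j "%l. Op (x l)"] cb[OF x] by simp
 qed
 have under_cells: "g:cells (under C K ?b) k <-> g:sset_hom (J k) C & (ALL j. ALL x:cells K j. g j (JLeft x) = ?b j x)" for g k unfolding under_def by simp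
 have under_opr: "opr (under C K ?b) k' k t g = (%j. \<lambda>z\<in>cells (J k') j. g j (join_map_right t j z))" for k' k t g unfolding under_def by simp
 have hc: "h k s:cells (under C K ?b) k" if s: "s:cells (boundary m) k" for k s unfolding under_cells
 proof (intro conjI allI ballI)
 show "h k s:sset_hom (J k) C"
 proof (rule sset_homI)
 show "h k s n:extensional (cells (J k) n)" for n using s unfolding h_def by simp
 show "h k s n z:cells C n" if "z:cells (J k) n" for n z using s that ev_in[OF XC f hw[OF that s]] unfolding h_def by simp
 fix n' n t z assume t: "dmap n' n t" and z: "z:cells (J k) n"
 have "h k s n' (opr (J k) n' n t z) = ev C f n' (wd s (join_opr K (std_simplex k) n' n t z))" using s opr_cells[OF z t] unfolding h_def join_opr_eq by simp
 also have "... = ev C f n' (wd s z o t)" by (rule ev_cong[OF XC f hw[OF opr_cells[OF z t] s]]) (use wd_opr[OF z t] in simp)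
 also have "... = opr C n' n t (h k s n z)" using ev_opr[OF XC f hw[OF z s] t] s z unfolding h_def by simp
 finally show "h k s n' (opr (J k) n' n t z) = opr C n' n t (h k s n z)" .
 qed
 fix j x assume x: "x:cells K j"
 hence "JLeft x:cells (J k) j" unfolding join_cells by blast
 thus "h k s j (JLeft x) = ?b j x" using s hJL[OF x] unfolding h_def by simp
 qed
 have hh: "h:sset_hom (boundary m) (under C K ?b)"
 proof (rule sset_homI)
 show "h n:extensional (cells (boundary m) n)" for n unfolding h_def by simp
 show "h n s:cells (under C K ?b) n" if "s:cells (boundary m) n" for n s by (rule hc[OF that])
 fix k' k t s assume t: "dmap k' k t" and s: "s:cells (boundary m) k"
 let ?s = "\<lambda>i\<in>{..k'}. s (t i)"
 have s': "?s:cells (boundary m) k'" using s t unfolding boundary_cells dmd by auto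
 show "h k' (opr (boundary m) k' k t s) = opr (under C K ?b) k' k t (h k s)" unfolding boundary_opr under_opr
 proof (intro ext)
 fix j z
 show "h k' ?s j z = (\<lambda>z\<in>cells (J k') j. h k s j (join_map_right t j z)) z"
 proof (cases "z:cells (J k') j")
 case True
 have r: "join_map_right t j z:cells (J k) j" by (rule map_right_cells[OF True t])
 have "ev C f j (wd ?s z) = ev C f j (wd s (join_map_right t j z))"
 proof (rule ev_cong[OF XC f hw[OF True s']])
 fix l assume l: "l <= j"
 have "wd ?s z l = wd (s o t) z l"
 proof -
 have "r i <= k'" if "r:cells (std_simplex k') n" "i <= n" for r n i using that unfolding std_cells dmd by auto
 thus ?thesis using True l unfolding wd_def join_cells by (auto simp: restrict_def)
 qed
 thus "wd ?s z l = wd s (join_map_right t j z) l" using wd_map_right[OF True l] by simp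
 qed
 thus ?thesis using True s s' r unfolding h_def by simp
 qed (use s' in "simp add: h_def")
 qed
 qed
 let ?s0 = "\<lambda>i\<in>{..0::nat}. 0::nat"
 have s0: "?s0:cells (boundary m) 0" using m unfolding boundary_cells dmd by (auto intro!: exI[of _ m])
 have h0: "h 0 ?s0 = ?q"
 proof (intro ext)
 fix j z
 show "h 0 ?s0 j z = ?q j z"
 proof (cases "z:cells (J 0) j")
 case True
 have vt0: "r i = 0" if "r:cells (std_simplex 0) n" "i <= n" for r n i using that unfolding std_cells dmd by auto
 have wdl: "wd ?s0 z l = (case z of JLeft x => Op (x l) | JRight r => Op V | JBoth i x r => if l <= i then Op (x l) else Op V)"
 if "l <= j" for l
 proof (cases z)
 case (JRight r) thus ?thesis using True vt0[of r j l] that unfolding join_cells wd_def vt_def by auto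
 next
 case (JBoth i x r)
 hence "r (l - i - 1) = 0" using True vt0[of r "j - i - 1" "l - i - 1"] that unfolding join_cells by auto
 thus ?thesis using JBoth unfolding wd_def vt_def by simp
 qed (simp add: wd_def)
 have d0: "dmap 0 m ?s0" by (rule sd[OF s0])
 have W: "wd ?s0 z ` {..j} <= T"
 proof -
 have "vt ` ?s0 ` {..0} <= T" unfolding vt_def by auto
 thus ?thesis using wd_props(2)[OF True d0] by blast
 qed
 have "(rs j (%i. opn (wd ?s0 z i))) = cocone_cell V j z"
 proof
 fix i
 show "(rs j (%i. opn (wd ?s0 z i))) i = cocone_cell V j z i"
 proof (cases "i <= j")
 case True thus ?thesis using wdl[OF True] unfolding cocone_cell_def by (cases z) auto
 next
 case False
 have "undefined = x i" if "x:cells K j" for x using that False unfolding incl_cells PiE_def extensional_def by auto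
 thus ?thesis using False \<open>z:cells (J 0) j\<close>
 by (cases z) (simp_all add: cocone_cell_def join_cells)
 qed
 qed
 hence "ev C f j (wd ?s0 z) = VF j (cocone_cell V j z)" using evF[OF wd_props(1)[OF True d0] W] by simp
 thus ?thesis using True s0 unfolding h_def by simp
 qed (use s0 in "simp add: h_def")
 qed
 have "initial_object (under C K ?b) ?q" using q unfolding colimit_cocone_def by blast
 then obtain x0 where x0: "x0:cells (under C K ?b) m"
 "!!k s. s:cells (boundary m) k ==> opr (under C K ?b) k m s x0 = h k s" using m hh h0 unfolding initial_object_def by blast
 have x0h: "x0:sset_hom (J m) C" using x0(1) unfolding under_cells by blast
 have em: "enum {..m} i = i" if "i <= m" for i using enum_unique[of m "%i. i" i] that by simp
 have wex: "EX z:cells (J m) n. ALL l<=n. wd (%i. i) z l = w l" if w: "word n w" "w ` {..n} <= P Un vt ` {..m}" for n w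
 proof -
 obtain z where z: "z:cells (J m) n" "!!l. l <= n ==> wd (enum {..m}) z l = w l" using wd_exists[OF w] by auto
 have "wd (%i. i) z l = wd (enum {..m}) z l" if "l <= n" for l
 proof -
 have "r i <= m" if "r:cells (std_simplex m) n" "i <= n" for r n i using that unfolding std_cells dmd by auto
 thus ?thesis using z(1) that em unfolding wd_def join_cells by auto
 qed
 thus ?thesis using z by (intro bexI[of _ z]) auto
 qed
 \<comment> \<open>The simplex of the join that has a given word, well defined by
   \<open>wd_exists\<close> and \<open>wd_unique\<close>.\<close>
 define zc where "zc = (%n w. THE z. z:cells (J m) n & (ALL l<=n. wd (%i. i) z l = w l))"
 have zc: "zc n w:cells (J m) n & (ALL l<=n. wd (%i. i) (zc n w) l = w l)"
 if w: "word n w" "w ` {..n} <= P Un vt ` {..m}" for n w unfolding zc_def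
 proof (rule theI')
 show "EX! z. z:cells (J m) n & (ALL l<=n. wd (%i. i) z l = w l)" using wex[OF w] wd_unique by (metis (no_types, lifting))
 qed
 have zcu: "zc n w = z" if "word n w" "w ` {..n} <= P Un vt ` {..m}" "z:cells (J m) n" "!!l. l <= n ==> wd (%i. i) z l = w l" for n w z
 using zc[OF that(1,2)] that(3,4) by (intro wd_unique[of _ n]) auto
 have vtm: "vt ` {..m} = insert (Op V) (Ex ` ka)"
 proof -
 have "x:vt ` {..m}" if "x:insert (Op V) (Ex ` ka)" for x using vt_tv[OF that] tv_le[OF that] by (metis atMost_iff image_eqI)
 thus ?thesis using vt_in by auto
 qed
 have jw: "word (dm sg) (enum sg)" "enum sg ` {..dm sg} <= P Un vt ` {..m}" "fchain sg" if s: "sg:jn T (Pow ka)" for sg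
 proof -
 show ch: "fchain sg" using s unfolding jn_def by blast
 show "word (dm sg) (enum sg)" by (rule word_enum[OF ch])
 have "sg <= T Un range Ex" "exs sg <= ka" using s unfolding jn_def by blast+
 hence "sg <= T Un Ex ` ka" unfolding exs_def by blast
 thus "enum sg ` {..dm sg} <= P Un vt ` {..m}" unfolding vtm enum_image[OF ch] by blast
 qed
 define f' where "f' = (%sg. x0 (dm sg) (zc (dm sg) (enum sg)))"
 have f': "cmap C (jn T (Pow ka)) f'" unfolding f'_def
 proof (rule cmap_of_words[where g = "%n w. x0 n (zc n w)", OF XC])
 show "chain_complex (jn T (Pow ka))" by (rule jn_complex) simp
 fix sg assume s: "sg:jn T (Pow ka)"
 show "x0 (dm sg) (zc (dm sg) (enum sg)):cells C (dm sg)" by (rule sset_homD(1)[OF x0h]) (use zc[OF jw(1,2)[OF s]] in blast)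
 fix k t assume t: "dmap k (dm sg) t"
 let ?z = "zc (dm sg) (enum sg)"
 have z: "?z:cells (J m) (dm sg)" "!!l. l <= dm sg ==> wd (%i. i) ?z l = enum sg l" using zc[OF jw(1,2)[OF s]] by blast+
 have tl: "t l <= dm sg" if "l <= k" for l using t that unfolding dmd by blast
 have "zc k (enum sg o t) = join_opr K (std_simplex m) k (dm sg) t ?z"
 proof (rule zcu[OF word_comp[OF jw(1)[OF s] t] _ opr_cells[OF z(1) t]])
 show "(enum sg o t) ` {..k} <= P Un vt ` {..m}"
 proof
 fix y assume "y:(enum sg o t) ` {..k}"
 then obtain l where "l <= k" "y = enum sg (t l)" by auto
 hence "y:enum sg ` {..dm sg}" using tl by auto
 thus "y:P Un vt ` {..m}" using jw(2)[OF s] by blast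
 qed
 show "wd (%i. i) (join_opr K (std_simplex m) k (dm sg) t ?z) l = (enum sg o t) l" if "l <= k" for l using wd_opr[OF z(1) t that] z(2)[OF tl[OF that]] by simp
 qed
 thus "opr C k (dm sg) t (x0 (dm sg) ?z) = x0 k (zc k (enum sg o t))" using sset_homD(2)[OF x0h t z(1)] unfolding join_opr_eq by simp
 next
 fix n :: nat and w w' :: "nat => 'a vtx" assume "!!i. i <= n ==> w i = w' i"
 hence "zc n w = zc n w'" unfolding zc_def by simp
 thus "x0 n (zc n w) = x0 n (zc n w')" by simp
 qed
 moreover have "f' sg = f sg" if s: "sg:bdc P T ka" for sg
 proof -
 have sj: "sg:jn T (Pow ka)" using s jn_mono[of P T "Pow ka" "Pow ka"] jn_mono[of T T "pbd ka" "Pow ka"] unfolding bdc_def by blast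
 have ch: "fchain sg" by (rule jw(3)[OF sj])
 \<comment> \<open>The vertices of the \<open>m\<close>-simplex that occur in \<open>sg\<close>. A
   chain inside \<open>P\<close> uses none; the value \<open>{0}\<close> then supplies a face, which
   must not be empty.\<close>
 define A where "A = (let B = {i. i <= m & vt i:sg} in if B = {} then {0} else B)"
 have sub: "sg <= P Un vt ` {..m}" using jw(2)[OF sj] unfolding enum_image[OF ch] .
 have sA: "sg <= P Un vt ` A"
 proof
 fix y assume y: "y:sg"
 show "y:P Un vt ` A"
 proof (cases "y:P")
 case False
 then obtain i where "i <= m" "y = vt i" using sub y by blast
 hence "i:A" using y unfolding A_def Let_def by auto
 thus ?thesis using \<open>y = vt i\<close> by blast
 qed blast
 qed
 have A: "A <= {..m}" "A~={}" unfolding A_def Let_def by auto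
 have "EX i<=m. vt i~:sg"
 proof -
 have "sg:jn T (pbd ka) | sg:jn P (Pow ka)" using s unfolding bdc_def by blast
 thus ?thesis
 proof
 assume "sg:jn P (Pow ka)"
 hence "sg <= P Un range Ex" unfolding jn_def by blast
 hence "vt 0~:sg" using vt_P[of 0] unfolding vt_def by auto
 thus ?thesis by blast
 next
 assume "sg:jn T (pbd ka)"
 hence "exs sg = {} | exs sg:pbd ka" unfolding jn_def by blast
 then obtain i where i: "i:ka" "Ex i~:sg" using ka(2) unfolding exs_def by blast
 hence "Ex i:vt ` {..m}" unfolding vtm by blast
 thus ?thesis using i(2) by (metis atMost_iff imageE)
 qed
 qed
 then obtain i0 where i0: "i0 <= m" "vt i0~:sg" by blast
 have "A~={..m}"
 proof
 assume e: "A = {..m}"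
 show False
 proof (cases "{i. i <= m & vt i:sg} = {}")
 case True
 hence "m:{0}" using e unfolding A_def Let_def by (metis atMost_iff order.refl)
 thus False using m by simp
 next
 case False
 hence "A = {i. i <= m & vt i:sg}" unfolding A_def Let_def by (rule if_not_P)
 moreover have "i0:A" using e i0(1) by simp
 ultimately show False using i0(2) by blast
 qed
 qed
 then obtain i1 where i1: "i1 <= m" "i1~:A" using A by auto
 have Ac: "fchain A" using A finite_subset[OF A(1)] by (simp add: fchain_nat)
 let ?k = "card A - 1" let ?s = "\<lambda>i\<in>{..?k}. enum A i"
 have eA: "enum A i:A" if "i <= ?k" for i using enum_in'[OF Ac that] .
 have sb: "?s:cells (boundary m) ?k" unfolding boundary_cells dmd
 proof (intro conjI allI impI)
 show "?s i <= m" if "i <= ?k" for i using eA[OF that] A that by auto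
 show "?s i <= ?s j" if "i <= j" "j <= ?k" for i j using enum_mono[OF Ac that] that by simp
 show "EX i<=m. i~:?s ` {..?k}" using i1 eA by (intro exI[of _ i1]) auto
 qed simp
 obtain z where z: "z:cells (J ?k) (dm sg)" "!!l. l <= dm sg ==> wd (enum A) z l = enum sg l"
 using wd_exists[OF jw(1)[OF sj] _ A, unfolded enum_image[OF ch], OF sA] by blast
 have zs: "wd ?s z l = enum sg l" if "l <= dm sg" for l
 proof -
 have rk: "r i <= ?k" if "r:cells (std_simplex ?k) n" "i <= n" for r n i using that unfolding std_cells dmd by auto
 have "wd ?s z l = wd (enum A) z l"
 proof (cases z)
 case (JRight r) thus ?thesis using z(1) rk[of r "dm sg" l] that unfolding join_cells wd_def by auto
 next
 case (JBoth i x r)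
 hence "r (l - i - 1) <= ?k" using z(1) rk[of r "dm sg - i - 1" "l - i - 1"] that unfolding join_cells by auto
 thus ?thesis using JBoth unfolding wd_def by simp
 qed (simp add: wd_def)
 thus ?thesis using z(2)[OF that] by simp
 qed
 have d: "dmap ?k m ?s" by (rule sd[OF sb])
 have "zc (dm sg) (enum sg) = join_map_right ?s (dm sg) z"
 proof (rule zcu[OF jw(1,2)[OF sj] map_right_cells[OF z(1) d]])
 fix l assume l: "l <= dm sg"
 show "wd (%i. i) (join_map_right ?s (dm sg) z) l = enum sg l" using wd_map_right[OF z(1) l, of "%i. i" ?s] zs[OF l] unfolding o_def by (simp only:)
 qed
 hence "f' sg = opr (under C K ?b) ?k m ?s x0 (dm sg) z" unfolding f'_def under_opr using z(1) by simp
 also have "... = ev C f (dm sg) (wd ?s z)" unfolding x0(2)[OF sb] h_def using sb z(1) by simp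
 also have "... = ev C f (dm sg) (enum sg)" by (rule ev_cong[OF XC f hw[OF z(1) sb] zs])
 also have "... = f sg" by (rule ev_enum[OF XC f ch s])
 finally show ?thesis .
 qed
 ultimately show ?thesis by blast
qed

end

section \<open>Two colimit cocones over one diagram\<close>

lemma enum_pair: "x < y ==> enum {x,y} 0 = x" "x < y ==> enum {x,y} (Suc 0) = y" using enum_list[of "[x,y]" 0] enum_list[of "[x,y]" 1] by simp_all

lemma Op_notin_Ex [simp]: "Op x~:range Ex" by auto

lemma jnI: "fchain W ==> W <= S Un range Ex ==> exs W:Av ==> W:jn S Av" unfolding jn_def by simp

lemma jnI': "fchain W ==> W <= S ==> S Int range Ex = {} ==> W:jn S Av" unfolding jn_def exs_def by auto

lemma triangle_edges:
 assumes X: "sst C" and f: "cmap C K f" and s: "{x,y,z}:K" "x < y" "y < z"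
 shows "f {x,y,z}:cells C 2" "edge C 2 0 1 (f {x,y,z}) = f {x,y}" "edge C 2 1 2 (f {x,y,z}) = f {y,z}"
 "edge C 2 0 2 (f {x,y,z}) = f {x,z}"
proof -
 have xz: "x < z" using s by simp
 have ch: "fchain {x,y,z}" using s xz unfolding fchain_def by (auto intro: less_imp_le)
 have "x~=y" "y~=z" "x~=z" using s xz by auto
 hence d: "dm {x,y,z} = 2" by simp
 have p: "pos {x,y,z} x = 0" "pos {x,y,z} y = 1" "pos {x,y,z} z = 2"
 using pos_list[of "[x,y,z]" 0] pos_list[of "[x,y,z]" 1] pos_list[of "[x,y,z]" 2] s xz by (simp_all add: numeral_2_eq_2)
 have c: "f {a,b} = edge C 2 (pos {x,y,z} a) (pos {x,y,z} b) (f {x,y,z})"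
 if "a < b" "{a,b} <= {x,y,z}" for a b using cmap_edge[OF X f ch s(1) that(2)] that(1) enum_pair[OF that(1)] unfolding d cface_def by auto
 show "f {x,y,z}:cells C 2" using cmapD(1)[OF f s(1)] unfolding d .
 show "edge C 2 0 1 (f {x,y,z}) = f {x,y}" "edge C 2 1 2 (f {x,y,z}) = f {y,z}"
 "edge C 2 0 2 (f {x,y,z}) = f {x,z}" using c[OF s(2)] c[OF s(3)] c[OF xz] p by simp_all
qed

lemma equivalence_const:
 assumes X: "sst C" and x: "x:cells C 0"
 shows "eqe C (kc C 1 x)"
proof -
 let ?e = "kc C 1 x" let ?u = "kc C 2 x"
 have d: "dmap k 0 (%_. 0)" for k unfolding dmd by auto
 have o: "opr C k n t (kc C n x) = kc C k x" if "dmap k n t" for k n t unfolding const_cell_def using sset_opr_opr[OF X that d x] by (simp add: o_def)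
 have c: "kc C k x:cells C k" for k unfolding const_cell_def by (rule sset_opr_in[OF X d x])
 have c0: "kc C 0 x = x" unfolding const_cell_def by (rule sset_opr_ident[OF X x]) simp
 have st: "source C ?e = x" "target C ?e = x" using o[of 0 1] c0 unfolding vertex_def by (auto simp: dmd)
 have ed: "edge C 2 i j ?u = ?e" if "i <= j" "j <= 2" for i j unfolding edge_def using that by (intro o) (auto simp: dmd)
 show ?thesis unfolding equivalence_edge_def using c ed st by (intro conjI bexI[of _ ?e] bexI[of _ ?u]) auto
qed

context diagram begin

lemma Fd_pair:
 assumes "x < y" shows "Fd {x,y} = VF 1 (rs 1 (%i. if i = 0 then opn x else opn y))"
proof -
 have "dm {x,y} = 1" using assms by auto
 moreover have "(rs 1 (%i. opn (enum {x,y} i))) = (rs 1 (%i. if i = 0 then opn x else opn y))"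
 using enum_pair[OF assms] by (intro restrict_ext) (auto simp: le_Suc_eq)
 ultimately show ?thesis unfolding Fd_def by simp
qed

lemma VF_const: assumes "U:Ov"
 shows "VF k (rs k (%i. U)) = kc C k (VF 0 (rs 0 (%i. U)))" "VF k (rs k (%i. U)):cells C k"
proof -
 have c: "(rs k (%i. U)):cells (inclusion_nerve Ov) k" for k using assms unfolding incl_cells by auto
 have "dmap k 0 (%_. 0)" unfolding dmd by auto
 from sset_homD(2)[OF VF this c] show "VF k (rs k (%i. U)) = kc C k (VF 0 (rs 0 (%i. U)))" unfolding const_cell_def incl_opr by (simp add: restrict_def)
 show "VF k (rs k (%i. U)):cells C k" by (rule sset_homD(1)[OF VF c])
qed

lemma equivalence_refl: "U:Ov ==> eqe C (VF 1 (rs 1 (%i. U)))" using VF_const[of U 1] VF_const(2)[of U 0] equivalence_const[OF XC] by simp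

lemma ext_cell:
 assumes "U:Ov" "V:Ov" "U <= V"
 shows "(rs 1 (%i. if i = 0 then U else V)):cells (inclusion_nerve Ov) 1" using assms unfolding incl_cells by auto

lemma ext_ends:
 assumes "U:Ov" "V:Ov" "U <= V"
 defines "e == VF 1 (rs 1 (%i. if i = 0 then U else V))"
 shows "e:cells C 1" "source C e = VF 0 (rs 0 (%i. U))" "target C e = VF 0 (rs 0 (%i. V))"
proof -
 note c = ext_cell[OF assms(1-3)]
 show "e:cells C 1" unfolding e_def by (rule sset_homD(1)[OF VF c])
 have "dmap 0 1 (%_. 0)" "dmap 0 1 (%_. 1)" by (auto simp: dmd)
 from sset_homD(2)[OF VF this(1) c] sset_homD(2)[OF VF this(2) c]
 show "source C e = VF 0 (rs 0 (%i. U))" "target C e = VF 0 (rs 0 (%i. V))" unfolding e_def vertex_def incl_opr by (simp_all add: restrict_def cong: if_cong)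
qed

lemma good_colimit:
 assumes X: "X <= Ov" "!!x. x:X ==> x <= V" and V: "V:Ov"
 and q: "colimit_cocone C (inclusion_nerve X) (%n. \<lambda>z\<in>cells (right_cone (inclusion_nerve X)) n. VF n (cocone_cell V n z))"
 shows "good C Fd (Op ` X) (insert (Op V) (Op ` X))"
proof (cases "V:X")
 case True
 hence "insert (Op V) (Op ` X) = Op ` X" by blast
 thus ?thesis using good_refl[of "Op ` X"] by auto
next
 case False
 show ?thesis unfolding good_def
 proof (intro conjI allI impI)
 fix ka f assume a: "finite ka" "ka~={}" "cmap C (bdc (Op ` X) (insert (Op V) (Op ` X)) ka) f"
 "ALL sg:jn (insert (Op V) (Op ` X)) {}. f sg = Fd sg"
 interpret weiss_colimit C Ov VF X V ka by unfold_locales (use X V False a in auto)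
 show "EX f'. cmap C (jn (insert (Op V) (Op ` X)) (Pow ka)) f' &
 (ALL sg:bdc (Op ` X) (insert (Op V) (Op ` X)) ka. f' sg = f sg)" by (rule colimit_extend[OF q a(3)]) (use a(4) in blast)
 qed auto
qed

lemma jn_base: "S <= {x. x~:range Ex & opn x:Ov} ==> jn S {} <= base"
proof
 fix sg assume a: "S <= {x. x~:range Ex & opn x:Ov}" "sg:jn S {}"
 hence s: "fchain sg" "sg <= S Un range Ex" "exs sg = {}" unfolding jn_def by blast+
 hence "sg <= S" unfolding exs_def by blast
 thus "sg:base" using s(1) a(1) unfolding base_def by blast
qed

text \<open>
 The inverse of the map from \<open>U\<close> to \<open>V\<close> is obtained as a vertex added to the cocone with tip \<open>V\<close>.
\<close>

lemma good_good_equivalence: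
 assumes X: "X <= Ov" "!!x. x:X ==> x <= U" and U: "U:Ov" "V:Ov" "U \<subset> V"
 and gU: "good C Fd (Op ` X) (insert (Op U) (Op ` X))"
 and gV: "good C Fd (Op ` X) (insert (Op V) (Op ` X))"
 shows "eqe C (VF 1 (rs 1 (%i. if i = 0 then U else V)))"
proof -
 let ?P = "Op ` X" let ?TU = "insert (Op U) ?P" let ?TV = "insert (Op V) ?P"
 have UV: "U <= V" "Op U < Op V" using U(3) by (auto simp: less_le)
 \<comment> \<open>Interprets the extra vertices 0 and 1 as the open sets \<open>a\<close> and
   \<open>b\<close>, so that pulling back the diagram along it produces cocones with these
   tips.\<close>
 define rh where "rh = (%a b x. case x of Ex i => if i = 0 then Op a else Op b | y => (y :: 'a vtx))"
 have rhS: "rh a b x = x" if "x~:range Ex" for a b x using that unfolding rh_def by (cases x) auto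
 have rhE: "rh a b (Ex i) = (if i = 0 then Op a else Op b)" for a b i unfolding rh_def by simp
 have exc: "x:S | (EX i:ka. x = Ex i)" if "sg:jn S (Pow ka)" "x:sg" for sg S ka x
 proof -
 have "sg <= S Un range Ex" "exs sg <= ka" using that unfolding jn_def by blast+
 thus ?thesis using that(2) unfolding exs_def by blast
 qed
 have rhpull: "cmap C (jn S Av) (pull C Fd (rh a b))"
 if S: "S <= Op ` Ov" and ab: "a:Ov" "b:Ov" and A: "downc Av" "Av <= Pow {0,1}"
 and m: "!!x. [|Op x:S; {0}:Av|] ==> x <= a" "!!x. [|Op x:S; {1}:Av|] ==> x <= b" "{0,1}:Av ==> a <= b"
 for S a b Av
 proof (rule pull_cmap[OF XC Fd_cmap jn_complex[OF A(1)]])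
 fix sg assume s: "sg:jn S Av"
 have ex: "exs sg = {} | exs sg:Av" using s unfolding jn_def by blast
 have exi: "{i}:Av" if "Ex i:sg" for i
 proof -
 have "{i} <= exs sg" using that unfolding exs_def by blast
 thus ?thesis using ex A(1) unfolding downc_def by blast
 qed
 have exij: "{0,1}:Av" if "Ex 0:sg" "Ex 1:sg"
 proof -
 have "{0,1} <= exs sg" using that unfolding exs_def by blast
 thus ?thesis using ex A(1) unfolding downc_def by blast
 qed
 have sub: "(EX z:Ov. x = Op z & Op z:S) | x = Ex 0 | x = Ex 1" if "x:sg" for x
 proof -
 have "sg <= S Un range Ex" using s unfolding jn_def by blast
 hence "x:S | (EX i. x = Ex i)" using that by blast
 moreover have "i = 0 | i = 1" if "x = Ex i" for i
 proof -
 have "{i}:Pow {0,1}" using exi[of i] that \<open>x:sg\<close> A(2) by auto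
 thus ?thesis by simp
 qed
 ultimately show ?thesis using S by auto
 qed
 show mono: "rh a b x <= rh a b y" if xy: "x:sg" "y:sg" "x <= y" for x y
 proof -
 consider z w where "x = Op z" "y = Op w" | z where "x = Op z" "Op z:S" "y = Ex 0"
 | z where "x = Op z" "Op z:S" "y = Ex 1" | "x = Ex 0" "y = Ex 1" | "x = y" using sub[OF xy(1)] sub[OF xy(2)] xy(3) by auto
 thus ?thesis
 proof cases
 case 1 thus ?thesis using xy(3) by (simp add: rh_def)
 next
 case 2
 hence "z <= a" using m(1)[of z] exi[of 0] xy(2) by simp
 thus ?thesis using 2 by (simp add: rh_def)
 next
 case 3
 hence "z <= b" using m(2)[of z] exi[of 1] xy(2) by simp
 thus ?thesis using 3 by (simp add: rh_def)
 next
 case 4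
 hence "a <= b" using m(3) exij xy by simp
 thus ?thesis using 4 by (simp add: rh_def)
 qed simp
 qed
 have ch: "fchain sg" using s unfolding jn_def by blast
 have opx: "EX w:Ov. rh a b x = Op w" if "x:sg" for x using sub[OF that] ab by (auto simp: rh_def)
 show "rh a b ` sg:base"
 proof -
 have "(rh a b o enum sg) ` {..dm sg} = rh a b ` sg" using enum_image[OF ch] by (simp only: image_comp[symmetric])
 moreover have "word (dm sg) (rh a b o enum sg)" by (rule mono_word[OF word_enum[OF ch]]) (use mono enum_image[OF ch] in auto)
 ultimately have "fchain (rh a b ` sg)" using word_fchain by metis
 moreover have "rh a b ` sg Int range Ex = {}" using opx by fastforce
 moreover have "opn ` rh a b ` sg <= Ov" using opx by fastforce
 ultimately show ?thesis unfolding base_def by blast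
 qed
 qed
 have SO: "?P <= Op ` Ov" "?TU <= Op ` Ov" "?TV <= Op ` Ov" using X U by auto
 have PO: "x <= U" "x <= V" if "x:X" for x using that X(2) UV by auto
 have nE: "?P Int range Ex = {}" "?TU Int range Ex = {}" "?TV Int range Ex = {}" by auto
 have P01: "Pow {0::nat} = {{},{0}}" "Pow {1::nat} = {{},{1}}" by auto
 have bd0: "jn ?TV {} <= bdc ?P ?TV {0}" unfolding bdc_def using jn_mono[of ?TV ?TV "{}" "pbd {0}"] by blast
 have pullS: "pull C Fd (rh a b) sg = Fd sg" if "sg:base" for sg a b
 by (rule pull_id[OF XC Fd_cmap base_complex that]) (use that in "auto simp: base_def intro!: rhS")
 let ?f = "pull C Fd (rh U V)"
 have f: "cmap C (bdc ?P ?TV {0}) ?f" unfolding bdc_def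
 proof (rule cmap_union; rule rhpull)
 show "{0}:pbd {0} ==> x <= U" "{1}:pbd {0} ==> x <= V" "{0,1}:pbd {0} ==> U <= V" for x by auto
 qed (use SO U PO UV in auto)
 have jb: "jn ?TV {} <= base" "jn ?TU {} <= base" by (rule jn_base; use X U in auto)+
 \<comment> \<open>The cocone with tip \<open>U\<close>, extended over the vertex \<open>V\<close>.
   Its new edge, from \<open>V\<close> to the extra vertex, is the candidate for the
   inverse.\<close>
 obtain f1 where f1: "cmap C (jn ?TV (Pow {0})) f1" "!!sg. sg:bdc ?P ?TV {0} ==> f1 sg = ?f sg" by (rule goodD[OF gV _ _ f]) (use pullS jb in auto)
 let ?e = "VF 1 (rs 1 (%i. if i = 0 then U else V))"
 let ?g = "f1 {Op V, Ex 0}"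
 have fUV: "Fd {Op U, Op V} = ?e" unfolding Fd_pair[OF UV(2)] opn.simps ..
 have cst: "pull C Fd (rh a b) {Op c, Ex i} = kc C 1 (VF 0 (rs 0 (%i. c)))"
 if c: "c:Ov" "rh a b (Ex i) = Op c" for a b c i
 proof -
 have e: "(rh a b o enum {Op c, Ex i}) j = Op c" if "j <= 1" for j
 using enum_pair[OF less_Ex[OF Op_notin_Ex[of c], of i]] that c rhS[OF Op_notin_Ex] by (cases j) (auto simp: le_Suc_eq)
 hence "(rh a b o enum {Op c, Ex i}) ` {..1} = {Op c}" by auto
 moreover have "{Op c}:base" using c unfolding base_def fchain_def by auto
 moreover have "word 1 (rh a b o enum {Op c, Ex i})" unfolding word_def using e by auto
 ultimately have "ev C Fd 1 (rh a b o enum {Op c, Ex i}) = VF 1 (rs 1 (%j. opn ((rh a b o enum {Op c, Ex i}) j)))" by (intro ev_Fd) simp_all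
 also have "(rs 1 (%j. opn ((rh a b o enum {Op c, Ex i}) j))) = (rs 1 (%j. c))" using e by (intro restrict_ext) simp
 also have "VF 1 (rs 1 (%j. c)) = kc C 1 (VF 0 (rs 0 (%i. c)))" by (rule VF_const(1)[OF c(1)])
 finally have "ev C Fd 1 (rh a b o enum {Op c, Ex i}) = kc C 1 (VF 0 (rs 0 (%i. c)))" .
 moreover have "dm {Op c, Ex i} = 1" by simp
 ultimately show ?thesis unfolding pull_def by (simp only:)
 qed
 have inj2: "pull C Fd (rh a b) {x, y} = ?e"
 if "x < y" "rh a b x = Op U" "rh a b y = Op V" for a b x y
 proof -
 have "{Op U, Op V}:base" using U UV unfolding base_def fchain_def by auto
 moreover have ch: "fchain {x,y}" using that unfolding fchain_def by (auto intro: less_imp_le)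
 ultimately have "pull C Fd (rh a b) {x, y} = Fd (rh a b ` {x,y})" using that UV by (intro pull_inj[OF XC Fd_cmap]) auto
 thus ?thesis using that fUV by simp
 qed
 have dc: "downc Av" if "Av:{Pow {0}, Pow {1}, pbd {0,1}, Pow {0,1::nat}, pbd {0}}" for Av using that by auto
 have ce: "{Op c, Ex 0, Ex 1}:jn (insert (Op c) ?P) (Pow {0,1})" for c
 proof -
 have "fchain {Op c, Ex 0, Ex 1}" unfolding fchain_def by auto
 moreover have "exs {Op c, Ex 0, Ex 1}:Pow {0,1}" unfolding exs_def by auto
 ultimately show ?thesis unfolding jn_def by blast
 qed
 have jm: "{Op c, Ex i}:jn (insert (Op c) ?P) (pbd {0,1})" if "i:{0,1}" for c i
 proof -
 have "fchain {Op c, Ex i}" unfolding fchain_def by auto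
 moreover have "exs {Op c, Ex i} = {i}" unfolding exs_def by auto
 ultimately show ?thesis unfolding jn_def using that by auto
 qed
 have jE: "{Ex 0, Ex 1}:jn ?P (Pow {0,1})"
 proof -
 have "fchain {Ex 0, Ex (1::nat)}" unfolding fchain_def by auto
 moreover have "exs {Ex 0, Ex (1::nat)} = {0,1}" unfolding exs_def by auto
 ultimately show ?thesis unfolding jn_def by blast
 qed
 have E01: "Ex 0 < (Ex 1 :: 'a vtx)" by (simp add: less_le)
 text \<open>The triangle \<open>U\<close>, \<open>V\<close>, \<open>U\<close>.\<close>
 define pj where "pj = (%x. case x of Ex i => if i = 0 then Op V else Ex 0 | y => (y :: 'a vtx))"
 have pjS: "pj x = x" if "x~:range Ex" for x using that unfolding pj_def by (cases x) auto
 have pjE: "pj (Ex i) = (if i = 0 then Op V else Ex 0)" for i unfolding pj_def by simp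
 have pjm: "pj x <= pj y" if s: "sg:jn ?P (Pow {0,1})" and xy: "x:sg" "y:sg" "x <= y" for sg x y
 proof -
 have "(EX z. x = Op z & Op z:?P) | x = Ex 0 | x = Ex 1" "(EX z. y = Op z & Op z:?P) | y = Ex 0 | y = Ex 1" using exc[OF s xy(1)] exc[OF s xy(2)] by auto
 thus ?thesis using xy(3) PO by (elim disjE exE conjE) (auto simp: pjS pjE)
 qed
 have pjin: "pj ` sg:jn ?TV (Pow {0})" "(exs sg~={0,1} --> pj ` sg:bdc ?P ?TV {0})"
 if s: "sg:jn ?P (Pow {0,1})" for sg
 proof -
 have ch: "fchain sg" using s unfolding jn_def by blast
 have "(pj o enum sg) ` {..dm sg} = pj ` sg" using enum_image[OF ch] by (simp only: image_comp[symmetric])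
 moreover have "word (dm sg) (pj o enum sg)" by (rule mono_word[OF word_enum[OF ch]]) (use pjm[OF s] enum_image[OF ch] in auto)
 ultimately have ch': "fchain (pj ` sg)" using word_fchain by metis
 have im: "pj x:insert (Ex 0) ?TV" "pj x = Ex 0 ==> x = Ex 1" "pj x = Op V ==> x = Ex 0 | x = Op V"
 if "x:sg" for x using exc[OF s that] by (auto simp: pjS pjE split: if_splits)
 have sub: "pj ` sg <= insert (Ex 0) ?TV" by (rule image_subsetI) (rule im(1))
 have ex: "exs (pj ` sg) <= {0}"
 proof
 fix i assume "i:exs (pj ` sg)"
 hence "Ex i:insert (Ex 0) ?TV" using sub unfolding exs_def by (simp only: mem_Collect_eq subset_iff)
 thus "i:{0}" by auto
 qed
 show "pj ` sg:jn ?TV (Pow {0})" using ch' sub ex by (intro jnI) auto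
 show "exs sg~={0,1} --> pj ` sg:bdc ?P ?TV {0}"
 proof
 assume ne: "exs sg~={0,1}"
 have "exs sg <= {0,1}" using s unfolding jn_def by blast
 hence "Ex 0~:sg | Ex 1~:sg" using ne unfolding exs_def by auto
 thus "pj ` sg:bdc ?P ?TV {0}"
 proof
 assume n1: "Ex 1~:sg"
 have "pj x:?TV" if "x:sg" for x using im(1,2)[OF that] n1 that by auto
 hence "pj ` sg <= ?TV" by (rule image_subsetI)
 hence "pj ` sg:jn ?TV (pbd {0})" using ch' nE(3) by (intro jnI')
 thus ?thesis unfolding bdc_def by (rule UnI1)
 next
 assume n0: "Ex 0~:sg"
 have "pj x:?P Un range Ex" if "x:sg" for x using exc[OF s that] n0 that by (auto simp: pjS pjE)
 hence "pj ` sg <= ?P Un range Ex" by (rule image_subsetI)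
 hence "pj ` sg:jn ?P (Pow {0})" using ch' ex by (intro jnI) auto
 thus ?thesis unfolding bdc_def by (rule UnI2)
 qed
 qed
 qed
 have ov: "pull C f1 pj sg = pull C Fd (rh V U) sg"
 if s: "sg:jn ?P (Pow {0,1})" "sg:jn ?TU (pbd {0,1})" for sg
 proof -
 have ne: "exs sg~={0,1}" using s(2) unfolding jn_def by auto
 have ch: "fchain sg" using s unfolding jn_def by blast
 have im: "(pj o enum sg) ` {..dm sg} = pj ` sg" using enum_image[OF ch] by (simp only: image_comp[symmetric])
 have w: "word (dm sg) (pj o enum sg)" by (rule mono_word[OF word_enum[OF ch]]) (use pjm[OF s(1)] enum_image[OF ch] in auto)
 have pb: "pj ` sg:bdc ?P ?TV {0}" using pjin(2)[OF s(1)] ne by blast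
 have rp: "rh U V (pj x) = rh V U x" if "x:sg" for x using exc[OF s(1) that] by (auto simp: pjS pjE rhS rhE)
 have rhw: "word (dm sg) (rh V U o enum sg)" "(rh V U o enum sg) ` {..dm sg}:base"
 proof -
 have mono: "rh V U x <= rh V U y" if xy: "x:sg" "y:sg" "x <= y" for x y
 proof -
 have "x = y | (EX z. x = Op z & Op z:?P)" using exc[OF s(1) xy(1)] exc[OF s(1) xy(2)] xy ne s(1) unfolding exs_def jn_def by auto
 thus ?thesis using exc[OF s(1) xy(2)] xy(3) PO by (auto simp: rhS rhE)
 qed
 show w': "word (dm sg) (rh V U o enum sg)" by (rule mono_word[OF word_enum[OF ch]]) (use mono enum_image[OF ch] in auto)
 have im': "(rh V U o enum sg) ` {..dm sg} = rh V U ` sg" using enum_image[OF ch] by (simp only: image_comp[symmetric])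
 have op: "EX w:Ov. rh V U x = Op w" if "x:sg" for x using exc[OF s(1) that] SO(1) U by (auto simp: rh_def)
 have "rh V U ` sg Int range Ex = {}" "opn ` rh V U ` sg <= Ov" using op by fastforce+
 thus "(rh V U o enum sg) ` {..dm sg}:base" using word_fchain[OF w'] unfolding im' base_def by blast
 qed
 have e1: "(rh U V o (pj o enum sg)) i = (rh V U o enum sg) i" if "i <= dm sg" for i using rp[OF enum_in'[OF ch that]] by simp
 have w2: "word (dm sg) (rh U V o (pj o enum sg))" using rhw(1) e1 unfolding word_def by (metis order.trans)
 have i2: "rh U V ` (pj o enum sg) ` {..dm sg}:base"
 proof -
 have "rh U V ` (pj o enum sg) ` {..dm sg} = (rh V U o enum sg) ` {..dm sg}" unfolding image_comp using e1 by (intro image_cong) auto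
 thus ?thesis using rhw(2) by simp
 qed
 have "pull C f1 pj sg = ev C ?f (dm sg) (pj o enum sg)" unfolding pull_def[of C f1] by (rule ev_agree) (simp only: im f1(2)[OF pb])
 also have "... = ev C Fd (dm sg) (rh U V o (pj o enum sg))" by (rule ev_pull[OF XC Fd_cmap w w2 i2])
 also have "... = ev C Fd (dm sg) (rh V U o enum sg)" by (rule ev_cong[OF XC Fd_cmap w2 _ e1]) (use i2 in "simp only: image_comp")
 finally show ?thesis unfolding pull_def .
 qed
 \<comment> \<open>The extra vertices 0 and 1 now mean \<open>V\<close> and \<open>U\<close>. Over
   \<open>P\<close> the cocone \<open>f1\<close> is reused with \<open>V\<close> in the role of
   vertex 0; over the boundary the functor itself supplies the edges that start at
   \<open>U\<close>.\<close>
 define f2 where "f2 = (%sg. if sg:jn ?P (Pow {0,1}) then pull C f1 pj sg else pull C Fd (rh V U) sg)"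
 have f2: "cmap C (jn ?P (Pow {0,1}) Un jn ?TU (pbd {0,1})) f2" unfolding f2_def
 proof (rule cmap_glue)
 show "cmap C (jn ?P (Pow {0,1})) (pull C f1 pj)" by (rule pull_cmap[OF XC f1(1) jn_complex pjm pjin(1)]) auto
 show "cmap C (jn ?TU (pbd {0,1})) (pull C Fd (rh V U))" by (rule rhpull) (use SO U PO UV in auto)
 show "pull C f1 pj sg = pull C Fd (rh V U) sg"
 if "sg:jn ?P (Pow {0,1})" "sg:jn ?TU (pbd {0,1})" for sg by (rule ov[OF that])
 qed (auto intro: jn_complex)
 have jnb: "jn S {} <= jn S Av" for S :: "'a vtx set" and Av by (rule jn_mono) auto
 have f2L: "f2 sg = pull C Fd (rh V U) sg" if "sg:jn ?TU (pbd {0,1})" for sg unfolding f2_def using ov[OF _ that] by simp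
 obtain f3 where f3: "cmap C (jn ?TU (Pow {0,1})) f3" "!!sg. sg:bdc ?P ?TU {0,1} ==> f3 sg = f2 sg"
 proof (rule goodD[OF gU])
 show "cmap C (bdc ?P ?TU {0,1}) f2" using f2 unfolding bdc_def by (simp only: Un_commute)
 fix sg assume s: "sg:jn ?TU {}"
 hence "sg:jn ?TU (pbd {0,1})" using jnb by blast
 thus "f2 sg = Fd sg" using f2L pullS jb(2) s by auto
 qed (use that in auto)
 have b3: "jn ?TU (pbd {0,1}) <= bdc ?P ?TU {0,1}" "jn ?P (Pow {0,1}) <= bdc ?P ?TU {0,1}" unfolding bdc_def by auto
 have u1: "f3 {Op U, Ex i} = pull C Fd (rh V U) {Op U, Ex i}" if i: "i:{0,1}" for i
 using f3(2)[of "{Op U, Ex i}"] b3(1) jm[OF i, of U] f2L[of "{Op U, Ex i}"] by auto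
 have u2: "f3 {Op U, Ex 0} = ?e" using u1[of 0] inj2[of "Op U" "Ex 0" V U] by (simp add: rhS rhE)
 have u3: "f3 {Op U, Ex 1} = kc C 1 (VF 0 (rs 0 (%i. U)))" using u1[of 1] cst[OF U(1), of V U 1] by (simp add: rhE)
 have u4: "f3 {Ex 0, Ex 1} = ?g"
 proof -
 have ch: "fchain {Ex 0, Ex (1::nat)}" unfolding fchain_def by auto
 have "f3 {Ex 0, Ex 1} = pull C f1 pj {Ex 0, Ex 1}" using f3(2) b3(2) jE unfolding f2_def by auto
 also have "... = f1 (pj ` {Ex 0, Ex 1})"
 proof (rule pull_inj[OF XC f1(1) ch pjin(1)[OF jE]])
 show "pj x < pj y" if "x:{Ex 0, Ex 1}" "y:{Ex 0, Ex 1}" "x < y" for x y using that by (auto simp: pjE less_le)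
 qed
 finally show ?thesis by (simp add: pjE)
 qed
 text \<open>The triangle \<open>V\<close>, \<open>U\<close>, \<open>V\<close>.\<close>
 define f4 where "f4 = (%sg. if sg:jn ?TV (Pow {0}) then f1 sg else ?f sg)"
 have f4: "cmap C (jn ?TV (Pow {0}) Un (jn ?P (Pow {0,1}) Un jn ?TV (Pow {1}))) f4" unfolding f4_def
 proof (rule cmap_glue[OF f1(1)])
 show "cmap C (jn ?P (Pow {0,1}) Un jn ?TV (Pow {1})) ?f" by (intro cmap_union; rule rhpull) (use SO U PO UV in auto)
 show "chain_complex (jn ?P (Pow {0,1}) Un jn ?TV (Pow {1}))" by (intro chain_complex_Un jn_complex) auto
 fix sg assume s: "sg:jn ?TV (Pow {0})" "sg:jn ?P (Pow {0,1}) Un jn ?TV (Pow {1})"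
 have e0: "exs sg <= {0}" "fchain sg" "sg <= ?TV Un range Ex" using s(1) unfolding jn_def by blast+
 have "sg <= ?P Un range Ex | exs sg <= {1}" using s(2) unfolding jn_def by blast
 hence "sg <= ?P Un range Ex | exs sg = {}" using e0(1) by auto
 hence "sg:bdc ?P ?TV {0}" using e0 unfolding bdc_def jn_def by blast
 thus "f1 sg = ?f sg" by (rule f1(2))
 qed (auto intro: jn_complex)
 have b4: "bdc ?P ?TV {0,1} <= jn ?TV (Pow {0}) Un (jn ?P (Pow {0,1}) Un jn ?TV (Pow {1}))"
 proof
 fix sg assume s: "sg:bdc ?P ?TV {0,1}"
 show "sg:jn ?TV (Pow {0}) Un (jn ?P (Pow {0,1}) Un jn ?TV (Pow {1}))"
 proof (cases "sg:jn ?P (Pow {0,1})")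
 case False
 hence j: "sg:jn ?TV (pbd {0,1})" using s unfolding bdc_def by blast
 hence "exs sg <= {0,1}" "exs sg~={0,1}" unfolding jn_def by auto
 hence "exs sg <= {0} | exs sg <= {1}" by auto
 moreover have "sg:jn ?TV (Pow {i})" if "exs sg <= {i}" for i using j that unfolding jn_def by simp
 ultimately show ?thesis by (elim disjE) simp_all
 qed simp
 qed
 obtain f5 where f5: "cmap C (jn ?TV (Pow {0,1})) f5" "!!sg. sg:bdc ?P ?TV {0,1} ==> f5 sg = f4 sg"
 proof (rule goodD[OF gV _ _ cmap_subset[OF f4 b4]])
 fix sg assume s: "sg:jn ?TV {}"
 have "f1 sg = ?f sg" using f1(2) s bd0 by blast
 thus "f4 sg = Fd sg" using pullS[of sg] jb s unfolding f4_def by auto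
 qed (use that in auto)
 have nj: "{Op V, Ex 1}~:jn ?TV (Pow {0})" "{Ex 0, Ex 1}~:jn ?TV (Pow {0})" "{Op V, Ex 0}:jn ?TV (Pow {0})" unfolding jn_def exs_def fchain_def by auto
 have m5: "{Op V, Ex i}:bdc ?P ?TV {0,1}" "{Ex 0, Ex 1}:bdc ?P ?TV {0,1}" if "i:{0,1}" for i
 unfolding bdc_def by (rule UnI1[OF jm[OF that]], rule UnI2[OF jE])
 have v1: "f5 {Op V, Ex 0} = ?g" using f5(2)[OF m5(1)[of 0]] nj(3) unfolding f4_def by simp
 have v2: "f5 {Op V, Ex 1} = kc C 1 (VF 0 (rs 0 (%i. V)))" using f5(2)[OF m5(1)[of 1]] nj(1) cst[OF U(2), of U V 1] unfolding f4_def by (simp add: rhE)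
 have v3: "f5 {Ex 0, Ex 1} = ?e" using f5(2)[OF m5(2)[of 0]] nj(2) inj2[OF E01, of U V] unfolding f4_def by (simp add: rhE)
 note ends = ext_ends[OF U(1,2) UV(1)]
 have VE: "Op V < Ex (0::nat)" "Op U < Ex (0::nat)" by auto
 note tu = triangle_edges[OF XC f3(1) ce VE(2) E01, unfolded u2 u3 u4]
 note tv = triangle_edges[OF XC f5(1) ce VE(1) E01, unfolded v1 v2 v3]
 have "?g:cells C 1" using cmapD(1)[OF f1(1) nj(3)] by simp
 thus ?thesis unfolding equivalence_edge_def using ends(1) tu tv unfolding ends(2,3) by blast
qed

end

section \<open>Descent of equivalences along a Weiss cover\<close>

context diagram begin

text \<open>Both \<open>U\<close> and \<open>V\<close> are recognized as colimits over the sets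
  below some \<open>U Int W\<close>. For \<open>V\<close>, formal intersections are adjoined to this
  sieve, which the hypothesis on finite intersections permits; in their presence the larger sieve of
  sets below some \<open>W\<close> can be adjoined as well, and afterwards the intersections are
  dropped again by cancellation.\<close>

theorem weiss_equivalence:
 assumes int: "!!x y. x:Ov ==> y:Ov ==> x Int y:Ov"
 and U: "U:Ov" "V:Ov" "U <= V" and W: "Wv <= Ov" "!!W. W:Wv ==> W <= V"
 and cU: "colimit_cocone C (inclusion_nerve {x:Ov. EX W:Wv. x <= U Int W})
 (%n. \<lambda>z\<in>cells (right_cone (inclusion_nerve {x:Ov. EX W:Wv. x <= U Int W})) n. VF n (cocone_cell U n z))"
 and cV: "colimit_cocone C (inclusion_nerve {x:Ov. EX W:Wv. x <= W})
 (%n. \<lambda>z\<in>cells (right_cone (inclusion_nerve {x:Ov. EX W:Wv. x <= W})) n. VF n (cocone_cell V n z))"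
 and eq: "!!T. finite T ==> T~={} ==> T <= Wv ==>
 eqe C (VF 1 (rs 1 (%i. if i = 0 then U Int \<Inter>T else \<Inter>T)))"
 shows "eqe C (VF 1 (rs 1 (%i. if i = 0 then U else V)))"
proof -
 let ?SU = "{x:Ov. EX W:Wv. x <= U Int W}" and ?SV = "{x:Ov. EX W:Wv. x <= W}"
 show ?thesis
 proof (cases "V:Wv | U = V")
 case True
 thus ?thesis
 proof
 assume "V:Wv"
 thus ?thesis using eq[of "{V}"] U(3) by (simp add: Int_absorb2 cong: if_cong)
 next
 assume "U = V"
 thus ?thesis using equivalence_refl[OF U(1)] by (simp only: if_cancel)
 qed
 next
 case False
 define P Q I where "P = Op ` ?SU" and "Q = Op ` ?SV" and "I = Ch ` {T. finite T & T~={} & T <= Wv}"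
 have TO: "\<Inter>T:Ov" if "finite T" "T~={}" "T <= Wv" for T using that by (induction T rule: finite_ne_induct) (use W(1) int in auto)
 have PQ: "P <= Q" unfolding P_def Q_def by auto
 have nE: "P Int range Ex = {}" "Q Int range Ex = {}" "I Int range Ex = {}" "P Int I = {}" "Q Int I = {}" unfolding P_def Q_def I_def by auto
 have QI_base: "jn (Q Un I) {} <= base"
 proof (rule jn_base)
 show "Q Un I <= {x. x~:range Ex & opn x:Ov}" 
 proof
 fix x assume "x:Q Un I"
 thus "x:{x. x~:range Ex & opn x:Ov}"
 proof
 assume "x:I"
 then obtain T where "x = Ch T" "finite T" "T~={}" "T <= Wv" unfolding I_def by blast
 thus ?thesis using TO[of T] by auto
 qed (auto simp: Q_def)
 qed
 qed
 have kan: "good C Fd (Op ` S) (Op ` S Un I)"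
 if S: "S = {x:Ov. EX W:Wv. x <= Y Int W}" and Y: "Y:Ov"
 and e: "!!T. finite T ==> T~={} ==> T <= Wv ==>
 eqe C (VF 1 (rs 1 (%i. if i = 0 then Y Int \<Inter>T else \<Inter>T)))" for S Y
 proof (rule good_kan[where y = "%i. Op (Y Int opn i)"])
 show "quasicategory C" by (rule C)
 show "Op ` S Int range Ex = {}" "I Int range Ex = {}" "Op ` S Int I = {}" unfolding I_def by auto
 fix i assume "i:I"
 then obtain T where T: "i = Ch T" "finite T" "T~={}" "T <= Wv" unfolding I_def by auto
 show "~i <= s" if "s:Op ` S" for s using T that by auto
 have "Y Int \<Inter>T:S" unfolding S using TO[OF T(2-4)] T(3,4) Y int by blast
 thus "Op (Y Int opn i):Op ` S" using T by auto
 show "Op (Y Int opn i) <= i" using T by auto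
 show "s <= Op (Y Int opn i)" if "s:Op ` S" "s <= i" for s using T that unfolding S by auto
 have "Op (Y Int opn i) < i" using T by (auto simp: less_le)
 from Fd_pair[OF this] have "Fd {Op (Y Int opn i), i} = VF 1 (rs 1 (%i. if i = 0 then Y Int \<Inter>T else \<Inter>T))" unfolding T(1) opn.simps .
 thus "eqe C (Fd {Op (Y Int opn i), i})" using e[OF T(2-4)] by simp
 qed
 have g1: "good C Fd P (P Un I)" unfolding P_def by (rule kan[OF refl U(1) eq])
 have g2: "good C Fd (P Un I) (Q Un I)"
 proof (rule good_cech[OF C PQ _ I_def])
 show "Q <= range Op" unfolding Q_def by auto
 show "q:P" if pq: "p:P" "q:Q" "q <= p" for p q
 proof -
 obtain x W where x: "p = Op x" "W:Wv" "x <= U Int W" using pq(1) unfolding P_def by blast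
 obtain y where y: "q = Op y" "y:Ov" using pq(2) unfolding Q_def by blast
 have "y <= U Int W" using pq(3) x y by auto
 thus ?thesis using x(2) y unfolding P_def by blast
 qed
 show "EX W:Wv. x <= W" if "Op x:Q" for x using that unfolding Q_def by auto
 qed
 have g3: "good C Fd Q (Q Un I)" unfolding Q_def
 proof (rule kan[where Y = V])
 show "?SV = {x:Ov. EX W:Wv. x <= V Int W}" using W(2) by blast
 fix T assume T: "finite T" "T~={}" "T <= Wv"
 hence "V Int \<Inter>T = \<Inter>T" using W(2) by blast
 thus "eqe C (VF 1 (rs 1 (%i. if i = 0 then V Int \<Inter>T else \<Inter>T)))" using equivalence_refl[OF TO[OF T]] by (simp only: if_cancel)
 qed (rule U(2))
 have g4: "good C Fd P Q" by (rule good_cancel[OF good_trans[OF g1 g2] g3 PQ cmap_subset[OF Fd_cmap QI_base]])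
 have SV: "x <= V" if "x:?SV" for x using that W(2) by blast
 have g5: "good C Fd Q (insert (Op V) Q)" unfolding Q_def by (rule good_colimit[OF _ SV U(2) cV]) auto
 \<comment> \<open>With the greatest vertex \<open>V\<close> present, the rest of the diagram no
   longer affects cocones.\<close>
 have g6: "good C Fd (insert (Op V) P) (insert (Op V) Q)"
 proof (rule good_top[OF C, where V = "Op V"])
 show "t <= Op V" if "t:insert (Op V) Q" for t
 proof -
 have "t = Op V | (EX x:?SV. t = Op x)" using that unfolding Q_def by blast
 thus ?thesis using SV by (elim disjE bexE) simp_all
 qed
 qed (use PQ nE in auto)
 have g7: "good C Fd P (insert (Op V) P)"
 proof (rule good_cancel[OF good_trans[OF g4 g5] g6 _ cmap_subset[OF Fd_cmap jn_base]])
 show "insert (Op V) Q <= {x. x~:range Ex & opn x:Ov}" using U(2) unfolding Q_def by auto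
 qed auto
 have SU: "x <= U" if "x:?SU" for x using that by blast
 have g8: "good C Fd P (insert (Op U) P)" unfolding P_def by (rule good_colimit[OF _ SU U(1) cU]) auto
 show ?thesis by (rule good_good_equivalence[OF _ SU U(1,2) _ g8[unfolded P_def] g7[unfolded P_def]]) (use U(3) False in auto)
 qed
qed

end

section \<open>The homotopy category\<close>

locale hom_cat =
 fixes H :: "'o => 'o => 'm set" and mult :: "'m => 'm => 'm" (infixl ";;" 70) and one :: "'o => 'm"
 assumes mult_in: "f:H x y ==> g:H y z ==> f ;; g:H x z"
 and assoc: "f:H x y ==> g:H y z ==> h:H z w ==> f ;; g ;; h = f ;; (g ;; h)"
 and one_in: "f:H x y ==> one x:H x x & one y:H y y"
 and one_left: "f:H x y ==> one x ;; f = f"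
 and one_right: "f:H x y ==> f ;; one y = f"
begin

definition iso :: "'o => 'o => 'm => bool" where
 "iso x y f <-> f:H x y & (EX g:H y x. f ;; g = one x & g ;; f = one y)"

lemma isoI: "f:H x y ==> g:H y x ==> f ;; g = one x ==> g ;; f = one y ==> iso x y f" unfolding iso_def by blast

lemma iso_left_right:
 assumes f: "f:H x y" "g:H y x" "h:H y x" and e: "f ;; g = one x" "h ;; f = one y"
 shows "iso x y f"
proof -
 have "h = h ;; (f ;; g)" using one_right[OF f(3)] e by simp
 also have "... = g" using assoc[OF f(3,1,2)] e one_left[OF f(2)] by simp
 finally show ?thesis using isoI[OF f(1,2) e(1)] e(2) by simp
qed

lemma iso_mult:
 assumes f: "iso x y f" and g: "iso y z g" shows "iso x z (f ;; g)"
proof -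
 obtain f' where f': "f:H x y" "f':H y x" "f ;; f' = one x" "f' ;; f = one y" using f unfolding iso_def by blast
 obtain g' where g': "g:H y z" "g':H z y" "g ;; g' = one y" "g' ;; g = one z" using g unfolding iso_def by blast
 have "f ;; g ;; (g' ;; f') = f ;; (g ;; (g' ;; f'))" by (rule assoc[OF f'(1) g'(1) mult_in[OF g'(2) f'(2)]])
 also have "g ;; (g' ;; f') = f'" using assoc[OF g'(1,2) f'(2)] g'(3) one_left[OF f'(2)] by simp
 finally have 1: "f ;; g ;; (g' ;; f') = one x" using f'(3) by simp
 have "g' ;; f' ;; (f ;; g) = g' ;; (f' ;; (f ;; g))" by (rule assoc[OF g'(2) f'(2) mult_in[OF f'(1) g'(1)]])
 also have "f' ;; (f ;; g) = g" using assoc[OF f'(2,1) g'(1)] f'(4) one_left[OF g'(1)] by simp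
 finally have 2: "g' ;; f' ;; (f ;; g) = one z" using g'(4) by simp
 show ?thesis by (rule isoI[OF mult_in[OF f'(1) g'(1)] mult_in[OF g'(2) f'(2)] 1 2])
qed

lemma iso_inv: assumes "iso x y f" obtains g where "iso y x g" "f ;; g = one x" "g ;; f = one y" using assms unfolding iso_def by blast

lemma iso_cancel_right:
 assumes f: "f:H x y" and g: "iso y z g" and fg: "iso x z (f ;; g)" shows "iso x y f"
proof -
 obtain g' where g': "iso z y g'" "g ;; g' = one y" using iso_inv[OF g] by blast
 have "f = f ;; g ;; g'" using assoc[OF f] g g' one_right[OF f] unfolding iso_def by metis
 thus ?thesis using iso_mult[OF fg g'(1)] by simp
qed

lemma iso_cancel_left:
 assumes f: "f:H y z" and g: "iso x y g" and fg: "iso x z (g ;; f)" shows "iso y z f"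
proof -
 obtain g' where g': "iso y x g'" "g' ;; g = one y" using iso_inv[OF g] by blast
 have "f = g' ;; (g ;; f)" using assoc[OF _ _ f, of g' y x g] g g' one_left[OF f] unfolding iso_def by metis
 thus ?thesis using iso_mult[OF g'(1) fg] by simp
qed

text \<open>The inverse of the second composite gives \<open>g\<close> a right inverse and that of
  the first gives it a left inverse; \<open>h\<close> then follows by cancellation.\<close>

lemma two_of_six:
 assumes f: "f:H a b" "g:H b c" "h:H c d" and fg: "iso a c (f ;; g)" and gh: "iso b d (g ;; h)"
 shows "iso b c g" "iso c d h"
proof -
 obtain p where p: "p:H c a" "p ;; (f ;; g) = one c" using fg unfolding iso_def by blast
 obtain q where q: "q:H d b" "g ;; h ;; q = one b" using gh unfolding iso_def by blast
 show g: "iso b c g"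
 proof (rule iso_left_right[OF f(2)])
 show "h ;; q:H c b" "p ;; f:H c b" using f p q mult_in by blast+
 show "g ;; (h ;; q) = one b" using assoc[OF f(2,3) q(1)] q(2) by simp
 show "p ;; f ;; g = one c" using assoc[OF p(1) f(1,2)] p(2) by simp
 qed
 show "iso c d h" by (rule iso_cancel_left[OF f(3) g gh])
qed

text \<open>The trace of a cocartesian edge on the homotopy category; \<open>L\<close> are the objects over its target.\<close>

definition wc :: "'o set => 'o => 'o => 'm => bool" where
 "wc L x y c <-> c:H x y & y:L & (ALL z:L. ALL h:H x z. EX! g. g:H y z & c ;; g = h)"

text \<open>The comparison in the other direction composes with \<open>g\<close> to an arrow that
  fixes a universal arrow, and uniqueness makes it an identity.\<close>

lemma wc_iso:
 assumes c: "wc L x y c" and c': "wc L x y' c'" and g: "g:H y y'" "c ;; g = c'"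
 shows "iso y y' g"
proof -
 have y: "c:H x y" "y:L" "c':H x y'" "y':L" using c c' unfolding wc_def by blast+
 obtain h where h: "h:H y' y" "c' ;; h = c" using c' y unfolding wc_def by blast
 have "c ;; (g ;; h) = c" using assoc[OF y(1) g(1) h(1)] g h by simp
 moreover have "c ;; one y = c" by (rule one_right[OF y(1)])
 ultimately have 1: "g ;; h = one y" using c y mult_in[OF g(1) h(1)] one_in[OF y(1)] unfolding wc_def by blast
 have "c' ;; (h ;; g) = c'" using assoc[OF y(3) h(1) g(1)] g h by simp
 moreover have "c' ;; one y' = c'" by (rule one_right[OF y(3)])
 ultimately have "h ;; g = one y'" using c' y mult_in[OF h(1) g(1)] one_in[OF y(3)] unfolding wc_def by blast
 thus ?thesis using isoI[OF g(1) h(1) 1] by blast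
qed

lemma wc_mult_iso:
 assumes c: "wc L x y c" and i: "iso y y' i" and y': "y':L" shows "wc L x y' (c ;; i)" unfolding wc_def
proof (intro conjI ballI)
 have c': "c:H x y" "y:L" using c unfolding wc_def by blast+
 have i': "i:H y y'" using i unfolding iso_def by blast
 obtain j where j: "j:H y' y" "i ;; j = one y" "j ;; i = one y'" using i unfolding iso_def by blast
 show "c ;; i:H x y'" "y':L" using mult_in[OF c'(1) i'] y' by blast+
 fix z h assume z: "z:L" "h:H x z"
 obtain g where g: "g:H y z" "c ;; g = h" "!!g'. g':H y z ==> c ;; g' = h ==> g' = g" using c z unfolding wc_def by blast
 show "EX! g. g:H y' z & c ;; i ;; g = h"
 proof (rule ex1I[of _ "j ;; g"])
 have jg: "j ;; g:H y' z" by (rule mult_in[OF j(1) g(1)])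
 have "c ;; i ;; (j ;; g) = c ;; (i ;; (j ;; g))" by (rule assoc[OF c'(1) i' jg])
 also have "i ;; (j ;; g) = g" using assoc[OF i' j(1) g(1)] j(2) one_left[OF g(1)] by simp
 finally show "j ;; g:H y' z & c ;; i ;; (j ;; g) = h" using g(2) jg by simp
 fix g' assume g': "g':H y' z & c ;; i ;; g' = h"
 hence g'': "g':H y' z" by blast
 have "i ;; g' = g" using g(3)[OF mult_in[OF i' g'']] assoc[OF c'(1) i' g''] g' by simp
 thus "g' = j ;; g" using assoc[OF j(1) i' g''] j(3) one_left[OF g''] by simp
 qed
qed

lemma wc_iso_mult:
 assumes c: "wc L x y c" and i: "iso x' x i" shows "wc L x' y (i ;; c)" unfolding wc_def
proof (intro conjI ballI)
 have c': "c:H x y" "y:L" using c unfolding wc_def by blast+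
 have i': "i:H x' x" using i unfolding iso_def by blast
 obtain j where j: "j:H x x'" "i ;; j = one x'" "j ;; i = one x" using i unfolding iso_def by blast
 show "i ;; c:H x' y" "y:L" using mult_in[OF i' c'(1)] c' by blast+
 fix z h assume z: "z:L" "h:H x' z"
 have jh: "j ;; h:H x z" by (rule mult_in[OF j(1) z(2)])
 have key: "i ;; c ;; g = h <-> c ;; g = j ;; h" if g: "g:H y z" for g
 proof
 assume "i ;; c ;; g = h"
 hence "j ;; h = j ;; (i ;; (c ;; g))" using assoc[OF i' c'(1) g] by simp
 also have "... = c ;; g" using assoc[OF j(1) i' mult_in[OF c'(1) g]] j(3) one_left[OF mult_in[OF c'(1) g]] by simp
 finally show "c ;; g = j ;; h" ..
 next
 assume "c ;; g = j ;; h"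
 hence "i ;; c ;; g = i ;; (j ;; h)" using assoc[OF i' c'(1) g] by simp
 thus "i ;; c ;; g = h" using assoc[OF i' j(1) z(2)] j(2) one_left[OF z(2)] by simp
 qed
 show "EX! g. g:H y z & i ;; c ;; g = h" using c z(1) jh key unfolding wc_def by metis
qed

text \<open>The induced map between targets depends on the universal arrows only up to isomorphism,
  so its invertibility may be tested on the pair \<open>jx\<close>, \<open>jy\<close>.\<close>

lemma wc_transport_iso:
 assumes c: "wc L x u cx" "wc L y v cy" and j: "wc L x u' jx" "wc L y v' jy"
 and w: "w:H x y" and f: "f:H u v" "cx ;; f = w ;; cy" and a: "iso u' v' a" "jx ;; a = w ;; jy"
 shows "iso u v f"
proof -
 have m: "cx:H x u" "cy:H y v" "jx:H x u'" "jy:H y v'" "u':L" "v':L" "a:H u' v'" using c j a unfolding wc_def iso_def by blast+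
 obtain tx where tx: "tx:H u u'" "cx ;; tx = jx" using c(1) m unfolding wc_def by blast
 obtain ty where ty: "ty:H v v'" "cy ;; ty = jy" using c(2) m unfolding wc_def by blast
 have itx: "iso u u' tx" by (rule wc_iso[OF c(1) j(1) tx])
 have ity: "iso v v' ty" by (rule wc_iso[OF c(2) j(2) ty])
 have "cx ;; (f ;; ty) = w ;; jy" using assoc[OF m(1) f(1) ty(1)] f(2) assoc[OF w m(2) ty(1)] ty(2) by simp
 moreover have "cx ;; (tx ;; a) = w ;; jy" using assoc[OF m(1) tx(1) m(7)] tx(2) a(2) by simp
 moreover have "w ;; jy:H x v'" by (rule mult_in[OF w m(4)])
 ultimately have "f ;; ty = tx ;; a" using c(1) m(6) mult_in[OF f(1) ty(1)] mult_in[OF tx(1) m(7)] unfolding wc_def by blast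
 thus ?thesis using iso_cancel_right[OF f(1) ity] iso_mult[OF itx a(1)] by simp
qed

end

section \<open>Composition of homotopy classes in a quasi-category\<close>

definition comp2 :: "'c sset => 'c => 'c => 'c => bool" where
 "comp2 C f g h <-> (EX u:cells C 2. edge C 2 0 1 u = f & edge C 2 1 2 u = g & edge C 2 0 2 u = h)"

definition arr :: "'c sset => 'c => 'c => 'c => bool" where
 "arr C x y f <-> f:cells C 1 & source C f = x & target C f = y"

lemma dm3: "dm {0::nat,1,2} = 2" "dm {1::nat,2,3} = 2" "dm {0::nat,2,3} = 2" "dm {0::nat,1,3} = 2" "dm {0::nat,1,2,3} = 3" by auto

lemma cface3: assumes "p < q" "q < (r::nat)"
 shows "cface {p,q} {p,q,r} 0 = 0" "cface {p,q} {p,q,r} (Suc 0) = Suc 0"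
 "cface {q,r} {p,q,r} 0 = Suc 0" "cface {q,r} {p,q,r} (Suc 0) = 2"
 "cface {p,r} {p,q,r} 0 = 0" "cface {p,r} {p,q,r} (Suc 0) = 2" using assms enum_pair[of p q] enum_pair[of q r] enum_pair[of p r]
 pos_list[of "[p,q,r]" 0] pos_list[of "[p,q,r]" 1] pos_list[of "[p,q,r]" 2] by (simp_all add: cface_def numeral_2_eq_2)

definition simp_fun :: "'c sset => nat set => 'c => nat set => 'c" where
 "simp_fun X sg x = (%ta. rst X ta sg x)"

lemma simp_fun:
 assumes X: "sst X" and pqr: "p < q" "q < (r::nat)" and x: "x:cells X 2"
 shows "cmap X {ta. ta <= {p,q,r} & ta~={}} (simp_fun X {p,q,r} x)" "simp_fun X {p,q,r} x {p,q,r} = x"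
 "simp_fun X {p,q,r} x {p,q} = edge X 2 0 1 x" "simp_fun X {p,q,r} x {q,r} = edge X 2 1 2 x"
 "simp_fun X {p,q,r} x {p,r} = edge X 2 0 2 x"
proof -
 have ch: "fchain {p,q,r}" by (simp add: fchain_nat)
 have d: "dm {p,q,r} = 2" using pqr by auto
 have x': "x:cells X (dm {p,q,r})" using x d by simp
 show c: "cmap X {ta. ta <= {p,q,r} & ta~={}} (simp_fun X {p,q,r} x)" unfolding simp_fun_def by (rule cmap_simplex[OF X ch x'])
 show t: "simp_fun X {p,q,r} x {p,q,r} = x" unfolding simp_fun_def by (rule cface_self[OF X ch x'])
 have e: "simp_fun X {p,q,r} x ta = edge X 2 (cface ta {p,q,r} 0) (cface ta {p,q,r} 1) x"
 if "ta <= {p,q,r}" "card ta = 2" for ta using cmap_edge[OF X c ch _ that] t d by auto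
 show "simp_fun X {p,q,r} x {p,q} = edge X 2 0 1 x" "simp_fun X {p,q,r} x {q,r} = edge X 2 1 2 x"
 "simp_fun X {p,q,r} x {p,r} = edge X 2 0 2 x" using e[of "{p,q}"] e[of "{q,r}"] e[of "{p,r}"] cface3[OF pqr] pqr by simp_all
qed

text \<open>
 The triangles are \<open>{a,b,c}\<close>, \<open>{a,b,d}\<close>
 and \<open>{a,c,d}\<close>, so that the missing one is opposite to \<open>a\<close>.
\<close>

lemma glue3:
 fixes A1 A2 A3 :: "nat set"
 assumes X: "sst X"
 and f: "cmap X {ta. ta <= A1 & ta~={}} f1" "cmap X {ta. ta <= A2 & ta~={}} f2" "cmap X {ta. ta <= A3 & ta~={}} f3"
 and fin: "finite A1" "finite A2" "finite A3"
 and ne: "A1 Int A2~={}" "A1 Int A3~={}" "A2 Int A3~={}"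
 and e: "f1 (A1 Int A2) = f2 (A1 Int A2)" "f1 (A1 Int A3) = f3 (A1 Int A3)" "f2 (A2 Int A3) = f3 (A2 Int A3)"
 obtains F where "cmap X {ta. ta~={} & (ta <= A1 | ta <= A2 | ta <= A3)} F"
 "!!ta. ta~={} ==> ta <= A1 ==> F ta = f1 ta" "!!ta. ta~={} ==> ta <= A2 ==> F ta = f2 ta"
 "!!ta. ta~={} ==> ta <= A3 ==> F ta = f3 ta"
proof -
 let ?P = "%sg. {ta. ta <= sg & ta~={}} :: nat set set"
 have cc: "chain_complex (?P A)" if "finite A" for A unfolding chain_complex_def fchain_nat using that finite_subset by auto
 have a12: "f1 ta = f2 ta" if "ta <= A1" "ta <= A2" "ta~={}" for ta by (rule cmap_agree[OF f(1,2), of "A1 Int A2"]) (use that ne e in auto)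
 have a13: "f1 ta = f3 ta" if "ta <= A1" "ta <= A3" "ta~={}" for ta by (rule cmap_agree[OF f(1,3), of "A1 Int A3"]) (use that ne e in auto)
 have a23: "f2 ta = f3 ta" if "ta <= A2" "ta <= A3" "ta~={}" for ta by (rule cmap_agree[OF f(2,3), of "A2 Int A3"]) (use that ne e in auto)
 define F where "F = (%ta. if ta <= A1 then f1 ta else if ta <= A2 then f2 ta else f3 ta)"
 have F: "F ta = f1 ta" if "ta~={}" "ta <= A1" for ta using that unfolding F_def by simp
 have F2: "F ta = f2 ta" if "ta~={}" "ta <= A2" for ta using that a12 unfolding F_def by simp
 have F3: "F ta = f3 ta" if "ta~={}" "ta <= A3" for ta using that a13 a23 unfolding F_def by simp
 have "cmap X (?P A1) F" "cmap X (?P A2) F" "cmap X (?P A3) F"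
 by (rule cmap_cong[OF f(1) cc[OF fin(1)]] cmap_cong[OF f(2) cc[OF fin(2)]] cmap_cong[OF f(3) cc[OF fin(3)]]; use F F2 F3 in simp)+
 hence "cmap X (?P A1 Un ?P A2 Un ?P A3) F" by (intro cmap_union)
 moreover have "?P A1 Un ?P A2 Un ?P A3 = {ta. ta~={} & (ta <= A1 | ta <= A2 | ta <= A3)}" by auto
 ultimately show ?thesis using that F F2 F3 by simp
qed

lemma hornc3: "hornc {0,1,2,3::nat} 2 = {ta. ta~={} & (ta <= {0,1,2} | ta <= {1,2,3} | ta <= {0,2,3})}"
 "hornc {0,1,2,3::nat} 1 = {ta. ta~={} & (ta <= {0,1,2} | ta <= {1,2,3} | ta <= {0,1,3})}"
 "hornc {0,1,2,3::nat} 0 = {ta. ta~={} & (ta <= {0,1,2} | ta <= {0,1,3} | ta <= {0,2,3})}" unfolding hornc_def by auto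

lemma simplex_face:
 assumes X: "sst X" and pqr: "p < q" "q < (r::nat)" "{p,q,r} <= {0,1,2,3}" and x: "x:cells X (dm {0::nat,1,2,3})"
 defines "F == (%ta. opr X (dm ta) (dm {0::nat,1,2,3}) (cface ta {0,1,2,3}) x)"
 shows "F {p,q,r}:cells X 2" "edge X 2 0 1 (F {p,q,r}) = F {p,q}" "edge X 2 1 2 (F {p,q,r}) = F {q,r}"
 "edge X 2 0 2 (F {p,q,r}) = F {p,r}"
proof -
 have ch: "fchain {0::nat,1,2,3}" by (simp add: fchain_nat)
 have c: "cmap X {ta. ta <= {0,1,2,3} & ta~={}} F" unfolding F_def by (rule cmap_simplex[OF X ch x])
 have m: "{p,q,r}:{ta. ta <= {0,1,2,3} & ta~={}}" using pqr(3) by blast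
 show "F {p,q,r}:cells X 2" "edge X 2 0 1 (F {p,q,r}) = F {p,q}" "edge X 2 1 2 (F {p,q,r}) = F {q,r}"
 "edge X 2 0 2 (F {p,q,r}) = F {p,r}" using triangle_edges[OF X c m pqr(1,2)] by blast+
qed

text \<open>Triangles with matching edges as horns of a 3-simplex at 2, 1 and 0. The first two are
  inner and give associativity; the third is for cocartesian edges.\<close>

lemma horn3_glue:
 assumes X: "sst X" and u: "u:cells X 2" and v: "v:cells X 2" and w: "w:cells X 2"
 shows "[|edge X 2 1 2 u = edge X 2 0 1 v; edge X 2 0 2 u = edge X 2 0 1 w; edge X 2 1 2 v = edge X 2 1 2 w;
 !!F :: nat set => _. cmap X (hornc {0,1,2,3} 2) F ==> F {0,1} = edge X 2 0 1 u ==> F {1,3} = edge X 2 0 2 v ==>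
 F {0,3} = edge X 2 0 2 w ==> thesis|] ==> thesis"
 "[|edge X 2 1 2 u = edge X 2 0 1 v; edge X 2 0 1 u = edge X 2 0 1 w; edge X 2 0 2 v = edge X 2 1 2 w;
 !!F :: nat set => _. cmap X (hornc {0,1,2,3} 1) F ==> F {0,2} = edge X 2 0 2 u ==> F {2,3} = edge X 2 1 2 v ==>
 F {0,3} = edge X 2 0 2 w ==> thesis|] ==> thesis"
 "[|edge X 2 0 1 u = edge X 2 0 1 v; edge X 2 0 2 u = edge X 2 0 1 w; edge X 2 0 2 v = edge X 2 0 2 w;
 !!F :: nat set => _. cmap X (hornc {0,1,2,3} 0) F ==> F {0,1} = edge X 2 0 1 u ==> F {1,2} = edge X 2 1 2 u ==>
 F {1,3} = edge X 2 1 2 v ==> F {2,3} = edge X 2 1 2 w ==>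
 (!!ta. ta~={} ==> ta <= {0,1,2} ==> F ta = simp_fun X {0,1,2} u ta) ==>
 (!!ta. ta~={} ==> ta <= {0,1,3} ==> F ta = simp_fun X {0,1,3} v ta) ==>
 (!!ta. ta~={} ==> ta <= {0,2,3} ==> F ta = simp_fun X {0,2,3} w ta) ==> thesis|] ==> thesis"
proof -
 have l: "(0::nat) < 1" "(1::nat) < 2" "(2::nat) < 3" "(0::nat) < 2" "(1::nat) < 3" by auto
 have fin: "finite {0::nat,1,2}" "finite {1::nat,2,3}" "finite {0::nat,2,3}" "finite {0::nat,1,3}" by auto
 have i: "{0,1,2} Int {1,2,3} = {1,2::nat}" "{0,1,2} Int {0,2,3} = {0,2::nat}" "{1,2,3} Int {0,2,3} = {2,3::nat}"
 "{0,1,2} Int {0,1,3} = {0,1::nat}" "{1,2,3} Int {0,1,3} = {1,3::nat}" "{0,1,3} Int {0,2,3} = {0,3::nat}" by auto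
 have ne: "{1,2::nat}~={}" "{0,2::nat}~={}" "{2,3::nat}~={}" "{0,1::nat}~={}" "{1,3::nat}~={}" "{0,3::nat}~={}" by auto
 note su = simp_fun[OF X l(1,2) u]
 { note sv = simp_fun[OF X l(2,3) v] and sw = simp_fun[OF X l(4,3) w]
 assume e: "edge X 2 1 2 u = edge X 2 0 1 v" "edge X 2 0 2 u = edge X 2 0 1 w" "edge X 2 1 2 v = edge X 2 1 2 w"
 and t: "!!F :: nat set => _. cmap X (hornc {0,1,2,3} 2) F ==> F {0,1} = edge X 2 0 1 u ==> F {1,3} = edge X 2 0 2 v ==>
 F {0,3} = edge X 2 0 2 w ==> thesis"
 show thesis
 proof (rule glue3[OF X su(1) sv(1) sw(1) fin(1-3), unfolded i, OF ne(1,2,3)])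
 fix F :: "nat set => _" assume F: "cmap X {ta. ta~={} & (ta <= {0,1,2} | ta <= {1,2,3} | ta <= {0,2,3})} F"
 "!!ta. ta~={} ==> ta <= {0,1,2} ==> F ta = simp_fun X {0,1,2} u ta"
 "!!ta. ta~={} ==> ta <= {1,2,3} ==> F ta = simp_fun X {1,2,3} v ta"
 "!!ta. ta~={} ==> ta <= {0,2,3} ==> F ta = simp_fun X {0,2,3} w ta"
 show thesis by (rule t[of F]; (unfold hornc3, rule F(1))?) (use F(2)[of "{0,1}"] F(3)[of "{1,3}"] F(4)[of "{0,3}"] su sv sw in simp_all)
 qed (simp_all only: su sv sw e) }
 { note sv = simp_fun[OF X l(2,3) v] and sw = simp_fun[OF X l(1,5) w]
 assume e: "edge X 2 1 2 u = edge X 2 0 1 v" "edge X 2 0 1 u = edge X 2 0 1 w" "edge X 2 0 2 v = edge X 2 1 2 w"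
 and t: "!!F :: nat set => _. cmap X (hornc {0,1,2,3} 1) F ==> F {0,2} = edge X 2 0 2 u ==> F {2,3} = edge X 2 1 2 v ==>
 F {0,3} = edge X 2 0 2 w ==> thesis"
 show thesis
 proof (rule glue3[OF X su(1) sv(1) sw(1) fin(1,2,4), unfolded i, OF ne(1,4,5)])
 fix F :: "nat set => _" assume F: "cmap X {ta. ta~={} & (ta <= {0,1,2} | ta <= {1,2,3} | ta <= {0,1,3})} F"
 "!!ta. ta~={} ==> ta <= {0,1,2} ==> F ta = simp_fun X {0,1,2} u ta"
 "!!ta. ta~={} ==> ta <= {1,2,3} ==> F ta = simp_fun X {1,2,3} v ta"
 "!!ta. ta~={} ==> ta <= {0,1,3} ==> F ta = simp_fun X {0,1,3} w ta"
 show thesis by (rule t[of F]; (unfold hornc3, rule F(1))?) (use F(2)[of "{0,2}"] F(3)[of "{2,3}"] F(4)[of "{0,3}"] su sv sw in simp_all)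
 qed (simp_all only: su sv sw e) }
 { note sv = simp_fun[OF X l(1,5) v] and sw = simp_fun[OF X l(4,3) w]
 assume e: "edge X 2 0 1 u = edge X 2 0 1 v" "edge X 2 0 2 u = edge X 2 0 1 w" "edge X 2 0 2 v = edge X 2 0 2 w"
 and t: "!!F :: nat set => _. cmap X (hornc {0,1,2,3} 0) F ==> F {0,1} = edge X 2 0 1 u ==> F {1,2} = edge X 2 1 2 u ==>
 F {1,3} = edge X 2 1 2 v ==> F {2,3} = edge X 2 1 2 w ==>
 (!!ta. ta~={} ==> ta <= {0,1,2} ==> F ta = simp_fun X {0,1,2} u ta) ==>
 (!!ta. ta~={} ==> ta <= {0,1,3} ==> F ta = simp_fun X {0,1,3} v ta) ==>
 (!!ta. ta~={} ==> ta <= {0,2,3} ==> F ta = simp_fun X {0,2,3} w ta) ==> thesis"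
 show thesis
 proof (rule glue3[OF X su(1) sv(1) sw(1) fin(1,4,3), unfolded i, OF ne(4,2,6)])
 fix F :: "nat set => _" assume F: "cmap X {ta. ta~={} & (ta <= {0,1,2} | ta <= {0,1,3} | ta <= {0,2,3})} F"
 "!!ta. ta~={} ==> ta <= {0,1,2} ==> F ta = simp_fun X {0,1,2} u ta"
 "!!ta. ta~={} ==> ta <= {0,1,3} ==> F ta = simp_fun X {0,1,3} v ta"
 "!!ta. ta~={} ==> ta <= {0,2,3} ==> F ta = simp_fun X {0,2,3} w ta"
 show thesis
 proof (rule t[of F])
 show "cmap X (hornc {0,1,2,3} 0) F" unfolding hornc3 by (rule F(1))
 qed (use F(2)[of "{0,1}"] F(2)[of "{1,2}"] F(3)[of "{1,3}"] F(4)[of "{2,3}"] F(2-4) su sv sw in simp_all)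
 qed (simp_all only: su sv sw e) }
qed

locale qcat = fixes C :: "'c sset" assumes C: "quasicategory C"
begin

lemma X: "sst C" by (rule quasicategory_sset[OF C])

lemma comp2_arr: assumes "comp2 C f g h"
 obtains x y z where "arr C x y f" "arr C y z g" "arr C x z h"
proof -
 obtain u where u: "u:cells C 2" "edge C 2 0 1 u = f" "edge C 2 1 2 u = g" "edge C 2 0 2 u = h" using assms unfolding comp2_def by blast
 have d: "dmap 1 2 (%k. if k = 0 then i else j)" if "i <= j" "j <= 2" for i j using that unfolding dmd by auto
 have v: "source C (edge C 2 i j u) = opr C 0 2 (%_. i) u" "target C (edge C 2 i j u) = opr C 0 2 (%_. j) u"
 "edge C 2 i j u:cells C 1" if "i <= j" "j <= 2" for i j
 using sset_opr_opr[OF X _ d[OF that] u(1), of 0 "%_. 0"] sset_opr_opr[OF X _ d[OF that] u(1), of 0 "%_. 1"]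
 sset_opr_in[OF X d[OF that] u(1)] unfolding vertex_def edge_def by (simp_all add: dmd o_def)
 show ?thesis by (rule that[of "opr C 0 2 (%_. 0) u" "opr C 0 2 (%_. 1) u" "opr C 0 2 (%_. 2) u"])
 (use v[of 0 1] v[of 1 2] v[of 0 2] u in "auto simp: arr_def")
qed

text \<open>The face 013 of a filler of the horn at 2.\<close>

lemma compA:
 assumes "comp2 C f g a" "comp2 C g h b" "comp2 C a h c" shows "comp2 C f b c"
proof -
 obtain u v w where u: "u:cells C 2" "edge C 2 0 1 u = f" "edge C 2 1 2 u = g" "edge C 2 0 2 u = a"
 and v: "v:cells C 2" "edge C 2 0 1 v = g" "edge C 2 1 2 v = h" "edge C 2 0 2 v = b"
 and w: "w:cells C 2" "edge C 2 0 1 w = a" "edge C 2 1 2 w = h" "edge C 2 0 2 w = c" using assms unfolding comp2_def by metis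
 obtain F :: "nat set => 'c" where F: "cmap C (hornc {0,1,2,3} 2) F" "F {0,1} = f" "F {1,3} = b" "F {0,3} = c"
 by (rule horn3_glue(1)[OF X u(1) v(1) w(1)]) (use u v w in simp_all)
 have ch: "fchain {0::nat,1,2,3}" by (simp add: fchain_nat)
 obtain x where x: "x:cells C (dm {0::nat,1,2,3})" "!!ta. ta:hornc {0,1,2,3} 2 ==>
 opr C (dm ta) (dm {0::nat,1,2,3}) (cface ta {0,1,2,3}) x = F ta" using inner_fill[OF C ch, of 2 0 3 F] F(1) by auto
 have m: "{0,1}:hornc {0,1,2,3} (2::nat)" "{1,3}:hornc {0,1,2,3} (2::nat)" "{0,3}:hornc {0,1,2,3} (2::nat)" unfolding hornc3 by auto
 show ?thesis unfolding comp2_def using simplex_face[OF X, of 0 1 3, OF _ _ _ x(1)] x(2)[OF m(1)] x(2)[OF m(2)] x(2)[OF m(3)] F(2-4) by (intro bexI) simp_all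
qed

text \<open>The face 023 of a filler of the horn at 1.\<close>

lemma compB:
 assumes "comp2 C f g a" "comp2 C g h b" "comp2 C f b c" shows "comp2 C a h c"
proof -
 obtain u v w where u: "u:cells C 2" "edge C 2 0 1 u = f" "edge C 2 1 2 u = g" "edge C 2 0 2 u = a"
 and v: "v:cells C 2" "edge C 2 0 1 v = g" "edge C 2 1 2 v = h" "edge C 2 0 2 v = b"
 and w: "w:cells C 2" "edge C 2 0 1 w = f" "edge C 2 1 2 w = b" "edge C 2 0 2 w = c" using assms unfolding comp2_def by metis
 obtain F :: "nat set => 'c" where F: "cmap C (hornc {0,1,2,3} 1) F" "F {0,2} = a" "F {2,3} = h" "F {0,3} = c"
 by (rule horn3_glue(2)[OF X u(1) v(1) w(1)]) (use u v w in simp_all)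
 have ch: "fchain {0::nat,1,2,3}" by (simp add: fchain_nat)
 obtain x where x: "x:cells C (dm {0::nat,1,2,3})" "!!ta. ta:hornc {0,1,2,3} 1 ==>
 opr C (dm ta) (dm {0::nat,1,2,3}) (cface ta {0,1,2,3}) x = F ta" using inner_fill[OF C ch, of 1 0 3 F] F(1) by auto
 have m: "{0,2}:hornc {0,1,2,3} (1::nat)" "{2,3}:hornc {0,1,2,3} (1::nat)" "{0,3}:hornc {0,1,2,3} (1::nat)" unfolding hornc3 by auto
 show ?thesis unfolding comp2_def using simplex_face[OF X, of 0 2 3, OF _ _ _ x(1)] x(2)[OF m(1)] x(2)[OF m(2)] x(2)[OF m(3)] F(2-4) by (intro bexI) simp_all
qed

lemma comp2_ex:
 assumes f: "arr C x y f" and g: "arr C y z g" shows "EX h. comp2 C f g h"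
proof -
 have ch: "fchain {0::nat,1}" "fchain {1::nat,2}" "fchain {0::nat,1,2}" by (simp_all add: fchain_nat)
 have d: "dm {0::nat,1} = 1" "dm {1::nat,2} = 1" "dm {0::nat,1,2} = 2" by auto
 let ?f = "%ta :: nat set. opr C (dm ta) (dm {0::nat,1}) (cface ta {0,1}) f"
 let ?g = "%ta :: nat set. opr C (dm ta) (dm {1::nat,2}) (cface ta {1,2}) g"
 have fc: "f:cells C (dm {0::nat,1})" "g:cells C (dm {1::nat,2})" using f g d unfolding arr_def by auto
 have cf: "cmap C {ta. ta <= {0,1} & ta~={}} ?f" "cmap C {ta. ta <= {1,2} & ta~={}} ?g"
 by (rule cmap_simplex[OF X ch(1) fc(1)] cmap_simplex[OF X ch(2) fc(2)])+
 have p: "pos {0::nat,1} 1 = 1" "pos {1::nat,2} 1 = 0" "enum {1::nat} 0 = 1"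
 using pos_list[of "[0::nat,1]" 1] pos_list[of "[1::nat,2]" 0] enum_list[of "[1::nat]" 0] by simp_all
 have y: "?f {1} = y" "?g {1} = y"
 proof -
 have dl: "dmap 0 1 (cface {1::nat} {0,1})" "dmap 0 1 (cface {1::nat} {1,2})"
 using delta_cface[OF ch(1), of "{1}"] delta_cface[OF ch(2), of "{1}"] by simp_all
 have "?f {1} = opr C 0 1 (cface {1::nat} {0,1}) f" by simp
 also have "... = target C f" unfolding vertex_def by (rule sset_opr_cong[OF X dl(1)]) (use fc p in "auto simp: cface_def")
 finally have 1: "?f {1} = target C f" .
 have "?g {1} = opr C 0 1 (cface {1::nat} {1,2}) g" by simp
 also have "... = source C g" unfolding vertex_def by (rule sset_opr_cong[OF X dl(2)]) (use fc p in "auto simp: cface_def")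
 finally have "?g {1} = source C g" .
 moreover note 1
 ultimately show "?f {1} = y" "?g {1} = y" using f g unfolding arr_def by auto
 qed
 define F where "F = (%sg. if sg:{ta. ta <= {0::nat,1} & ta~={}} then ?f sg else ?g sg)"
 have "cmap C ({ta. ta <= {0,1} & ta~={}} Un {ta. ta <= {1,2} & ta~={}}) F" unfolding F_def
 proof (rule cmap_glue[OF cf chain_complex_Pow[OF ch(1)] chain_complex_Pow[OF ch(2)]])
 fix sg :: "nat set" assume "sg:{ta. ta <= {0,1} & ta~={}}" "sg:{ta. ta <= {1,2} & ta~={}}"
 hence "sg <= {0,1} Int {1,2}" "sg~={}" by blast+
 hence "sg = {1}" by auto
 thus "?f sg = ?g sg" using y by simp
 qed
 moreover have "{ta. ta <= {0::nat,1} & ta~={}} Un {ta. ta <= {1,2} & ta~={}} = hornc {0,1,2} 1" unfolding hornc_def by auto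
 ultimately have F: "cmap C (hornc {0,1,2} 1) F" by simp
 obtain x where x: "x:cells C (dm {0::nat,1,2})" "!!ta. ta:hornc {0,1,2} 1 ==>
 opr C (dm ta) (dm {0::nat,1,2}) (cface ta {0,1,2}) x = F ta" using inner_fill[OF C ch(3), of 1 0 2 F] F by auto
 have x2: "x:cells C 2" using x(1) unfolding d .
 have l: "(0::nat) < 1" "(1::nat) < 2" by auto
 note s = simp_fun[OF X l x2, unfolded simp_fun_def]
 have "{0,1}:hornc {0,1,2} (1::nat)" "{1,2}:hornc {0,1,2} (1::nat)" unfolding hornc_def by auto
 from this[THEN x(2)] have "edge C 2 0 1 x = F {0,1}" "edge C 2 1 2 x = F {1,2}" using s(3,4) by simp_all
 moreover have "F {0,1} = f" "F {1,2} = g" using cface_self[OF X ch(1) fc(1)] cface_self[OF X ch(2) fc(2)] unfolding F_def by auto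
 ultimately show ?thesis unfolding comp2_def using x2 by blast
qed

abbreviation idc :: "'c => 'c" where "idc == kc C 1"

lemma arr_ends: "arr C x y f ==> x:cells C 0 & y:cells C 0" unfolding arr_def vertex_def by (auto intro!: sset_opr_in[OF X] simp: dmd)

lemma comp2_id: assumes f: "arr C x y f" shows "comp2 C (idc x) f f" "comp2 C f (idc y) f"
proof -
 have fc: "f:cells C 1" using f unfolding arr_def by blast
 let ?l = "%k::nat. if k = 2 then 1 else (0::nat)" let ?r = "%k::nat. if k = 0 then 0 else (1::nat)"
 have d: "dmap 2 1 ?l" "dmap 2 1 ?r" unfolding dmd by auto
 have de: "dmap 1 2 (%k. if k = 0 then i else j)" if "i <= j" "j <= 2" for i j using that unfolding dmd by auto
 have e: "edge C 2 i j (opr C 2 1 t f) = opr C 1 1 (%k. if k = 0 then t i else t j) f"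
 if "dmap 2 1 t" "i <= j" "j <= 2" for t i j
 proof -
 have "edge C 2 i j (opr C 2 1 t f) = opr C 1 1 (t o (%k. if k = 0 then i else j)) f"
 unfolding edge_def by (rule sset_opr_opr[OF X de[OF that(2,3)] that(1) fc])
 thus ?thesis by (simp add: o_def if_distrib)
 qed
 have f1: "opr C 1 1 (%k. if k = 0 then 0 else 1) f = f" by (rule sset_opr_ident[OF X fc]) auto
 have cc: "opr C 1 1 (%k. if k = 0 then i else i) f = idc (opr C 0 1 (%_. i) f)" if "i <= 1" for i
 unfolding const_cell_def using sset_opr_opr[OF X _ _ fc, of 1 0 "%_. 0" "%_. i"] that by (simp add: dmd o_def)
 have xy: "opr C 0 1 (%_. 0) f = x" "opr C 0 1 (%_. 1) f = y" using f unfolding arr_def vertex_def by auto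
 show "comp2 C (idc x) f f" unfolding comp2_def using e[OF d(1), of 0 1] e[OF d(1), of 1 2] e[OF d(1), of 0 2] f1 cc[of 0] xy sset_opr_in[OF X d(1) fc]
 by (intro bexI[of _ "opr C 2 1 ?l f"]) auto
 show "comp2 C f (idc y) f" unfolding comp2_def using e[OF d(2), of 0 1] e[OF d(2), of 1 2] e[OF d(2), of 0 2] f1 cc[of 1] xy sset_opr_in[OF X d(2) fc]
 by (intro bexI[of _ "opr C 2 1 ?r f"]) auto
qed

lemma arr_id: "x:cells C 0 ==> arr C x x (idc x)" unfolding arr_def vertex_def const_cell_def
 using sset_opr_opr[OF X, of 0 1 _ 0 "%_. 0" x] sset_opr_ident[OF X, of x 0] sset_opr_in[OF X, of 1 0 "%_. 0" x] by (auto simp: dmd o_def)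

lemma comp2_arr': "comp2 C f g h ==> arr C x y f ==> arr C y z g ==> arr C x z h" by (elim comp2_arr) (auto simp: arr_def)

definition heq :: "'c => 'c => bool" where "heq f g <-> (EX x y. arr C x y f & comp2 C f (idc y) g)"

lemma heq_arr: "heq f g ==> arr C x y f ==> arr C x y g & comp2 C f (idc y) g"
proof -
 assume h: "heq f g" and f: "arr C x y f"
 hence c: "comp2 C f (idc y) g" unfolding heq_def arr_def by blast
 have "arr C y y (idc y)" using arr_id arr_ends[OF f] by blast
 thus "arr C x y g & comp2 C f (idc y) g" using comp2_arr'[OF c f] c by blast
qed

lemma heq_refl: "arr C x y f ==> heq f f" unfolding heq_def using comp2_id by blast

lemma heq_sym: assumes "heq f g" shows "heq g f"
proof -
 obtain x y where f: "arr C x y f" "comp2 C f (idc y) g" using assms unfolding heq_def by blast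
 have "comp2 C (idc y) (idc y) (idc y)" using comp2_id arr_id arr_ends f by blast
 hence "comp2 C g (idc y) f" using compB[OF f(2) _ comp2_id(2)[OF f(1)]] by blast
 thus ?thesis unfolding heq_def using heq_arr[OF assms f(1)] by blast
qed

lemma heq_trans: assumes "heq f g" "heq g h" shows "heq f h"
proof -
 obtain x y where f: "arr C x y f" "comp2 C f (idc y) g" using assms unfolding heq_def by blast
 have g: "comp2 C g (idc y) h" using heq_arr[OF assms(2)] heq_arr[OF assms(1) f(1)] by blast
 have "comp2 C (idc y) (idc y) (idc y)" using comp2_id arr_id arr_ends f by blast
 hence "comp2 C f (idc y) h" using compA[OF f(2) _ g] by blast
 thus ?thesis unfolding heq_def using f by blast
qed

lemma comp2_heq3: assumes "comp2 C f g h" "heq h h'" shows "comp2 C f g h'"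
proof -
 obtain x y z where a: "arr C x y f" "arr C y z g" "arr C x z h" by (rule comp2_arr[OF assms(1)])
 show ?thesis by (rule compA[OF assms(1) comp2_id(2)[OF a(2)]]) (use heq_arr[OF assms(2) a(3)] in blast)
qed

lemma comp2_heq2: assumes "comp2 C f g h" "heq g g'" shows "comp2 C f g' h"
proof -
 obtain x y z where a: "arr C x y f" "arr C y z g" "arr C x z h" by (rule comp2_arr[OF assms(1)])
 show ?thesis by (rule compA[OF assms(1) _ comp2_id(2)[OF a(3)]]) (use heq_arr[OF assms(2) a(2)] in blast)
qed

lemma comp2_heq1: assumes "comp2 C f g h" "heq f f'" shows "comp2 C f' g h"
proof -
 obtain x y z where a: "arr C x y f" "arr C y z g" "arr C x z h" by (rule comp2_arr[OF assms(1)])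
 show ?thesis by (rule compB[OF _ comp2_id(1)[OF a(2)] assms(1)]) (use heq_arr[OF assms(2) a(1)] in blast)
qed

lemma comp2_unique: assumes "comp2 C f g h" "comp2 C f g h'" shows "heq h h'"
proof -
 obtain x y z where a: "arr C x y f" "arr C y z g" "arr C x z h" by (rule comp2_arr[OF assms(1)])
 have "comp2 C h (idc z) h'" by (rule compB[OF assms(1) comp2_id(2)[OF a(2)] assms(2)])
 thus ?thesis unfolding heq_def using a by blast
qed

definition cls :: "'c => 'c set" where "cls f = {g. heq f g}"

lemma cls_eq: "arr C x y f ==> cls f = cls g <-> heq f g" unfolding cls_def using heq_refl heq_sym heq_trans by blast

definition Hm :: "'c => 'c => 'c set set" where "Hm x y = {cls f |f. arr C x y f}"

text \<open>All composites of all representatives; \<open>hmul_cls\<close> shows that they make up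
  exactly one class, so no choice of a composite is needed.\<close>

definition hmul :: "'c set => 'c set => 'c set" where
 "hmul A B = {h. EX f:A. EX g:B. comp2 C f g h}"

lemma hmul_cls: assumes "comp2 C f g h" shows "hmul (cls f) (cls g) = cls h"
proof -
 obtain x y z where a: "arr C x y f" "arr C y z g" "arr C x z h" by (rule comp2_arr[OF assms])
 show ?thesis
 proof (intro set_eqI iffI)
 fix k assume "k:hmul (cls f) (cls g)"
 then obtain f' g' where "heq f f'" "heq g g'" "comp2 C f' g' k" unfolding hmul_def cls_def by blast
 hence "comp2 C f g k" using comp2_heq1[OF comp2_heq2] heq_sym by blast
 thus "k:cls h" using comp2_unique[OF assms] unfolding cls_def by blast
 next
 fix k assume "k:cls h"
 hence "comp2 C f g k" using comp2_heq3[OF assms] unfolding cls_def by blast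
 thus "k:hmul (cls f) (cls g)" using heq_refl a unfolding hmul_def cls_def by blast
 qed
qed

lemma hmul_eq_iff: assumes "arr C x y f" "arr C y z g" "arr C x z h"
 shows "hmul (cls f) (cls g) = cls h <-> comp2 C f g h"
proof
 obtain k where k: "comp2 C f g k" using comp2_ex assms by blast
 assume "hmul (cls f) (cls g) = cls h"
 hence "cls h = cls k" using hmul_cls[OF k] by simp
 thus "comp2 C f g h" using comp2_heq3[OF k] heq_sym cls_eq[OF assms(3)] by blast
qed (rule hmul_cls)

sublocale hom_cat Hm hmul "%x. cls (idc x)"
proof
 fix A B D x y z w
 { assume "A:Hm x y" "B:Hm y z"
 then obtain f g where f: "A = cls f" "arr C x y f" "B = cls g" "arr C y z g" unfolding Hm_def by blast
 then obtain h where h: "comp2 C f g h" using comp2_ex by blast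
 thus "hmul A B:Hm x z" using f hmul_cls comp2_arr' unfolding Hm_def by blast
 assume "D:Hm z w"
 then obtain k where k: "D = cls k" "arr C z w k" unfolding Hm_def by blast
 have ah: "arr C x z h" by (rule comp2_arr'[OF h f(2,4)])
 obtain l where l: "comp2 C g k l" using comp2_ex f k by blast
 obtain m where m: "comp2 C h k m" using comp2_ex[OF ah k(2)] by blast
 have "comp2 C f l m" by (rule compA[OF h l m])
 thus "hmul (hmul A B) D = hmul A (hmul B D)" unfolding f(1,3) k(1) hmul_cls[OF h] hmul_cls[OF l] hmul_cls[OF m] by (simp add: hmul_cls) }
 assume "A:Hm x y"
 then obtain f where f: "A = cls f" "arr C x y f" unfolding Hm_def by blast
 show "cls (idc x):Hm x x & cls (idc y):Hm y y" using arr_id arr_ends[OF f(2)] unfolding Hm_def by blast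
 show "hmul (cls (idc x)) A = A" "hmul A (cls (idc y)) = A" unfolding f(1) by (rule hmul_cls comp2_id[OF f(2)])+
qed

lemma iso_iff: "arr C x y f ==> iso x y (cls f) <-> eqe C f"
proof
 assume f: "arr C x y f" and "iso x y (cls f)"
 then obtain g where g: "arr C y x g" "hmul (cls f) (cls g) = cls (idc x)" "hmul (cls g) (cls f) = cls (idc y)" unfolding iso_def Hm_def by blast
 have "comp2 C f g (idc x)" "comp2 C g f (idc y)" using hmul_eq_iff[OF f g(1) arr_id] hmul_eq_iff[OF g(1) f arr_id] g(2,3) arr_ends[OF f] by simp_all
 moreover have "source C f = x" "target C f = y" "f:cells C 1" "g:cells C 1" using f g(1) unfolding arr_def by auto
 ultimately show "eqe C f" unfolding equivalence_edge_def comp2_def by auto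
next
 assume f: "arr C x y f" and "eqe C f"
 then obtain g where g: "comp2 C f g (idc x)" "comp2 C g f (idc y)" "g:cells C 1" unfolding equivalence_edge_def comp2_def arr_def by blast
 obtain a b c where "arr C a b f" "arr C b c g" "arr C a c (idc x)" by (rule comp2_arr[OF g(1)])
 hence "arr C y x g" using f arr_id[of x] arr_ends[OF f] unfolding arr_def by auto
 thus "iso x y (cls f)" using f hmul_cls g by (intro isoI[of _ _ _ "cls g"]) (auto simp: Hm_def)
qed

end

section \<open>Inner fibrations over an edge\<close>

lemma sub_sset [simp]:
 "opr (E\<lparr>cells := S\<rparr>) = opr E" "vertex (E\<lparr>cells := S\<rparr>) = vertex E" "edge (E\<lparr>cells := S\<rparr>) = edge E"
 "kc (E\<lparr>cells := S\<rparr>) = kc E" by (simp_all add: fun_eq_iff vertex_def edge_def const_cell_def)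

lemma sub_simplicial:
 assumes "sst E" "!!n. S n <= cells E n"
 "!!m n t x. dmap m n t ==> x:S n ==> opr E m n t x:S m"
 shows "sst (E\<lparr>cells := S\<rparr>)" using assms unfolding simplicial_set_def by (simp add: subset_iff)

lemma sub_hom: "h:sset_hom X (E\<lparr>cells := S\<rparr>) ==> (!!n. S n <= cells E n) ==> h:sset_hom X E" unfolding sset_hom_def by (auto simp: PiE_iff)

lemma sub_cmap: "cmap (E\<lparr>cells := S\<rparr>) K f ==> (!!n. S n <= cells E n) ==> cmap E K f" unfolding cmap_def by auto

lemma inner_fibration_fill:
 assumes "inner_fibration E B p" "h:sset_hom (horn n k) E" "b:cells B n" "0 < k" "k < n"
 "ALL m. ALL s:cells (horn n k) m. p m (h m s) = opr B m n s b"
 shows "EX x:cells E n. p n x = b & (ALL m. ALL s:cells (horn n k) m. opr E m n s x = h m s)"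
 using assms(1)[unfolded inner_fibration_def, THEN conjunct2, THEN conjunct2, THEN conjunct2,
 rule_format, OF assms(2-5), OF assms(6)[rule_format]] .

text \<open>An inner horn in the subcomplex is filled in \<open>E\<close>, over a simplex of
  \<open>B\<close> chosen so that all its lifts belong to the subcomplex.\<close>

lemma sub_quasicategory:
 assumes ib: "inner_fibration E B p" and S: "!!n. S n <= cells E n"
 "!!m n t x. dmap m n t ==> x:S n ==> opr E m n t x:S m"
 and h: "!!n k h. h:sset_hom (horn n k) (E\<lparr>cells := S\<rparr>) ==> 0 < k ==> k < n ==>
 EX b:cells B n. (ALL m. ALL s:cells (horn n k) m. p m (h m s) = opr B m n s b) & (ALL x:cells E n. p n x = b --> x:S n)"
 shows "quasicategory (E\<lparr>cells := S\<rparr>)"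
proof -
 have "sst (E\<lparr>cells := S\<rparr>)" using ib S unfolding inner_fibration_def by (intro sub_simplicial) auto
 moreover have "EX x:S n. ALL m. ALL s:cells (horn n k) m. opr E m n s x = h m s"
 if a: "h:sset_hom (horn n k) (E\<lparr>cells := S\<rparr>)" "0 < k" "k < n" for n k h
 proof -
 obtain b where b: "b:cells B n" "ALL m. ALL s:cells (horn n k) m. p m (h m s) = opr B m n s b"
 "ALL x:cells E n. p n x = b --> x:S n" using h[OF a] by blast
 have "h:sset_hom (horn n k) E" by (rule sub_hom[OF a(1) S(1)])
 then obtain x where "x:cells E n" "p n x = b" "ALL m. ALL s:cells (horn n k) m. opr E m n s x = h m s"
 using inner_fibration_fill[OF ib _ b(1) a(2,3) b(2)] by auto
 thus ?thesis using b(3) by auto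
 qed
 ultimately show ?thesis unfolding quasicategory_def by simp
qed

lemma inner_fibrationD:
 assumes "inner_fibration E B p"
 shows "sst E" "sst B" "p:sset_hom E B" using assms unfolding inner_fibration_def by auto

lemma opr_const_cell: "sst B ==> b:cells B 0 ==> dmap m n s ==> opr B m n s (kc B n b) = kc B m b"
 unfolding const_cell_def by (subst sset_opr_opr) (auto simp: dmd o_def)

lemma const_cell_in: "sst B ==> b:cells B 0 ==> kc B n b:cells B n" unfolding const_cell_def by (rule sset_opr_in) (auto simp: dmd)

lemma fibre_quasicategory:
 assumes ib: "inner_fibration E B p" and b: "b:cells B 0" shows "quasicategory (fibre E B p b)" unfolding fibre_def
proof (rule sub_quasicategory[OF ib])
 note i = inner_fibrationD[OF ib]
 fix m n t x assume "dmap m n t" "x:{x:cells E n. p n x = kc B n b}"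
 thus "opr E m n t x:{x:cells E m. p m x = kc B m b}" using sset_homD(2)[OF i(3)] opr_const_cell[OF i(2) b] sset_opr_in[OF i(1)] by auto
next
 note i = inner_fibrationD[OF ib]
 fix n k h assume h: "h:sset_hom (horn n k) (E\<lparr>cells := %n. {x:cells E n. p n x = kc B n b}\<rparr>)"
 have "p m (h m s) = opr B m n s (kc B n b)" if "s:cells (horn n k) m" for m s
 using sset_homD(1)[OF h that] that opr_const_cell[OF i(2) b] unfolding horn_cells by auto
 thus "EX ba:cells B n. (ALL m. ALL s:cells (horn n k) m. p m (h m s) = opr B m n s ba) &
 (ALL x:cells E n. p n x = ba --> x:{x:cells E n. p n x = kc B n b})" using const_cell_in[OF i(2) b] by (intro bexI[of _ "kc B n b"]) auto
qed auto

text \<open>The part of \<open>E\<close> over one edge, taken as a subcomplex instead of a pullback.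
  This requires the ends of the edge to differ: the projection of a simplex is then determined by
  the levels of its vertices.\<close>

locale over_edge =
 fixes E :: "'e sset" and B :: "'b sset" and p :: "nat => 'e => 'b" and a :: 'b
 assumes ib: "inner_fibration E B p" and a: "a:cells B 1" and ne: "source B a~=target B a"
begin

lemmas i = inner_fibrationD[OF ib]

definition DS :: "nat => 'e set" where
 "DS = (%n. {x:cells E n. EX t. dmap n 1 t & p n x = opr B n 1 t a})"

abbreviation D :: "'e sset" where "D == E\<lparr>cells := DS\<rparr>"

definition lev :: "nat => 'e => nat => nat" where
 "lev n x i = (if p 0 (vertex E n i x) = source B a then 0 else 1)"

lemma DS_sub: "DS n <= cells E n" unfolding DS_def by auto

lemma DS_opr: assumes "dmap m n t" "x:DS n" shows "opr E m n t x:DS m"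
proof -
 obtain s where s: "x:cells E n" "dmap n 1 s" "p n x = opr B n 1 s a" using assms unfolding DS_def by blast
 have "p m (opr E m n t x) = opr B m 1 (s o t) a" using sset_homD(2)[OF i(3) assms(1) s(1)] sset_opr_opr[OF i(2) assms(1) s(2) a] s(3) by simp
 thus ?thesis using delta_comp[OF assms(1) s(2)] sset_opr_in[OF i(1) assms(1) s(1)] unfolding DS_def by blast
qed

lemma vertex_le: "j <= n ==> dmap 0 n (%_. j)" unfolding dmd by auto

lemma lev_eq:
 assumes "x:cells E n" "dmap n 1 t" "p n x = opr B n 1 t a" "j <= n"
 shows "p 0 (vertex E n j x) = (if t j = 0 then source B a else target B a)" "lev n x j = t j"
proof -
 have "p 0 (vertex E n j x) = opr B 0 1 (%_. t j) a" unfolding vertex_def using sset_homD(2)[OF i(3) vertex_le[OF assms(4)] assms(1)] assms(3)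
 sset_opr_opr[OF i(2) vertex_le[OF assms(4)] assms(2) a] by (simp add: o_def)
 moreover have "t j = 0 | t j = 1" using assms(2,4) unfolding dmd by (metis One_nat_def le_SucE le_zero_eq)
 ultimately show "p 0 (vertex E n j x) = (if t j = 0 then source B a else target B a)" "lev n x j = t j" using ne unfolding lev_def vertex_def by auto
qed

lemma lev: assumes "x:DS n" shows "dmap n 1 (lev n x)" "p n x = opr B n 1 (lev n x) a"
proof -
 obtain t where t: "x:cells E n" "dmap n 1 t" "p n x = opr B n 1 t a" using assms unfolding DS_def by blast
 show d: "dmap n 1 (lev n x)" using lev_eq(2)[OF t] t(2) unfolding dmd by auto
 show "p n x = opr B n 1 (lev n x) a" unfolding t(3) by (rule sset_opr_cong[OF i(2) t(2) _ a]) (use lev_eq(2)[OF t] in auto)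
qed

lemma proj_lev: assumes x: "x:DS n" and t: "!!j. j <= n ==> lev n x j = t j" shows "p n x = opr B n 1 t a"
 using lev(2)[OF x] sset_opr_cong[OF i(2) lev(1)[OF x] t a] by simp

lemma vertex_0: "x:cells E 0 ==> vertex E 0 0 x = x" unfolding vertex_def by (rule sset_opr_ident[OF i(1)]) auto

lemma lev_vertex: assumes "x:cells E n" "j <= n" shows "lev n x j = lev 0 (vertex E n j x) 0"
 unfolding lev_def using vertex_0 sset_opr_in[OF i(1) vertex_le[OF assms(2)] assms(1)] by (simp add: vertex_def)

text \<open>An inner horn contains all edges between consecutive vertices. The levels of its
  vertices are therefore monotone, and they determine the simplex of \<open>B\<close> over which to
  fill.\<close>

lemma quasicategory_over_edge: "quasicategory D"
proof (rule sub_quasicategory[OF ib DS_sub DS_opr])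
 fix n k h assume h: "h:sset_hom (horn n k) D" and k: "0 < k" "k < n"
 define t where "t j = lev 0 (h 0 (rs 0 (%_. j))) 0" for j
 have lt: "lev m (h m s) j = t (s j)" if s: "s:cells (horn n k) m" and j: "j <= m" for m s j
 proof -
 have hs: "h m s:cells E m" using sset_homD(1)[OF h s] DS_sub by auto
 have "vertex E m j (h m s) = h 0 (rs 0 (%_. s j))" unfolding vertex_def using sset_homD(2)[OF h vertex_le[OF j] s] by (simp add: horn_opr)
 thus ?thesis using lev_vertex[OF hs j] by (simp add: t_def)
 qed
 have "t j <= t (Suc j)" if "j < n" for j
 proof -
 let ?s = "\<lambda>l\<in>{..1}. if l = 0 then j else Suc j"
 \<comment> \<open>A vertex other than \<open>k\<close> that the edge from \<open>j\<close> to
   \<open>Suc j\<close> misses, so that this edge belongs to the horn; it exists since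
   \<open>k\<close> is neither 0 nor \<open>n\<close>.\<close>
 have "EX l<=n. l~=k & l~=j & l~=Suc j" by (rule exI[of _ "if k <= j then 0 else n"]) (use k that in auto)
 hence s: "?s:cells (horn n k) 1" using that unfolding horn_cells dmd by (auto simp del: One_nat_def)
 have "dmap 1 1 (lev 1 (h 1 ?s))" using lev(1) sset_homD(1)[OF h s] by simp
 hence "lev 1 (h 1 ?s) 0 <= lev 1 (h 1 ?s) 1" unfolding dmd by blast
 thus ?thesis using lt[OF s] by simp
 qed
 note step = this
 have "t j <= t l" if "j <= l" "l <= n" for j l using that
 proof (induction l rule: dec_induct)
 case (step l)
 thus ?case using \<open>!!j. j < n ==> t j <= t (Suc j)\<close>[of l] by simp
 qed simp
 moreover have "t j <= 1" for j unfolding t_def lev_def by simp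
 ultimately have t: "dmap n 1 t" unfolding dmd by blast
 let ?b = "opr B n 1 t a"
 have "p m (h m s) = opr B m n s ?b" if s: "s:cells (horn n k) m" for m s
 proof -
 have "p m (h m s) = opr B m 1 (t o s) a" using proj_lev[of "h m s" m "t o s"] lt[OF s] sset_homD(1)[OF h s] by simp
 thus ?thesis using sset_opr_opr[OF i(2) _ t a, of m s] s unfolding horn_cells by simp
 qed
 thus "EX b:cells B n. (ALL m. ALL s:cells (horn n k) m. p m (h m s) = opr B m n s b) & (ALL x:cells E n. p n x = b --> x:DS n)"
 using sset_opr_in[OF i(2) t a] t unfolding DS_def by (intro bexI[of _ ?b]) auto
qed

sublocale qcat D by unfold_locales (rule quasicategory_over_edge)

lemma fibre_DS:
 "x:cells (fibre E B p (source B a)) n ==> x:DS n"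
 "x:cells (fibre E B p (target B a)) n ==> x:DS n"
proof -
 have d: "dmap n 1 (%_. j)" "dmap n 0 (%_. 0)" "dmap 0 1 (%_. j)" if "j <= 1" for j using that unfolding dmd by auto
 have "kc B n (opr B 0 1 (%_. j) a) = opr B n 1 (%_. j) a" if "j <= 1" for j
 unfolding const_cell_def using sset_opr_opr[OF i(2) d(2) d(3) a] that by (simp add: o_def)
 thus "x:cells (fibre E B p (source B a)) n ==> x:DS n"
 "x:cells (fibre E B p (target B a)) n ==> x:DS n" unfolding fibre_def DS_def vertex_def using d(1)[of 0] d(1)[of 1] by (auto simp del: One_nat_def)
qed

lemma DS_fibre:
 assumes x: "x:DS n" and v: "!!j. j <= n ==> p 0 (vertex E n j x) = target B a"
 shows "x:cells (fibre E B p (target B a)) n"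
proof -
 have "p n x = opr B n 1 (%_. 1) a" by (rule proj_lev[OF x]) (use v ne in "auto simp: lev_def")
 also have "... = kc B n (target B a)" unfolding const_cell_def vertex_def by (subst sset_opr_opr[OF i(2) _ _ a]) (auto simp: dmd o_def)
 finally show ?thesis using x DS_sub unfolding fibre_def by auto
qed

definition L :: "'e set" where "L = {z:DS 0. p 0 z = target B a}"

lemma arr_fibre: assumes f: "arr D y z f" "y:L" "z:L" shows "f:cells (fibre E B p (target B a)) 1"
proof (rule DS_fibre)
 show "f:DS 1" using f unfolding arr_def by simp
 show "p 0 (vertex E 1 j f) = target B a" if "j <= 1" for j using f that unfolding arr_def L_def by (cases "j = 0") (auto simp: le_Suc_eq)
qed

text \<open>The triangles that witness an inverse in \<open>D\<close> have all their vertices over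
  the target, so they lie in the fibre.\<close>

lemma equivalence_fibre:
 assumes f: "arr D y z f" "y:L" "z:L" and e: "eqe D f"
 shows "eqe (fibre E B p (target B a)) f"
proof -
 let ?F = "fibre E B p (target B a)"
 obtain g u v where g: "g:DS 1" "u:DS 2" "v:DS 2"
 "edge E 2 0 1 u = f" "edge E 2 1 2 u = g" "edge E 2 0 2 u = kc E 1 y"
 "edge E 2 0 1 v = g" "edge E 2 1 2 v = f" "edge E 2 0 2 v = kc E 1 z" using e f(1) unfolding equivalence_edge_def arr_def by auto
 have ve: "source E (edge E 2 j k w) = vertex E 2 j w" "target E (edge E 2 j k w) = vertex E 2 k w"
 if "w:DS 2" "j <= k" "k <= 2" for w j k unfolding vertex_def edge_def using that DS_sub by (subst sset_opr_opr[OF i(1)]; auto simp: dmd o_def)+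
 have fv: "source E f = y" "target E f = z" using f(1) unfolding arr_def by auto
 have yz: "p 0 y = target B a" "p 0 z = target B a" using f unfolding L_def by auto
 have cz: "source E (kc E 1 x) = x" "target E (kc E 1 x) = x" if "x:L" for x using arr_id[of x] that unfolding arr_def L_def by auto
 have u: "vertex E 2 0 u = y" "vertex E 2 1 u = z" "vertex E 2 2 u = y" using ve[OF g(2), of 0 1] ve[OF g(2), of 0 2] g fv cz[OF f(2)] by simp_all
 have v: "vertex E 2 0 v = z" "vertex E 2 1 v = y" "vertex E 2 2 v = z" using ve[OF g(3), of 1 2] ve[OF g(3), of 0 2] g fv cz[OF f(3)] by simp_all
 have j2: "j = 0 | j = 1 | j = 2" if "j <= 2" for j :: nat using that by auto
 have "u:cells ?F 2" "v:cells ?F 2" using DS_fibre[OF g(2)] DS_fibre[OF g(3)] u v yz j2 by metis+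
 moreover have "g:cells ?F 1"
 proof (rule arr_fibre[OF _ f(3,2)])
 show "arr D z y g" unfolding arr_def using g(1) ve[OF g(2), of 1 2] g(5) u by simp
 qed
 ultimately show ?thesis using arr_fibre[OF f] g fv unfolding equivalence_edge_def
 by (intro conjI bexI[of _ g] bexI[of _ u] bexI[of _ v]) (simp_all add: fibre_def)
qed

lemma equivalence_D:
 assumes e: "eqe (fibre E B p b) f" and b: "b = source B a | b = target B a"
 shows "eqe D f"
proof -
 have "cells (fibre E B p b) n <= DS n" for n using fibre_DS b by blast
 hence *: "!!x. x:cells (fibre E B p b) n ==> x:cells D n" for n by auto
 have [simp]: "edge (fibre E B p b) = edge E" "vertex (fibre E B p b) = vertex E" "kc (fibre E B p b) = kc E" unfolding fibre_def by simp_all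
 show ?thesis using e unfolding equivalence_edge_def using * by (simp del: One_nat_def) blast
qed

text \<open>The levels of the vertices force the horn to lie over the degenerate simplex
  \<open>?b\<close>, for which the cocartesian property provides a filler; that filler is again over
  the edge.\<close>

lemma cocartesian_fill:
 fixes F :: "nat set => 'e"
 assumes e: "cocartesian_edge E B p e" and n: "n >= 2" and F: "cmap D (hornc {..n} 0) F" "F {0,1} = e"
 and v: "p 0 (F {0}) = source B a" "!!j. 0 < j ==> j <= n ==> p 0 (F {j}) = target B a"
 obtains x where "x:DS n" "!!ta. ta:hornc {..n} 0 ==> opr E (dm ta) n (cface ta {..n}) x = F ta"
proof -
 let ?t = "%j::nat. if j = 0 then 0 else (1::nat)"
 have s: "fchain {..n}" by (simp add: fchain_nat)
 have d: "dm {..n} = n" by simp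
 have ps: "pos {..n} j = j" if "j <= n" for j
 proof -
 have "{y:{..n}. y < j} = {..<j}" using that by auto
 thus ?thesis unfolding pos_def by simp
 qed
 have en: "enum {..n} j = j" if "j <= n" for j using enum_pos[OF s, of j] ps[OF that] that by simp
 have t: "dmap n 1 ?t" unfolding dmd by auto
 let ?b = "opr B n 1 ?t a"
 have b: "?b:cells B n" by (rule sset_opr_in[OF i(2) t a])
 have FE: "cmap E (hornc {..n} 0) F" by (rule sub_cmap[OF F(1) DS_sub])
 have pf: "p (dm ta) (F ta) = opr B (dm ta) (dm {..n}) (cface ta {..n}) ?b" if ta: "ta:hornc {..n} 0" for ta
 proof -
 have c: "fchain ta" "ta <= {..n}" "ta~={}" using chain_complexD(1)[OF chain_complex_hornc[OF s] ta] ta unfolding hornc_def by auto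
 have FD: "F ta:DS (dm ta)" using cmapD(1)[OF F(1) ta] by simp
 have "p (dm ta) (F ta) = opr B (dm ta) 1 (?t o cface ta {..n}) a"
 proof (rule proj_lev[OF FD])
 fix j assume j: "j <= dm ta"
 have je: "enum ta j:ta" by (rule enum_in'[OF c(1) j])
 have c1: "dm {enum ta j} = 0" by simp
 have e0: "enum {enum ta j} 0 = enum ta j" using enum_list[of "[enum ta j]" 0] by simp
 have "F {enum ta j} = opr E 0 (dm ta) (cface {enum ta j} ta) (F ta)" using cmapD(2)[OF FE ta, of "{enum ta j}"] je c1 by simp
 also have "... = vertex E (dm ta) j (F ta)" unfolding vertex_def
 proof (rule sset_opr_cong[OF i(1)])
 show "dmap 0 (dm ta) (cface {enum ta j} ta)" using delta_cface[OF c(1), of "{enum ta j}"] je by simp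
 show "cface {enum ta j} ta i = j" if "i <= 0" for i using that e0 pos_enum'[OF c(1) j] by (simp add: cface_def)
 show "F ta:cells E (dm ta)" by (rule cmapD(1)[OF FE ta])
 qed
 finally have "F {enum ta j} = vertex E (dm ta) j (F ta)" .
 moreover have "enum ta j <= n" using je c(2) by auto
 ultimately show "lev (dm ta) (F ta) j = (?t o cface ta {..n}) j"
 using v(1) v(2)[of "enum ta j"] ps[of "enum ta j"] ne by (cases "enum ta j = 0") (auto simp: lev_def cface_def)
 qed
 also have "... = opr B (dm ta) (dm {..n}) (cface ta {..n}) ?b"
 using sset_opr_opr[OF i(2) _ t a, of "dm ta" "cface ta {..n}"] delta_cface[OF s c(2,3)] d by simp
 finally show ?thesis .
 qed
 have 0: "(0::nat):{..n}" "pos {..n} 0 = 0" using ps by auto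
 let ?h = "horn_hom E F {..n} 0"
 have h: "?h:sset_hom (horn n 0) E" using horn_hom_in[OF i(1) s 0(1) FE] 0(2) d by simp
 have hp: "p m (?h m x) = opr B m n x ?b" if "x:cells (horn n 0) m" for m x using horn_hom_proj[OF i s 0(1) FE _ pf, of x m] that b 0(2) d by simp
 have he: "?h 1 (rs 1 (%i. i)) = e"
 proof -
 have c: "(rs 1 (%i. i)):cells (horn n 0) 1" using n unfolding horn_cells dmd by (auto intro!: exI[of _ 2])
 have m: "{0,1}:hornc {..n} (0::nat)" using n unfolding hornc_def by (auto intro!: bexI[of _ 2])
 have f01: "fchain {0::nat,1}" by (simp add: fchain_nat)
 have d1: "dm {0::nat,1} = 1" by simp
 have l: "(0::nat) < 1" by simp
 have "?h 1 (rs 1 (%i. i)) = ev E F 1 (enum {..n} o (rs 1 (%i. i)))" unfolding horn_hom_def using c 0(2) d by simp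
 also have "... = ev E F 1 (enum {0,1})"
 proof (rule ev_cong[OF i(1) FE, symmetric])
 show "word 1 (enum {0::nat,1})" using word_enum[OF f01] unfolding d1 .
 show "enum {0::nat,1} ` {..1}:hornc {..n} 0" using enum_image[OF f01] m unfolding d1 by simp
 show "enum {0,1} i = (enum {..n} o (rs 1 (%i. i))) i" if "i <= 1" for i :: nat
 using that n enum_pair[OF l] en[of i] by (cases "i = 0") (auto simp: le_Suc_eq)
 qed
 also have "... = e" using ev_enum[OF i(1) FE f01 m] F(2) unfolding d1 by simp
 finally show ?thesis .
 qed
 obtain x where x: "x:cells E n" "p n x = ?b" "ALL m. ALL s:cells (horn n 0) m. opr E m n s x = ?h m s"
 using e[unfolded cocartesian_edge_def, THEN conjunct2, rule_format, OF n h b he] hp by auto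
 show thesis
 proof (rule that)
 show "x:DS n" using x t unfolding DS_def by blast
 show "opr E (dm ta) n (cface ta {..n}) x = F ta" if "ta:hornc {..n} 0" for ta using horn_hom_fill[OF i(1) s 0(1) FE _ _ that] x 0(2) d by simp
 qed
qed

text \<open>A horn of dimension 2 at its first vertex, whose leading edge is the cocartesian
  one.\<close>

lemma comp2_cocartesian_ex:
 assumes e: "cocartesian_edge E B p e" "arr D x y e" "p 0 x = source B a" "y:L" and f: "arr D x z f" and z: "z:L"
 shows "EX g. arr D y z g & comp2 D e g f"
proof -
 have ch: "fchain {0::nat,1}" "fchain {0::nat,2}" by (simp_all add: fchain_nat)
 have d: "dm {0::nat,1} = 1" "dm {0::nat,2} = 1" "dm {..2::nat} = 2" by auto
 let ?f = "%ta :: nat set. opr D (dm ta) (dm {0::nat,1}) (cface ta {0,1}) e"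
 let ?g = "%ta :: nat set. opr D (dm ta) (dm {0::nat,2}) (cface ta {0,2}) f"
 have fc: "e:cells D (dm {0::nat,1})" "f:cells D (dm {0::nat,2})" using e(2) f d unfolding arr_def by auto
 have cf: "cmap D {ta. ta <= {0,1} & ta~={}} ?f" "cmap D {ta. ta <= {0,2} & ta~={}} ?g"
 by (rule cmap_simplex[OF X ch(1) fc(1)] cmap_simplex[OF X ch(2) fc(2)])+
 have p: "pos {0::nat,1} 0 = 0" "pos {0::nat,2} 0 = 0" "pos {0::nat,1} 1 = 1" "pos {0::nat,2} 2 = 1"
 "enum {0::nat} 0 = 0" "enum {1::nat} 0 = 1" "enum {2::nat} 0 = 2"
 using pos_list[of "[0::nat,1]" 0] pos_list[of "[0::nat,2]" 0] pos_list[of "[0::nat,1]" 1] pos_list[of "[0::nat,2]" 1]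
 enum_list[of "[0::nat]" 0] enum_list[of "[1::nat]" 0] enum_list[of "[2::nat]" 0] by simp_all
 have v: "?f {0} = x" "?g {0} = x" "?f {1} = y" "?g {2} = z"
 proof -
 have dl: "dmap 0 1 (cface {0::nat} {0,1})" "dmap 0 1 (cface {0::nat} {0,2})"
 "dmap 0 1 (cface {1::nat} {0,1})" "dmap 0 1 (cface {2::nat} {0,2})" using delta_cface[OF ch(1), of "{0}"] delta_cface[OF ch(2), of "{0}"]
 delta_cface[OF ch(1), of "{1}"] delta_cface[OF ch(2), of "{2}"] by simp_all
 have fc1: "e:cells D 1" "f:cells D 1" using e(2) f unfolding arr_def by auto
 have "opr D 0 1 (cface {0::nat} {0,1}) e = opr D 0 1 (%_. 0) e" by (rule sset_opr_cong[OF X dl(1) _ fc1(1)]) (simp add: cface_def p[unfolded One_nat_def])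
 moreover have "opr D 0 1 (cface {0::nat} {0,2}) f = opr D 0 1 (%_. 0) f" by (rule sset_opr_cong[OF X dl(2) _ fc1(2)]) (simp add: cface_def p)
 moreover have "opr D 0 1 (cface {1::nat} {0,1}) e = opr D 0 1 (%_. 1) e" by (rule sset_opr_cong[OF X dl(3) _ fc1(1)]) (simp add: cface_def p[unfolded One_nat_def])
 moreover have "opr D 0 1 (cface {2::nat} {0,2}) f = opr D 0 1 (%_. 1) f" by (rule sset_opr_cong[OF X dl(4) _ fc1(2)]) (simp add: cface_def p)
 ultimately show "?f {0} = x" "?g {0} = x" "?f {1} = y" "?g {2} = z" using e(2) f unfolding arr_def vertex_def by simp_all
 qed
 define F where "F = (%sg. if sg:{ta. ta <= {0::nat,1} & ta~={}} then ?f sg else ?g sg)"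
 have "cmap D ({ta. ta <= {0,1} & ta~={}} Un {ta. ta <= {0,2} & ta~={}}) F" unfolding F_def
 proof (rule cmap_glue[OF cf chain_complex_Pow[OF ch(1)] chain_complex_Pow[OF ch(2)]])
 fix sg :: "nat set" assume "sg:{ta. ta <= {0,1} & ta~={}}" "sg:{ta. ta <= {0,2} & ta~={}}"
 hence "sg <= {0,1} Int {0,2}" "sg~={}" by blast+
 hence "sg = {0}" by auto
 thus "?f sg = ?g sg" using v by simp
 qed
 moreover have "{ta. ta <= {0::nat,1} & ta~={}} Un {ta. ta <= {0,2} & ta~={}} = hornc {..2} 0"
 proof -
 have "{..2::nat} = {0,1,2}" by auto
 moreover have "ta <= {0,1} <-> ta <= {0,1,2} & 2~:ta" "ta <= {0,2} <-> ta <= {0,1,2} & 1~:ta" for ta :: "nat set" by auto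
 moreover have "(EX x:{0,1,2::nat}. x~=0 & x~:ta) <-> 1~:ta | 2~:ta" for ta by auto
 ultimately show ?thesis unfolding hornc_def by (simp only:) blast
 qed
 ultimately have F: "cmap D (hornc {..2} 0) F" by simp
 have Fe: "F {0,1} = e" "F {0,2} = f" using cface_self[OF X ch(1) fc(1)] cface_self[OF X ch(2) fc(2)] unfolding F_def by auto
 have Fv: "F {0} = x" "F {1} = y" "F {2} = z" using v unfolding F_def by simp_all
 have c3: "p 0 (F {0}) = source B a" using Fv e(3) by simp
 have c4: "p 0 (F {j}) = target B a" if "0 < j" "j <= 2" for j
 proof -
 have "j = 1 | j = 2" using that by auto
 thus ?thesis using Fv e(4) z unfolding L_def by auto
 qed
 obtain w where w: "w:DS 2" "!!ta. ta:hornc {..2} 0 ==> opr E (dm ta) 2 (cface ta {..2}) w = F ta"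
 using cocartesian_fill[OF e(1) order.refl F Fe(1) c3 c4] by blast
 have w2: "w:cells D 2" using w(1) by simp
 have a2: "{..2::nat} = {0,1,2}" by auto
 have m: "{0,1}:hornc {..2} (0::nat)" "{0,2}:hornc {..2} (0::nat)" unfolding hornc_def by auto
 have l: "(0::nat) < 1" "(1::nat) < 2" by auto
 have d3: "dm {0::nat,1,2} = 2" by simp
 note s = simp_fun[OF X l w2, unfolded simp_fun_def d3]
 have "edge D 2 0 1 w = F {0,1}" "edge D 2 0 2 w = F {0,2}" using w(2)[OF m(1)] w(2)[OF m(2)] s(3,5) unfolding a2 by simp_all
 hence c: "comp2 D e (edge D 2 1 2 w) f" unfolding comp2_def using w2 Fe by blast
 obtain x' y' z' where "arr D x' y' e" "arr D y' z' (edge D 2 1 2 w)" "arr D x' z' f" by (rule comp2_arr[OF c])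
 hence "arr D y z (edge D 2 1 2 w)" using e(2) f unfolding arr_def by auto
 thus ?thesis using c by blast
qed

text \<open>Two solutions span the faces 012 and 013 of a horn at 0 whose face 023 is degenerate;
  the face 123 of the filler is a homotopy between them.\<close>

lemma comp2_cocartesian_unique:
 assumes e: "cocartesian_edge E B p e" "arr D x y e" "p 0 x = source B a" "y:L" and z: "z:L"
 and g: "comp2 D e g f" "comp2 D e g' f" "arr D y z g"
 shows "heq g g'"
proof -
 have f: "arr D x z f" by (rule comp2_arr'[OF g(1) e(2) g(3)])
 obtain u v w where u: "u:cells D 2" "edge D 2 0 1 u = e" "edge D 2 1 2 u = g" "edge D 2 0 2 u = f"
 and v: "v:cells D 2" "edge D 2 0 1 v = e" "edge D 2 1 2 v = g'" "edge D 2 0 2 v = f"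
 and w: "w:cells D 2" "edge D 2 0 1 w = f" "edge D 2 1 2 w = idc z" "edge D 2 0 2 w = f" using g(1,2) comp2_id(2)[OF f] unfolding comp2_def by metis
 obtain F :: "nat set => 'e" where F: "cmap D (hornc {0,1,2,3} 0) F" "F {0,1} = e" "F {1,2} = g"
 "F {1,3} = g'" "F {2,3} = idc z"
 "!!ta. ta~={} ==> ta <= {0,1,2} ==> F ta = simp_fun D {0,1,2} u ta" by (rule horn3_glue(3)[OF X u(1) v(1) w(1)]) (use u v w in simp_all)
 have a3: "{..3::nat} = {0,1,2,3}" by auto
 have ch: "fchain {0::nat,1}" "fchain {1::nat,2}" "fchain {2::nat,3}" by (simp_all add: fchain_nat)
 have hm: "{0,1}:hornc {0,1,2,3} (0::nat)" "{1,2}:hornc {0,1,2,3} (0::nat)" "{2,3}:hornc {0,1,2,3} (0::nat)" unfolding hornc3 by auto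
 have vx: "F {q} = source D (F {q,r})" "F {r} = target D (F {q,r})" if "{q,r}:hornc {0,1,2,3} (0::nat)" "q < r" for q r
 proof -
 have c: "fchain {q,r}" by (simp add: fchain_nat)
 have d: "dm {q,r} = 1" "dm {q} = 0" "dm {r} = 0" using that(2) by auto
 have p: "pos {q,r} q = 0" "pos {q,r} r = 1" "enum {q} 0 = q" "enum {r} 0 = r"
 using pos_list[of "[q,r]" 0] pos_list[of "[q,r]" 1] that(2) enum_list[of "[q]" 0] enum_list[of "[r]" 0] by simp_all
 have dl: "dmap 0 1 (cface {q} {q,r})" "dmap 0 1 (cface {r} {q,r})" using delta_cface[OF c, of "{q}"] delta_cface[OF c, of "{r}"] d by simp_all
 have Fm: "F {q,r}:cells D 1" using cmapD(1)[OF F(1) that(1)] d by simp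
 have "opr D 0 1 (cface {q} {q,r}) (F {q,r}) = opr D 0 1 (%_. 0) (F {q,r})"
 "opr D 0 1 (cface {r} {q,r}) (F {q,r}) = opr D 0 1 (%_. 1) (F {q,r})"
 by (rule sset_opr_cong[OF X dl(1)] sset_opr_cong[OF X dl(2)]; use Fm p in "simp add: cface_def del: One_nat_def")+
 thus "F {q} = source D (F {q,r})" "F {r} = target D (F {q,r})"
 using cmapD(2)[OF F(1) that(1), of "{q}"] cmapD(2)[OF F(1) that(1), of "{r}"] d unfolding vertex_def by simp_all
 qed
 have l: "(0::nat) < 1" "(1::nat) < 2" "(2::nat) < 3" "(1::nat) < 3" by auto
 have Fv: "F {0} = x" "F {1} = y" "F {2} = z" "F {3} = z"
 using vx[OF hm(1) l(1)] vx[OF hm(2) l(2)] vx[OF hm(3) l(3)] F(2,3,5) e(2) g(3) arr_id[of z] z unfolding arr_def L_def by auto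
 have c2: "cmap D (hornc {..3} 0) F" unfolding a3 by (rule F(1))
 have c3: "p 0 (F {0}) = source B a" using Fv e(3) by simp
 have c4: "p 0 (F {j}) = target B a" if "0 < j" "j <= 3" for j
 proof -
 have "j = 1 | j = 2 | j = 3" using that by auto
 thus ?thesis using Fv e(4) z unfolding L_def by auto
 qed
 obtain t where t: "t:DS 3" "!!ta. ta:hornc {..3} 0 ==> opr E (dm ta) 3 (cface ta {..3}) t = F ta" using cocartesian_fill[OF e(1) _ c2 F(2) c3 c4] by auto
 have t3: "t:cells D (dm {0::nat,1,2,3})" unfolding dm3(5) using t(1) by simp
 have hm3: "{1,3}:hornc {0,1,2,3} (0::nat)" unfolding hornc3 by auto
 have 123: "{1,2,3} <= {0::nat,1,2,3}" by auto
 note sf = simplex_face[OF X l(2,3) 123 t3]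
 have tf: "opr D (dm ta) (dm {0::nat,1,2,3}) (cface ta {0,1,2,3}) t = F ta" if "ta:hornc {0,1,2,3} 0" for ta
 unfolding dm3(5) sub_sset using t(2)[of ta, unfolded a3] that by blast
 have "comp2 D g (idc z) g'" unfolding comp2_def by (rule bexI[OF _ sf(1)]) (simp only: sf(2-4) tf[OF hm(2)] tf[OF hm(3)] tf[OF hm3] F(3-5))
 thus ?thesis unfolding heq_def using g(3) by blast
qed

theorem cocartesian_wc:
 assumes e: "cocartesian_edge E B p e" "arr D x y e" "p 0 x = source B a" "y:L"
 shows "wc L x y (cls e)" unfolding wc_def
proof (intro conjI ballI)
 show "cls e:Hm x y" "y:L" using e unfolding Hm_def by blast+
 fix z h assume z: "z:L" and "h:Hm x z"
 then obtain f where f: "h = cls f" "arr D x z f" unfolding Hm_def by blast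
 obtain g where g: "arr D y z g" "comp2 D e g f" using comp2_cocartesian_ex[OF e f(2) z] by blast
 show "EX! g. g:Hm y z & hmul (cls e) g = h"
 proof (rule ex1I[of _ "cls g"])
 show "cls g:Hm y z & hmul (cls e) (cls g) = h" using g hmul_cls f unfolding Hm_def by blast
 fix k assume k: "k:Hm y z & hmul (cls e) k = h"
 then obtain g' where g': "k = cls g'" "arr D y z g'" unfolding Hm_def by blast
 hence "comp2 D e g' f" using hmul_eq_iff[OF e(2) g'(2) f(2)] k f(1) by simp
 hence "heq g g'" using comp2_cocartesian_unique[OF e z g(2) _ g(1)] by blast
 thus "k = cls g" using cls_eq[OF g(1)] g'(1) by blast
 qed
qed

end

section \<open>Equivalences and pushforward functors\<close>

context qcat begin

lemma comp2_equivalence: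
 assumes "comp2 C f g h"
 shows "eqe C f ==> eqe C g ==> eqe C h"
 "eqe C f ==> eqe C h ==> eqe C g"
 "eqe C g ==> eqe C h ==> eqe C f"
proof -
 obtain x y z where a: "arr C x y f" "arr C y z g" "arr C x z h" by (rule comp2_arr[OF assms])
 have m: "hmul (cls f) (cls g) = cls h" by (rule hmul_cls[OF assms])
 have H: "cls f:Hm x y" "cls g:Hm y z" using a unfolding Hm_def by blast+
 note i = iso_iff[OF a(1)] iso_iff[OF a(2)] iso_iff[OF a(3)]
 show "eqe C f ==> eqe C g ==> eqe C h" using iso_mult[of x y "cls f" z "cls g"] i m by simp
 show "eqe C f ==> eqe C h ==> eqe C g" using iso_cancel_left[OF H(2), of x "cls f"] i m by simp
 show "eqe C g ==> eqe C h ==> eqe C f" using iso_cancel_right[OF H(1), of z "cls g"] i m by simp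
qed

end

lemma delta_edge: "i <= j ==> j <= n ==> dmap 1 n (%k. if k = 0 then i else j)"
 and delta_const: "j <= n ==> dmap m n (%_. j)" unfolding dmd by auto

lemma hom_edge: "f:sset_hom X Y ==> x:cells X n ==> i <= j ==> j <= n ==> f 1 (edge X n i j x) = edge Y n i j (f n x)"
 unfolding edge_def by (rule sset_homD(2)[OF _ delta_edge])

lemma hom_vertex: "f:sset_hom X Y ==> x:cells X n ==> j <= n ==> f 0 (vertex X n j x) = vertex Y n j (f n x)"
 unfolding vertex_def by (rule sset_homD(2)[OF _ delta_const])

lemma hom_const: "f:sset_hom X Y ==> x:cells X 0 ==> f n (kc X n x) = kc Y n (f 0 x)"
 unfolding const_cell_def by (rule sset_homD(2)[OF _ delta_const]) simp_all

lemma vertex_in: "sst X ==> x:cells X n ==> j <= n ==> vertex X n j x:cells X 0" unfolding vertex_def by (rule sset_opr_in[OF _ delta_const])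

lemma hom_arr: "f:sset_hom X Y ==> arr X x y e ==> arr Y (f 0 x) (f 0 y) (f 1 e)"
 unfolding arr_def using hom_vertex[of f X Y e 1 0] hom_vertex[of f X Y e 1 1] sset_homD(1)[of f X Y e 1] by auto

lemma hom_comp2: "F:sset_hom X Y ==> comp2 X f g h ==> comp2 Y (F 1 f) (F 1 g) (F 1 h)" unfolding comp2_def
 by (elim bexE, rule_tac x = "F 2 u" in bexI) (auto simp: hom_edge[symmetric] intro: sset_homD(1))

lemma equivalence_comp2:
 "eqe C e <-> e:cells C 1 &
 (EX g:cells C 1. comp2 C e g (kc C 1 (source C e)) & comp2 C g e (kc C 1 (target C e)))" unfolding equivalence_edge_def comp2_def by blast

lemma hom_equivalence:
 assumes F: "F:sset_hom X Y" and X: "sst X" and e: "eqe X e"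
 shows "eqe Y (F 1 e)"
proof -
 obtain g where g: "e:cells X 1" "g:cells X 1" "comp2 X e g (kc X 1 (source X e))"
 "comp2 X g e (kc X 1 (target X e))" using e unfolding equivalence_comp2 by blast
 have "F 1 (kc X 1 (source X e)) = kc Y 1 (source Y (F 1 e))"
 "F 1 (kc X 1 (target X e)) = kc Y 1 (target Y (F 1 e))" using hom_const[OF F] hom_vertex[OF F g(1)] vertex_in[OF X g(1)] by simp_all
 thus ?thesis using hom_comp2[OF F g(3)] hom_comp2[OF F g(4)] sset_homD(1)[OF F g(1)] sset_homD(1)[OF F g(2)] unfolding equivalence_comp2 by auto
qed

lemma prod_cells: "(x, s):cells (prod_sset X Y) n <-> x:cells X n & s:cells Y n"
 and prod_opr: "opr (prod_sset X Y) m n t (x, s) = (opr X m n t x, opr Y m n t s)" by (simp_all add: prod_sset_def)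

lemma hom_prod:
 assumes "H:sset_hom (prod_sset X (std_simplex k)) Y" "dmap m n t" "x:cells X n" "s:cells (std_simplex k) n"
 shows "opr Y m n t (H n (x, s)) = H m (opr X m n t x, \<lambda>i\<in>{..m}. s (t i))"
 using sset_homD(2)[OF assms(1,2), of "(x, s)"] assms(3,4) by (simp add: prod_cells prod_opr std_opr)

abbreviation idm :: "nat => nat => nat" where "idm n == \<lambda>i\<in>{..n}. i"

lemma restrict_1: "(rs 1 (%i. f i)) = (rs 1 (%i. g i)) <-> f 0 = g 0 & f (1::nat) = g 1" by (auto simp: fun_eq_iff restrict_def le_Suc_eq split: if_splits)

text \<open>The naturality square of the homotopy \<open>H\<close> at \<open>w\<close>, divided into
  two triangles with common diagonal \<open>d\<close>.\<close>

lemma prism: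
 assumes H: "H:sset_hom (prod_sset X (std_simplex 1)) Y" and X: "sst X" and w: "arr X x y w"
 shows "EX d. comp2 Y (H 1 (w, \<lambda>_\<in>{..1}. 0)) (H 1 (kc X 1 y, idm 1)) d &
 comp2 Y (H 1 (kc X 1 x, idm 1)) (H 1 (w, \<lambda>_\<in>{..1}. 1)) d"
proof -
 let ?l = "%i::nat. if i = 0 then 0 else (1::nat)" and ?r = "%i::nat. if i <= 1 then 0 else (1::nat)"
 have wc: "w:cells X 1" "source X w = x" "target X w = y" using w unfolding arr_def by auto
 have d: "dmap 2 1 ?l" "dmap 2 1 ?r" unfolding dmd by auto
 have sc: "(rs 2 (%i. ?l i)):cells (std_simplex 1) 2" "(rs 2 (%i. ?r i)):cells (std_simplex 1) 2" unfolding std_cells dmd by auto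
 have e: "edge Y 2 i j (H 2 (opr X 2 1 t w, \<lambda>i\<in>{..2}. s i)) = H 1 (opr X 1 1 (%k. t (if k = 0 then i else j)) w, \<lambda>k\<in>{..1}. s (if k = 0 then i else j))"
 if ij: "i <= j" "j <= 2" and t: "dmap 2 1 t" and s: "(rs 2 (%i. s i)):cells (std_simplex 1) 2" for i j t s
 proof -
 have 1: "opr X 2 1 t w:cells X 2" by (rule sset_opr_in[OF X t wc(1)])
 have 2: "opr X 1 2 (%k. if k = 0 then i else j) (opr X 2 1 t w) = opr X 1 1 (%k. t (if k = 0 then i else j)) w"
 using sset_opr_opr[OF X delta_edge[OF ij] t wc(1)] by (simp add: o_def)
 have 3: "(rs 1 (%k. (rs 2 (%i. s i)) (if k = 0 then i else j))) = (rs 1 (%k. s (if k = 0 then i else j)))" using ij by (intro restrict_ext) auto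
 show ?thesis unfolding edge_def hom_prod[OF H delta_edge[OF ij] 1 s] 2 3 ..
 qed
 have id1: "opr X 1 1 (%k. if k = 0 then 0 else 1) w = w" by (rule sset_opr_ident[OF X wc(1)]) auto
 have cx: "opr X 1 1 (%k. 0) w = kc X 1 x" "opr X 1 1 (%k. 1) w = kc X 1 y" using sset_opr_opr[OF X delta_const[of 0 0 1] delta_const[of 0 1 0] wc(1)]
 sset_opr_opr[OF X delta_const[of 0 0 1] delta_const[of 1 1 0] wc(1)] wc(2,3) unfolding const_cell_def vertex_def by (simp_all add: o_def)
 have si: "(rs 1 (%k. if k = 0 then 0 else 1)) = idm 1" unfolding restrict_1 by simp
 let ?P = "H 2 (opr X 2 1 ?l w, \<lambda>i\<in>{..2}. ?r i)" and ?Q = "H 2 (opr X 2 1 ?r w, \<lambda>i\<in>{..2}. ?l i)"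
 have PQ: "?P:cells Y 2" "?Q:cells Y 2" using sset_homD(1)[OF H, of _ 2] sset_opr_in[OF X _ wc(1)] d sc by (simp_all add: prod_cells)
 have ifs: "(if (if k = 0 then (0::nat) else 1) = 0 then 0 else (1::nat)) = (if k = 0 then 0 else 1)"
 "(if (if k = 0 then (0::nat) else 1) <= 1 then 0 else (1::nat)) = 0"
 "(if (if k = 0 then (1::nat) else 2) = 0 then 0 else (1::nat)) = 1"
 "(if (if k = 0 then (1::nat) else 2) <= 1 then 0 else (1::nat)) = (if k = 0 then 0 else 1)"
 "(if (if k = 0 then (0::nat) else 2) = 0 then 0 else (1::nat)) = (if k = 0 then 0 else 1)"
 "(if (if k = 0 then (0::nat) else 2) <= 1 then 0 else (1::nat)) = (if k = 0 then 0 else 1)" for k :: nat by auto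
 have le: "(0::nat) <= 1" "(1::nat) <= 2" "(0::nat) <= 2" "(2::nat) <= 2" by auto
 have P: "edge Y 2 0 1 ?P = H 1 (w, \<lambda>_\<in>{..1}. 0)" "edge Y 2 1 2 ?P = H 1 (kc X 1 y, idm 1)"
 "edge Y 2 0 2 ?P = H 1 (w, idm 1)" using e[OF le(1,2) d(1) sc(2)] e[OF le(2,4) d(1) sc(2)] e[OF le(3,4) d(1) sc(2)] unfolding ifs id1 cx si by blast+
 have Q: "edge Y 2 0 1 ?Q = H 1 (kc X 1 x, idm 1)" "edge Y 2 1 2 ?Q = H 1 (w, \<lambda>_\<in>{..1}. 1)"
 "edge Y 2 0 2 ?Q = H 1 (w, idm 1)" using e[OF le(1,2) d(2) sc(1)] e[OF le(2,4) d(2) sc(1)] e[OF le(3,4) d(2) sc(1)] unfolding ifs id1 cx si by blast+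
 show ?thesis unfolding comp2_def using P Q PQ by blast
qed

section \<open>Natural equivalences and categorical equivalences\<close>

lemma fun_opr: "x:cells X k ==> s:cells (std_simplex m) k ==>
 opr (fun_sset X Y) m n t g k (x, s) = g k (x, \<lambda>i\<in>{..k}. t (s i))" by (simp add: fun_sset_def prod_cells)

lemma std_restrict: "dmap m n t ==> (rs m (%i. t i)):cells (std_simplex n) m" unfolding std_cells dmd by auto

text \<open>Evaluation at an object carries an inverse in the functor complex, together with its
  witnessing triangles, to an inverse of the component.\<close>

lemma naturally_equivalent_component:
 assumes X: "sst X" and Y: "sst Y" and n: "naturally_equivalent X Y F G"
 obtains e where "e:sset_hom (prod_sset X (std_simplex 1)) Y"
 "!!k x. x:cells X k ==> e k (x, \<lambda>_\<in>{..k}. 0) = F k x" "!!k x. x:cells X k ==> e k (x, \<lambda>_\<in>{..k}. 1) = G k x"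
 "!!x. x:cells X 0 ==> eqe Y (e 1 (kc X 1 x, idm 1))"
proof -
 let ?E = "fun_sset X Y"
 obtain e where e: "eqe ?E e" "source ?E e = fun_vertex X F" "target ?E e = fun_vertex X G" using n unfolding naturally_equivalent_def by blast
 obtain g u v where g: "e:cells ?E 1" "g:cells ?E 1" "u:cells ?E 2" "v:cells ?E 2"
 "edge ?E 2 0 1 u = e" "edge ?E 2 1 2 u = g" "edge ?E 2 0 2 u = kc ?E 1 (source ?E e)"
 "edge ?E 2 0 1 v = g" "edge ?E 2 1 2 v = e" "edge ?E 2 0 2 v = kc ?E 1 (target ?E e)" using e(1) unfolding equivalence_edge_def by blast
 have fc: "f:sset_hom (prod_sset X (std_simplex n)) Y" if "f:cells ?E n" for f n using that by (simp add: fun_sset_def)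
 have s0: "(rs k (%_. 0)):cells (std_simplex 0) k" for k unfolding std_cells dmd by auto
 have "e k (x, \<lambda>_\<in>{..k}. j) = vertex ?E 1 j e k (x, \<lambda>_\<in>{..k}. 0)" if "x:cells X k" for k x j
 unfolding vertex_def fun_opr[OF that s0] by (rule arg_cong[of _ _ "%s. e k (x, s)"]) auto
 hence FG: "e k (x, \<lambda>_\<in>{..k}. 0) = F k x" "e k (x, \<lambda>_\<in>{..k}. 1) = G k x" if "x:cells X k" for k x
 using that e(2,3) s0 by (simp_all add: fun_vertex_def prod_cells)
 have "eqe Y (e 1 (kc X 1 x, idm 1))" if x: "x:cells X 0" for x
 proof -
 \<comment> \<open>Evaluation at \<open>x\<close>: the constant simplex at \<open>x\<close> is
   paired with the tautological simplex of dimension \<open>n\<close>.\<close>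
 define atx where "atx n f = f n (kc X n x, idm n)" for n :: nat and f :: "nat => 'a \<times> (nat => nat) => 'b"
 have c: "kc X n x:cells X n" for n by (rule const_cell_in[OF X x])
 have ids: "idm n:cells (std_simplex n) n" for n by (rule std_restrict) (simp add: dmd)
 have nat: "f m (kc X m x, \<lambda>i\<in>{..m}. t i) = opr Y m n t (atx n f)" if f: "f:cells ?E n" and t: "dmap m n t" for f m n t
 proof -
 have "(rs m (%i. idm n (t i))) = (rs m (%i. t i))" using t unfolding dmd by (intro restrict_ext) auto
 thus ?thesis unfolding atx_def hom_prod[OF fc[OF f] t c ids] opr_const_cell[OF X x t] by simp
 qed
 have atc: "atx n f:cells Y n" if "f:cells ?E n" for n f unfolding atx_def by (rule sset_homD(1)[OF fc[OF that]]) (simp add: prod_cells c ids)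
 have ed: "atx 1 (edge ?E 2 i j f) = edge Y 2 i j (atx 2 f)" if "f:cells ?E 2" "i <= j" "j <= 2" for f i j
 proof -
 have "atx 1 (edge ?E 2 i j f) = f 1 (kc X 1 x, \<lambda>k\<in>{..1}. (%k. if k = 0 then i else j) (idm 1 k))" unfolding atx_def edge_def fun_opr[OF c ids] ..
 also have "(rs 1 (%k. (%k. if k = 0 then i else j) (idm 1 k))) = (rs 1 (%k. if k = 0 then i else j))" unfolding restrict_1 by simp
 finally show ?thesis unfolding nat[OF that(1) delta_edge[OF that(2,3)]] edge_def .
 qed
 have co: "atx 1 (kc ?E 1 (vertex ?E 1 j e)) = kc Y 1 (vertex Y 1 j (atx 1 e))" if j: "j <= 1" for j
 proof -
 have s: "(rs 1 (%i. 0)):cells (std_simplex 0) 1" by (rule s0)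
 have "atx 1 (kc ?E 1 (vertex ?E 1 j e)) = vertex ?E 1 j e 1 (kc X 1 x, \<lambda>i\<in>{..1}. 0)" unfolding atx_def const_cell_def[of ?E] fun_opr[OF c ids] ..
 also have "... = e 1 (kc X 1 x, \<lambda>i\<in>{..1}. j)" unfolding vertex_def fun_opr[OF c s] ..
 also have "... = opr Y 1 1 (%_. j) (atx 1 e)" by (rule nat[OF g(1) delta_const[OF j]])
 also have "... = kc Y 1 (vertex Y 1 j (atx 1 e))" unfolding const_cell_def vertex_def
 using sset_opr_opr[OF Y delta_const[of 0 0 1] delta_const[OF j] atc[OF g(1)]] by (simp add: o_def)
 finally show ?thesis .
 qed
 have eu: "edge Y 2 0 1 (atx 2 u) = atx 1 e" "edge Y 2 1 2 (atx 2 u) = atx 1 g"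
 "edge Y 2 0 2 (atx 2 u) = kc Y 1 (source Y (atx 1 e))"
 "edge Y 2 0 1 (atx 2 v) = atx 1 g" "edge Y 2 1 2 (atx 2 v) = atx 1 e"
 "edge Y 2 0 2 (atx 2 v) = kc Y 1 (target Y (atx 1 e))"
 using ed[OF g(3), of 0 1] ed[OF g(3), of 1 2] ed[OF g(3), of 0 2] ed[OF g(4), of 0 1] ed[OF g(4), of 1 2]
 ed[OF g(4), of 0 2] co[of 0] co[of 1] g by (simp_all del: One_nat_def)
 have "comp2 Y (atx 1 e) (atx 1 g) (kc Y 1 (source Y (atx 1 e)))" "comp2 Y (atx 1 g) (atx 1 e) (kc Y 1 (target Y (atx 1 e)))"
 unfolding comp2_def using eu atc[OF g(3)] atc[OF g(4)] by blast+
 hence "eqe Y (atx 1 e)" unfolding equivalence_comp2 using atc[OF g(1)] atc[OF g(2)] by blast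
 thus ?thesis unfolding atx_def .
 qed
 thus ?thesis using that[OF fc[OF g(1)] FG] by blast
qed

text \<open>If the image of \<open>w\<close> is invertible, so is its image under \<open>G\<close>,
  and the naturality square connects the latter with \<open>w\<close> through invertible
  components.\<close>

lemma categorical_equivalence_reflect:
 assumes X: "quasicategory X" and Y: "sst Y" and F: "categorical_equivalence X Y F"
 and w: "w:cells X 1" and e: "eqe Y (F 1 w)"
 shows "eqe X w"
proof -
 interpret qcat X by unfold_locales (rule X)
 obtain G where G: "F:sset_hom X Y" "G:sset_hom Y X" "naturally_equivalent X X (sset_comp X G F) (sset_id X)"
 using F unfolding categorical_equivalence_def by blast
 obtain e where e': "e:sset_hom (prod_sset X (std_simplex 1)) X"
 "!!k x. x:cells X k ==> e k (x, \<lambda>_\<in>{..k}. 0) = sset_comp X G F k x"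
 "!!k x. x:cells X k ==> e k (x, \<lambda>_\<in>{..k}. 1) = sset_id X k x"
 "!!x. x:cells X 0 ==> eqe X (e 1 (kc X 1 x, idm 1))" using naturally_equivalent_component[OF X X G(3)] by blast
 obtain x y where a: "arr X x y w" using w unfolding arr_def by blast
 have xy: "x:cells X 0" "y:cells X 0" using arr_ends[OF a] by auto
 obtain d where d: "comp2 X (G 1 (F 1 w)) (e 1 (kc X 1 y, idm 1)) d" "comp2 X (e 1 (kc X 1 x, idm 1)) w d"
 using prism[OF e'(1) X a] e'(2,3)[OF w] w by (auto simp: sset_comp_def sset_id_def)
 have "eqe X (G 1 (F 1 w))" by (rule hom_equivalence[OF G(2) Y e])
 hence "eqe X d" using comp2_equivalence(1)[OF d(1)] e'(4)[OF xy(2)] by blast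
 thus ?thesis using comp2_equivalence(2)[OF d(2)] e'(4)[OF xy(1)] by blast
qed

lemma power_simplicial: assumes "sst X" shows "sst (power_sset I X)" unfolding simplicial_set_def
proof (intro conjI allI impI ballI)
 fix m n t x assume "dmap m n t" "x:cells (power_sset I X) n"
 thus "opr (power_sset I X) m n t x:cells (power_sset I X) m" using sset_opr_in[OF assms] by (auto simp: power_sset_def PiE_iff)
next
 fix n x assume "x:cells (power_sset I X) n"
 thus "opr (power_sset I X) n n (%i. i) x = x"
 using sset_opr_ident[OF assms, of _ n "%i. i"] by (fastforce simp: power_sset_def fun_eq_iff PiE_iff extensional_def)
next
 fix k m n s t x assume "dmap k m s" "dmap m n t" "x:cells (power_sset I X) n"
 thus "opr (power_sset I X) k m s (opr (power_sset I X) m n t x) = opr (power_sset I X) k n (t o s) x"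
 using sset_opr_opr[OF assms] by (fastforce simp: power_sset_def fun_eq_iff PiE_iff)
next
 fix m n s t x assume "dmap m n s" "ALL i<=m. s i = t i" "x:cells (power_sset I X) n"
 thus "opr (power_sset I X) m n s x = opr (power_sset I X) m n t x" using sset_opr_cong[OF assms] by (fastforce simp: power_sset_def fun_eq_iff PiE_iff)
qed

lemma power_equivalence:
 assumes e: "e:I \<rightarrow>\<^sub>E cells X 1" "!!i. i:I ==> eqe X (e i)"
 shows "eqe (power_sset I X) e"
proof -
 let ?P = "%i g u v. g:cells X 1 & u:cells X 2 & v:cells X 2 &
 edge X 2 0 1 u = e i & edge X 2 1 2 u = g & edge X 2 0 2 u = kc X 1 (source X (e i)) &
 edge X 2 0 1 v = g & edge X 2 1 2 v = e i & edge X 2 0 2 v = kc X 1 (target X (e i))"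
 have "EX g u v. ?P i g u v" if "i:I" for i using e(2)[OF that] unfolding equivalence_edge_def by blast
 then obtain g u v where g: "!!i. i:I ==> ?P i (g i) (u i) (v i)" by metis
 have ed: "edge (power_sset I X) n i j x = (\<lambda>k\<in>I. edge X n i j (x k))" for n i j x by (simp add: power_sset_def edge_def)
 have co: "kc (power_sset I X) 1 (vertex (power_sset I X) 1 j e) = (\<lambda>k\<in>I. kc X 1 (vertex X 1 j (e k)))" for j
 by (auto simp: power_sset_def const_cell_def vertex_def restrict_def fun_eq_iff)
 have ee: "e k = undefined" if "k~:I" for k using e(1) that by (auto simp: PiE_iff extensional_def)
 show ?thesis unfolding equivalence_edge_def ed co
 by (intro conjI bexI[of _ "\<lambda>i\<in>I. g i"] bexI[of _ "\<lambda>i\<in>I. u i"] bexI[of _ "\<lambda>i\<in>I. v i"])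
 (use g e(1) ee in "auto simp: power_sset_def fun_eq_iff")
qed

section \<open>Pushforward along an edge\<close>

context over_edge begin

abbreviation "Ea == fibre E B p (source B a)"
abbreviation "Eb == fibre E B p (target B a)"

lemma source_target: "source B a:cells B 0" "target B a:cells B 0" using vertex_in[OF i(2) a] by auto

lemma fibre_sset: "b:cells B 0 ==> sst (fibre E B p b)" using quasicategory_sset fibre_quasicategory[OF ib] by blast

lemma const_cell_0: "b:cells B 0 ==> kc B 0 b = b" unfolding const_cell_def by (rule sset_opr_ident[OF i(2)]) auto

lemma fibre_0: "x:cells Ea 0 ==> p 0 x = source B a" "x:cells Eb 0 ==> x:L"
 using const_cell_0 source_target fibre_DS(2)[of x 0] unfolding fibre_def L_def by auto

lemma arr_Ea: "arr Ea x y w ==> arr D x y w" using fibre_DS(1)[of w 1] unfolding arr_def by (simp add: fibre_def)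

lemma arr_Eb: "arr Eb x y w ==> arr D x y w" using fibre_DS(2)[of w 1] unfolding arr_def by (simp add: fibre_def)

text \<open>The functor \<open>F\<close> comes with cocartesian edges of its own, not with
  \<open>jx\<close> and \<open>jy\<close>. Universal arrows being unique up to isomorphism,
  invertibility of \<open>s\<close> carries over to \<open>F 1 w\<close>.\<close>

lemma pushforward_equivalence:
 assumes F: "pushforward E B p a F" and w: "arr Ea x y w"
 and jx: "cocartesian_edge E B p jx" "arr D x u jx" and jy: "cocartesian_edge E B p jy" "arr D y v jy"
 and s: "arr Eb u v s" "eqe Eb s" and sq: "comp2 D jx s d" "comp2 D w jy d"
 shows "eqe Eb (F 1 w)"
proof -
 obtain H where F': "F:sset_hom Ea Eb" and H: "H:sset_hom (prod_sset Ea (std_simplex 1)) E"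
 "!!n x s. (x, s):cells (prod_sset Ea (std_simplex 1)) n ==> p n (H n (x, s)) = opr B n 1 s a"
 "!!n x. x:cells Ea n ==> H n (x, \<lambda>i\<in>{..n}. 0) = x & H n (x, \<lambda>i\<in>{..n}. 1) = F n x"
 "!!x. x:cells Ea 0 ==> cocartesian_edge E B p (H 1 (kc Ea 1 x, idm 1))" using F unfolding pushforward_def Let_def by blast
 \<comment> \<open>The homotopy projects into the edge, so it may be regarded as a map to
   \<open>D\<close>.\<close>
 have HD: "H:sset_hom (prod_sset Ea (std_simplex 1)) D"
 proof (rule sset_homI)
 show "H n:extensional (cells (prod_sset Ea (std_simplex 1)) n)" for n by (rule sset_homD(3)[OF H(1)])
 show "H n z:cells D n" if z: "z:cells (prod_sset Ea (std_simplex 1)) n" for n z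
 proof -
 obtain x s where xs: "z = (x, s)" by (cases z)
 have "dmap n 1 s" using z unfolding xs prod_cells std_cells by blast
 thus ?thesis using H(2)[of x s n] sset_homD(1)[OF H(1) z] z unfolding xs DS_def by auto
 qed
 show "H m (opr (prod_sset Ea (std_simplex 1)) m n t z) = opr D m n t (H n z)"
 if "dmap m n t" "z:cells (prod_sset Ea (std_simplex 1)) n" for m n t z using sset_homD(2)[OF H(1) that] by simp
 qed
 have Ea: "sst Ea" by (rule fibre_sset[OF source_target(1)])
 have wc: "w:cells Ea 1" using w unfolding arr_def by blast
 have xy: "x:cells Ea 0" "y:cells Ea 0" using w vertex_in[OF Ea, of w 1] unfolding arr_def by auto
 obtain d' where d': "comp2 D w (H 1 (kc Ea 1 y, idm 1)) d'" "comp2 D (H 1 (kc Ea 1 x, idm 1)) (F 1 w) d'" using prism[OF HD Ea w] H(3)[OF wc] by auto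
 have Fz: "F 0 z:L" if "z:cells Ea 0" for z by (rule fibre_0(2)[OF sset_homD(1)[OF F' that]])
 have ca: "arr D z (F 0 z) (H 1 (kc Ea 1 z, idm 1))" if z: "z:cells Ea 0" for z
 proof -
 have c: "kc Ea 1 z:cells Ea 1" by (rule const_cell_in[OF Ea z])
 have s1: "idm 1:cells (std_simplex 1) 1" by (rule std_restrict) (simp add: dmd)
 have v: "vertex D 1 j (H 1 (kc Ea 1 z, idm 1)) = H 0 (z, \<lambda>_\<in>{..0}. j)" if "j <= 1" for j
 proof -
 have 1: "opr Ea 0 1 (%_. j) (kc Ea 1 z) = z"
 using opr_const_cell[OF Ea z delta_const[OF that], of 0] sset_opr_ident[OF Ea z, of "%_. 0"] unfolding const_cell_def[of _ 0] by simp
 have 2: "(rs 0 (%i. idm 1 j)) = (rs 0 (%_. j))" using that by simp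
 show ?thesis unfolding vertex_def[of D] hom_prod[OF HD delta_const[OF that] c s1] 1 2 ..
 qed
 have "H 1 (kc Ea 1 z, idm 1):cells D 1" by (rule sset_homD(1)[OF HD]) (use c s1 in "simp add: prod_cells")
 thus ?thesis unfolding arr_def using v[of 0] v[of 1] H(3)[OF z] by simp
 qed
 have Fw: "arr Eb (F 0 x) (F 0 y) (F 1 w)" by (rule hom_arr[OF F' w])
 have Eb: "sst Eb" by (rule fibre_sset[OF source_target(2)])
 have uv: "u:L" "v:L" using s(1) vertex_in[OF Eb, of s 1] fibre_0(2) unfolding arr_def by auto
 have sD: "eqe D s" by (rule equivalence_D[OF s(2)]) simp
 have "iso (F 0 x) (F 0 y) (cls (F 1 w))"
 proof (rule wc_transport_iso)
 show "wc L x (F 0 x) (cls (H 1 (kc Ea 1 x, idm 1)))" "wc L y (F 0 y) (cls (H 1 (kc Ea 1 y, idm 1)))"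
 by (rule cocartesian_wc[OF H(4) ca fibre_0(1) Fz]; rule xy)+
 show "wc L x u (cls jx)" "wc L y v (cls jy)" by (rule cocartesian_wc[OF jx fibre_0(1)[OF xy(1)] uv(1)] cocartesian_wc[OF jy fibre_0(1)[OF xy(2)] uv(2)])+
 show "cls w:Hm x y" "cls (F 1 w):Hm (F 0 x) (F 0 y)" using arr_Ea[OF w] arr_Eb[OF Fw] unfolding Hm_def by blast+
 show "iso u v (cls s)" using iso_iff[OF arr_Eb[OF s(1)]] sD by simp
 show "hmul (cls (H 1 (kc Ea 1 x, idm 1))) (cls (F 1 w)) = hmul (cls w) (cls (H 1 (kc Ea 1 y, idm 1)))" using hmul_cls[OF d'(1)] hmul_cls[OF d'(2)] by simp
 show "hmul (cls jx) (cls s) = hmul (cls w) (cls jy)" using hmul_cls[OF sq(1)] hmul_cls[OF sq(2)] by simp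
 qed
 hence "eqe D (F 1 w)" using iso_iff[OF arr_Eb[OF Fw]] by simp
 thus ?thesis using equivalence_fibre[OF arr_Eb[OF Fw]] Fz xy by blast
qed

end

section \<open>Prefactorization algebras\<close>

lemma nerve_cells: "(x, f):cells (nerve K) n <-> x:{..n} \<rightarrow>\<^sub>E obj K & f = arrows n f &
 (ALL i j. i <= j --> j <= n --> f i j:hom K (x i) (x j)) &
 (ALL i<=n. f i i = ident K (x i)) &
 (ALL i j k. i <= j --> j <= k --> k <= n --> f i k = comp K (f j k) (f i j))"
 and nerve_opr: "opr (nerve K) m n t (x, f) = (rs m (%i. x (t i)), arrows m (%i j. f (t i) (t j)))" by (simp_all add: nerve_def)

lemma nerve_cellsD:
 assumes "(x, f):cells (nerve K) n"
 shows "x:{..n} \<rightarrow>\<^sub>E obj K" "f = arrows n f" "!!i j. i <= j ==> j <= n ==> f i j:hom K (x i) (x j)"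
 "!!i. i <= n ==> f i i = ident K (x i)" "!!i j k. i <= j ==> j <= k ==> k <= n ==> f i k = comp K (f j k) (f i j)"
 using assms unfolding nerve_cells by blast+

lemma arrows_cong: "arrows n f = arrows n g <-> (ALL i j. i <= j --> j <= n --> f i j = g i j)" unfolding arrows_def fun_eq_iff by auto

lemma arrows_eqI:
 assumes f: "f = arrows n f" and g: "g = arrows n g" and e: "!!i j. i <= j ==> j <= n ==> f i j = g i j"
 shows "f = g"
proof -
 have "arrows n f = arrows n g" using e by (simp add: arrows_cong)
 thus ?thesis by (rule trans[OF f trans[OF _ g[symmetric]]])
qed

lemma le2: "i <= (2::nat) <-> i = 0 | i = 1 | i = 2" by auto

lemma nerve_edge_2: "edge (nerve K) 2 i j (x, f) = (rs 1 (%k. x (if k = 0 then i else j)),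
 arrows 1 (%k l. f (if k = 0 then i else j) (if l = 0 then i else j)))" unfolding edge_def nerve_opr ..

lemma pair_le1: "(ALL i j. i <= j --> j <= (1::nat) --> P i j) <-> P 0 0 & P 0 1 & P 1 1" by (auto simp: le_Suc_eq)

lemma edge2_eq: "edge (nerve K) 2 i j (x, f) = (rs 1 (%k. y k), arrows 1 g) <->
 x i = y 0 & x j = y 1 & f i i = g 0 0 & f i j = g 0 1 & f j j = g 1 1" unfolding nerve_edge_2 prod.inject restrict_1 arrows_cong pair_le1 by simp

lemma nerve2_eq:
 assumes b: "b:cells (nerve K) 2" "c:cells (nerve K) 2"
 and e: "edge (nerve K) 2 0 1 b = edge (nerve K) 2 0 1 c" "edge (nerve K) 2 1 2 b = edge (nerve K) 2 1 2 c"
 shows "b = c"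
proof -
 obtain x f y g where xf: "b = (x, f)" "c = (y, g)" by fastforce
 have x: "x 0 = y 0" "x 1 = y 1" "x 2 = y 2" "f 0 0 = g 0 0" "f 0 1 = g 0 1" "f 1 1 = g 1 1" "f 1 2 = g 1 2" "f 2 2 = g 2 2"
 using e unfolding xf nerve_edge_2[of _ _ _ y] edge2_eq by simp_all
 have "f 0 2 = comp K (f 1 2) (f 0 1)" "g 0 2 = comp K (g 1 2) (g 0 1)" using b unfolding xf nerve_cells by auto
 hence "f i j = g i j" if "i <= j" "j <= 2" for i j using x that le_trans[OF that] unfolding le2 by (elim disjE) simp_all
 moreover have "f = arrows 2 f" "g = arrows 2 g" "x:extensional {..2}" "y:extensional {..2}" using b unfolding xf nerve_cells by (auto simp: PiE_def)
 moreover have "x i = y i" if "i:{..2}" for i using x(1-3) that unfolding atMost_iff le2 by (elim disjE) simp_all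
 ultimately show ?thesis unfolding xf using arrows_eqI[of f 2 g] extensionalityI[of x "{..2}" y] by simp
qed

definition triangle_cell :: "('o, 'm) cat => 'o => 'o => 'o => 'm => 'm => ('o, 'm) nerve_cell" where
 "triangle_cell K a b c f g = (let x = (rs 2 (%i. if i = 0 then a else if i = 1 then b else c)) in
 (x, arrows 2 (%i j. if i = j then ident K (x i) else if j = 1 then f else if i = 1 then g else comp K g f)))"

lemma triangle_cell:
 assumes "a:obj K" "b:obj K" "c:obj K" "f:hom K a b" "g:hom K b c" "comp K g f:hom K a c"
 "!!x. x:{a,b,c} ==> ident K x:hom K x x & comp K (ident K x) (ident K x) = ident K x"
 "comp K f (ident K a) = f" "comp K (ident K b) f = f" "comp K g (ident K b) = g" "comp K (ident K c) g = g"
 "comp K (comp K g f) (ident K a) = comp K g f" "comp K (ident K c) (comp K g f) = comp K g f"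
 shows "triangle_cell K a b c f g:cells (nerve K) 2"
 "edge (nerve K) 2 0 1 (triangle_cell K a b c f g) = nerve_edge K a b f"
 "edge (nerve K) 2 1 2 (triangle_cell K a b c f g) = nerve_edge K b c g"
 "edge (nerve K) 2 0 2 (triangle_cell K a b c f g) = nerve_edge K a c (comp K g f)"
proof -
 define x where "x = (rs 2 (%i. if i = 0 then a else if i = 1 then b else c))"
 define F where "F = arrows 2 (%i j. if i = j then ident K (x i) else if j = 1 then f else if i = 1 then g else comp K g f)"
 have x: "x 0 = a" "x 1 = b" "x 2 = c" by (simp_all add: x_def)
 have F: "F 0 0 = ident K a" "F 1 1 = ident K b" "F 2 2 = ident K c" "F 0 1 = f" "F 1 2 = g" "F 0 2 = comp K g f" using x by (simp_all add: F_def arrows_def)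
 have tc: "triangle_cell K a b c f g = (x, F)" unfolding triangle_cell_def Let_def x_def F_def ..
 note id = assms(7)[of a, simplified] assms(7)[of b, simplified] assms(7)[of c, simplified]
 show "triangle_cell K a b c f g:cells (nerve K) 2" unfolding tc nerve_cells
 proof (intro conjI allI impI)
 fix i j k :: nat assume l: "i <= j" "j <= k" "k <= 2"
 hence "i = 0 | i = 1 | i = 2" "j = 0 | j = 1 | j = 2" "k = 0 | k = 1 | k = 2" by linarith+
 thus "F i k = comp K (F j k) (F i j)" using l by (elim disjE) (simp_all add: F id assms(8-) del: One_nat_def)
 next
 fix i j :: nat assume l: "i <= j" "j <= 2"
 hence "i = 0 | i = 1 | i = 2" "j = 0 | j = 1 | j = 2" by linarith+
 thus "F i j:hom K (x i) (x j)" using l by (elim disjE) (simp_all add: F x id assms(4-6) del: One_nat_def)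
 next
 show "F = arrows 2 F" unfolding F_def arrows_cong by (simp add: arrows_def)
 show "x:{..2} \<rightarrow>\<^sub>E obj K" using assms(1-3) by (auto simp: x_def)
 show "F i i = ident K (x i)" if "i <= 2" for i using that by (simp add: F_def arrows_def)
 qed
 show "edge (nerve K) 2 0 1 (triangle_cell K a b c f g) = nerve_edge K a b f"
 "edge (nerve K) 2 1 2 (triangle_cell K a b c f g) = nerve_edge K b c g"
 "edge (nerve K) 2 0 2 (triangle_cell K a b c f g) = nerve_edge K a c (comp K g f)"
 unfolding tc nerve_edge_def edge2_eq by (simp_all add: F x del: One_nat_def)
qed

lemma nerve_edge_cell:
 assumes "a:obj K" "b:obj K" "f:hom K a b"
 "!!x. x:{a,b} ==> ident K x:hom K x x & comp K (ident K x) (ident K x) = ident K x"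
 "comp K f (ident K a) = f" "comp K (ident K b) f = f"
 shows "nerve_edge K a b f:cells (nerve K) 1" unfolding nerve_edge_def nerve_cells
proof (intro conjI, goal_cases)
 case 2
 show ?case unfolding arrows_cong by (simp add: arrows_def)
qed (use assms(1-3,5,6) assms(4)[of a] assms(4)[of b] in "auto simp: arrows_def le_Suc_eq")

lemma nerve_edge_ends:
 "source (nerve K) (nerve_edge K a b f) = nerve_vertex K a" "target (nerve K) (nerve_edge K a b f) = nerve_vertex K b"
 unfolding nerve_edge_def vertex_def nerve_opr nerve_vertex_def by (auto simp: arrows_def fun_eq_iff restrict_def)

lemma nerve_const: "kc (nerve K) 1 (nerve_vertex K a) = nerve_edge K a a (ident K a)"
 unfolding nerve_edge_def const_cell_def nerve_opr nerve_vertex_def by (auto simp: arrows_def fun_eq_iff restrict_def)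

lemma pointed_comp:
 "al:pointed_maps m n ==> al o pointed_id m = al" "al:pointed_maps m n ==> pointed_id n o al = al"
 "pointed_id m:pointed_maps m m" "pointed_id m o pointed_id m = pointed_id m"
 "al:pointed_maps m n ==> be:pointed_maps n k ==> be o al:pointed_maps m k"
 unfolding pointed_maps_def pointed_id_def by (auto simp: fun_eq_iff) (metis le0 linorder_not_le)

lemma open_hom_pointed: "al:open_hom bs cs ==> al:pointed_maps (length bs) (length cs)"
 and open_hom_id: "pointed_id (length bs):open_hom bs bs" using pointed_comp(3)[of "length bs"] unfolding open_hom_def by (auto simp: pointed_id_def)

lemma fin_edge_cell: "al:pointed_maps m n ==> nerve_edge fin_cat m n al:cells NFin 1" by (rule nerve_edge_cell) (auto simp: fin_cat_def pointed_comp)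

lemma nerve_vertex_inj: "nerve_vertex K a = nerve_vertex K b ==> a = b" unfolding nerve_vertex_def by (auto simp: fun_eq_iff restrict_def split: if_splits)

text \<open>If the second factor is an identity, the first is the whole map. Needed to see over
  which map of finite pointed sets a comparison triangle starts.\<close>

lemma fin_edge_left:
 assumes b: "b:cells NFin 2" "edge NFin 2 0 2 b = nerve_edge fin_cat m n al"
 and e: "edge NFin 2 1 2 b = kc NFin 1 (nerve_vertex fin_cat n)"
 shows "edge NFin 2 0 1 b = nerve_edge fin_cat m n al"
proof -
 obtain x f where xf: "b = (x, f)" by fastforce
 have 1: "x 0 = m" "x 2 = n" "f 0 2 = al" "x 1 = n" "f 1 2 = pointed_id n"
 using b(2) e unfolding xf nerve_const nerve_edge_def edge2_eq by (auto simp: fin_cat_def)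
 have "f 0 1:pointed_maps (x 0) (x 1)" "f 0 2 = f 1 2 o f 0 1" "f 0 0 = pointed_id (x 0)" "f 1 1 = pointed_id (x 1)"
 using b(1) unfolding xf nerve_cells by (auto simp: fin_cat_def)
 thus ?thesis unfolding xf nerve_edge_def edge2_eq using 1 pointed_comp(2) by (auto simp: fin_cat_def)
qed

locale over_nerve_edge = over_edge E "nerve K" p a
 for E :: "'e sset" and K :: "('o, 'm) cat" and p a
begin

abbreviation "B == nerve K"

text \<open>Triangles of a nerve are determined by two consecutive edges, so the projection of this
  one is a degenerate triangle on \<open>a\<close>, and the triangle belongs to
  \<open>D\<close>.\<close>

lemma comp2_D:
 assumes c: "comp2 E f g h"
 and e: "p 1 f = kc B 1 (source B a) & p 1 g = a | p 1 f = a & p 1 g = kc B 1 (target B a)"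
 shows "comp2 D f g h"
proof -
 obtain u where u: "u:cells E 2" "edge E 2 0 1 u = f" "edge E 2 1 2 u = g" "edge E 2 0 2 u = h" using c unfolding comp2_def by blast
 have pu: "p 2 u:cells B 2" "edge B 2 0 1 (p 2 u) = p 1 f" "edge B 2 1 2 (p 2 u) = p 1 g"
 using hom_edge[OF i(3) u(1), of 0 1] hom_edge[OF i(3) u(1), of 1 2] u sset_homD(1)[OF i(3) u(1)] by simp_all
 have co: "opr B 1 1 (%_. j) a = kc B 1 (vertex B 1 j a)" if "j <= 1" for j
 unfolding const_cell_def vertex_def using sset_opr_opr[OF i(2) delta_const[of 0 0 1] delta_const[OF that] a] by (simp add: o_def)
 have ed: "edge B 2 k l (opr B 2 1 t a) = opr B 1 1 (%i. t (if i = 0 then k else l)) a" if "dmap 2 1 t" "k <= l" "l <= 2" for t k l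
 unfolding edge_def using sset_opr_opr[OF i(2) delta_edge[OF that(2,3)] that(1) a] by (simp add: o_def)
 have id: "opr B 1 1 (%i. if i = 0 then 0 else 1) a = a" by (rule sset_opr_ident[OF i(2) a]) auto
 let ?l = "%i::nat. if i = 0 then 0 else (1::nat)" and ?r = "%i::nat. if i <= 1 then 0 else (1::nat)"
 have d: "dmap 2 1 ?l" "dmap 2 1 ?r" unfolding dmd by auto
 have *: "(%i. ?l (if i = 0 then 0 else 1)) = ?l" "(%i. ?l (if i = 0 then 1 else 2)) = (%_. 1)"
 "(%i. ?r (if i = 0 then 0 else 1)) = (%_. 0)" "(%i. ?r (if i = 0 then 1 else 2)) = ?l" for i :: nat by auto
 have L: "edge B 2 0 1 (opr B 2 1 ?l a) = a" "edge B 2 1 2 (opr B 2 1 ?l a) = kc B 1 (target B a)"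
 "edge B 2 0 1 (opr B 2 1 ?r a) = kc B 1 (source B a)" "edge B 2 1 2 (opr B 2 1 ?r a) = a"
 using ed[OF d(1), of 0 1] ed[OF d(1), of 1 2] ed[OF d(2), of 0 1] ed[OF d(2), of 1 2] co[of 0] co[of 1] id unfolding * by simp_all
 have "p 2 u = opr B 2 1 ?r a | p 2 u = opr B 2 1 ?l a" using e
 proof
 assume "p 1 f = kc B 1 (source B a) & p 1 g = a"
 hence "p 2 u = opr B 2 1 ?r a" using nerve2_eq[of "p 2 u" K "opr B 2 1 ?r a"] pu L sset_opr_in[OF i(2) d(2) a] by simp
 thus ?thesis ..
 next
 assume "p 1 f = a & p 1 g = kc B 1 (target B a)"
 hence "p 2 u = opr B 2 1 ?l a" using nerve2_eq[of "p 2 u" K "opr B 2 1 ?l a"] pu L sset_opr_in[OF i(2) d(1) a] by simp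
 thus ?thesis ..
 qed
 hence "u:DS 2" using u(1) d unfolding DS_def by blast
 thus ?thesis unfolding comp2_def using u by auto
qed

end

section \<open>Edges of the operad of open sets\<close>

lemma select_map_hom: "i:{1..length bs} ==> select_map i:open_hom bs [bs ! (i - 1)]" unfolding open_hom_def pointed_maps_def select_map_def by auto

lemma open_edge_cell:
 assumes "set bs <= {U. openin X U}" "set cs <= {U. openin X U}" "al:open_hom bs cs"
 shows "nerve_edge (open_cat X) bs cs al:cells (open_operad X) 1"
 "open_proj X 1 (nerve_edge (open_cat X) bs cs al) = nerve_edge fin_cat (length bs) (length cs) al"
proof -
 show 1: "nerve_edge (open_cat X) bs cs al:cells (open_operad X) 1"
 using assms open_hom_id open_hom_pointed[OF assms(3)] by (intro nerve_edge_cell) (auto simp: open_cat_def pointed_comp)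
 show "open_proj X 1 (nerve_edge (open_cat X) bs cs al) = nerve_edge fin_cat (length bs) (length cs) al"
 proof -
 have "(rs 1 (%i. length ((rs 1 (%i. if i = 0 then bs else cs)) i))) = (rs 1 (%i. if i = 0 then length bs else length cs))" unfolding restrict_1 by simp
 moreover have "arrows 1 (%i j. if i < j then al else ident (open_cat X) (if i = 0 then bs else cs)) =
 arrows 1 (%i j. if i < j then al else ident fin_cat (if i = 0 then length bs else length cs))" unfolding arrows_cong by (simp add: open_cat_def fin_cat_def)
 ultimately show ?thesis using 1 unfolding open_proj_def nerve_edge_def by simp
 qed
qed

text \<open>Morphisms of the operad are maps of pointed sets subject to conditions on the colours. A
  lift is therefore determined by its vertices and its projection, and only edges outside the horn
  leave something to check.\<close>

lemma inert_select:
 assumes bs: "set bs <= {U. openin X U}" and k: "k:{1..length bs}"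
 shows "inert_edge (open_operad X) (open_proj X) (nerve_edge (open_cat X) bs [bs ! (k - 1)] (select_map k))"
proof -
 let ?c = "[bs ! (k - 1)]" let ?O = "open_operad X"
 have c: "set ?c <= {U. openin X U}" using bs k by (auto simp: subset_iff)
 note e = open_edge_cell[OF bs c select_map_hom[OF k]]
 have "inert (length bs) (length ?c) (select_map k)" using k open_hom_pointed[OF select_map_hom[OF k]] unfolding inert_def by (auto simp: select_map_def)
 moreover have "cocartesian_edge ?O NFin (open_proj X) (nerve_edge (open_cat X) bs ?c (select_map k))" unfolding cocartesian_edge_def
 proof (intro conjI allI ballI impI)
 fix n h b assume n: "2 <= n" and h: "h:sset_hom (horn n 0) ?O" and b: "b:cells NFin n"
 and he: "h 1 (idm 1) = nerve_edge (open_cat X) bs ?c (select_map k)"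
 and hp: "ALL m. ALL s:cells (horn n 0) m. open_proj X m (h m s) = opr NFin m n s b"
 obtain y g where yg: "b = (y, g)" by fastforce
 define ob where "ob i = fst (h 0 (rs 0 (%_. i))) 0" for i
 have bc: "y:{..n} \<rightarrow>\<^sub>E UNIV" "g = arrows n g" "!!i j. i <= j ==> j <= n ==> g i j:pointed_maps (y i) (y j)"
 "!!i. i <= n ==> g i i = pointed_id (y i)" "!!i j l. i <= j ==> j <= l ==> l <= n ==> g i l = g j l o g i j"
 proof -
 note d = nerve_cellsD[OF b[unfolded yg]]
 show "y:{..n} \<rightarrow>\<^sub>E UNIV" using d(1) by (simp add: fin_cat_def)
 show "g = arrows n g" by (rule d(2))
 show "!!i j. i <= j ==> j <= n ==> g i j:pointed_maps (y i) (y j)" using d(3) by (simp add: fin_cat_def)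
 show "!!i. i <= n ==> g i i = pointed_id (y i)" using d(4) by (simp add: fin_cat_def)
 show "!!i j l. i <= j ==> j <= l ==> l <= n ==> g i l = g j l o g i j" using d(5) unfolding fin_cat_def cat.simps .
 qed
 have face: "h m s = (rs m (%i. ob (s i)), arrows m (%i j. g (s i) (s j)))" if s: "s:cells (horn n 0) m" for m s
 proof -
 obtain x f where xf: "h m s = (x, f)" by fastforce
 have xc: "(x, f):cells ?O m" using sset_homD(1)[OF h s] xf by simp
 have "x i = ob (s i)" if "i <= m" for i
 proof -
 have "h 0 (rs 0 (%_. s i)) = opr ?O 0 m (%_. i) (x, f)" using sset_homD(2)[OF h delta_const[OF that] s, of 0] xf by (simp add: horn_opr)
 thus ?thesis unfolding ob_def nerve_opr by simp
 qed
 moreover have "x:extensional {..m}" using nerve_cellsD(1)[OF xc] by (auto simp: PiE_def)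
 ultimately have "x = (rs m (%i. ob (s i)))" by (intro extensionalityI) auto
 moreover have "f = arrows m (%i j. g (s i) (s j))" using hp[rule_format, OF s] xc unfolding xf yg nerve_opr open_proj_def by simp
 ultimately show ?thesis using xf by simp
 qed
 have v: "(rs 0 (%_. i)):cells (horn n 0) 0" if "i <= n" for i
 using that n unfolding horn_cells dmd by (auto intro!: exI[of _ "if i = 1 then 2 else 1"] split: if_splits)
 have ob: "ob i:lists {U. openin X U}" "length (ob i) = y i" if "i <= n" for i
 proof -
 have "h 0 (rs 0 (%_. i)):cells ?O 0" by (rule sset_homD(1)[OF h v[OF that]])
 thus "ob i:lists {U. openin X U}" unfolding face[OF v[OF that]] by (drule_tac nerve_cellsD(1)) (auto simp: open_cat_def)
 have "open_proj X 0 (h 0 (rs 0 (%_. i))) = opr NFin 0 n (rs 0 (%_. i)) b" using hp v[OF that] by blast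
 thus "length (ob i) = y i" using \<open>h 0 (rs 0 (%_. i)):cells ?O 0\<close> unfolding yg nerve_opr face[OF v[OF that]] open_proj_def
 by (auto simp: fun_eq_iff restrict_def split: if_splits)
 qed
 have hom1: "g i j:open_hom (ob i) (ob j)" if ij: "i <= j" "j <= n" and l: "l <= n" "l~=0" "l~=i" "l~=j" for i j l
 proof -
 let ?s = "\<lambda>k\<in>{..1}. if k = 0 then i else j"
 have s: "?s:cells (horn n 0) 1" using ij l unfolding horn_cells dmd by (auto intro!: exI[of _ l])
 have "h 1 ?s:cells ?O 1" by (rule sset_homD(1)[OF h s])
 from nerve_cellsD(3)[OF this[unfolded face[OF s]], of 0 1]
 show ?thesis by (simp add: arrows_def open_cat_def)
 qed
 have hom: "g i j:open_hom (ob i) (ob j)" if ij: "i <= j" "j <= n" for i j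
 \<comment> \<open>An edge that misses a vertex other than 0 lies in the horn. The only exception is
   the edge from 1 to 2 in dimension 2.\<close>
 proof (cases "EX l<=n. l~=0 & l~=i & l~=j")
 case True thus ?thesis using hom1[OF ij] by blast
 next
 case False
 hence F: "l <= n --> l = 0 | l = i | l = j" for l by blast
 have n2: "i = 1" "j = 2" "n = 2" using F[of 1] F[of 2] F[of 3] n ij by linarith+
 have s: "idm 1:cells (horn n 0) 1" using n unfolding horn_cells dmd by (auto intro!: exI[of _ 2])
 have o: "ob 0 = bs" "ob 1 = ?c" "g 0 1 = select_map k" using he unfolding face[OF s] nerve_edge_def prod.inject restrict_1 arrows_cong pair_le1 by simp_all
 have g02: "g 0 2:open_hom bs (ob 2)" using hom1[of 0 2 1] n n2 o by simp
 have "g 0 2 = g 1 2 o select_map k" using bc(5)[of 0 1 2] n n2 o by simp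
 \<comment> \<open>Vertex 1 carries just the colour selected by \<open>k\<close>, so the condition
   on the missing edge is the one that \<open>g 0 2\<close> satisfies at \<open>k\<close>.\<close>
 hence gk: "g 0 2 k = g 1 2 1" by (simp add: select_map_def)
 have gp: "g 1 2:pointed_maps 1 (length (ob 2))" using bc(3)[of 1 2] ob(2)[of 1] ob(2)[of 2] n n2 o by simp
 have "g 1 2 1~=0 ==> bs ! (k - 1) <= ob 2 ! (g 1 2 1 - 1)" using g02 k unfolding open_hom_def gk[symmetric] by blast
 thus ?thesis unfolding n2 o open_hom_def using gp by auto
 qed
 let ?x = "(rs n (%i. ob i), g)"
 have x: "?x:cells ?O n" unfolding nerve_cells
 proof (intro conjI allI impI)
 show "g = arrows n g" by (rule bc(2))
 show "g i k = cat.comp (open_cat X) (g j k) (g i j)" if "i <= j" "j <= k" "k <= n" for i j k using bc(5)[OF that] by (simp add: open_cat_def)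
 qed (use ob bc(4) hom in "auto simp: open_cat_def")
 have "open_proj X n ?x = b"
 proof -
 have "(rs n (%i. length (ob i))) = y" using bc(1) ob(2) by (intro extensionalityI[of _ "{..n}"]) (auto simp: PiE_def)
 moreover have "(rs n (%i. length ((rs n (%i. ob i)) i))) = (rs n (%i. length (ob i)))" by (intro restrict_ext) simp
 ultimately show ?thesis using x unfolding open_proj_def yg by simp
 qed
 moreover have "opr ?O m n s ?x = h m s" if s: "s:cells (horn n 0) m" for m s
 using s unfolding face[OF s] nerve_opr horn_cells dmd by (auto intro!: restrict_ext)
 ultimately show "EX x:cells ?O n. open_proj X n x = b & (ALL m. ALL s:cells (horn n 0) m. opr ?O m n s x = h m s)" using x by blast
 qed (rule e(1))
 ultimately show ?thesis unfolding inert_edge_def using e(2) by blast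
qed

section \<open>Extension maps of a factorization algebra\<close>

lemmas nerve_edge_ends' = nerve_edge_ends nerve_edge_ends[unfolded One_nat_def]

locale fact_algebra =
 fixes C :: "'c sset" and p :: "nat => 'c => fin_cell" and X :: "'a topology" and A :: "('a, 'c) prefact"
 assumes sm: "symmetric_monoidal C p" and fa: "factorization_algebra C p X A"
begin

abbreviation "ops == {U. openin X U}"
abbreviation "C1 == tensor_fibre C p 1"

lemma ib: "inner_fibration C NFin p" using sm unfolding symmetric_monoidal_def cocartesian_fibration_def by blast

lemmas ibD = inner_fibrationD[OF ib]

lemma A: "A:sset_hom (open_operad X) C" "!!n x. x:cells (open_operad X) n ==> p n (A n x) = open_proj X n x"
 "!!e. inert_edge (open_operad X) (open_proj X) e ==> cocartesian_edge C NFin p (A 1 e)"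
 using fa unfolding factorization_algebra_def prefactorization_algebra_def operad_map_def inert_edge_def by blast+

definition val :: "'a set list => 'a set list => (nat => nat) => 'c" where
 "val bs cs al = A 1 (nerve_edge (open_cat X) bs cs al)"

definition val0 :: "'a set list => 'c" where "val0 bs = A 0 (nerve_vertex (open_cat X) bs)"

context
 fixes bs cs :: "'a set list" and al
 assumes b: "set bs <= ops" "set cs <= ops" "al:open_hom bs cs"
begin

lemma val_arr: "arr C (val0 bs) (val0 cs) (val bs cs al)"
proof -
 note e = open_edge_cell(1)[OF b]
 show ?thesis unfolding arr_def val_def val0_def
 using sset_homD(1)[OF A(1) e] hom_vertex[OF A(1) e, of 0] hom_vertex[OF A(1) e, of 1] by (simp add: nerve_edge_ends' del: One_nat_def)
qed

lemma val_proj: "p 1 (val bs cs al) = nerve_edge fin_cat (length bs) (length cs) al"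
 unfolding val_def A(2)[OF open_edge_cell(1)[OF b]] by (rule open_edge_cell(2)[OF b])

lemma val_comp:
 assumes c: "set ds <= ops" "be:open_hom cs ds" "be o al:open_hom bs ds"
 shows "comp2 C (val bs cs al) (val cs ds be) (val bs ds (be o al))"
proof -
 let ?K = "open_cat X"
 note pc = open_hom_pointed[OF b(3)] open_hom_pointed[OF c(2)] open_hom_pointed[OF c(3)]
 note t = triangle_cell[of bs ?K cs ds al be]
 have 1: "bs:obj ?K" "cs:obj ?K" "ds:obj ?K" "al:hom ?K bs cs" "be:hom ?K cs ds" "cat.comp ?K be al:hom ?K bs ds" using b c by (auto simp: open_cat_def)
 have 2: "ident ?K x:hom ?K x x & cat.comp ?K (ident ?K x) (ident ?K x) = ident ?K x" for x using open_hom_id by (simp add: open_cat_def pointed_comp)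
 have 3: "cat.comp ?K al (ident ?K bs) = al" "cat.comp ?K (ident ?K cs) al = al" "cat.comp ?K be (ident ?K cs) = be"
 "cat.comp ?K (ident ?K ds) be = be" "cat.comp ?K (cat.comp ?K be al) (ident ?K bs) = cat.comp ?K be al"
 "cat.comp ?K (ident ?K ds) (cat.comp ?K be al) = cat.comp ?K be al" using pc pointed_comp(1,2) unfolding open_cat_def cat.simps by blast+
 note tt = t[OF 1 2 3]
 have "cat.comp ?K be al = be o al" by (simp add: open_cat_def)
 thus ?thesis unfolding comp2_def val_def using hom_edge[OF A(1) tt(1), of 0 1] hom_edge[OF A(1) tt(1), of 1 2] hom_edge[OF A(1) tt(1), of 0 2] tt
 sset_homD(1)[OF A(1) tt(1)] by (intro bexI[of _ "A 2 (triangle_cell ?K bs cs ds al be)"]) simp_all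
qed

end

lemma vertex_cell: "nerve_vertex fin_cat n:cells NFin 0"
 using vertex_in[OF ibD(2) fin_edge_cell[OF pointed_comp(3), of n], of 0] by (simp add: nerve_edge_ends' del: One_nat_def)

lemma fibre_val:
 assumes "set bs <= ops" "set cs <= ops" "al:open_hom bs cs" "al = pointed_id n" "length bs = n" "length cs = n"
 shows "arr (tensor_fibre C p n) (val0 bs) (val0 cs) (val bs cs al)"
proof -
 have "p 1 (val bs cs al) = kc NFin 1 (nerve_vertex fin_cat n)" using val_proj[OF assms(1-3)] assms(4-6) unfolding nerve_const by (simp add: fin_cat_def)
 thus ?thesis using val_arr[OF assms(1-3)] unfolding arr_def fibre_def by simp
qed

abbreviation ext :: "'a set => 'a set => 'c" where "ext == extension_map X A"

lemma unary_in: assumes "x:cells (inclusion_nerve ops) n" shows "unary_cell n x:cells (open_operad X) n" unfolding unary_cell_def nerve_cells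
proof (intro conjI allI impI)
 have x: "x:{..n} \<rightarrow>\<^sub>E ops" "!!i j. i <= j ==> j <= n ==> x i <= x j" using assms unfolding incl_cells by auto
 show "(rs n (%i. [x i])):{..n} \<rightarrow>\<^sub>E obj (open_cat X)" using x(1) by (auto simp: open_cat_def)
 show "arrows n (%i j. pointed_id 1) = arrows n (arrows n (%i j. pointed_id 1))" unfolding arrows_cong by (simp add: arrows_def)
 show "arrows n (%i j. pointed_id 1) i j:hom (open_cat X) ((rs n (%i. [x i])) i) ((rs n (%i. [x i])) j)"
 if "i <= j" "j <= n" for i j using that x(2)[OF that] pointed_comp(3)[of 1] by (auto simp: arrows_def open_cat_def open_hom_def pointed_id_def)
 show "arrows n (%i j. pointed_id 1) i i = ident (open_cat X) ((rs n (%i. [x i])) i)" if "i <= n" for i using that by (simp add: arrows_def open_cat_def)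
 show "arrows n (%i j. pointed_id 1) i k = cat.comp (open_cat X) (arrows n (%i j. pointed_id 1) j k) (arrows n (%i j. pointed_id 1) i j)"
 if "i <= j" "j <= k" "k <= n" for i j k using that pointed_comp(4)[of 1] by (simp add: arrows_def open_cat_def)
qed

lemma values_functor_hom: "values_functor X A:sset_hom (inclusion_nerve ops) C1"
proof (rule sset_homI)
 show "values_functor X A n:extensional (cells (inclusion_nerve ops) n)" for n unfolding values_functor_def by auto
 fix n x assume x: "x:cells (inclusion_nerve ops) n"
 note u = unary_in[OF x]
 have "open_proj X n (unary_cell n x) = kc NFin n (nerve_vertex fin_cat 1)"
 proof -
 have 1: "(rs n (%i. length ((rs n (%i. [x i])) i))) = (rs n (%i. (rs 0 (%_. 1)) 0))" by (intro restrict_ext) auto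
 have 2: "arrows n (%i j. pointed_id 1) = arrows n (%i j. arrows 0 (%i j. ident fin_cat 1) 0 0)" unfolding arrows_cong by (simp add: arrows_def fin_cat_def)
 show ?thesis using u 1 2 unfolding open_proj_def unary_cell_def const_cell_def nerve_vertex_def nerve_opr by simp
 qed
 thus "values_functor X A n x:cells C1 n" using x sset_homD(1)[OF A(1) u] A(2)[OF u] unfolding values_functor_def fibre_def by simp
 fix m t assume t: "dmap m n t"
 have "opr (inclusion_nerve ops) m n t x:cells (inclusion_nerve ops) m" using x t unfolding incl_cells incl_opr dmd by auto
 moreover have "unary_cell m (opr (inclusion_nerve ops) m n t x) = opr (open_operad X) m n t (unary_cell n x)"
 proof -
 have 1: "(rs m (%i. [(rs m (%i. x (t i))) i])) = (rs m (%i. (rs n (%i. [x i])) (t i)))" using t unfolding dmd by (intro restrict_ext) simp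
 have 2: "arrows m (%i j. pointed_id 1) = arrows m (%i j. arrows n (%i j. pointed_id 1) (t i) (t j))"
 using t unfolding arrows_cong dmd by (simp add: arrows_def)
 show ?thesis unfolding unary_cell_def nerve_opr incl_opr 1 2 ..
 qed
 ultimately show "values_functor X A m (opr (inclusion_nerve ops) m n t x) = opr C1 m n t (values_functor X A n x)"
 using x sset_homD(2)[OF A(1) t u] unfolding values_functor_def by (simp add: fibre_def)
qed

lemma quasicategory_C1: "quasicategory C1" by (rule fibre_quasicategory[OF ib vertex_cell])

sublocale diagram C1 ops "values_functor X A" by unfold_locales (rule quasicategory_C1 values_functor_hom)+

sublocale Q: qcat C1 by unfold_locales (rule quasicategory_C1)

lemma ext_val: assumes "openin X U" "openin X V" "U <= V" shows "ext U V = val [U] [V] (pointed_id 1)"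
proof -
 have c: "(rs 1 (%i. if i = 0 then U else V)):cells (inclusion_nerve ops) 1" by (rule ext_cell) (use assms in auto)
 have "unary_cell 1 (rs 1 (%i. if i = 0 then U else V)) = nerve_edge (open_cat X) [U] [V] (pointed_id 1)"
 proof -
 have 1: "(rs 1 (%i. [(rs 1 (%i. if i = 0 then U else V)) i])) = (rs 1 (%i. if i = 0 then [U] else [V]))" unfolding restrict_1 by simp
 have 2: "arrows 1 (%i j. pointed_id 1) = arrows 1 (%i j. if i < j then pointed_id 1 else ident (open_cat X) (if i = 0 then [U] else [V]))"
 unfolding arrows_cong by (simp add: open_cat_def)
 show ?thesis unfolding unary_cell_def nerve_edge_def 1 2 ..
 qed
 thus ?thesis using c unfolding extension_map_def values_functor_def val_def by simp
qed

section \<open>Closure properties of equivalences\<close>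

definition eqv :: "'a set => 'a set => bool" where
 "eqv U V <-> openin X U & openin X V & U <= V & eqe C1 (ext U V)"

lemma eqv_refl: "openin X U ==> eqv U U" using equivalence_refl[of U] unfolding eqv_def extension_map_def if_cancel by auto

lemma ext_comp:
 assumes "openin X U" "openin X V" "openin X W" "U <= V" "V <= W"
 shows "comp2 C1 (ext U V) (ext V W) (ext U W)"
proof -
 let ?x = "\<lambda>i\<in>{..2::nat}. if i = 0 then U else if i = 1 then V else W"
 have x: "?x:cells (inclusion_nerve ops) 2" using assms unfolding incl_cells by auto
 have e: "edge (inclusion_nerve ops) 2 0 1 ?x = (rs 1 (%k. if k = 0 then U else V))"
 "edge (inclusion_nerve ops) 2 1 2 ?x = (rs 1 (%k. if k = 0 then V else W))"
 "edge (inclusion_nerve ops) 2 0 2 ?x = (rs 1 (%k. if k = 0 then U else W))" unfolding edge_def incl_opr restrict_1 by simp_all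
 have "values_functor X A 2 ?x:cells C1 2" by (rule sset_homD(1)[OF VF x])
 moreover have "edge C1 2 0 1 (values_functor X A 2 ?x) = ext U V" "edge C1 2 1 2 (values_functor X A 2 ?x) = ext V W"
 "edge C1 2 0 2 (values_functor X A 2 ?x) = ext U W" using hom_edge[OF VF x, of 0 1] hom_edge[OF VF x, of 1 2] hom_edge[OF VF x, of 0 2]
 unfolding e extension_map_def by simp_all
 ultimately show ?thesis unfolding comp2_def by blast
qed

lemma eqv_trans: "eqv U V ==> eqv V W ==> eqv U W" unfolding eqv_def using Q.comp2_equivalence(1)[OF ext_comp[of U V W]] by auto

lemma eqv_two_of_six:
 assumes s: "U <= V" "V <= W" "W <= Y" and o: "openin X V" "openin X W" and e: "eqv U W" "eqv V Y"
 shows "eqv V W" "eqv W Y"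
proof -
 have op: "openin X U" "openin X Y" using e unfolding eqv_def by auto
 have VY: "V <= Y" using s by blast
 note c1 = ext_comp[OF op(1) o s(1,2)] and c2 = ext_comp[OF o op(2) s(2,3)]
 obtain x y z where a: "arr C1 x y (ext U V)" "arr C1 y z (ext V W)" "arr C1 x z (ext U W)" by (rule Q.comp2_arr[OF c1])
 obtain x' y' z' where a': "arr C1 x' y' (ext V W)" "arr C1 y' z' (ext W Y)" "arr C1 x' z' (ext V Y)" by (rule Q.comp2_arr[OF c2])
 have xy: "x' = y" "y' = z" using a(2) a'(1) unfolding arr_def by auto
 note a'' = a'[unfolded xy]
 have H: "Q.cls (ext U V):Q.Hm x y" "Q.cls (ext V W):Q.Hm y z" "Q.cls (ext W Y):Q.Hm z z'" using a a'' unfolding Q.Hm_def by blast+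
 have "Q.iso x z (Q.hmul (Q.cls (ext U V)) (Q.cls (ext V W)))" "Q.iso y z' (Q.hmul (Q.cls (ext V W)) (Q.cls (ext W Y)))"
 using Q.hmul_cls[OF c1] Q.hmul_cls[OF c2] Q.iso_iff[OF a(3)] Q.iso_iff[OF a''(3)] e unfolding eqv_def by simp_all
 hence "Q.iso y z (Q.cls (ext V W))" "Q.iso z z' (Q.cls (ext W Y))" using Q.two_of_six[OF H] by blast+
 thus "eqv V W" "eqv W Y" using Q.iso_iff[OF a(2)] Q.iso_iff[OF a''(2)] o op s unfolding eqv_def by blast+
qed

text \<open>The traces \<open>U Int W\<close> form a Weiss cover of \<open>U\<close>, so the cosheaf
  condition gives both colimits required by \<open>weiss_equivalence\<close>.\<close>

lemma eqv_weiss: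
 assumes U: "openin X U" "U <= V" and V: "openin X V" and W: "weiss_cover X V Wv"
 and e: "!!T. finite T ==> T~={} ==> T <= Wv ==> eqv (U Int \<Inter>T) (\<Inter>T)"
 shows "eqv U V"
proof -
 have wc: "weiss_cosheaf C p X A" using fa unfolding factorization_algebra_def by blast
 have WO: "!!W. W:Wv ==> openin X W & W <= V" using W unfolding weiss_cover_def by blast
 have WU: "weiss_cover X U ((Int) U ` Wv)" unfolding weiss_cover_def
 proof (intro conjI ballI allI impI)
 fix S assume S: "finite S" "S <= U"
 hence "S <= V" using U(2) by blast
 then obtain W where "W:Wv" "S <= W" using W S(1) unfolding weiss_cover_def by blast
 thus "EX W:(Int) U ` Wv. S <= W" using S(2) by (intro bexI[of _ "U Int W"]) auto
 qed (use WO U(1) in auto)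
 have SU: "{V. openin X V & (EX W:(Int) U ` Wv. V <= W)} = {x:ops. EX W:Wv. x <= U Int W}"
 and SV: "{V. openin X V & (EX W:Wv. V <= W)} = {x:ops. EX W:Wv. x <= W}" by auto
 have "eqe C1 (values_functor X A 1 (rs 1 (%i. if i = 0 then U else V)))"
 proof (rule weiss_equivalence[where Wv = Wv])
 show "x Int y:ops" if "x:ops" "y:ops" for x y using that by auto
 show "Wv <= ops" "!!W. W:Wv ==> W <= V" using WO by auto
 show "eqe C1 (values_functor X A 1 (rs 1 (%i. if i = 0 then U Int \<Inter> T else \<Inter> T)))"
 if "finite T" "T~={}" "T <= Wv" for T using e[OF that] unfolding eqv_def extension_map_def by blast
 qed (use U V in simp, use V in simp, use U in simp,
 use wc[unfolded weiss_cosheaf_def Let_def, rule_format, OF U(1) WU, unfolded SU] in blast,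
 use wc[unfolded weiss_cosheaf_def Let_def, rule_format, OF V W, unfolded SV] in blast)
 thus ?thesis using U V unfolding eqv_def extension_map_def by blast
qed

section \<open>Stability under disjoint unions\<close>

context
 fixes U1 U2 V1 V2
 assumes e1: "eqv U1 V1" and e2: "eqv U2 V2" and dis: "V1 Int V2 = {}"
begin

abbreviation "bU == [U1, U2]" abbreviation "bV == [V1, V2]"

lemma pr: "set bU <= ops" "set bV <= ops" "U1 <= V1" "U2 <= V2" "U1 Int U2 = {}" using e1 e2 dis unfolding eqv_def by auto

lemma w_hom: "pointed_id 2:open_hom bU bV"
proof -
 have l: "length bU = 2" "length bV = 2" by simp_all
 have "i = 1 | i = 2" if "i:{1..2}" for i :: nat using that by auto
 thus ?thesis using pr(3,4) pointed_comp(3)[of 2] unfolding open_hom_def l by (auto simp: pointed_id_def nth_Cons')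
qed

abbreviation "wd == val bU bV (pointed_id 2)"

lemma wd_arr: "arr (tensor_fibre C p 2) (val0 bU) (val0 bV) wd" by (rule fibre_val[OF pr(1,2) w_hom]) simp_all

lemma unary_hom: "U <= V ==> pointed_id 1:open_hom [U] [V]" using pointed_comp(3)[of 1] unfolding open_hom_def by (auto simp: pointed_id_def)

lemma edge_ne: "over_nerve_edge C fin_cat p (nerve_edge fin_cat 2 1 al)" if "al:pointed_maps 2 1"
 by unfold_locales (use ib fin_edge_cell[OF that] nerve_vertex_inj[of fin_cat 2 1] in "auto simp: nerve_edge_ends'")

text \<open>Selecting a component is inert, and \<open>A\<close> preserves inert edges. The selected
  part of \<open>wd\<close> is thus compared with an extension map, which is an equivalence by
  assumption.\<close>

lemma pushforward_wd:
 assumes k: "k:{1..2}" and F: "pushforward C NFin p (nerve_edge fin_cat 2 1 (select_map k)) F"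
 shows "eqe C1 (F 1 wd)"
proof -
 let ?U = "bU ! (k - 1)" and ?V = "bV ! (k - 1)"
 have UV: "eqv ?U ?V" using k e1 e2 by (cases "k = 1") auto
 hence UV': "set [?U] <= ops" "set [?V] <= ops" "?U <= ?V" "eqe C1 (ext ?U ?V)" unfolding eqv_def by auto
 have kl: "k:{1..length bU}" "k:{1..length bV}" using k by auto
 note sU = select_map_hom[OF kl(1)] and sV = select_map_hom[OF kl(2)] and u = unary_hom[OF UV'(3)]
 have l: "length bU = 2" "length bV = 2" "length [?U] = 1" "length [?V] = 1" by simp_all
 have sp: "select_map k:pointed_maps 2 1" using open_hom_pointed[OF sU] unfolding l .
 interpret over_nerve_edge C fin_cat p "nerve_edge fin_cat 2 1 (select_map k)" by (rule edge_ne[OF sp])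
 have c1: "pointed_id 1 o select_map k = select_map k" "select_map k o pointed_id 2 = select_map k" using pointed_comp(1,2)[OF sp] by auto
 have sUV: "select_map k:open_hom bU [?V]" using sU UV'(3) k unfolding open_hom_def by (auto simp: select_map_def)
 have q: "p 1 (val bU [?U] (select_map k)) = nerve_edge fin_cat 2 1 (select_map k)"
 "p 1 (val [?U] [?V] (pointed_id 1)) = nerve_edge fin_cat 1 1 (pointed_id 1)"
 "p 1 wd = nerve_edge fin_cat 2 2 (pointed_id 2)"
 "p 1 (val bV [?V] (select_map k)) = nerve_edge fin_cat 2 1 (select_map k)"
 using val_proj[OF pr(1) UV'(1) sU] val_proj[OF UV'(1,2) u] val_proj[OF pr(1,2) w_hom] val_proj[OF pr(2) UV'(2) sV] unfolding l .
 have id: "ident fin_cat n = pointed_id n" for n by (simp add: fin_cat_def)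
 have sq: "comp2 D (val bU [?U] (select_map k)) (val [?U] [?V] (pointed_id 1)) (val bU [?V] (select_map k))"
 "comp2 D wd (val bV [?V] (select_map k)) (val bU [?V] (select_map k))" using val_comp[OF pr(1) UV'(1) sU UV'(2) u] val_comp[OF pr(1,2) w_hom UV'(2) sV] sUV q
 unfolding c1 by (auto intro!: comp2_D simp: nerve_edge_ends' nerve_const id simp del: One_nat_def)
 have co: "cocartesian_edge C NFin p (val bU [?U] (select_map k))" "cocartesian_edge C NFin p (val bV [?V] (select_map k))"
 unfolding val_def by (rule A(3)[OF inert_select[OF pr(1) kl(1)]] A(3)[OF inert_select[OF pr(2) kl(2)]])+
 obtain x y z where a: "arr D x y (val bU [?U] (select_map k))" by (rule comp2_arr[OF sq(1)])
 obtain x' y' z' where a': "arr D x' y' (val bV [?V] (select_map k))" by (rule comp2_arr[OF sq(2)])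
 have aD: "arr D (val0 bU) (val0 [?U]) (val bU [?U] (select_map k))" "arr D (val0 bV) (val0 [?V]) (val bV [?V] (select_map k))"
 using a a' val_arr[OF pr(1) UV'(1) sU] val_arr[OF pr(2) UV'(2) sV] unfolding arr_def by auto
 have "eqe Eb (F 1 wd)"
 proof (rule pushforward_equivalence[OF F _ co(1) aD(1) co(2) aD(2) _ _ sq])
 show "arr Ea (val0 bU) (val0 bV) wd" unfolding nerve_edge_ends by (rule wd_arr)
 show "arr Eb (val0 [?U]) (val0 [?V]) (val [?U] [?V] (pointed_id 1))" unfolding nerve_edge_ends by (rule fibre_val[OF UV'(1,2) u]) simp_all
 show "eqe Eb (val [?U] [?V] (pointed_id 1))" unfolding nerve_edge_ends using UV'(4) ext_val[of ?U ?V] UV' by simp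
 qed
 thus ?thesis unfolding nerve_edge_ends .
qed

text \<open>By the Segal condition the fibre over 2 is equivalent to pairs of objects, and an edge
  of pairs is invertible if both components are.\<close>

lemma wd_equivalence: "eqe (tensor_fibre C p 2) wd"
proof -
 obtain F where F: "!!i. i:{1..2} ==> pushforward C NFin p (nerve_edge fin_cat 2 1 (select_map i)) (F i)"
 "categorical_equivalence (tensor_fibre C p 2) (power_sset {1..2} C1)
 (%k. \<lambda>x\<in>cells (tensor_fibre C p 2) k. \<lambda>i\<in>{1..2}. F i k x)"
 proof (rule exE[OF sm[unfolded symmetric_monoidal_def, THEN conjunct2, rule_format, of 2]])
 fix F assume F: "(ALL i:{1..2}. pushforward C NFin p (nerve_edge fin_cat 2 1 (select_map i)) (F i)) &
 categorical_equivalence (tensor_fibre C p 2) (power_sset {1..2} C1)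
 (%k. \<lambda>x\<in>cells (tensor_fibre C p 2) k. \<lambda>i\<in>{1..2}. F i k x)"
 show thesis by (rule that[OF F[THEN conjunct1, rule_format] F[THEN conjunct2]])
 qed
 have w: "wd:cells (tensor_fibre C p 2) 1" using wd_arr unfolding arr_def by blast
 have q: "quasicategory (tensor_fibre C p 2)" by (rule fibre_quasicategory[OF ib vertex_cell])
 have Fe: "eqe C1 (F i 1 wd)" if "i:{1..2}" for i using pushforward_wd[OF that F(1)[OF that]] .
 hence "F i 1 wd:cells C1 1" if "i:{1..2}" for i using that unfolding equivalence_edge_def by blast
 hence "eqe (power_sset {1..2} C1) (\<lambda>i\<in>{1..2}. F i 1 wd)" by (intro power_equivalence) (use Fe in auto)
 thus ?thesis using categorical_equivalence_reflect[OF q power_simplicial[OF quasicategory_sset[OF quasicategory_C1]] F(2) w] w by simp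
qed

text \<open>Multiplicativity makes the map from a pair to its union universal in the homotopy
  category. Precomposing with the invertible \<open>wd\<close> preserves universality, so the
  extension map between the unions compares two universal arrows.\<close>

lemma eqv_disjoint: "eqv (U1 Un U2) (V1 Un V2)"
proof -
 let ?a = "nerve_edge fin_cat 2 1 (mult_map 2)" let ?U = "[U1 Un U2]" and ?V = "[V1 Un V2]"
 have o: "set ?U <= ops" "set ?V <= ops" "U1 Un U2 <= V1 Un V2" using pr by auto
 have mm: "mult_map 2:pointed_maps 2 1" unfolding mult_map_def pointed_maps_def by auto
 have l: "length bU = 2" "length bV = 2" "length ?U = 1" "length ?V = 1" by simp_all
 have mh: "mult_map 2:open_hom bU ?U" "mult_map 2:open_hom bV ?V" "mult_map 2:open_hom bU ?V"
 using mm pr dis unfolding open_hom_def l by (auto simp: mult_map_def less_Suc_eq le_Suc_eq nth_Cons')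
 interpret over_nerve_edge C fin_cat p ?a by (rule edge_ne[OF mm])
 have id: "ident fin_cat n = pointed_id n" for n by (simp add: fin_cat_def)
 \<comment> \<open>Multiplicativity factors the map as a cocartesian edge followed by an
   equivalence. The latter lies over an identity, so the former lies over
   \<open>mult_map 2\<close>.\<close>
 have wcm: "wc L (val0 bs) (val0 [\<Union>(set bs)]) (cls (val bs [\<Union>(set bs)] (mult_map 2)))" "arr D (val0 bs) (val0 [\<Union>(set bs)]) (val bs [\<Union>(set bs)] (mult_map 2))"
 if bs: "set bs <= ops" "length bs = 2" "ALL i<length bs. ALL j<length bs. i~=j --> bs ! i Int bs ! j = {}"
 "mult_map 2:open_hom bs [\<Union>(set bs)]" for bs
 proof -
 let ?b = "[\<Union>(set bs)]"
 obtain u where u: "u:cells C 2" "cocartesian_edge C NFin p (edge C 2 0 1 u)"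
 "edge C 2 0 2 u = val bs ?b (mult_map 2)" "eqe C1 (edge C 2 1 2 u)" using fa bs unfolding factorization_algebra_def multiplicative_def val_def by metis
 have ob: "set ?b <= ops" using bs(1) by auto
 have pu: "p 2 u:cells NFin 2" "edge NFin 2 0 1 (p 2 u) = p 1 (edge C 2 0 1 u)"
 "edge NFin 2 1 2 (p 2 u) = p 1 (edge C 2 1 2 u)" "edge NFin 2 0 2 (p 2 u) = p 1 (edge C 2 0 2 u)"
 using sset_homD(1)[OF ibD(3) u(1)] hom_edge[OF ibD(3) u(1), of 0 1] hom_edge[OF ibD(3) u(1), of 1 2] hom_edge[OF ibD(3) u(1), of 0 2] by simp_all
 have e12: "edge C 2 1 2 u:cells C1 1" using u(4) unfolding equivalence_edge_def by blast
 hence p12: "p 1 (edge C 2 1 2 u) = kc NFin 1 (nerve_vertex fin_cat 1)" unfolding fibre_def by simp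
 have p02: "p 1 (edge C 2 0 2 u) = ?a" unfolding u(3) using val_proj[OF bs(1) ob bs(4)] bs(2) by simp
 have p01: "p 1 (edge C 2 0 1 u) = ?a" using fin_edge_left[OF pu(1)] pu p12 p02 by simp
 have c: "comp2 D (edge C 2 0 1 u) (edge C 2 1 2 u) (val bs ?b (mult_map 2))"
 proof (rule comp2_D)
 show "comp2 C (edge C 2 0 1 u) (edge C 2 1 2 u) (val bs ?b (mult_map 2))" unfolding comp2_def using u by blast
 qed (simp only: p01 p12 nerve_edge_ends simp_thms)
 obtain x y z where a: "arr D x y (edge C 2 0 1 u)" "arr D y z (edge C 2 1 2 u)" "arr D x z (val bs ?b (mult_map 2))" by (rule comp2_arr[OF c])
 have xz: "x = val0 bs" "z = val0 ?b" using a(3) val_arr[OF bs(1) ob bs(4)] unfolding arr_def by auto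
 have s: "source C (edge C 2 1 2 u) = y" "target C (edge C 2 1 2 u) = z" using a(2) unfolding arr_def by auto
 have "arr C1 y z (edge C 2 1 2 u)" using e12 s unfolding arr_def fibre_def by simp
 hence "y:cells C1 0" "z:cells C1 0" using Q.arr_ends by auto
 hence yz: "y:L" "z:L" using fibre_0(2) unfolding nerve_edge_ends by auto
 have aC: "arr C x y (edge C 2 0 1 u)" using a(1) DS_sub unfolding arr_def by auto
 have "p 0 x = source NFin ?a" using hom_arr[OF ibD(3) aC] p01 unfolding arr_def by simp
 hence "wc L x y (cls (edge C 2 0 1 u))" by (rule cocartesian_wc[OF u(2) a(1) _ yz(1)])
 moreover have "iso y z (cls (edge C 2 1 2 u))" using iso_iff[OF a(2)] equivalence_D[of "nerve_vertex fin_cat 1"] u(4) nerve_edge_ends by metis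
 ultimately have "wc L x z (hmul (cls (edge C 2 0 1 u)) (cls (edge C 2 1 2 u)))" by (rule wc_mult_iso[OF _ _ yz(2)])
 thus "wc L (val0 bs) (val0 ?b) (cls (val bs ?b (mult_map 2)))" unfolding hmul_cls[OF c] xz .
 show "arr D (val0 bs) (val0 ?b) (val bs ?b (mult_map 2))" using a(3) unfolding xz .
 qed
 have dj: "ALL i<length bU. ALL j<length bU. i~=j --> bU ! i Int bU ! j = {}" "ALL i<length bV. ALL j<length bV. i~=j --> bV ! i Int bV ! j = {}"
 using pr(5) dis by (auto simp: less_Suc_eq)
 have un: "\<Union>(set bU) = U1 Un U2" "\<Union>(set bV) = V1 Un V2" by auto
 have wU: "wc L (val0 bU) (val0 ?U) (cls (val bU ?U (mult_map 2)))" and aU: "arr D (val0 bU) (val0 ?U) (val bU ?U (mult_map 2))"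
 using wcm[of bU] pr(1) dj(1) mh(1) unfolding un by simp_all
 have wV: "wc L (val0 bV) (val0 ?V) (cls (val bV ?V (mult_map 2)))" and aV: "arr D (val0 bV) (val0 ?V) (val bV ?V (mult_map 2))"
 using wcm[of bV] pr(2) dj(2) mh(2) unfolding un by simp_all
 have wda: "arr D (val0 bU) (val0 bV) wd" using arr_Ea[unfolded nerve_edge_ends, OF wd_arr] .
 have "eqe D wd" using equivalence_D[of "nerve_vertex fin_cat 2"] wd_equivalence nerve_edge_ends by metis
 hence wi: "iso (val0 bU) (val0 bV) (cls wd)" using iso_iff[OF wda] by simp
 have wm: "wc L (val0 bU) (val0 ?V) (hmul (cls wd) (cls (val bV ?V (mult_map 2))))" by (rule wc_iso_mult[OF wV wi])
 note u = unary_hom[OF o(3)]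
 have q: "p 1 (val bU ?U (mult_map 2)) = ?a" "p 1 (val ?U ?V (pointed_id 1)) = nerve_edge fin_cat 1 1 (pointed_id 1)"
 "p 1 wd = nerve_edge fin_cat 2 2 (pointed_id 2)" "p 1 (val bV ?V (mult_map 2)) = ?a"
 using val_proj[OF pr(1) o(1) mh(1)] val_proj[OF o(1,2) u] val_proj[OF pr(1,2) w_hom] val_proj[OF pr(2) o(2) mh(2)] unfolding l .
 have c1: "pointed_id 1 o mult_map 2 = mult_map 2" "mult_map 2 o pointed_id 2 = mult_map 2" using pointed_comp(1,2)[OF mm] by auto
 have sq: "comp2 D (val bU ?U (mult_map 2)) (val ?U ?V (pointed_id 1)) (val bU ?V (mult_map 2))"
 "comp2 D wd (val bV ?V (mult_map 2)) (val bU ?V (mult_map 2))" using val_comp[OF pr(1) o(1) mh(1) o(2) u] val_comp[OF pr(1,2) w_hom o(2) mh(2)] mh(3) q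
 unfolding c1 by (auto intro!: comp2_D simp: nerve_edge_ends' nerve_const id simp del: One_nat_def)
 have ab: "arr C1 (val0 ?U) (val0 ?V) (val ?U ?V (pointed_id 1))" by (rule fibre_val[OF o(1,2) u]) simp_all
 hence abD: "arr D (val0 ?U) (val0 ?V) (val ?U ?V (pointed_id 1))" using arr_Eb[unfolded nerve_edge_ends] by blast
 have "iso (val0 ?U) (val0 ?V) (cls (val ?U ?V (pointed_id 1)))"
 proof (rule wc_iso[OF wU wm])
 show "cls (val ?U ?V (pointed_id 1)):Hm (val0 ?U) (val0 ?V)" using abD unfolding Hm_def by blast
 show "hmul (cls (val bU ?U (mult_map 2))) (cls (val ?U ?V (pointed_id 1))) = hmul (cls wd) (cls (val bV ?V (mult_map 2)))"
 using hmul_cls[OF sq(1)] hmul_cls[OF sq(2)] by simp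
 qed
 hence "eqe D (val ?U ?V (pointed_id 1))" using iso_iff[OF abD] by simp
 moreover have "val0 ?U:L" "val0 ?V:L" using wU wV unfolding wc_def by blast+
 ultimately have "eqe C1 (val ?U ?V (pointed_id 1))" using equivalence_fibre[OF abD] unfolding nerve_edge_ends by blast
 thus ?thesis unfolding eqv_def using o ext_val[of "U1 Un U2" "V1 Un V2"] by auto
qed

end

end

section \<open>Weiss systems\<close>

text \<open>What the geometric argument needs to know about equivalences. \<open>E_six\<close>
  records only the last of the conclusions of two-out-of-six.\<close>

locale weiss_system =
 fixes T :: "'a topology" and E :: "'a set => 'a set => bool"
 assumes haus: "Hausdorff_space T"
 and E_open: "E U V ==> openin T U & openin T V & U <= V"
 and E_refl: "openin T U ==> E U U"
 and E_trans: "E U V ==> E V W ==> E U W"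
 and E_six: "E U W ==> E V Y ==> U <= V ==> V <= W ==> W <= Y ==> E W Y"
 and E_disjoint: "E U1 V1 ==> E U2 V2 ==> V1 Int V2 = {} ==> E (U1 Un U2) (V1 Un V2)"
 and E_weiss: "openin T U ==> openin T V ==> U <= V ==> weiss_cover T V Wv ==>
 (!!F. finite F ==> F~={} ==> F <= Wv ==> E (U Int \<Inter>F) (\<Inter>F)) ==> E U V"
begin

definition pull_E :: "'b topology => ('b => 'a) => 'b set => 'b set => bool" where
 "pull_E T' ph U V <-> openin T' U & openin T' V & U <= V & E (ph ` U) (ph ` V)"

text \<open>An injective open map carries Weiss covers to Weiss covers of the image, and it commutes
  with intersections, so each axiom is inherited from \<open>T\<close>.\<close>

lemma pull_weiss_system:
 assumes c: "continuous_map T' T ph" and o: "open_map T' T ph" and i: "inj_on ph (topspace T')"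
 shows "weiss_system T' (pull_E T' ph)"
proof
 show "Hausdorff_space T'" using Hausdorff_space_injective_preimage[OF haus c i] .
 have im: "openin T (ph ` U)" if "openin T' U" for U using o that unfolding open_map_def by blast
 show "pull_E T' ph U V ==> openin T' U & openin T' V & U <= V" for U V unfolding pull_E_def by blast
 show "openin T' U ==> pull_E T' ph U U" for U unfolding pull_E_def using E_refl im by blast
 show "pull_E T' ph U V ==> pull_E T' ph V W ==> pull_E T' ph U W" for U V W unfolding pull_E_def using E_trans by blast
 show "pull_E T' ph U W ==> pull_E T' ph V Y ==> U <= V ==> V <= W ==> W <= Y ==> pull_E T' ph W Y" for U V W Y
 unfolding pull_E_def using E_six[of "ph ` U" "ph ` W" "ph ` V" "ph ` Y"] image_mono by metis
 show "pull_E T' ph (U1 Un U2) (V1 Un V2)" if a: "pull_E T' ph U1 V1" "pull_E T' ph U2 V2" "V1 Int V2 = {}" for U1 V1 U2 V2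
 proof -
 have "V1 <= topspace T'" "V2 <= topspace T'" using a openin_subset unfolding pull_E_def by blast+
 hence "ph ` V1 Int ph ` V2 = {}" using a(3) i unfolding inj_on_def by blast
 thus ?thesis using a E_disjoint[of "ph ` U1" "ph ` V1" "ph ` U2" "ph ` V2"] unfolding pull_E_def image_Un by blast
 qed
 fix U V Wv assume a: "openin T' U" "openin T' V" "U <= V" "weiss_cover T' V Wv"
 "!!F. finite F ==> F~={} ==> F <= Wv ==> pull_E T' ph (U Int \<Inter>F) (\<Inter>F)"
 have WO: "W <= V" "openin T' W" if "W:Wv" for W using a(4) that unfolding weiss_cover_def by blast+
 have V: "V <= topspace T'" by (rule openin_subset[OF a(2)])
 have "E (ph ` U) (ph ` V)"
 proof (rule E_weiss[OF im[OF a(1)] im[OF a(2)] image_mono[OF a(3)]])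
 show "weiss_cover T (ph ` V) ((`) ph ` Wv)" unfolding weiss_cover_def
 proof (intro conjI ballI allI impI)
 fix S assume S: "finite S" "S <= ph ` V"
 then obtain R where R: "R <= V" "finite R" "S = ph ` R" by (metis finite_subset_image)
 then obtain W where W: "W:Wv" "R <= W" using a(4) unfolding weiss_cover_def by blast
 show "EX W:(`) ph ` Wv. S <= W" by (rule bexI[of _ "ph ` W"]) (use R W in auto)
 qed (use WO im in auto)
 fix F assume F: "finite F" "F~={}" "F <= (`) ph ` Wv"
 then obtain G where G: "G <= Wv" "finite G" "F = (`) ph ` G" by (metis finite_subset_image)
 have Gn: "G~={}" using F G by blast
 have inj: "inj_on ph V" using i V inj_on_subset by blast
 have 1: "\<Inter>F = ph ` \<Inter>G" unfolding G(3)
 proof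
 show "ph ` \<Inter>G <= \<Inter> ((`) ph ` G)" by blast
 show "\<Inter> ((`) ph ` G) <= ph ` \<Inter>G"
 proof
 fix y assume y: "y:\<Inter> ((`) ph ` G)"
 obtain W0 where W0: "W0:G" using Gn by blast
 then obtain x where x: "x:W0" "y = ph x" using y by blast
 have "x:W" if W: "W:G" for W
 proof -
 obtain x' where x': "x':W" "y = ph x'" using y W by blast
 have "x:V" "x':V" using x x' W W0 WO G(1) by blast+
 thus ?thesis using inj x x' unfolding inj_on_def by blast
 qed
 thus "y:ph ` \<Inter>G" using x by blast
 qed
 qed
 have "\<Inter>G <= V" using Gn G(1) WO by blast
 hence 2: "ph ` U Int \<Inter>F = ph ` (U Int \<Inter>G)" unfolding 1 using inj_on_image_Int[OF inj a(3)] by simp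
 show "E (ph ` U Int \<Inter>F) (\<Inter>F)" unfolding 2 unfolding 1 using a(5)[OF G(2) Gn G(1)] unfolding pull_E_def by blast
 qed
 thus "pull_E T' ph U V" unfolding pull_E_def using a by blast
qed

section \<open>Weiss covers from levels of a function and from a basis\<close>

lemma open_cond:
 assumes "openin T V" "continuous_map T eur ta" "open S" shows "openin T {x:V. ta x:S}"
proof -
 have "openin T {x:topspace T. ta x:S}" using assms(2,3) openin_continuous_map_preimage[of T eur ta S] by simp
 hence "openin T (V Int {x:topspace T. ta x:S})" using assms(1) by blast
 moreover have "V Int {x:topspace T. ta x:S} = {x:V. ta x:S}" using openin_subset[OF assms(1)] by blast
 ultimately show ?thesis by simp
qed

text \<open>A finite set avoids almost every level \<open>ta = c\<close>, so removing single levels gives a Weiss cover.\<close>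

lemma cut:
 assumes V: "openin T V" and ta: "continuous_map T eur ta" and b: "b <= b'" "c0 < d0" "d0 <= b"
 and h: "!!c. c0 < c ==> c < d0 ==> E {x:V. c < ta x & ta x < b} {x:V. c < ta x & ta x < b'}"
 shows "E {x:V. ta x < b} {x:V. ta x < b'}"
proof -
 have o: "openin T {x:V. ta x:S}" if "open S" for S by (rule open_cond[OF V ta that])
 define W where "W c = {x:V. ta x:{..<b'} - {c}}" for c
 define Wv where "Wv = W ` {c0<..<d0}"
 show ?thesis
 proof (rule E_weiss[where Wv = Wv])
 show "openin T {x:V. ta x < b}" "openin T {x:V. ta x < b'}" using o[of "{..<b}"] o[of "{..<b'}"] by simp_all
 show "{x:V. ta x < b} <= {x:V. ta x < b'}" using b(1) by auto
 show "weiss_cover T {x:V. ta x < b'} Wv" unfolding weiss_cover_def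
 proof (intro conjI ballI allI impI)
 fix X assume "X:Wv"
 then obtain c where c: "X = W c" unfolding Wv_def by blast
 show "openin T X" unfolding c W_def by (rule o) auto
 show "X <= {x:V. ta x < b'}" unfolding c W_def by auto
 next
 fix S assume S: "finite S" "S <= {x:V. ta x < b'}"
 have "infinite ({c0<..<d0} - ta ` S)" using S(1) b(2) by (simp add: infinite_Ioo)
 then obtain c where "c:{c0<..<d0}" "c~:ta ` S" by (metis Diff_iff finite.emptyI ex_in_conv)
 thus "EX W:Wv. S <= W" unfolding Wv_def W_def using S(2) by (intro bexI[of _ "W c"]) (auto simp: W_def)
 qed
 fix F assume F: "finite F" "F~={}" "F <= Wv"
 then obtain K where K: "K <= {c0<..<d0}" "finite K" "F = W ` K" unfolding Wv_def by (metis finite_subset_image)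
 have Kn: "K~={}" using F(2) K(3) by blast
 \<comment> \<open>Above the largest removed level the two sets are the slabs of the hypothesis; the
   part below it is common to both.\<close>
 define c where "c = Max K"
 have c: "c:K" "!!k. k:K ==> k <= c" unfolding c_def using K(2) Kn by auto
 have cd: "c0 < c" "c < d0" "c < b" using c(1) K(1) b(3) by auto
 let ?L = "{x:V. ta x:{..<c} - K}"
 have I: "\<Inter>F = {x:V. ta x < b' & ta x~:K}" unfolding K(3) W_def using Kn by auto
 have r: "t < d & t~:K <-> t < c & t~:K | c < t & t < d" if "c < d" for t d using c that by (cases t c rule: linorder_cases) (auto dest: c(2))
 have 1: "\<Inter>F = ?L Un {x:V. c < ta x & ta x < b'}" unfolding I using r[of b'] cd b(1) by auto
 have "{x:V. ta x < b} Int \<Inter>F = {x:V. ta x < b & ta x~:K}" unfolding I using b(1) by auto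
 hence 2: "{x:V. ta x < b} Int \<Inter>F = ?L Un {x:V. c < ta x & ta x < b}" using r[of b] cd by auto
 have "openin T ?L" by (rule o) (use K(2) in "simp add: finite_imp_closed open_Diff")
 hence "E (?L Un {x:V. c < ta x & ta x < b}) (?L Un {x:V. c < ta x & ta x < b'})" by (intro E_disjoint E_refl h cd) auto
 thus "E ({x:V. ta x < b} Int \<Inter>F) (\<Inter>F)" unfolding 2 unfolding 1 .
 qed
qed

lemma finite_separation:
 assumes B: "finite B" "B <= topspace T"
 obtains G where "!!b. b:B ==> openin T (G b) & b:G b" "!!b c. b:B ==> c:B ==> b~=c ==> G b Int G c = {}"
proof -
 have "EX U V. openin T U & openin T V & b:U & c:V & U Int V = {}" if "b:B" "c:B" "b~=c" for b c
 using haus B(2) that unfolding Hausdorff_space_def disjnt_def by blast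
 then obtain u v where uv: "!!b c. b:B ==> c:B ==> b~=c ==>
 openin T (u b c) & openin T (v b c) & b:u b c & c:v b c & u b c Int v b c = {}" by metis
 define G where "G b = topspace T Int \<Inter>((%c. u b c Int v c b) ` (B - {b}))" for b
 show ?thesis
 proof (rule that)
 fix b assume b: "b:B"
 have "openin T (topspace T Int \<Inter>((%c. u b c Int v c b) ` K))" if "finite K" "K <= B - {b}" for K using that
 proof (induction K)
 case (insert c K)
 hence "openin T (u b c Int v c b)" using uv[OF b, of c] uv[of c b] b by auto
 hence "openin T ((topspace T Int \<Inter>((%c. u b c Int v c b) ` K)) Int (u b c Int v c b))" using insert by auto
 moreover have "(topspace T Int \<Inter>((%c. u b c Int v c b) ` K)) Int (u b c Int v c b) = topspace T Int \<Inter>((%c. u b c Int v c b) ` insert c K)"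
 by auto
 ultimately show ?case by simp
 qed simp
 thus "openin T (G b) & b:G b" unfolding G_def using B uv[OF b] uv[OF _ b] b by auto
 next
 fix b c assume "b:B" "c:B" "b~=c"
 hence "G b <= u b c" "G c <= v b c" "u b c Int v b c = {}" using uv[of b c] unfolding G_def by auto
 thus "G b Int G c = {}" by blast
 qed
qed

text \<open>Finite disjoint unions of preimages form a Weiss cover closed under intersections: a
  finite set has a finite image under \<open>pj\<close>, whose points are separated and then placed
  in basic sets. Disjointness is asked of the preimages in \<open>V\<close> only, as the axiom on
  unions concerns nothing else.\<close>

lemma basis_local:
 assumes pj: "continuous_map T T pj" and O: "!!P. P:Ov ==> openin T P" "!!P Q. P:Ov ==> Q:Ov ==> P Int Q:Ov"
 and UV: "openin T U" "openin T V" "U <= V" and H: "openin T H"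
 and e: "!!P. P:Ov ==> E {y:U. pj y:P} {y:V. pj y:P}"
 and basis: "!!y G. y:topspace T ==> openin T G ==> G <= H ==> pj y:G ==>
 EX P:Ov. pj y:P & (ALL x:topspace T. pj x:P --> pj x:G)"
 shows "E {y:U. pj y:H} {y:V. pj y:H}"
proof -
 define pre where "pre P = {y:V. pj y:P}" for P
 have Vt: "V <= topspace T" by (rule openin_subset[OF UV(2)])
 have po: "openin T {y:Q. pj y:P}" if "openin T P" "openin T Q" for P Q
 proof -
 have "{y:Q. pj y:P} = Q Int {y:topspace T. pj y:P}" using openin_subset[OF that(2)] by blast
 thus ?thesis using openin_continuous_map_preimage[OF pj that(1)] that(2) by auto
 qed
 define adm where "adm Pv <-> finite Pv & Pv <= Ov & (ALL P:Pv. ALL Q:Pv. P~=Q --> pre P Int pre Q = {}) & (ALL P:Pv. pre P <= pre H)" for Pv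
 define Wv where "Wv = {\<Union>(pre ` Pv) |Pv. adm Pv}"
 have Wm: "adm Pv ==> \<Union>(pre ` Pv):Wv" for Pv unfolding Wv_def by blast
 have WI: "\<Union>(pre ` Pv) Int \<Union>(pre ` Qv):Wv" if a: "adm Pv" "adm Qv" for Pv Qv
 proof -
 define Rv where "Rv = (%(P, Q). P Int Q) ` (Pv \<times> Qv)"
 have pI: "pre (P Int Q) = pre P Int pre Q" for P Q unfolding pre_def by blast
 have "adm Rv" unfolding adm_def
 proof (intro conjI ballI impI)
 have RD: "EX P:Pv. EX Q:Qv. A = P Int Q" if "A:Rv" for A using that unfolding Rv_def by auto
 show "finite Rv" unfolding Rv_def using a unfolding adm_def by (intro finite_imageI finite_cartesian_product) blast+
 show "Rv <= Ov"
 proof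
 fix A assume "A:Rv"
 then obtain P Q where "P:Pv" "Q:Qv" "A = P Int Q" using RD by blast
 thus "A:Ov" using O(2)[of P Q] a unfolding adm_def by auto
 qed
 fix A assume "A:Rv"
 then obtain P Q where A: "P:Pv" "Q:Qv" "A = P Int Q" using RD by blast
 have "pre P <= pre H" using a(1) A(1) unfolding adm_def by blast
 thus "pre A <= pre H" unfolding A(3) pI by blast
 fix B assume "B:Rv" "A~=B"
 then obtain P' Q' where B: "P':Pv" "Q':Qv" "B = P' Int Q'" "P~=P' | Q~=Q'" using RD A by metis
 have "P~=P' ==> pre P Int pre P' = {}" "Q~=Q' ==> pre Q Int pre Q' = {}" using a A B unfolding adm_def by simp_all
 thus "pre A Int pre B = {}" using B(4) unfolding A(3) B(3) pI by blast
 qed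
 moreover have "\<Union>(pre ` Pv) Int \<Union>(pre ` Qv) = \<Union>(pre ` Rv)" unfolding Rv_def by (auto simp: pre_def)
 ultimately show ?thesis unfolding Wv_def by blast
 qed
 have WE: "E (U Int \<Union>(pre ` Pv)) (\<Union>(pre ` Pv))" if a: "adm Pv" for Pv
 proof -
 have "finite Pv" using a unfolding adm_def by blast
 moreover have "ALL P:Pv. P:Ov" "ALL P:Pv. ALL Q:Pv. P~=Q --> pre P Int pre Q = {}" using a unfolding adm_def by blast+
 ultimately show ?thesis
 proof (induction Pv)
 case empty thus ?case using E_refl by simp
 next
 case (insert P Pv)
 have 1: "U Int pre P = {y:U. pj y:P}" unfolding pre_def using UV(3) by blast
 have "E (U Int pre P) (pre P)" unfolding 1 unfolding pre_def using e insert.prems(1) by simp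
 moreover have "E (U Int \<Union>(pre ` Pv)) (\<Union>(pre ` Pv))" by (rule insert.IH) (use insert.prems in "simp_all")
 moreover have "pre P Int pre Q = {}" if "Q:Pv" for Q using insert.prems(2) insert.hyps(2) that by (metis insertCI)
 hence "pre P Int \<Union>(pre ` Pv) = {}" by blast
 ultimately have "E (U Int pre P Un U Int \<Union>(pre ` Pv)) (pre P Un \<Union>(pre ` Pv))" by (rule E_disjoint)
 thus ?case by (simp add: Int_Un_distrib)
 qed
 qed
 have "E {y:U. pj y:H} (pre H)"
 proof (rule E_weiss[where Wv = Wv])
 show "openin T {y:U. pj y:H}" "openin T (pre H)" unfolding pre_def using po H UV by blast+
 show "{y:U. pj y:H} <= pre H" unfolding pre_def using UV(3) by blast
 show "weiss_cover T (pre H) Wv" unfolding weiss_cover_def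
 proof (intro conjI ballI allI impI)
 fix W assume "W:Wv"
 then obtain Pv where P: "adm Pv" "W = \<Union>(pre ` Pv)" unfolding Wv_def by blast
 show "openin T W" unfolding P(2) using E_open[OF WE[OF P(1)]] by blast
 show "W <= pre H" using P unfolding adm_def by blast
 next
 fix S assume S: "finite S" "S <= pre H"
 have St: "S <= topspace T" using S(2) Vt unfolding pre_def by blast
 have "pj ` S <= topspace T" using St pj unfolding continuous_map_def by blast
 then obtain G where G: "!!b. b:pj ` S ==> openin T (G b) & b:G b"
 "!!b c. b:pj ` S ==> c:pj ` S ==> b~=c ==> G b Int G c = {}" using finite_separation[of "pj ` S"] S(1) by (metis finite_imageI)
 have "EX P:Ov. b:P & (ALL x:topspace T. pj x:P --> pj x:G b Int H)" if b: "b:pj ` S" for b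
 proof -
 obtain y where y: "y:S" "b = pj y" using b by blast
 show ?thesis unfolding y(2) by (rule basis) (use y St S(2) G(1)[OF b] H in "auto simp: pre_def")
 qed
 then obtain P where P: "!!b. b:pj ` S ==> P b:Ov & b:P b & (ALL x:topspace T. pj x:P b --> pj x:G b Int H)" by metis
 have pG: "pre (P b) <= pre (G b) Int pre H" if "b:pj ` S" for b using P[OF that] Vt unfolding pre_def by blast
 have "adm (P ` pj ` S)" unfolding adm_def
 proof (intro conjI ballI impI)
 show "finite (P ` pj ` S)" using S(1) by blast
 show "P ` pj ` S <= Ov" using P by blast
 fix A assume "A:P ` pj ` S"
 then obtain b where b: "A = P b" "b:pj ` S" by blast
 thus "pre A <= pre H" using pG by blast
 fix B assume "B:P ` pj ` S" "A~=B"
 then obtain c where c: "B = P c" "c:pj ` S" by blast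
 have bc: "b~=c" using b(1) c(1) \<open>A~=B\<close> by metis
 have "pre (G b) Int pre (G c) = {}" using G(2)[OF b(2) c(2) bc] unfolding pre_def by blast
 thus "pre A Int pre B = {}" using pG[OF b(2)] pG[OF c(2)] unfolding b(1) c(1) by blast
 qed
 moreover have "S <= \<Union>(pre ` P ` pj ` S)"
 proof
 fix x assume x: "x:S"
 hence "pj x:P (pj x)" "x:V" using P[of "pj x"] S(2) unfolding pre_def by auto
 hence "x:pre (P (pj x))" unfolding pre_def by simp
 thus "x:\<Union>(pre ` P ` pj ` S)" by (rule UnionI[rotated]) (intro imageI x)
 qed
 ultimately show "EX W:Wv. S <= W" by (intro bexI[of _ "\<Union>(pre ` P ` pj ` S)"] Wm)
 qed
 fix F assume "finite F" "F~={}" "F <= Wv"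
 hence "\<Inter>F:Wv"
 proof (induction F rule: finite_ne_induct)
 case (insert W F)
 hence W: "W:Wv" "\<Inter>F:Wv" by auto
 obtain Pv where P: "W = \<Union>(pre ` Pv)" "adm Pv" using W(1) unfolding Wv_def by blast
 obtain Qv where Q: "\<Inter>F = \<Union>(pre ` Qv)" "adm Qv" using W(2) unfolding Wv_def by blast
 show ?case using WI[OF P(2) Q(2)] unfolding Inter_insert P(1) Q(1) .
 qed simp
 then obtain Pv where P: "adm Pv" "\<Inter>F = \<Union>(pre ` Pv)" unfolding Wv_def by blast
 have "\<Union>(pre ` Pv) <= pre H" using P(1) unfolding adm_def by (intro UN_least) blast
 moreover have "U Int Z = {y:U. pj y:H} Int Z" if "Z <= pre H" for Z using that unfolding pre_def by blast
 ultimately show "E ({y:U. pj y:H} Int \<Inter>F) (\<Inter>F)" unfolding P(2) using WE[OF P(1)] by metis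
 qed
 thus ?thesis unfolding pre_def .
qed

section \<open>Slabs between two levels\<close>

definition slab :: "('a => 'a) => ('a => real) => 'a set => real => real => 'a set" where
 "slab pj v H a b = {y:topspace T. pj y:H & a < v y & v y < b}"

definition slab_local :: "('a => 'a) => ('a => real) => bool" where
 "slab_local pj v <-> (ALL z:topspace T. ALL t. EX N. openin T N & pj z:N & (EX ep>0. ALL H. openin T H --> H <= N -->
 (ALL a' a b b'. t - ep < a' --> a' <= a --> a < b --> b <= b' --> b' < t + ep -->
 E (slab pj v H a b) (slab pj v H a' b'))))"

context
 fixes pj :: "'a => 'a" and v :: "'a => real"
 assumes pj: "continuous_map T T pj" and v: "continuous_map T eur v" and loc: "slab_local pj v"
begin

text \<open>Bolzano's lemma reduces the interval between the two levels to short ones, where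
  \<open>cut\<close> applies; the neighbourhoods are intersected whenever two intervals are
  joined.\<close>

lemma slab_right:
 assumes z: "z:topspace T" and xy: "x <= y"
 shows "EX N. openin T N & pj z:N & (ALL H. openin T H --> H <= N --> (ALL c<x. E (slab pj v H c x) (slab pj v H c y)))"
 (is "?P x y") using xy
proof (induction rule: Bolzano)
 case (trans x y w)
 obtain N where N: "openin T N" "pj z:N" "ALL H. openin T H --> H <= N --> (ALL c<x. E (slab pj v H c x) (slab pj v H c y))"
 using trans(1) by (elim exE conjE)
 obtain M where M: "openin T M" "pj z:M" "ALL H. openin T H --> H <= M --> (ALL c<y. E (slab pj v H c y) (slab pj v H c w))"
 using trans(2) by (elim exE conjE)
 show ?case
 proof (intro exI[of _ "N Int M"] conjI allI impI)
 fix H c assume h: "openin T H" "H <= N Int M" "c < x"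
 show "E (slab pj v H c x) (slab pj v H c w)" by (rule E_trans[OF N(3)[rule_format] M(3)[rule_format]]) (use h trans(3) in auto)
 qed (use N M in auto)
next
 case (local t)
 obtain N ep where N: "openin T N" "pj z:N" "ep > 0" and h: "!!H a' a b b'. openin T H ==> H <= N ==>
 t - ep < a' ==> a' <= a ==> a < b ==> b <= b' ==> b' < t + ep ==> E (slab pj v H a b) (slab pj v H a' b')"
 using loc[unfolded slab_local_def, rule_format, OF z, of t] by (elim exE conjE) simp
 have "?P a b" if ab: "a <= t" "t <= b" "b - a < ep" for a b
 proof (intro exI[of _ N] conjI allI impI N(1,2))
 fix H c assume H: "openin T H" "H <= N" and c: "c < a"
 let ?V = "{y:topspace T. pj y:H & c < v y}"
 have V: "openin T ?V"
 proof -
 have "?V = {y:{y:topspace T. pj y:H}. v y:{c<..}}" by auto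
 thus ?thesis using open_cond[OF openin_continuous_map_preimage[OF pj H(1)] v, of "{c<..}"] by simp
 qed
 have s: "slab pj v H c d = {y:?V. v y < d}" for d unfolding slab_def by auto
 \<comment> \<open>The removed levels lie above both \<open>c\<close> and \<open>t - ep\<close>, so
   the slabs that start at them are thin enough for the local hypothesis.\<close>
 show "E (slab pj v H c a) (slab pj v H c b)" unfolding s
 proof (rule cut[OF V v, of a b "max c (t - ep)" a])
 fix k assume k: "max c (t - ep) < k" "k < a"
 have s': "slab pj v H k d = {y:?V. k < v y & v y < d}" for d unfolding slab_def using k by auto
 show "E {y:?V. k < v y & v y < a} {y:?V. k < v y & v y < b}" unfolding s'[symmetric] by (rule h) (use H k ab in auto)
 qed (use ab c N(3) in auto)
 qed
 thus ?case using N(3) by blast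
qed

end

lemma slab_neg: "slab pj (%x. - v x) H a b = slab pj v H (- b) (- a)" unfolding slab_def by auto

text \<open>The upper end is moved by \<open>slab_right\<close>, the lower end by the same lemma for
  \<open>- v\<close>. Each holds only over small \<open>H\<close>, and \<open>basis_local\<close>
  passes to arbitrary ones.\<close>

theorem slab_equivalence:
 assumes pj: "continuous_map T T pj" and v: "continuous_map T eur v" and loc: "slab_local pj v"
 and H: "openin T H" and ab: "a' <= a" "a < b" "b <= b'"
 shows "E (slab pj v H a b) (slab pj v H a' b')"
proof -
 have nv: "continuous_map T eur (%x. - v x)" using v by (rule continuous_map_minus)
 have nloc: "slab_local pj (%x. - v x)" unfolding slab_local_def
 proof (intro ballI allI)
 fix z t assume z: "z:topspace T"
 obtain N ep where N: "openin T N" "pj z:N" "ep > 0" and h: "!!H a' a b b'. openin T H ==> H <= N ==>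
 - t - ep < a' ==> a' <= a ==> a < b ==> b <= b' ==> b' < - t + ep ==> E (slab pj v H a b) (slab pj v H a' b')"
 using loc[unfolded slab_local_def, rule_format, OF z, of "- t"] by (elim exE conjE) simp
 show "EX N. openin T N & pj z:N & (EX ep>0. ALL H. openin T H --> H <= N -->
 (ALL a' a b b'. t - ep < a' --> a' <= a --> a < b --> b <= b' --> b' < t + ep -->
 E (slab pj (%x. - v x) H a b) (slab pj (%x. - v x) H a' b')))" by (intro exI[of _ N] conjI N(1,2) exI[of _ ep] N(3) allI impI; unfold slab_neg; rule h; simp)
 qed
 let ?U = "{y:topspace T. a < v y & v y < b}" and ?V = "{y:topspace T. a' < v y & v y < b'}"
 let ?O = "{P. openin T P & (ALL H. openin T H --> H <= P --> E (slab pj v H a b) (slab pj v H a' b'))}"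
 have o: "openin T {y:topspace T. c < v y & v y < d}" for c d using open_cond[OF openin_topspace v, of "{c<..<d}"] by simp
 have s: "slab pj v H c d = {y:{y:topspace T. c < v y & v y < d}. pj y:H}" for H c d unfolding slab_def by auto
 show ?thesis unfolding s
 proof (rule basis_local[OF pj, where Ov = ?O])
 show "?U <= ?V" using ab by auto
 show "E {y:?U. pj y:P} {y:?V. pj y:P}" if "P:?O" for P using that unfolding s by blast
 fix y G assume y: "y:topspace T" and G: "openin T G" "pj y:G"
 obtain N where N: "openin T N" "pj y:N" "ALL H. openin T H --> H <= N --> (ALL c<b. E (slab pj v H c b) (slab pj v H c b'))"
 using slab_right[OF pj v loc y ab(3)] by (elim exE conjE)
 have aa: "- a <= - a'" using ab(1) by simp
 obtain M where M: "openin T M" "pj y:M" "ALL H. openin T H --> H <= M -->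
 (ALL c< - a. E (slab pj (%x. - v x) H c (- a)) (slab pj (%x. - v x) H c (- a')))" using slab_right[OF pj nv nloc y aa] by (elim exE conjE)
 show "EX P:?O. pj y:P & (ALL x:topspace T. pj x:P --> pj x:G)"
 proof (rule bexI[of _ "G Int N Int M"])
 have "E (slab pj v H a b) (slab pj v H a' b')" if H: "openin T H" "H <= G Int N Int M" for H
 proof (rule E_trans)
 show "E (slab pj v H a b) (slab pj v H a b')" by (rule N(3)[rule_format]) (use H ab in auto)
 have "E (slab pj (%x. - v x) H (- b') (- a)) (slab pj (%x. - v x) H (- b') (- a'))" by (rule M(3)[rule_format]) (use H ab in auto)
 thus "E (slab pj v H a b') (slab pj v H a' b')" unfolding slab_neg minus_minus .
 qed
 thus "G Int N Int M:?O" using G(1) N(1) M(1) by (intro CollectI conjI allI impI openin_Int)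
 qed (use G(2) N(2) M(2) in simp_all)
 qed (use H o in auto)
qed

end

section \<open>Cones and their charts\<close>

lemma open_embedding:
 assumes f: "continuous_map X Y f" and N: "openin Y N" and g: "continuous_map (subtopology Y N) X g"
 and fN: "!!x. x:topspace X ==> f x:N" and gf: "!!x. x:topspace X ==> g (f x) = x" and fg: "!!y. y:N ==> f (g y) = y"
 shows "open_map X Y f" "inj_on f (topspace X)" "f ` topspace X = N"
proof -
 have NY: "N <= topspace Y" by (rule openin_subset[OF N])
 have gX: "g y:topspace X" if "y:N" for y using g that NY unfolding continuous_map_def by auto
 show "open_map X Y f" unfolding open_map_def
 proof (intro allI impI)
 fix U assume U: "openin X U"
 have "f ` U = {y:topspace (subtopology Y N). g y:U}"
 proof (intro equalityI subsetI)
 fix y assume "y:f ` U"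
 then obtain x where x: "x:U" "y = f x" by blast
 hence "x:topspace X" using openin_subset[OF U] by blast
 thus "y:{y:topspace (subtopology Y N). g y:U}" using x fN gf NY by auto
 next
 fix y assume "y:{y:topspace (subtopology Y N). g y:U}"
 hence "y:N" "g y:U" by auto
 thus "y:f ` U" using fg[of y] by (metis imageI)
 qed
 hence "openin (subtopology Y N) (f ` U)" using openin_continuous_map_preimage[OF g U] by simp
 thus "openin Y (f ` U)" using openin_trans_full N by blast
 qed
 show "inj_on f (topspace X)" by (rule inj_on_inverseI) (rule gf)
 show "f ` topspace X = N"
 proof (intro equalityI subsetI)
 fix y assume "y:N"
 thus "y:f ` topspace X" using fg[of y] gX by (metis imageI)
 qed (use fN in auto)
qed

lemma topspace_cone: "topspace (cone_topology X) = insert None (Some ` ({0<..} \<times> topspace X))"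
proof
 show "topspace (cone_topology X) <= insert None (Some ` ({0<..} \<times> topspace X))"
 using openin_topspace[of "cone_topology X"] unfolding openin_cone_topology by blast
 have "{z:{0..} \<times> topspace X. cone_quot z:insert None (Some ` ({0<..} \<times> topspace X))} = topspace (prod_topology (top_of_set {0..}) X)"
 by (auto simp: cone_quot_def)
 hence "openin (cone_topology X) (insert None (Some ` ({0<..} \<times> topspace X)))"
 unfolding openin_cone_topology using openin_topspace[of "prod_topology (top_of_set {0::real..}) X"] by auto
 thus "insert None (Some ` ({0<..} \<times> topspace X)) <= topspace (cone_topology X)" by (rule openin_subset)
qed

lemma cone_quot_continuous: "continuous_map (prod_topology (top_of_set {0..}) X) (cone_topology X) cone_quot"
proof -
 have "cone_quot z:topspace (cone_topology X)" if "z:topspace (prod_topology (top_of_set {0..}) X)" for z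
 using that by (cases z; cases "fst z = 0") (auto simp: cone_quot_def topspace_cone)
 thus ?thesis unfolding continuous_map_def openin_cone_topology by auto
qed

definition rad :: "(real \<times> 'a) option => real" where "rad c = (case c of None => 0 | Some z => fst z)"

lemma rad_simps [simp]: "rad None = 0" "rad (Some z) = fst z" by (simp_all add: rad_def)

lemma rad_quot [simp]: "rad (cone_quot z) = fst z" by (simp add: cone_quot_def)

lemma rad_ge: "c:topspace (cone_topology X) ==> rad c >= 0" unfolding topspace_cone by auto

lemma fst_half_line: "continuous_map (prod_topology (top_of_set {0::real..}) X) eur fst" using continuous_map_into_fulltopology[OF continuous_map_fst] .

lemma rad_continuous: "continuous_map (cone_topology X) eur rad" unfolding continuous_map_def
proof (intro conjI allI impI)
 fix U :: "real set" assume U: "openin eur U"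
 have "{z:{0..} \<times> topspace X. cone_quot z:{c:topspace (cone_topology X). rad c:U}} =
 {z:topspace (prod_topology (top_of_set {0..}) X). fst z:U}" by (auto simp: topspace_cone cone_quot_def)
 thus "openin (cone_topology X) {c:topspace (cone_topology X). rad c:U}"
 unfolding openin_cone_topology using openin_continuous_map_preimage[OF fst_half_line U] by (auto simp: topspace_cone)
qed simp

definition cone_scale :: "(real => real) => (real \<times> 'a) option => (real \<times> 'a) option" where
 "cone_scale f = map_option (%(s, z). (f s, z))"

lemma cone_scale_simps [simp]: "cone_scale f None = None" "cone_scale f (Some (s, z)) = Some (f s, z)" by (simp_all add: cone_scale_def)

text \<open>Continuity is checked after composing with the quotient map, where it is continuity of a
  product map. Openness of \<open>D\<close> allows passing from the product over \<open>D\<close> to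
  the product over the half line.\<close>

lemma cone_scale_continuous:
 assumes D: "openin (top_of_set {0..}) D" and f: "continuous_on D f" "!!s. s:D ==> 0 < s ==> 0 < f s" "f 0 = 0"
 shows "continuous_map (subtopology (cone_topology X) {c. rad c:D}) (cone_topology X) (cone_scale f)"
proof -
 let ?P = "prod_topology (top_of_set {0..}) X"
 have D0: "D <= {0..}" using openin_subset[OF D] by simp
 have f0: "0 <= f s" if "s:D" for s using f(2)[OF that] f(3) D0 that by (cases "s = 0") auto
 have cm: "continuous_map (prod_topology (top_of_set D) X) ?P (%z. (f (fst z), snd z))"
 proof (intro continuous_map_pairedI continuous_map_snd)
 have "continuous_map (top_of_set D) (top_of_set {0..}) f" using f(1) f0 by (auto simp: continuous_map_in_subtopology)
 from continuous_map_compose[OF continuous_map_fst this, of X]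
 show "continuous_map (prod_topology (top_of_set D) X) (top_of_set {0..}) (%z. f (fst z))" by (simp only: o_def)
 qed
 have sc: "cone_scale f (cone_quot z) = cone_quot (f (fst z), snd z)" if "fst z:D" for z
 using f(2)[OF that] f(3) D0 that by (cases z) (auto simp: cone_quot_def less_le)
 have tp: "cone_scale f c:topspace (cone_topology X)" if "c:topspace (cone_topology X)" "rad c:D" for c using that f(2) unfolding topspace_cone by auto
 show ?thesis unfolding continuous_map_def
 proof (intro conjI allI impI)
 show "cone_scale f:topspace (subtopology (cone_topology X) {c. rad c:D}) \<rightarrow> topspace (cone_topology X)" using tp by auto
 fix V assume V: "openin (cone_topology X) V"
 let ?W = "{c:topspace (cone_topology X). rad c:D & cone_scale f c:V}"
 have q: "cone_quot z:topspace (cone_topology X)" if "z:{0..} \<times> topspace X" for z using that by (auto simp: topspace_cone cone_quot_def)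
 have e: "{z:{0..} \<times> topspace X. cone_quot z:?W} = {z:topspace (prod_topology (top_of_set D) X). (f (fst z), snd z):{z:{0..} \<times> topspace X. cone_quot z:V}}"
 (is "?L = ?R")
 proof (rule set_eqI)
 fix z show "z:?L <-> z:?R"
 proof (cases "fst z:D & snd z:topspace X")
 case True
 hence "z:{0..} \<times> topspace X" "0 <= f (fst z)" using D0 f0 by (auto simp: mem_Times_iff)
 thus ?thesis using True q[of z] sc[of z] by (simp add: mem_Times_iff)
 next
 case False
 thus ?thesis by (auto simp: mem_Times_iff)
 qed
 qed
 have "openin (prod_topology (top_of_set D) X) {z:topspace (prod_topology (top_of_set D) X). (f (fst z), snd z):{z:{0..} \<times> topspace X. cone_quot z:V}}"
 by (rule openin_continuous_map_preimage[OF cm]) (use V in "simp add: openin_cone_topology")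
 moreover have "top_of_set D = subtopology (top_of_set {0..}) D" using D0 by (simp add: subtopology_subtopology Int_absorb1)
 hence "prod_topology (top_of_set D) X = subtopology ?P (D \<times> topspace X)" by (simp only: prod_topology_subtopology(1))
 ultimately have "openin (subtopology ?P (D \<times> topspace X)) {z:{0..} \<times> topspace X. cone_quot z:?W}" unfolding e by simp
 moreover have "openin ?P (D \<times> topspace X)" using D by (simp add: openin_prod_Times_iff)
 ultimately have "openin ?P {z:{0..} \<times> topspace X. cone_quot z:?W}" by (rule openin_trans_full)
 hence "openin (cone_topology X) ?W" unfolding openin_cone_topology by (auto simp: topspace_cone)
 hence "openin (subtopology (cone_topology X) {c. rad c:D}) (?W Int {c. rad c:D})" unfolding openin_subtopology by blast
 moreover have "?W Int {c. rad c:D} = {x:topspace (subtopology (cone_topology X) {c. rad c:D}). cone_scale f x:V}" by auto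
 ultimately show "openin (subtopology (cone_topology X) {c. rad c:D}) {x:topspace (subtopology (cone_topology X) {c. rad c:D}). cone_scale f x:V}" by simp
 qed
qed

text \<open>Off the tip the quotient map is injective, so the cone carries the product topology
  there.\<close>

lemma the_continuous: "continuous_map (subtopology (cone_topology X) {c. 0 < rad c}) (prod_topology eur X) the" unfolding continuous_map_def
proof (intro conjI allI impI)
 show "the:topspace (subtopology (cone_topology X) {c. 0 < rad c}) \<rightarrow> topspace (prod_topology eur X)" by (auto simp: topspace_cone)
 fix V assume V: "openin (prod_topology eur X) V"
 let ?W = "{c:topspace (cone_topology X). 0 < rad c & the c:V}"
 have i: "continuous_map (prod_topology (top_of_set {0..}) X) (prod_topology eur X) (%z. z)"
 using continuous_map_pairedI[OF fst_half_line continuous_map_snd] by simp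
 have "{z:{0..} \<times> topspace X. cone_quot z:?W} =
 {z:topspace (prod_topology (top_of_set {0..}) X). fst z:{0<..}} Int {z:topspace (prod_topology (top_of_set {0..}) X). z:V}"
 by (auto simp: topspace_cone cone_quot_def)
 hence "openin (prod_topology (top_of_set {0..}) X) {z:{0..} \<times> topspace X. cone_quot z:?W}"
 using openin_continuous_map_preimage[OF fst_half_line, of "{0<..}"] openin_continuous_map_preimage[OF i V] by auto
 hence "openin (cone_topology X) ?W" unfolding openin_cone_topology by (auto simp: topspace_cone)
 hence "openin (subtopology (cone_topology X) {c. 0 < rad c}) (?W Int {c. 0 < rad c})" unfolding openin_subtopology by blast
 moreover have "?W Int {c. 0 < rad c} = {x:topspace (subtopology (cone_topology X) {c. 0 < rad c}). the x:V}" by auto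
 ultimately show "openin (subtopology (cone_topology X) {c. 0 < rad c}) {x:topspace (subtopology (cone_topology X) {c. 0 < rad c}). the x:V}" by simp
qed

section \<open>Stratified open embeddings and cylinders in a cone\<close>

lemma Euclidean_proj: "continuous_map (ES n) eur (%x. x i)"
 unfolding Euclidean_space_def by (intro continuous_map_from_subtopology continuous_map_product_projection) simp

text \<open>An isomorphism onto an open part of \<open>X\<close>; the embedding of strata need not
  reach all strata of \<open>X\<close>.\<close>

definition semb :: "('a, 's) strat_space => ('b, 't) strat_space => ('a => 'b) => bool" where
 "semb Y X ph <-> continuous_map (pts Y) (pts X) ph & open_map (pts Y) (pts X) ph & inj_on ph (pt Y) &
 (EX g. g:strata Y \<rightarrow> strata X & inj_on g (strata Y) & (ALL a:strata Y. ALL b:strata Y. sle Y a b <-> sle X (g a) (g b)) &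
 (ALL y:pt Y. strat X (ph y) = g (strat Y y)))"

lemma semb_compose: assumes "semb Y X ph" "semb W Y py" shows "semb W X (ph o py)"
proof -
 obtain g where g: "g:strata Y \<rightarrow> strata X" "inj_on g (strata Y)" "ALL a:strata Y. ALL b:strata Y. sle Y a b <-> sle X (g a) (g b)"
 "ALL y:pt Y. strat X (ph y) = g (strat Y y)" using assms(1) unfolding semb_def by blast
 obtain h where h: "h:strata W \<rightarrow> strata Y" "inj_on h (strata W)" "ALL a:strata W. ALL b:strata W. sle W a b <-> sle Y (h a) (h b)"
 "ALL y:pt W. strat Y (py y) = h (strat W y)" using assms(2) unfolding semb_def by blast
 have c: "continuous_map (pts Y) (pts X) ph" "continuous_map (pts W) (pts Y) py" "open_map (pts Y) (pts X) ph" "open_map (pts W) (pts Y) py"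
 "inj_on ph (pt Y)" "inj_on py (pt W)" using assms unfolding semb_def by blast+
 have im: "py y:pt Y" if "y:pt W" for y using c(2) that unfolding continuous_map_def by blast
 show ?thesis unfolding semb_def
 proof (intro conjI exI[of _ "g o h"])
 show "continuous_map (pts W) (pts X) (ph o py)" by (rule continuous_map_compose[OF c(2,1)])
 show "open_map (pts W) (pts X) (ph o py)" by (rule open_map_compose[OF c(4,3)])
 show "inj_on (ph o py) (pt W)" by (rule comp_inj_on[OF c(6)]) (use c(5) im in "auto intro: inj_on_subset")
 show "inj_on (g o h) (strata W)" by (rule comp_inj_on[OF h(2)]) (use g(2) h(1) in "auto intro: inj_on_subset")
 qed (use g h im in "auto simp: Pi_iff")
qed

abbreviation "CR Z m == times_euclidean (cone Z) m"

abbreviation "cpt Z n == pt (CR Z n)"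

lemma CR_simps [simp]:
 "pts (CR Z m) = prod_topology (cone_topology (pts Z)) (ES m)"
 "strata (CR Z m) = insert None (Some ` strata Z)" "strat (CR Z m) (c, x) = map_option (%z. strat Z (snd z)) c"
 "sle (CR Z m) None a = True" "sle (CR Z m) (Some s) None = False" "sle (CR Z m) (Some s) (Some t) = sle Z s t"
 by (simp_all add: times_euclidean_def cone_def)

definition cyl :: "('a, 's) strat_space => nat => real => (nat => real) => (nat => real) => ((real \<times> 'a) option \<times> (nat => real)) set" where
 "cyl Z m rh p q = {(c, x):cpt Z m. rad c < rh & (ALL j<m. p j < x j & x j < q j)}"

lemma CR_coord: "continuous_map (pts (CR Z m)) eur (%(c, x). x i)" "continuous_map (pts (CR Z m)) eur (%(c, x). rad c)"
 using continuous_map_compose[OF continuous_map_snd Euclidean_proj, of "cone_topology (pts Z)" m i]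
 continuous_map_compose[OF continuous_map_fst rad_continuous, of "pts Z" "ES m"] by (simp_all add: o_def case_prod_beta')

lemma openin_preimage: "continuous_map T eur f ==> open S ==> openin T {x:topspace T. f x:S}" using openin_continuous_map_preimage[of T eur f S] by simp

lemma openin_cyl: "openin (pts (CR Z m)) (cyl Z m rh p q)"
proof -
 let ?T = "pts (CR Z m)"
 have fin: "openin ?T {y:topspace ?T. ALL j<k. p j < snd y j & snd y j < q j}" for k
 proof (induction k)
 case 0 show ?case by (simp del: CR_simps)
 next
 case (Suc k)
 have "openin ?T {y:topspace ?T. (%(c, x). x k) y:{p k<..<q k}}" by (rule openin_preimage[OF CR_coord(1)]) simp
 hence "openin ?T ({y:topspace ?T. ALL j<k. p j < snd y j & snd y j < q j} Int {y:topspace ?T. (%(c, x). x k) y:{p k<..<q k}})"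
 using Suc by (rule openin_Int[rotated])
 moreover have "... = {y:topspace ?T. ALL j<Suc k. p j < snd y j & snd y j < q j}" by (auto simp: less_Suc_eq case_prod_beta')
 ultimately show ?case by simp
 qed
 have "openin ?T {y:topspace ?T. (%(c, x). rad c) y:{..<rh}}" by (rule openin_preimage[OF CR_coord(2)]) simp
 hence "openin ?T ({y:topspace ?T. (%(c, x). rad c) y:{..<rh}} Int {y:topspace ?T. ALL j<m. p j < snd y j & snd y j < q j})" using fin by (rule openin_Int)
 moreover have "... = cyl Z m rh p q" unfolding cyl_def by auto
 ultimately show ?thesis by simp
qed

lemma openin_half_line: "openin (top_of_set {0::real..}) {0..<rh}"
proof -
 have "{0..<rh} = {0..} Int {..<rh}" by auto
 thus ?thesis using openin_open_Int[OF open_lessThan] by simp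
qed

text \<open>The radius is reparametrized by \<open>rh * s / (1 + s)\<close> and each coordinate by a
  logistic function onto its interval, so a cylinder is a copy of the whole cone times Euclidean
  space; strata are untouched.\<close>

lemma cyl_chart:
 assumes rh: "rh > 0" and pq: "!!j. j < m ==> p j < q j"
 shows "EX be. semb (CR Z m) (CR Z m) be & be ` cpt Z m = cyl Z m rh p q"
proof -
 let ?T = "pts (CR Z m)" let ?f = "%s. rh * s / (1 + s)" and ?g = "%s. s / (rh - s)"
 define u where "u j t = p j + (q j - p j) * exp t / (1 + exp t)" for j and t :: real
 define w where "w j t = ln ((t - p j) / (q j - t))" for j and t :: real
 define be where "be = (%(c :: (real \<times> 'a) option, x). (cone_scale ?f c, %j. if j < m then u j (x j) else 0))"
 define ga where "ga = (%(c :: (real \<times> 'a) option, x). (cone_scale ?g c, %j. if j < m then w j (x j) else 0))"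
 have e: "1 + exp t~=0" "1 + exp t > 0" for t :: real using exp_gt_zero[of t] by linarith+
 have uc: "continuous_on UNIV (u j)" for j unfolding u_def using e by (intro continuous_intros) auto
 have up: "p j < u j t & u j t < q j" if "j < m" for j t
 proof -
 have "0 < (q j - p j) * exp t" "(q j - p j) * exp t < (q j - p j) * (1 + exp t)" using pq[OF that] by (auto simp: algebra_simps)
 hence "0 < (q j - p j) * exp t / (1 + exp t)" "(q j - p j) * exp t / (1 + exp t) < q j - p j" using e(2)[of t] by (simp_all add: field_simps)
 thus ?thesis unfolding u_def by linarith
 qed
 have wu: "w j (u j t) = t" if "j < m" for j t
 proof -
 have d: "q j - p j~=0" using pq[OF that] by simp
 have "u j t - p j = (q j - p j) * exp t / (1 + exp t)" unfolding u_def by simp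
 moreover have "q j - u j t = (q j - p j) / (1 + exp t)" unfolding u_def using e[of t] by (simp add: field_simps)
 ultimately have "(u j t - p j) / (q j - u j t) = exp t" using d e[of t] by simp
 thus ?thesis unfolding w_def by simp
 qed
 have uw: "u j (w j t) = t" if "j < m" "p j < t" "t < q j" for j t
 proof -
 have E: "exp (w j t) = (t - p j) / (q j - t)" unfolding w_def using that by simp
 moreover have E1: "1 + (t - p j) / (q j - t) = (q j - p j) / (q j - t)" using that by (simp add: field_simps)
 have "exp (w j t) / (1 + exp (w j t)) = (t - p j) / (q j - p j)" unfolding E E1 using that by simp
 hence "(q j - p j) * exp (w j t) / (1 + exp (w j t)) = (q j - p j) * ((t - p j) / (q j - p j))" by (metis times_divide_eq_right)
 thus ?thesis unfolding u_def using pq[OF that(1)] by simp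
 qed
 have fc: "continuous_map (cone_topology (pts Z)) (cone_topology (pts Z)) (cone_scale ?f)"
 proof -
 have "continuous_map (subtopology (cone_topology (pts Z)) {c. rad c:{0..}}) (cone_topology (pts Z)) (cone_scale ?f)"
 by (rule cone_scale_continuous) (use rh in "auto intro!: continuous_intros")
 moreover have "subtopology (cone_topology (pts Z)) {c. rad c:{0..}} = cone_topology (pts Z)" by (rule subtopology_superset) (use rad_ge in auto)
 ultimately show ?thesis by simp
 qed
 have gc: "continuous_map (subtopology (cone_topology (pts Z)) {c. rad c:{0..<rh}}) (cone_topology (pts Z)) (cone_scale ?g)"
 by (rule cone_scale_continuous[OF openin_half_line]) (auto intro!: continuous_intros)
 have b1: "continuous_map ?T ?T be" unfolding be_def case_prod_beta' CR_simps
 proof (intro continuous_map_pairedI)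
 show "continuous_map (prod_topology (cone_topology (pts Z)) (ES m)) (cone_topology (pts Z)) (%z. cone_scale ?f (fst z))"
 using continuous_map_compose[OF continuous_map_fst fc, of "ES m"] by (simp add: o_def)
 show "continuous_map (prod_topology (cone_topology (pts Z)) (ES m)) (ES m) (%z j. if j < m then u j (snd z j) else 0)"
 unfolding continuous_map_componentwise_Euclidean_space
 proof (intro allI impI)
 fix j
 have "continuous_map eur eur (u j)" using uc by simp
 thus "continuous_map (prod_topology (cone_topology (pts Z)) (ES m)) eur (%z. u j (snd z j))"
 using continuous_map_compose[OF CR_coord(1)[of Z m j], of eur "u j"] by (simp add: o_def case_prod_beta')
 qed
 qed
 let ?S = "subtopology ?T (cyl Z m rh p q)"
 have b2: "continuous_map ?S ?T ga" unfolding ga_def case_prod_beta' CR_simps(1)[of Z m]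
 proof (intro continuous_map_pairedI)
 have "continuous_map ?S (cone_topology (pts Z)) fst" using continuous_map_from_subtopology[OF continuous_map_fst] by simp
 hence "continuous_map ?S (subtopology (cone_topology (pts Z)) {c. rad c:{0..<rh}}) fst"
 unfolding continuous_map_in_subtopology using rad_ge by (auto simp: cyl_def)
 from continuous_map_compose[OF this gc]
 show "continuous_map (subtopology (prod_topology (cone_topology (pts Z)) (ES m)) (cyl Z m rh p q)) (cone_topology (pts Z)) (%z. cone_scale ?g (fst z))"
 by (simp add: o_def)
 show "continuous_map (subtopology (prod_topology (cone_topology (pts Z)) (ES m)) (cyl Z m rh p q)) (ES m) (%z j. if j < m then w j (snd z j) else 0)"
 unfolding continuous_map_componentwise_Euclidean_space
 proof (intro allI impI)
 fix j assume j: "j < m"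
 have "continuous_on {p j<..<q j} (w j)" unfolding w_def by (intro continuous_intros) auto
 hence 1: "continuous_map (top_of_set {p j<..<q j}) eur (w j)" by simp
 have "continuous_map ?S eur (%z. snd z j)" using continuous_map_from_subtopology[OF CR_coord(1)[of Z m j]] by (simp add: case_prod_beta')
 hence "continuous_map ?S (top_of_set {p j<..<q j}) (%z. snd z j)" unfolding continuous_map_in_subtopology using j by (auto simp: cyl_def)
 from continuous_map_compose[OF this 1]
 show "continuous_map (subtopology (prod_topology (cone_topology (pts Z)) (ES m)) (cyl Z m rh p q)) eur (%z. w j (snd z j))" by (simp add: o_def)
 qed
 qed
 have fg: "?g (?f s) = s" "?f s < rh" "0 < ?f s" if "s > 0" for s
 proof -
 have "rh - ?f s = rh / (1 + s)" using that by (simp add: field_simps)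
 hence "?g (?f s) = s * (rh / (1 + s)) / (rh / (1 + s))" by simp
 moreover have "rh / (1 + s)~=0" using that rh by simp
 ultimately show "?g (?f s) = s" by (metis nonzero_mult_div_cancel_right)
 qed (use that rh in "auto simp: field_simps")
 have gf: "?f (?g s) = s" if "0 < s" "s < rh" for s
 proof -
 have "1 + ?g s = rh / (rh - s)" using that by (simp add: field_simps)
 thus ?thesis using that rh by (simp add: field_simps)
 qed
 have ET: "topspace (ES m) = {x. ALL i>=m. x i = 0}" by (rule topspace_Euclidean_space)
 have in1: "be y:cyl Z m rh p q" and in2: "ga (be y) = y" if "y:topspace ?T" for y
 using that up fg rh wu unfolding be_def ga_def cyl_def by (auto simp: topspace_cone ET fun_eq_iff)
 have in3: "be (ga y) = y" if "y:cyl Z m rh p q" for y using that uw gf unfolding be_def ga_def cyl_def by (auto simp: topspace_cone ET fun_eq_iff)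
 note em = open_embedding[OF b1 openin_cyl b2 in1 in2 in3]
 have st: "strat (CR Z m) (be y) = strat (CR Z m) y" for y unfolding be_def by (cases y; cases "fst y") auto
 have "semb (CR Z m) (CR Z m) be" unfolding semb_def by (intro conjI b1 em(1,2) exI[of _ "%a. a"]) (auto simp: st simp del: CR_simps)
 thus ?thesis using em(3) by blast
qed

lemma inv_continuous:
 assumes "continuous_map X Y f" "open_map X Y f" "inj_on f (topspace X)"
 shows "continuous_map (subtopology Y (f ` topspace X)) X (inv_into (topspace X) f)" unfolding continuous_map_def
proof (intro conjI allI impI)
 show "inv_into (topspace X) f:topspace (subtopology Y (f ` topspace X)) \<rightarrow> topspace X" by (auto intro: inv_into_into)
 fix U assume U: "openin X U"
 have "{y:topspace (subtopology Y (f ` topspace X)). inv_into (topspace X) f y:U} = f ` U Int f ` topspace X"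
 proof (intro equalityI subsetI)
 fix y assume "y:{y:topspace (subtopology Y (f ` topspace X)). inv_into (topspace X) f y:U}"
 hence y: "y:f ` topspace X" "inv_into (topspace X) f y:U" by auto
 thus "y:f ` U Int f ` topspace X" using f_inv_into_f[OF y(1)] by (metis IntI imageI)
 next
 fix y assume "y:f ` U Int f ` topspace X"
 then obtain u where u: "u:U" "y = f u" by blast
 have "u:topspace X" using openin_subset[OF U] u by blast
 thus "y:{y:topspace (subtopology Y (f ` topspace X)). inv_into (topspace X) f y:U}" using u assms(1,3) unfolding continuous_map_def by auto
 qed
 moreover have "openin Y (f ` U)" using assms(2) U unfolding open_map_def by blast
 ultimately show "openin (subtopology Y (f ` topspace X)) {y:topspace (subtopology Y (f ` topspace X)). inv_into (topspace X) f y:U}"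
 unfolding openin_subtopology by auto
qed

text \<open>Order of the coordinates in the source: \<open>n\<close> from the chart of the link,
  then the logarithmic radius, then the \<open>m\<close> coordinates already there.\<close>

definition kappa :: "nat => nat => ('b \<times> (nat => real) => 'a) => 'b \<times> (nat => real) => (real \<times> 'a) option \<times> (nat => real)" where
 "kappa n m py = (%(c, y). (Some (exp (y n), py (c, %i. if i < n then y i else 0)), %j. if j < m then y (n + 1 + j) else 0))"

text \<open>A chart of \<open>Z\<close> gives a chart of \<open>C(Z) \<times> \<real>\<^sup>m\<close> away from the cone point, whose coordinate \<open>n\<close> is the logarithm of the radius.\<close>

lemma kappa_chart:
 fixes n m :: nat
 assumes py: "semb (CR Z' n) Z py"
 defines "k == n + 1 + m"
 shows "semb (CR Z' k) (CR Z m) (kappa n m py)"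
 "kappa n m py ` topspace (pts (CR Z' k)) = {(c, x):cpt Z m. 0 < rad c & snd (the c):py ` topspace (pts (CR Z' n))}"
proof -
 let ?A = "pts (CR Z' n)" let ?X = "pts (CR Z' k)" let ?Y = "pts (CR Z m)"
 let ?N = "{(c, x):topspace ?Y. 0 < rad c & snd (the c):py ` topspace ?A}"
 define py' where "py' = inv_into (topspace ?A) py"
 have pyc: "continuous_map ?A (pts Z) py" "open_map ?A (pts Z) py" "inj_on py (topspace ?A)" using py unfolding semb_def by blast+
 have py'c: "continuous_map (subtopology (pts Z) (py ` topspace ?A)) ?A py'" unfolding py'_def by (rule inv_continuous[OF pyc])
 have py'e: "py' (py y) = y" if "y:topspace ?A" for y unfolding py'_def using pyc(3) that by simp
 have pypy': "py (py' w) = w" "py' w:topspace ?A" if "w:py ` topspace ?A" for w unfolding py'_def using that by (simp_all add: f_inv_into_f inv_into_into)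
 have pyt: "py y:pt Z" if "y:topspace ?A" for y using pyc(1) that unfolding continuous_map_def by blast
 define g where "g = (%z :: (real \<times> 'c) option \<times> (nat => real). (fst (py' (snd (the (fst z)))),
 %i. if i < k then (if i < n then snd (py' (snd (the (fst z)))) i else if i = n then ln (fst (the (fst z))) else snd z (i - (n + 1))) else 0))"
 have tr: "(c, %i. if i < n then y i else 0):topspace ?A" if "(c, y):topspace ?X" for c y using that by (auto simp: topspace_Euclidean_space)
 have co: "continuous_map ?X eur (%z. snd z i)" for i using CR_coord(1)[of Z' k i] by (simp add: case_prod_beta')
 have f1: "continuous_map ?X ?A (%z. (fst z, %i. if i < n then snd z i else 0))" unfolding CR_simps(1)[of Z' n]
 by (intro continuous_map_pairedI) (use co in "auto simp: continuous_map_componentwise_Euclidean_space continuous_map_fst")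
 have f2: "continuous_map ?X (prod_topology (top_of_set {0..}) (pts Z)) (%z. (exp (snd z n), py (fst z, %i. if i < n then snd z i else 0)))"
 proof (intro continuous_map_pairedI)
 have "continuous_map eur (top_of_set {0..}) (exp :: real => real)" by (auto simp: continuous_map_in_subtopology intro!: continuous_intros)
 from continuous_map_compose[OF co this] show "continuous_map ?X (top_of_set {0..}) (%z. exp (snd z n))" by (simp add: o_def)
 from continuous_map_compose[OF f1 pyc(1)] show "continuous_map ?X (pts Z) (%z. py (fst z, %i. if i < n then snd z i else 0))" by (simp add: o_def)
 qed
 have f: "continuous_map ?X ?Y (kappa n m py)" unfolding kappa_def case_prod_beta' CR_simps(1)[of Z m]
 proof (intro continuous_map_pairedI)
 from continuous_map_compose[OF f2 cone_quot_continuous]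
 show "continuous_map ?X (cone_topology (pts Z)) (%z. Some (exp (snd z n), py (fst z, %i. if i < n then snd z i else 0)))" by (simp add: o_def cone_quot_def)
 show "continuous_map ?X (ES m) (%z j. if j < m then snd z (n + 1 + j) else 0)" unfolding continuous_map_componentwise_Euclidean_space using co by blast
 qed
 let ?P = "{z:topspace ?Y. (%(c, x). rad c) z:{0<..}}"
 have P: "openin ?Y ?P" by (rule openin_preimage[OF CR_coord(2)]) simp
 have th0: "continuous_map (subtopology ?Y ?P) (prod_topology eur (pts Z)) (%z. the (fst z))"
 proof -
 have "continuous_map (subtopology ?Y ?P) (cone_topology (pts Z)) fst" using continuous_map_from_subtopology[OF continuous_map_fst] by simp
 hence "continuous_map (subtopology ?Y ?P) (subtopology (cone_topology (pts Z)) {c. 0 < rad c}) fst" unfolding continuous_map_in_subtopology by auto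
 from continuous_map_compose[OF this the_continuous] show ?thesis by (simp add: o_def)
 qed
 have N: "openin ?Y ?N"
 proof -
 have "openin (prod_topology eur (pts Z)) (UNIV \<times> py ` topspace ?A)"
 using pyc(2) unfolding open_map_def by (simp add: openin_prod_Times_iff del: CR_simps)
 from openin_continuous_map_preimage[OF th0 this] have "openin ?Y {z:topspace (subtopology ?Y ?P). the (fst z):UNIV \<times> py ` topspace ?A}"
 using openin_trans_full P by blast
 moreover have "{z:topspace (subtopology ?Y ?P). the (fst z):UNIV \<times> py ` topspace ?A} = ?N" by (auto simp: mem_Times_iff case_prod_beta')
 ultimately show ?thesis by simp
 qed
 let ?S = "subtopology ?Y ?N"
 have NP: "?N <= ?P" by auto
 have th: "continuous_map ?S (prod_topology eur (pts Z)) (%z. the (fst z))" using continuous_map_from_subtopology_mono[OF th0 NP] .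
 have th1: "continuous_map ?S (top_of_set {0<..}) (%z. fst (the (fst z)))"
 using continuous_map_compose[OF th continuous_map_fst] unfolding continuous_map_in_subtopology by (auto simp: o_def topspace_cone)
 have th2: "continuous_map ?S ?A (%z. py' (snd (the (fst z))))"
 proof -
 have "continuous_map ?S (subtopology (pts Z) (py ` topspace ?A)) (%z. snd (the (fst z)))"
 using continuous_map_compose[OF th continuous_map_snd] unfolding continuous_map_in_subtopology by (auto simp: o_def simp del: CR_simps)
 from continuous_map_compose[OF this py'c] show ?thesis by (simp add: o_def)
 qed
 have gc: "continuous_map ?S ?X g" unfolding g_def CR_simps(1)[of Z' k]
 proof (intro continuous_map_pairedI)
 from continuous_map_compose[OF th2[unfolded CR_simps(1)[of Z' n]] continuous_map_fst]
 show "continuous_map ?S (cone_topology (pts Z')) (%z. fst (py' (snd (the (fst z)))))" by (simp add: o_def)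
 have x: "continuous_map ?S eur (%z. snd z i)" for i using continuous_map_from_subtopology[OF CR_coord(1)[of Z m i]] by (simp add: case_prod_beta')
 have l: "continuous_map ?S eur (%z. ln (fst (the (fst z))))"
 proof -
 have "continuous_map (top_of_set {0<..}) eur (ln :: real => real)" by (auto intro!: continuous_intros)
 from continuous_map_compose[OF th1 this] show ?thesis by (simp add: o_def)
 qed
 have a: "continuous_map ?S eur (%z. snd (py' (snd (the (fst z)))) i)" for i
 using continuous_map_compose[OF th2 CR_coord(1)[of Z' n i]] by (simp add: o_def case_prod_beta')
 show "continuous_map ?S (ES k) (%z i. if i < k then (if i < n then snd (py' (snd (the (fst z)))) i
 else if i = n then ln (fst (the (fst z))) else snd z (i - (n + 1))) else 0)" unfolding continuous_map_componentwise_Euclidean_space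
 proof (intro allI impI)
 fix i
 show "continuous_map ?S eur (%z. if i < n then snd (py' (snd (the (fst z)))) i
 else if i = n then ln (fst (the (fst z))) else snd z (i - (n + 1)))"
 using a[of i] l x[of "i - (n + 1)"] by (cases "i < n"; cases "i = n") (simp_all del: CR_simps)
 qed
 qed
 have i1: "kappa n m py y:?N" if y: "y:topspace ?X" for y
 proof -
 obtain c x where cx: "y = (c, x)" by (cases y)
 have "kappa n m py y:topspace ?Y" using f y unfolding continuous_map_def by blast
 thus ?thesis using tr[of c x] y unfolding cx kappa_def by (simp del: CR_simps)
 qed
 have i2: "g (kappa n m py y) = y" if y: "y:topspace ?X" for y
 proof -
 obtain c x where cx: "y = (c, x)" by (cases y)
 have x0: "x i = 0" if "i >= k" for i using y that unfolding cx by (auto simp: topspace_Euclidean_space)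
 show ?thesis using py'e[OF tr[of c x]] y x0 unfolding cx kappa_def g_def by (auto simp: fun_eq_iff k_def simp del: CR_simps)
 qed
 have i3: "kappa n m py (g y) = y" if y: "y:?N" for y
 proof -
 obtain s z x where sz: "y = (Some (s, z), x)" "s > 0" "z:py ` topspace ?A" "ALL i>=m. x i = 0" using y by (auto simp: topspace_cone topspace_Euclidean_space)
 obtain c a where ca: "py' z = (c, a)" by (cases "py' z")
 have "(%i. if i < n then a i else 0) = a" using pypy'(2)[OF sz(3)] unfolding ca by (auto simp: topspace_Euclidean_space fun_eq_iff)
 moreover have "(%i. if i < n then if i < k then a i else 0 else 0) = (%i. if i < n then a i else 0)" by (auto simp: k_def)
 ultimately show ?thesis using pypy'(1)[OF sz(3)] sz ca unfolding kappa_def g_def by (auto simp: k_def fun_eq_iff cong: if_cong)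
 qed
 note em = open_embedding[OF f N gc i1 i2 i3]
 show "kappa n m py ` topspace ?X = ?N" by (rule em(3))
 obtain h where h: "h:strata (CR Z' n) \<rightarrow> strata Z" "inj_on h (strata (CR Z' n))"
 "ALL a:strata (CR Z' n). ALL b:strata (CR Z' n). sle (CR Z' n) a b <-> sle Z (h a) (h b)"
 "ALL y:topspace ?A. strat Z (py y) = h (strat (CR Z' n) y)" using py unfolding semb_def by blast
 have ss: "strata (CR Z' k) = strata (CR Z' n)" "sle (CR Z' k) = sle (CR Z' n)" by (simp_all add: times_euclidean_def)
 show "semb (CR Z' k) (CR Z m) (kappa n m py)" unfolding semb_def ss
 proof (intro conjI f em(1,2) exI[of _ "%a. Some (h a)"] ballI)
 show "(%a. Some (h a)):strata (CR Z' n) \<rightarrow> strata (CR Z m)" using h(1) by auto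
 show "inj_on (%a. Some (h a)) (strata (CR Z' n))" using h(2) unfolding inj_on_def by blast
 show "sle (CR Z' n) a b = sle (CR Z m) (Some (h a)) (Some (h b))" if "a:strata (CR Z' n)" "b:strata (CR Z' n)" for a b
 using h(3) that by (simp del: CR_simps add: CR_simps(6))
 fix y assume y: "y:topspace ?X"
 obtain c x where cx: "y = (c, x)" by (cases y)
 show "strat (CR Z m) (kappa n m py y) = Some (h (strat (CR Z' k) y))"
 using h(4)[rule_format, OF tr[of c x]] y unfolding cx kappa_def by (simp del: CR_simps(1,2))
 qed
qed

section \<open>Local constructibility on cones\<close>

text \<open>Constructibility near each point, phrased with charts instead of disks so that it passes
  along embeddings. Isomorphic disks appear as two charts with the same source.\<close>

definition lcp :: "('a, 's) strat_space => ('a set => 'a set => bool) => bool" where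
 "lcp Y E <-> (ALL y:pt Y. EX U. openin (pts Y) U & y:U &
 (ALL (Z :: (real, real) strat_space) n ph ph'. conical_manifold_real Z --> compact_space (pts Z) -->
 semb (CR Z n) Y ph --> semb (CR Z n) Y ph' -->
 ph ` cpt Z n <= ph' ` cpt Z n --> ph' ` cpt Z n <= U -->
 E (ph ` cpt Z n) (ph' ` cpt Z n)))"

lemma sembD:
 assumes "semb Y X ph"
 shows "continuous_map (pts Y) (pts X) ph" "open_map (pts Y) (pts X) ph" "inj_on ph (pt Y)"
 "!!y. y:pt Y ==> ph y:pt X" "openin (pts X) (ph ` pt Y)" using assms openin_topspace[of "pts Y"] unfolding semb_def continuous_map_def open_map_def by blast+

text \<open>Charts of \<open>Y\<close> become charts of \<open>X\<close> by composition with
  \<open>py\<close>, and neighbourhoods are pulled back.\<close>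

lemma (in weiss_system) lcp_pull:
 assumes X: "T = pts X" and py: "semb Y X py" and l: "lcp X E"
 shows "lcp Y (pull_E (pts Y) py)" unfolding lcp_def
proof (intro ballI)
 fix y assume y: "y:pt Y"
 note s = sembD[OF py]
 obtain U where U: "openin (pts X) U" "py y:U" "!!(Z :: (real, real) strat_space) n ph ph'. conical_manifold_real Z ==> compact_space (pts Z) ==>
 semb (CR Z n) X ph ==> semb (CR Z n) X ph' ==>
 ph ` cpt Z n <= ph' ` cpt Z n ==> ph' ` cpt Z n <= U ==>
 E (ph ` cpt Z n) (ph' ` cpt Z n)" using l[unfolded lcp_def, rule_format, OF s(4)[OF y]] by (elim exE conjE) (simp del: CR_simps)
 let ?U = "{y:pt Y. py y:U}"
 show "EX U. openin (pts Y) U & y:U & (ALL (Z :: (real, real) strat_space) n ph ph'. conical_manifold_real Z --> compact_space (pts Z) -->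
 semb (CR Z n) Y ph --> semb (CR Z n) Y ph' -->
 ph ` cpt Z n <= ph' ` cpt Z n --> ph' ` cpt Z n <= U -->
 pull_E (pts Y) py (ph ` cpt Z n) (ph' ` cpt Z n))"
 proof (intro exI[of _ ?U] conjI allI impI)
 show "openin (pts Y) ?U" by (rule openin_continuous_map_preimage[OF s(1) U(1)])
 show "y:?U" using y U(2) by simp
 fix Z :: "(real, real) strat_space" and n ph ph'
 let ?T = "cpt Z n"
 assume a: "conical_manifold_real Z" "compact_space (pts Z)" "semb (CR Z n) Y ph" "semb (CR Z n) Y ph'" "ph ` ?T <= ph' ` ?T" "ph' ` ?T <= ?U"
 have "E ((py o ph) ` ?T) ((py o ph') ` ?T)"
 proof (rule U(3)[OF a(1,2) semb_compose[OF py a(3)] semb_compose[OF py a(4)]])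
 show "(py o ph) ` ?T <= (py o ph') ` ?T" unfolding image_comp[symmetric] by (rule image_mono[OF a(5)])
 show "(py o ph') ` ?T <= U" using a(6) by auto
 qed
 thus "pull_E (pts Y) py (ph ` ?T) (ph' ` ?T)" unfolding pull_E_def image_comp using sembD(5)[OF a(3)] sembD(5)[OF a(4)] a(5) by blast
 qed
qed

lemma finite_radius:
 assumes "!!j. j < m ==> EX e>0. ALL t. \<bar>t - x j\<bar> < e --> t:X j"
 shows "EX e>0. ALL j<m. ALL t::real. \<bar>t - x j\<bar> < e --> t:X (j::nat)" using assms
proof (induction m)
 case 0 show ?case by (intro exI[of _ 1]) auto
next
 case (Suc m)
 obtain e where e: "e > 0" "ALL j<m. ALL t. \<bar>t - x j\<bar> < e --> t:X j" using Suc by auto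
 obtain d where d: "d > 0" "ALL t. \<bar>t - x m\<bar> < d --> t:X m" using Suc.prems[of m] by auto
 have "ALL j<Suc m. ALL t. \<bar>t - x j\<bar> < min e d --> t:X j" using e d by (auto simp: less_Suc_eq)
 thus ?case using e(1) d(1) by (intro exI[of _ "min e d"]) simp
qed

text \<open>Compactness of the link gives, by the tube lemma, one radius for all its points;
  finitely many coordinates admit a common \<open>ep\<close>.\<close>

lemma apex_cyl:
 assumes Z: "compact_space (pts Z)" and G: "openin (pts (CR Z m)) G" "(None, x):G"
 shows "EX rh>0. EX ep>0. cyl Z m rh (%j. x j - ep) (%j. x j + ep) <= G"
proof -
 obtain U V where UV: "openin (cone_topology (pts Z)) U" "openin (ES m) V" "None:U" "x:V" "U \<times> V <= G"
 using G(1)[unfolded CR_simps openin_prod_topology_alt, rule_format, OF G(2)] by blast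
 let ?W = "{z:{0..} \<times> pt Z. cone_quot z:U}"
 have W: "openin (prod_topology (top_of_set {0..}) (pts Z)) ?W" using UV(1) unfolding openin_cone_topology by blast
 have C: "compactin (pts Z) (pt Z)" using Z unfolding compact_space_def .
 have s: "{0} \<times> pt Z <= ?W" using UV(3) by (auto simp: cone_quot_def)
 obtain A B where AB: "openin (top_of_set {0::real..}) A" "0:A" "pt Z <= B" "A \<times> B <= ?W" using tube_lemma_right[OF W C _ s] by auto
 obtain O' where O': "open O'" "A = {0..} Int O'" using AB(1) unfolding openin_open by blast
 have "0:O'" using AB(2) O'(2) by simp
 then obtain rh where rh: "rh > 0" "!!s. \<bar>s\<bar> < rh ==> s:O'" using O'(1) unfolding open_dist by (auto simp: dist_real_def)
 obtain S where S: "openin (powertop_real UNIV) S" "V = S Int {x. ALL i>=m. x i = 0}" using UV(2) unfolding Euclidean_space_def openin_subtopology by blast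
 have xS: "x:S" "!!i. i >= m ==> x i = 0" using UV(4) S(2) by auto
 obtain X where X: "!!i. x i:X i" "!!i. open (X i)" "(\<Pi>\<^sub>E i\<in>UNIV. X i) <= S"
 using product_topology_open_contains_basis[OF S(1) xS(1)] by (auto simp: PiE_UNIV_domain)
 have "EX e>0. ALL t. \<bar>t - x j\<bar> < e --> t:X j" for j using X(1,2)[of j] unfolding open_dist dist_real_def by blast
 then obtain ep where ep: "ep > 0" "ALL j<m. ALL t. \<bar>t - x j\<bar> < ep --> t:X j" using finite_radius[of m x X] by blast
 have "cyl Z m rh (%j. x j - ep) (%j. x j + ep) <= G"
 proof
 fix w assume w: "w:cyl Z m rh (%j. x j - ep) (%j. x j + ep)"
 obtain c y where cy: "w = (c, y)" by (cases w)
 have b: "c:topspace (cone_topology (pts Z))" "ALL i>=m. y i = 0" "rad c < rh" "!!j. j < m ==> x j - ep < y j & y j < x j + ep"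
 using w unfolding cy cyl_def by (auto simp: topspace_Euclidean_space)
 have "y i:X i" for i
 proof (cases "i < m")
 case True thus ?thesis using b(4)[of i] ep(2) by (simp add: abs_less_iff)
 next
 case False thus ?thesis using b(2) xS(2)[of i] X(1)[of i] by simp
 qed
 hence "y:V" using X(3) b(2) unfolding S(2) by auto
 moreover have "c:U"
 proof (cases c)
 case None thus ?thesis using UV(3) by simp
 next
 case (Some z)
 hence z: "fst z > 0" "snd z:pt Z" using b(1) unfolding topspace_cone by auto
 hence "fst z:A" using rh(2)[of "fst z"] b(3) Some O'(2) by simp
 hence "z:A \<times> B" using subsetD[OF AB(3) z(2)] by (simp add: mem_Times_iff)
 hence "z:?W" by (rule subsetD[OF AB(4)])
 thus ?thesis using Some z by (simp add: cone_quot_def)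
 qed
 ultimately show "w:G" using UV(5) cy by blast
 qed
 thus ?thesis using rh(1) ep(1) by blast
qed

section \<open>Slabs off the cone stratum\<close>

abbreviation "away Z m == {w:cpt Z m. 0 < rad (fst w)}"
text \<open>The pairs \<open>pc i\<close>, \<open>vc i\<close> and \<open>pr\<close>,
  \<open>vr\<close> describe coordinate slabs and radial slabs. Setting a coordinate to 0 or the
  radius to 1 keeps the projections inside the same space, as \<open>slab\<close> requires.\<close>

abbreviation "pc i == (%w :: (real \<times> 'a) option \<times> (nat => real). (fst w, (snd w)(i := 0)))"
abbreviation "vc i == (%w :: (real \<times> 'a) option \<times> (nat => real). snd w i)"
abbreviation "pr == (%w :: (real \<times> 'a) option \<times> (nat => real). (Some (1 :: real, snd (the (fst w))), snd w))"
abbreviation "vr == (%w :: (real \<times> 'a) option \<times> (nat => real). ln (rad (fst w)))"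

text \<open>A form of \<open>slab\<close> free of any Weiss system, so that it can occur in a
  statement quantified over \<open>E\<close>.\<close>

definition slabs :: "'b topology => ('b => 'b) => ('b => real) => 'b set => real => real => 'b set" where
 "slabs T pj v H a b = {y:topspace T. pj y:H & a < v y & v y < b}"

lemma (in weiss_system) slab_slabs: "slab = slabs T" by (simp add: slab_def slabs_def fun_eq_iff)

text \<open>The inductive claim. All \<open>m\<close> and all \<open>E\<close> occur because a chart
  of the link changes the number of coordinates and pulls back the relation.\<close>

definition cone_slabs :: "(real, real) strat_space => bool" where
 "cone_slabs Z <-> (ALL m E i H a' a b b'. weiss_system (pts (CR Z m)) E --> lcp (CR Z m) E --> i < m -->
 openin (pts (CR Z m)) H --> a' <= a --> a < b --> b <= b' -->
 E (slabs (pts (CR Z m)) (pc i) (vc i) H a b) (slabs (pts (CR Z m)) (pc i) (vc i) H a' b'))"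

definition slab_base :: "(real, real) strat_space => bool" where
 "slab_base Z <-> (ALL z:pt Z. EX (Z' :: (real, real) strat_space) n py.
 cone_slabs Z' & semb (CR Z' n) Z py & z:py ` topspace (pts (CR Z' n)))"

lemma CR_fst_snd: "continuous_map (pts (CR Z m)) (cone_topology (pts Z)) fst" "continuous_map (pts (CR Z m)) eur (%w. snd w i)"
 "continuous_map (pts (CR Z m)) eur (%w. rad (fst w))" using continuous_map_fst CR_coord[of Z m] by (simp_all add: case_prod_beta')

lemma openin_away: "openin (pts (CR Z m)) (away Z m)" using openin_preimage[OF CR_fst_snd(3), of "{0<..}" Z m] by (simp del: CR_simps)

lemma pc_continuous: assumes "i < m" shows "continuous_map (pts (CR Z m)) (pts (CR Z m)) (pc i)"
proof -
 have e: "(snd w)(i := 0) = (%j. if j < m then (if j = i then 0 else snd w j) else 0)" if "w:cpt Z m" for w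
 using that assms by (auto simp: fun_eq_iff topspace_Euclidean_space)
 have "continuous_map (pts (CR Z m)) (pts (CR Z m)) (%w. (fst w, %j. if j < m then (if j = i then 0 else snd w j) else 0))" unfolding CR_simps(1)[of Z m]
 proof (intro continuous_map_pairedI continuous_map_fst)
 show "continuous_map (prod_topology (cone_topology (pts Z)) (ES m)) (ES m) (%w j. if j < m then (if j = i then 0 else snd w j) else 0)"
 unfolding continuous_map_componentwise_Euclidean_space
 proof (intro allI impI)
 fix j show "continuous_map (prod_topology (cone_topology (pts Z)) (ES m)) eur (%w. if j = i then 0 else snd w j)"
 using CR_fst_snd(2)[of Z m j] by (cases "j = i") simp_all
 qed
 qed
 thus ?thesis by (rule continuous_map_eq) (use e in "simp del: CR_simps")
qed

lemma away_continuous: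
 "i < m ==> continuous_map (subtopology (pts (CR Z m)) (away Z m)) (subtopology (pts (CR Z m)) (away Z m)) (pc i)"
 "continuous_map (subtopology (pts (CR Z m)) (away Z m)) (subtopology (pts (CR Z m)) (away Z m)) pr"
 "continuous_map (subtopology (pts (CR Z m)) (away Z m)) eur (vc i)"
 "continuous_map (subtopology (pts (CR Z m)) (away Z m)) eur vr"
proof -
 let ?T = "pts (CR Z m)" let ?S = "subtopology ?T (away Z m)"
 note f = CR_fst_snd[where Z = Z and m = m]
 show "continuous_map ?S ?S (pc i)" if i: "i < m"
 proof -
 have "pc i w:topspace ?T" if "w:topspace ?T" for w using pc_continuous[OF i, of Z] that unfolding continuous_map_def by blast
 thus ?thesis unfolding continuous_map_in_subtopology using continuous_map_from_subtopology[OF pc_continuous[OF i, of Z]] by (auto simp del: CR_simps)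
 qed
 show "continuous_map ?S eur (vc i)" by (rule continuous_map_from_subtopology[OF f(2)])
 have r: "continuous_map ?S (top_of_set {0<..}) (%w. rad (fst w))"
 unfolding continuous_map_in_subtopology using continuous_map_from_subtopology[OF f(3)] by (auto simp del: CR_simps)
 have "continuous_map (top_of_set {0<..}) eur (ln :: real => real)" by (auto intro!: continuous_intros)
 from continuous_map_compose[OF r this] show "continuous_map ?S eur vr" by (simp only: o_def)
 have c: "continuous_map ?S (subtopology (cone_topology (pts Z)) {c. 0 < rad c}) fst"
 unfolding continuous_map_in_subtopology using continuous_map_from_subtopology[OF f(1)] by (auto simp del: CR_simps)
 have th: "continuous_map ?S (pts Z) (%w. snd (the (fst w)))"
 using continuous_map_compose[OF continuous_map_compose[OF c the_continuous] continuous_map_snd] by (simp only: o_def)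
 have "continuous_map ?S (prod_topology (top_of_set {0::real..}) (pts Z)) (%w. (1, snd (the (fst w))))" by (intro continuous_map_pairedI th) auto
 from continuous_map_compose[OF this cone_quot_continuous]
 have q: "continuous_map ?S (cone_topology (pts Z)) (%w. Some (1, snd (the (fst w))))" by (simp add: o_def cone_quot_def del: CR_simps)
 have sn: "continuous_map ?S (ES m) snd" by (rule continuous_map_from_subtopology) (simp add: continuous_map_snd)
 have p: "continuous_map ?S ?T pr" unfolding CR_simps(1)[of Z m] by (intro continuous_map_pairedI) (use q sn in "simp_all")
 hence "pr w:topspace ?T" if "w:topspace ?S" for w using that unfolding continuous_map_def by blast
 thus "continuous_map ?S ?S pr" unfolding continuous_map_in_subtopology[of ?S ?T] using p by (auto simp del: CR_simps)
qed

text \<open>Near a point off the cone stratum, \<open>kappa\<close> turns the slabs into coordinate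
  slabs over a cone on a smaller link, where the claim is already known. The index
  \<open>l n\<close> tells which coordinate of the chart is the height; this treats coordinate and
  radial slabs together.\<close>

lemma away_slabs:
 assumes W: "weiss_system (pts (CR Z m)) E" and l: "lcp (CR Z m) E" and Z: "slab_base Z"
 defines "S == subtopology (pts (CR Z m)) (away Z m)"
 assumes pj: "continuous_map S S pj" and v: "continuous_map S eur v"
 and rel: "!!n (Z' :: (real, real) strat_space) py y. semb (CR Z' n) Z py ==> y:topspace (pts (CR Z' (n + 1 + m))) ==>
 v (kappa n m py y) = snd y (l n) & pj (kappa n m py y) = kappa n m py (pc (l n) y)"
 and ln: "!!n. l n < n + 1 + m"
 and sat: "!!w. w:away Z m ==> snd (the (fst (pj w))) = snd (the (fst w))"
 and H: "openin S H" and ab: "a' <= a" "a < b" "b <= b'"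
 shows "E (slabs S pj v H a b) (slabs S pj v H a' b')"
proof -
 let ?T = "pts (CR Z m)"
 interpret weiss_system ?T E by (rule W)
 have aw: "openin ?T (away Z m)" by (rule openin_away)
 have tS: "topspace S = away Z m" unfolding S_def by (auto simp del: CR_simps)
 have oS: "openin S U <-> openin ?T U & U <= away Z m" for U unfolding S_def using openin_open_subtopology[OF aw] by blast
 have "weiss_system S (pull_E S (%x. x))"
 proof (rule pull_weiss_system)
 show "continuous_map S ?T (%x. x)" unfolding S_def by (rule continuous_map_from_subtopology) simp
 show "open_map S ?T (%x. x)" unfolding open_map_def oS by simp
 qed simp
 then interpret S: weiss_system S "pull_E S (%x. x)" .
 have loc: "S.slab_local pj v" unfolding S.slab_local_def
 proof (intro ballI allI)
 fix z t assume "z:topspace S"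
 hence z: "z:away Z m" unfolding tS .
 hence "snd (the (fst z)):pt Z" by (auto simp: topspace_cone)
 then obtain Z' :: "(real, real) strat_space" and n py where py: "cone_slabs Z'" "semb (CR Z' n) Z py" "snd (the (fst z)):py ` topspace (pts (CR Z' n))"
 using Z unfolding slab_base_def by blast
 let ?k = "n + 1 + m" let ?ka = "kappa n m py" let ?X = "pts (CR Z' ?k)"
 let ?N = "?ka ` topspace ?X"
 note ka = kappa_chart[OF py(2), where m = m]
 note kas = sembD[OF ka(1)]
 have Nin: "w:?N <-> w:away Z m & snd (the (fst w)):py ` topspace (pts (CR Z' n))" for w unfolding ka(2) by (auto simp del: CR_simps)
 have Na: "?N <= away Z m" using Nin by blast
 have pjz: "pj w:away Z m" if "w:away Z m" for w using pj that unfolding continuous_map_def tS by blast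
 have wk: "weiss_system ?X (pull_E ?X ?ka)" by (rule pull_weiss_system[OF kas(1-3)])
 have lk: "lcp (CR Z' ?k) (pull_E ?X ?ka)" by (rule lcp_pull[OF refl ka(1) l])
 have main: "pull_E S (%x. x) (S.slab pj v H a b) (S.slab pj v H a' b')"
 if H: "openin S H" "H <= ?N" and ab: "a' <= a" "a < b" "b <= b'" for H a' a b b'
 proof -
 let ?H = "{y:topspace ?X. ?ka y:H}"
 have HT: "openin ?T H" using H(1) oS by blast
 have "openin ?X ?H" by (rule openin_continuous_map_preimage[OF kas(1) HT])
 hence e: "pull_E ?X ?ka (slabs ?X (pc (l n)) (vc (l n)) ?H a b) (slabs ?X (pc (l n)) (vc (l n)) ?H a' b')"
 using py(1)[unfolded cone_slabs_def, rule_format, OF wk lk ln _ ab] by blast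
 have im: "?ka ` slabs ?X (pc (l n)) (vc (l n)) ?H c d = slabs S pj v H c d" for c d
 proof (intro equalityI subsetI)
 fix w assume "w:?ka ` slabs ?X (pc (l n)) (vc (l n)) ?H c d"
 then obtain y where y: "y:slabs ?X (pc (l n)) (vc (l n)) ?H c d" "w = ?ka y" by blast
 hence y': "y:topspace ?X" "?ka (pc (l n) y):H" "c < vc (l n) y" "vc (l n) y < d" unfolding slabs_def by blast+
 have "w:topspace S" using y' y(2) Na unfolding tS by blast
 thus "w:slabs S pj v H c d" using rel[OF py(2) y'(1)] y'(2-4) y(2) unfolding slabs_def by simp
 next
 fix w assume w: "w:slabs S pj v H c d"
 hence w': "w:away Z m" "pj w:H" "c < v w" "v w < d" unfolding slabs_def tS by blast+
 \<comment> \<open>The chart domain is described by the link point, which \<open>pj\<close>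
   preserves; so \<open>w\<close> itself lies in the chart and not only its projection.\<close>
 have "pj w:?N" using w'(2) H(2) by blast
 hence "snd (the (fst w)):py ` topspace (pts (CR Z' n))" unfolding Nin using sat[OF w'(1)] by simp
 then obtain y where y: "y:topspace ?X" "w = ?ka y" using Nin w'(1) by blast
 have "pc (l n) y:topspace ?X" using pc_continuous[where Z = Z', OF ln[of n]] y(1) unfolding continuous_map_def by blast
 hence "y:slabs ?X (pc (l n)) (vc (l n)) ?H c d" using rel[OF py(2) y(1)] w' y unfolding slabs_def by simp
 thus "w:?ka ` slabs ?X (pc (l n)) (vc (l n)) ?H c d" using y(2) by blast
 qed
 have "E (slabs S pj v H a b) (slabs S pj v H a' b')" using e unfolding pull_E_def im by blast
 moreover have "slabs S pj v H c d <= away Z m" for c d unfolding slabs_def tS by blast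
 ultimately show ?thesis unfolding S.slab_slabs unfolding pull_E_def[of S] oS using E_open by simp
 qed
 show "EX N. openin S N & pj z:N & (EX ep>0. ALL H. openin S H --> H <= N -->
 (ALL a' a b b'. t - ep < a' --> a' <= a --> a < b --> b <= b' --> b' < t + ep -->
 pull_E S (%x. x) (S.slab pj v H a b) (S.slab pj v H a' b')))"
 proof (intro exI[of _ ?N] exI[of _ 1] conjI allI impI)
 show "openin S ?N" using kas(5) Na oS by blast
 show "pj z:?N" unfolding Nin using pjz[OF z] sat[OF z] py(3) by simp
 show "(0::real) < 1" by simp
 qed (rule main)
 qed
 have "pull_E S (%x. x) (S.slab pj v H a b) (S.slab pj v H a' b')" by (rule S.slab_equivalence[OF pj v loc H ab])
 thus ?thesis unfolding pull_E_def S.slab_slabs by simp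
qed

lemma away_coord:
 assumes W: "weiss_system (pts (CR Z m)) E" "lcp (CR Z m) E" "slab_base Z" and i: "i < m"
 and H: "openin (pts (CR Z m)) H" "H <= away Z m" and ab: "a' <= a" "a < b" "b <= b'"
 shows "E (slabs (pts (CR Z m)) (pc i) (vc i) H a b) (slabs (pts (CR Z m)) (pc i) (vc i) H a' b')"
proof -
 let ?S = "subtopology (pts (CR Z m)) (away Z m)"
 have "E (slabs ?S (pc i) (vc i) H a b) (slabs ?S (pc i) (vc i) H a' b')"
 \<comment> \<open>In the chart the old coordinate \<open>i\<close> comes after the \<open>n\<close>
   coordinates of the link and the logarithmic radius.\<close>
 proof (rule away_slabs[where l = "%n. n + 1 + i", OF W away_continuous(1)[OF i] away_continuous(3)])
 show "vc i (kappa n m py y) = snd y (n + 1 + i) & pc i (kappa n m py y) = kappa n m py (pc (n + 1 + i) y)" for n py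
 and y :: "(real \<times> real) option \<times> (nat => real)" using i unfolding kappa_def by (cases y) (auto simp: fun_eq_iff intro!: arg_cong[where f = py])
 show "n + 1 + i < n + 1 + m" for n using i by simp
 show "openin ?S H" using H openin_open_subtopology[OF openin_away] by blast
 qed (use ab in simp_all)
 moreover have "slabs ?S (pc i) (vc i) H c d = slabs (pts (CR Z m)) (pc i) (vc i) H c d" for c d using H(2) unfolding slabs_def by (auto simp del: CR_simps)
 ultimately show ?thesis by simp
qed

lemma away_radial:
 assumes W: "weiss_system (pts (CR Z m)) E" "lcp (CR Z m) E" "slab_base Z"
 and H: "openin (pts (CR Z m)) H" "H <= away Z m" and ab: "a' <= a" "a < b" "b <= b'"
 defines "S == subtopology (pts (CR Z m)) (away Z m)"
 shows "E (slabs S pr vr H a b) (slabs S pr vr H a' b')" unfolding S_def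
proof (rule away_slabs[where l = "%n. n", OF W away_continuous(2) away_continuous(4)])
 show "vr (kappa n m py y) = snd y n & pr (kappa n m py y) = kappa n m py (pc n y)" for n py
 and y :: "(real \<times> real) option \<times> (nat => real)" unfolding kappa_def by (cases y) (auto simp: fun_eq_iff cong: if_cong)
 show "openin (subtopology (pts (CR Z m)) (away Z m)) H" using H openin_open_subtopology[OF openin_away] by blast
qed (use ab in simp_all)

text \<open>The projection puts coordinate \<open>i\<close> to 0, so the interval from -1 to 1 is no
  condition on it, and the height alone decides.\<close>

lemma slab_cyl:
 fixes Z :: "('a, 's) strat_space"
 assumes i: "i < m"
 shows "slabs (pts (CR Z m)) (pc i) (vc i) (cyl Z m rh (p(i := -1)) (q(i := 1))) a b = cyl Z m rh (p(i := a)) (q(i := b))"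
proof (rule set_eqI)
 fix w :: "(real \<times> 'a) option \<times> (nat => real)"
 let ?T = "cpt Z m"
 obtain c x where w: "w = (c, x)" by (cases w)
 have T: "pc i w:?T" if "w:?T" using pc_continuous[OF i, of Z] that unfolding continuous_map_def by blast
 have "(ALL j<m. (p(i := -1)) j < (x(i := 0)) j & (x(i := 0)) j < (q(i := 1)) j) <-> (ALL j<m. j~=i --> p j < x j & x j < q j)" by auto
 moreover have "(ALL j<m. (p(i := a)) j < x j & x j < (q(i := b)) j) <-> a < x i & x i < b & (ALL j<m. j~=i --> p j < x j & x j < q j)" using i by auto
 ultimately show "w:slabs (pts (CR Z m)) (pc i) (vc i) (cyl Z m rh (p(i := -1)) (q(i := 1))) a b <-> w:cyl Z m rh (p(i := a)) (q(i := b))"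
 using T unfolding slabs_def cyl_def w by (auto simp del: CR_simps fun_upd_apply)
qed

section \<open>Slabs across the cone stratum\<close>

lemma cyl_mono: "rh <= rh' ==> (!!j. j < m ==> p' j <= p j & q j <= q' j) ==> cyl Z m rh p q <= cyl Z m rh' p' q'"
 unfolding cyl_def by (fastforce simp del: CR_simps)

lemma cyl_empty: "~(rh > 0 & (ALL j<m. p j < q j)) ==> cyl Z m rh p q = {}"
proof -
 assume a: "~(rh > 0 & (ALL j<m. p j < q j))"
 have "w~:cyl Z m rh p q" for w
 proof
 assume w: "w:cyl Z m rh p q"
 hence "0 <= rad (fst w)" using rad_ge[of "fst w"] unfolding cyl_def by auto
 hence "rh > 0" using w unfolding cyl_def by auto
 moreover have "p j < q j" if "j < m" for j using w that unfolding cyl_def by (auto dest!: spec[of _ j] simp del: CR_simps)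
 ultimately show False using a by blast
 qed
 thus ?thesis by blast
qed

lemma cyl_Int: "cyl Z m rh p q Int cyl Z m rh' p' q' = cyl Z m (min rh rh') (%j. max (p j) (p' j)) (%j. min (q j) (q' j))"
 unfolding cyl_def by (auto simp del: CR_simps)

text \<open>Nonempty cylinders are images of charts whose source is the same cone, so inside
  \<open>U\<close> the local condition compares them directly.\<close>

lemma lcp_cyl:
 assumes Z: "conical_manifold_real Z" "compact_space (pts Z)"
 and U: "!!(Z :: (real, real) strat_space) n ph ph'. conical_manifold_real Z ==> compact_space (pts Z) ==>
 semb (CR Z n) (CR Z' m) ph ==> semb (CR Z n) (CR Z' m) ph' ==>
 ph ` cpt Z n <= ph' ` cpt Z n ==> ph' ` cpt Z n <= U ==>
 E (ph ` cpt Z n) (ph' ` cpt Z n)" "Z' = Z"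
 and b: "rh > 0" "rh' > 0" "!!j. j < m ==> p j < q j" "!!j. j < m ==> p' j < q' j" "cyl Z m rh p q <= cyl Z m rh' p' q'" "cyl Z m rh' p' q' <= U"
 shows "E (cyl Z m rh p q) (cyl Z m rh' p' q')"
proof -
 obtain be where be: "semb (CR Z m) (CR Z m) be" "be ` cpt Z m = cyl Z m rh p q" using cyl_chart[where p = p and q = q and Z = Z, OF b(1)] b(3) by blast
 obtain be' where be': "semb (CR Z m) (CR Z m) be'" "be' ` cpt Z m = cyl Z m rh' p' q'" using cyl_chart[where p = p' and q = q' and Z = Z, OF b(2)] b(4) by blast
 show ?thesis using U(1)[OF Z, of m be be'] unfolding U(2) be(2) be'(2) using be(1) be'(1) b(5,6) by blast
qed

text \<open>Slabs are compared locally. Off the cone stratum this is \<open>away_coord\<close>. A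
  neighbourhood of a point on the stratum also contains points off it, so the basis there mixes
  small cylinders, compared by local constructibility, with open sets that avoid the
  stratum.\<close>

lemma cone_slabs_step:
 assumes Z: "conical_manifold_real Z" "compact_space (pts Z)" "slab_base Z"
 shows "cone_slabs Z" unfolding cone_slabs_def
proof (intro allI impI)
 fix m E i H a' a b b'
 let ?T = "pts (CR Z m)" let ?S = "slabs ?T (pc i) (vc i)"
 assume W: "weiss_system ?T E" and l: "lcp (CR Z m) E" and i: "i < m" and H: "openin ?T H" and ab: "a' <= a" "a < b" "b <= (b' :: real)"
 interpret weiss_system ?T E by (rule W)
 have pT: "pc i w:topspace ?T" if "w:topspace ?T" for w using pc_continuous[OF i, of Z] that unfolding continuous_map_def by blast
 have "slab_local (pc i) (vc i)" unfolding slab_local_def slab_slabs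
 proof (intro ballI allI)
 fix z t assume z: "z:topspace ?T"
 obtain c x0 where cx: "z = (c, x0)" by (cases z)
 show "EX N. openin ?T N & pc i z:N & (EX ep>0. ALL H. openin ?T H --> H <= N -->
 (ALL a' a b b'. t - ep < a' --> a' <= a --> a < b --> b <= b' --> b' < t + ep --> E (?S H a b) (?S H a' b')))"
 proof (cases c)
 case (Some u)
 have "fst u > 0" using z unfolding cx Some by (auto simp: topspace_cone)
 hence "pc i z:away Z m" using pT[OF z] unfolding cx Some by (simp del: CR_simps)
 thus ?thesis by (intro exI[of _ "away Z m"] exI[of _ 1] conjI allI impI openin_away) (simp_all add: away_coord[OF W l Z(3) i] del: CR_simps)
 next
 case None
 \<comment> \<open>Slabs near level \<open>t\<close> over the projection of \<open>z\<close>
   surround the point whose coordinate \<open>i\<close> is \<open>t\<close>, so the neighbourhood is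
   taken there.\<close>
 let ?y = "(None, x0(i := t))"
 have yT: "?y:topspace ?T" using z i unfolding cx None by (auto simp: topspace_Euclidean_space topspace_cone)
 obtain U where U: "openin ?T U" "?y:U" "!!(Z' :: (real, real) strat_space) n ph ph'. conical_manifold_real Z' ==> compact_space (pts Z') ==>
 semb (CR Z' n) (CR Z m) ph ==> semb (CR Z' n) (CR Z m) ph' ==>
 ph ` topspace (pts (CR Z' n)) <= ph' ` topspace (pts (CR Z' n)) ==> ph' ` topspace (pts (CR Z' n)) <= U ==>
 E (ph ` topspace (pts (CR Z' n))) (ph' ` topspace (pts (CR Z' n)))" using l[unfolded lcp_def, rule_format, OF yT] by (elim exE conjE) (simp del: CR_simps)
 obtain rh0 ep where rh0: "rh0 > 0" "ep > 0" "cyl Z m rh0 (%j. (x0(i := t)) j - ep) (%j. (x0(i := t)) j + ep) <= U" using apex_cyl[OF Z(2) U(1,2)] by blast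
 define P where "P = (%j. x0 j - ep)" define Q where "Q = (%j. x0 j + ep)"
 let ?N = "cyl Z m rh0 (P(i := -1)) (Q(i := 1))"
 define small where "small rh p q <-> rh <= rh0 & (ALL j<m. j~=i --> P j <= p j & q j <= Q j)" for rh and p q :: "nat => real"
 \<comment> \<open>Closed under intersections: two cylinders meet in a cylinder, and an intersection
   with a set off the cone stratum stays off it.\<close>
 define Ov where "Ov = {cyl Z m rh (p(i := -1)) (q(i := 1)) |rh p q. small rh p q} Un {G. openin ?T G & G <= away Z m}"
 have main: "E (?S H a b) (?S H a' b')" if H: "openin ?T H" "H <= ?N" and t: "t - ep < a'" "b' < t + ep" and ab: "a' <= a" "a < b" "b <= b'" for H a' a b b'
 proof -
 have s: "?S H c d = {w:{w:topspace ?T. c < vc i w & vc i w < d}. pc i w:H}" for H c d unfolding slabs_def by blast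
 have o: "openin ?T {w:topspace ?T. c < vc i w & vc i w < d}" for c d using openin_preimage[OF CR_fst_snd(2), of "{c<..<d}" Z m i] by (simp del: CR_simps)
 have "E {w:{w:topspace ?T. a < vc i w & vc i w < b}. pc i w:H} {w:{w:topspace ?T. a' < vc i w & vc i w < b'}. pc i w:H}"
 proof (rule basis_local[where Ov = Ov, OF pc_continuous[OF i] _ _ o o _ H(1)])
 show "openin ?T G" if "G:Ov" for G using that openin_cyl unfolding Ov_def by blast
 show "{w:topspace ?T. a < vc i w & vc i w < b} <= {w:topspace ?T. a' < vc i w & vc i w < b'}" using ab by auto
 show "G Int G':Ov" if G: "G:Ov" "G':Ov" for G G'
 proof (cases "G <= away Z m | G' <= away Z m")
 case True
 have "openin ?T G" "openin ?T G'" using G openin_cyl unfolding Ov_def by blast+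
 thus ?thesis using True unfolding Ov_def by blast
 next
 case False
 then obtain rh p q rh' p' q' where g: "small rh p q" "small rh' p' q'" "G = cyl Z m rh (p(i := -1)) (q(i := 1))" "G' = cyl Z m rh' (p'(i := -1)) (q'(i := 1))"
 using G unfolding Ov_def by blast
 define p'' where "p'' = (%j. max (p j) (p' j))" define q'' where "q'' = (%j. min (q j) (q' j))"
 have "small (min rh rh') p'' q''" using g(1,2) unfolding small_def p''_def q''_def by auto
 moreover have "(%j. max ((p(i := -1)) j) ((p'(i := -1)) j)) = p''(i := -1)" "(%j. min ((q(i := 1)) j) ((q'(i := 1)) j)) = q''(i := 1)"
 unfolding p''_def q''_def by auto
 ultimately show ?thesis unfolding g(3,4) cyl_Int Ov_def by auto
 qed
 show "E {w:{w:topspace ?T. a < vc i w & vc i w < b}. pc i w:G} {w:{w:topspace ?T. a' < vc i w & vc i w < b'}. pc i w:G}"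
 if G: "G:Ov" for G unfolding s[symmetric]
 proof (cases "G <= away Z m")
 case True
 have "openin ?T G" using G openin_cyl unfolding Ov_def by blast
 thus "E (?S G a b) (?S G a' b')" using away_coord[OF W l Z(3) i _ True ab] by blast
 next
 case False
 then obtain rh p q where g: "small rh p q" "G = cyl Z m rh (p(i := -1)) (q(i := 1))" using G unfolding Ov_def by blast
 show "E (?S G a b) (?S G a' b')" unfolding g(2) slab_cyl[OF i]
 \<comment> \<open>The basis contains degenerate boxes, as intersections do arise; their slabs are
   empty on both sides.\<close>
 proof (cases "rh > 0 & (ALL j<m. j~=i --> p j < q j)")
 case True
 have sU: "cyl Z m rh (p(i := a')) (q(i := b')) <= U" by (rule subset_trans[OF cyl_mono rh0(3)]) (use g(1) t in "auto simp: small_def P_def Q_def")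
 have mono: "cyl Z m rh (p(i := a)) (q(i := b)) <= cyl Z m rh (p(i := a')) (q(i := b'))" by (rule cyl_mono) (use ab in auto)
 show "E (cyl Z m rh (p(i := a)) (q(i := b))) (cyl Z m rh (p(i := a')) (q(i := b')))"
 proof (rule lcp_cyl[where U = U and Z' = Z, OF Z(1,2) _ refl _ _ _ _ mono sU])
 show "rh > 0" "rh > 0" using True by blast+
 show "(p(i := a)) j < (q(i := b)) j" "(p(i := a')) j < (q(i := b')) j" if "j < m" for j using True ab that by auto
 qed (rule U(3))
 next
 case False
 hence "cyl Z m rh (p(i := c)) (q(i := d)) = {}" for c d by (intro cyl_empty) auto
 thus "E (cyl Z m rh (p(i := a)) (q(i := b))) (cyl Z m rh (p(i := a')) (q(i := b')))" using E_refl[OF openin_empty] by simp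
 qed
 qed
 fix y G assume y: "y:topspace ?T" and G: "openin ?T G" "G <= H" "pc i y:G"
 obtain c' x' where y': "y = (c', x')" by (cases y)
 show "EX G':Ov. pc i y:G' & (ALL w:topspace ?T. pc i w:G' --> pc i w:G)"
 proof (cases c')
 case (Some u)
 have "fst u > 0" using y unfolding y' Some by (auto simp: topspace_cone)
 hence "pc i y:away Z m" using pT[OF y] unfolding y' Some by (simp del: CR_simps)
 moreover have "openin ?T (G Int away Z m)" using G(1) openin_away by blast
 ultimately show ?thesis using G(3) unfolding Ov_def by (intro bexI[of _ "G Int away Z m"]) blast+
 next
 case None
 have "(None, x'(i := 0)):G" using G(3) unfolding y' None by simp
 then obtain rh1 ep1 where e1: "rh1 > 0" "ep1 > 0" "cyl Z m rh1 (%j. (x'(i := 0)) j - ep1) (%j. (x'(i := 0)) j + ep1) <= G"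
 using apex_cyl[OF Z(2) G(1)] by blast
 \<comment> \<open>The bounds \<open>P\<close> and \<open>Q\<close> keep the cylinder small, while
   the bounds from \<open>ep1\<close> keep it inside \<open>G\<close> after projection.\<close>
 define p where "p j = max (x' j - ep1) (P j)" for j define q where "q j = min (x' j + ep1) (Q j)" for j
 let ?G = "cyl Z m (min rh0 rh1) (p(i := -1)) (q(i := 1))"
 have "pc i y:?N" using G(2,3) H(2) by blast
 hence N: "P j < x' j & x' j < Q j" if "j < m" "j~=i" for j using that unfolding y' cyl_def by (auto simp del: CR_simps dest!: spec[of _ j])
 show ?thesis
 proof (rule bexI[of _ ?G])
 have "small (min rh0 rh1) p q" unfolding small_def p_def q_def by auto
 thus "?G:Ov" unfolding Ov_def by blast
 have y1: "pc i y:?G" unfolding cyl_def using pT[OF y] N e1 rh0 unfolding y' None p_def q_def by (auto simp del: CR_simps)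
 have "pc i w:G" if w: "w:topspace ?T" "pc i w:?G" for w
 proof -
 obtain c x where cx: "w = (c, x)" by (cases w)
 have "rad c < rh1" "!!j. j < m ==> j~=i ==> p j < x j & x j < q j" using w(2) unfolding cx cyl_def by (auto simp del: CR_simps split: if_splits)
 hence "pc i w:cyl Z m rh1 (%j. (x'(i := 0)) j - ep1) (%j. (x'(i := 0)) j + ep1)"
 using pT[OF w(1)] e1(2) unfolding cx cyl_def p_def q_def by (auto simp del: CR_simps)
 thus ?thesis using e1(3) by blast
 qed
 thus "pc i y:?G & (ALL w:topspace ?T. pc i w:?G --> pc i w:G)" using y1 by blast
 qed
 qed
 qed
 thus ?thesis unfolding s .
 qed
 show ?thesis
 proof (intro exI[of _ ?N] exI[of _ ep] conjI allI impI openin_cyl)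
 show "pc i z:?N" using pT[OF z] rh0(1,2) unfolding cx None cyl_def P_def Q_def by (auto simp del: CR_simps)
 show "0 < ep" by (rule rh0(2))
 qed (rule main)
 qed
 qed
 from slab_equivalence[OF pc_continuous[OF i] CR_fst_snd(2) this H ab]
 show "E (?S H a b) (?S H a' b')" unfolding slab_slabs .
qed

section \<open>Charts of disks and the induction over links\<close>

lemma semb_of_iso:
 assumes X: "stratified_space X" and D: "openin (pts X) D" and i: "strat_iso (strat_restrict X D) Y"
 obtains ph where "semb Y X ph" "ph ` pt Y = D"
proof -
 let ?S = "strat X ` (pt X Int D)"
 have DX: "D <= pt X" "pt X Int D = D" using openin_subset[OF D] by blast+
 obtain f g where fg: "homeomorphic_map (pts (strat_restrict X D)) (pts Y) f" "bij_betw g (strata (strat_restrict X D)) (strata Y)"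
 "ALL a:strata (strat_restrict X D). ALL b:strata (strat_restrict X D). sle (strat_restrict X D) a b <-> sle Y (g a) (g b)"
 "ALL x:topspace (pts (strat_restrict X D)). strat Y (f x) = g (strat (strat_restrict X D) x)" using i unfolding strat_iso_def by blast
 have f: "homeomorphic_map (subtopology (pts X) D) (pts Y) f" and g: "bij_betw g ?S (strata Y)"
 "!!a b. a:?S ==> b:?S ==> sle X a b <-> sle Y (g a) (g b)" "!!x. x:D ==> strat Y (f x) = g (strat X x)" using fg DX unfolding strat_restrict_def by auto
 obtain f' where f': "homeomorphic_maps (subtopology (pts X) D) (pts Y) f f'" using f unfolding homeomorphic_map_maps by blast
 have c: "continuous_map (pts Y) (pts X) f'" "continuous_map (subtopology (pts X) D) (pts Y) f"
 "!!y. y:pt Y ==> f' y:D" "!!y. y:pt Y ==> f (f' y) = y" "!!x. x:D ==> f' (f x) = x"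
 using f' DX unfolding homeomorphic_maps_def continuous_map_in_subtopology by auto
 note em = open_embedding[OF c(1) D c(2-5)]
 define h where "h = inv_into ?S g"
 have h: "h s:?S" "g (h s) = s" if "s:strata Y" for s using that g(1) unfolding h_def bij_betw_def by (metis inv_into_into, metis f_inv_into_f)
 have hg: "h (g a) = a" if "a:?S" for a using g(1) that unfolding h_def bij_betw_def by (simp add: inv_into_f_f)
 have SX: "?S <= strata X" using X unfolding stratified_space_def by blast
 have "semb Y X f'" unfolding semb_def
 proof (intro conjI c(1) em(1,2) exI[of _ h] ballI)
 show "h:strata Y \<rightarrow> strata X" using h(1) SX by blast
 show "inj_on h (strata Y)" by (rule inj_on_inverseI[of _ g]) (rule h(2))
 show "sle Y a b = sle X (h a) (h b)" if "a:strata Y" "b:strata Y" for a b using g(2)[OF h(1)[OF that(1)] h(1)[OF that(2)]] h(2) that by simp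
 show "strat X (f' y) = h (strat Y y)" if y: "y:pt Y" for y
 proof -
 have "strat X (f' y):?S" using c(3)[OF y] DX by blast
 thus ?thesis using g(3)[OF c(3)[OF y]] c(4)[OF y] hg by simp
 qed
 qed
 thus ?thesis using that em(3) by blast
qed

text \<open>Induction over manifolds and disks at once. Finiteness of the strata is carried along: a
  compact manifold is covered by finitely many disks, and a disk has one stratum more than its link.
  It is needed to match the strata of two charts.\<close>

lemma manifold_slab_base:
 "(conical_manifold_real M --> slab_base M & (compact_space (pts M) --> finite (strata M))) &
 (conical_disk_real D --> finite (strata D) & (EX (Z :: (real, real) strat_space) n. cone_slabs Z & strat_iso D (CR Z n)))"
proof (induction rule: conical_manifold_real_conical_disk_real.induct)
 case (manifold M)
 have d: "EX D. openin (pts M) D & x:D & finite (strata (strat_restrict M D)) &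
 (EX (Z :: (real, real) strat_space) n. cone_slabs Z & strat_iso (strat_restrict M D) (CR Z n))" if "x:pt M" for x
 using manifold(4)[rule_format, OF openin_topspace that] by blast
 show ?case
 proof
 show "slab_base M" unfolding slab_base_def
 proof
 fix x assume "x:pt M"
 then obtain D and Z :: "(real, real) strat_space" and n where D: "openin (pts M) D" "x:D" "cone_slabs Z" "strat_iso (strat_restrict M D) (CR Z n)" using d by blast
 obtain ph where "semb (CR Z n) M ph" "ph ` cpt Z n = D" by (rule semb_of_iso[OF manifold(1) D(1,4)])
 thus "EX (Z :: (real, real) strat_space) n py. cone_slabs Z & semb (CR Z n) M py & x:py ` cpt Z n" using D(2,3) by blast
 qed
 show "compact_space (pts M) --> finite (strata M)"
 proof
 assume C: "compact_space (pts M)"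
 obtain D where D: "!!x. x:pt M ==> openin (pts M) (D x) & x:D x & finite (strata (strat_restrict M (D x)))" using d by metis
 have DO: "ALL U:D ` pt M. openin (pts M) U" and DT: "pt M <= \<Union>(D ` pt M)" using D by blast+
 obtain F where F: "finite F" "F <= D ` pt M" "pt M <= \<Union>F"
 using C[unfolded compact_space_def compactin_def, THEN conjunct2, rule_format, of "D ` pt M"] DO DT by blast
 have "strata M = strat M ` pt M" using manifold(1) unfolding stratified_space_def by simp
 also have "... <= (\<Union>U\<in>F. strat M ` (pt M Int U))" using F(3) by blast
 finally have "strata M <= (\<Union>U\<in>F. strat M ` (pt M Int U))" .
 moreover have "finite (strat M ` (pt M Int U))" if "U:F" for U using that F(2) D by (auto simp: strat_restrict_def)
 ultimately show "finite (strata M)" using F(1) by (meson finite_UN_I finite_subset)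
 qed
 qed
next
 case (disk D Z n)
 hence "cone_slabs Z" "finite (strata Z)" using cone_slabs_step by blast+
 moreover have "finite (strata D)"
 proof -
 obtain g where "bij_betw g (strata D) (strata (CR Z n))" using disk(4) unfolding strat_iso_def by blast
 thus ?thesis using bij_betw_finite calculation(2) by fastforce
 qed
 ultimately show ?case using disk(4) by blast
qed

section \<open>Equivalence of isomorphic disks\<close>

lemma cyl_cong: "(!!j. j < m ==> p j = p' j & q j = q' j) ==> cyl Z m rh p q = cyl Z m rh p' q'"
 using cyl_mono[of rh rh m p p' q' q Z] cyl_mono[of rh rh m p' p q q' Z] by fastforce

section \<open>Exhaustion of a chart by cylinders\<close>

context
 fixes Z :: "(real, real) strat_space" and m E
 assumes Z: "slab_base Z" "cone_slabs Z" and W: "weiss_system (pts (CR Z m)) E" and l: "lcp (CR Z m) E"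
begin

text \<open>Coordinates are widened one at a time, each step being a comparison of coordinate slabs
  over a cylinder.\<close>

lemma cyl_coords:
 assumes "!!j. j < m ==> p' j <= p j & p j < q j & q j <= q' j" and "k <= m"
 shows "E (cyl Z m rh p q) (cyl Z m rh (%j. if j < k then p' j else p j) (%j. if j < k then q' j else q j))" using assms(2)
proof (induction k)
 case 0
 interpret weiss_system "pts (CR Z m)" E by (rule W)
 show ?case using E_refl[OF openin_cyl] by simp
next
 case (Suc k)
 interpret weiss_system "pts (CR Z m)" E by (rule W)
 define P where "P = (%j. if j < k then p' j else p j)" define Q where "Q = (%j. if j < k then q' j else q j)"
 have k: "k < m" using Suc by simp
 have e: "(%j. if j < Suc k then p' j else p j) = P(k := p' k)" "(%j. if j < Suc k then q' j else q j) = Q(k := q' k)"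
 "P(k := p k) = P" "Q(k := q k) = Q" unfolding P_def Q_def by (auto simp: fun_eq_iff)
 have a: "p' k <= p k" "p k < q k" "q k <= q' k" using assms(1)[OF k] by auto
 have "E (cyl Z m rh (P(k := p k)) (Q(k := q k))) (cyl Z m rh (P(k := p' k)) (Q(k := q' k)))"
 using Z(2)[unfolded cone_slabs_def, rule_format, OF W l k openin_cyl a, of rh "P(k := -1)" "Q(k := 1)"] unfolding slab_cyl[OF k] .
 thus ?case using Suc.IH k E_trans unfolding e P_def[symmetric] Q_def[symmetric] by (metis less_imp_le)
qed

text \<open>Once the coordinates are widened, \<open>cut\<close> enlarges the radius: between two
  positive radii a cylinder is a slab for the logarithmic radius.\<close>

lemma cyl_change:
 assumes rh: "0 < rh" "rh <= rh'" and pq: "!!j. j < m ==> p' j <= p j & p j < q j & q j <= q' j"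
 shows "E (cyl Z m rh p q) (cyl Z m rh' p' q')"
proof -
 let ?T = "pts (CR Z m)"
 interpret weiss_system ?T E by (rule W)
 have 1: "E (cyl Z m rh p q) (cyl Z m rh p' q')"
 using cyl_coords[of p' p q q' m rh] pq cyl_cong[of m "%j. if j < m then p' j else p j" p' "%j. if j < m then q' j else q j" q' Z rh] by simp
 \<comment> \<open>\<open>rh' + 1\<close> exceeds both radii in play, and the bound 2 in
   \<open>?H\<close> is no condition because \<open>pr\<close> sets the radius to 1.\<close>
 let ?V = "cyl Z m (rh' + 1) p' q'" let ?H = "cyl Z m 2 p' q' Int away Z m"
 have V: "cyl Z m r p' q' = {w:?V. rad (fst w) < r}" if "r <= rh'" for r using that unfolding cyl_def by (auto simp del: CR_simps)
 have "E {w:?V. rad (fst w) < rh} {w:?V. rad (fst w) < rh'}"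
 proof (rule cut[OF openin_cyl CR_fst_snd(3) rh(2,1) order.refl])
 fix c assume c: "0 < c" "c < rh"
 let ?S = "subtopology ?T (away Z m)"
 have s: "{w:?V. c < rad (fst w) & rad (fst w) < r} = slabs ?S pr vr ?H (ln c) (ln r)" if r: "c < r" "r <= rh'" for r
 proof (rule set_eqI)
 fix w
 have pw: "pr w:topspace ?T" if "w:away Z m" using away_continuous(2)[of Z m] that unfolding continuous_map_def by (auto simp del: CR_simps)
 have H: "pr w:?H <-> (ALL j<m. p' j < snd w j & snd w j < q' j)" if "w:away Z m" using pw[OF that] unfolding cyl_def by (auto simp del: CR_simps)
 have lnr: "ln c < ln (rad (fst w)) <-> c < rad (fst w)" "ln (rad (fst w)) < ln r <-> rad (fst w) < r" if "w:away Z m" using that c r by simp_all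
 have tS: "topspace ?S = away Z m" by (auto simp del: CR_simps)
 show "w:{w:?V. c < rad (fst w) & rad (fst w) < r} <-> w:slabs ?S pr vr ?H (ln c) (ln r)"
 proof (cases "w:away Z m")
 case True
 hence "w:topspace ?T" by blast
 thus ?thesis using H[OF True] lnr[OF True] True r unfolding slabs_def tS cyl_def by (auto simp del: CR_simps)
 next
 case False
 thus ?thesis using c unfolding slabs_def tS cyl_def by (auto simp del: CR_simps)
 qed
 qed
 have H: "openin ?T ?H" by (intro openin_Int openin_cyl openin_away)
 have "ln c <= ln c" "ln c < ln rh" "ln rh <= ln rh'" using c rh by auto
 from away_radial[OF W l Z(1) H _ this]
 show "E {w:?V. c < rad (fst w) & rad (fst w) < rh} {w:?V. c < rad (fst w) & rad (fst w) < rh'}" using s[of rh] s[of rh'] c rh by simp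
 qed
 hence "E (cyl Z m rh p' q') (cyl Z m rh' p' q')" using V[OF rh(2)] V[of rh'] by simp
 thus ?thesis using 1 E_trans by blast
qed

text \<open>Growing cylinders form a Weiss cover, since a finite set lies in one of them, and a
  finite intersection is its smallest member. Each of them is compared with the given cylinder by
  \<open>cyl_change\<close>.\<close>

lemma cyl_exhaust:
 assumes rh: "0 < rh" and pq: "!!j. j < m ==> p j < q j"
 shows "E (cyl Z m rh p q) (cpt Z m)"
proof -
 let ?T = "pts (CR Z m)"
 interpret weiss_system ?T E by (rule W)
 define B where "B k = cyl Z m (rh + real k) (%j. p j - real k) (%j. q j + real k)" for k :: nat
 have mono: "B k <= B k'" if "k <= k'" for k k' unfolding B_def by (rule cyl_mono) (use that in auto)
 have EB: "E (cyl Z m rh p q) (B k)" for k unfolding B_def by (rule cyl_change) (use rh pq in auto)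
 have oB: "openin ?T (B k)" for k unfolding B_def by (rule openin_cyl)
 have sub: "cyl Z m rh p q <= B k" for k using EB E_open by blast
 show ?thesis
 proof (rule E_weiss[where Wv = "range B", OF openin_cyl openin_topspace openin_subset[OF openin_cyl]])
 show "weiss_cover ?T (topspace ?T) (range B)" unfolding weiss_cover_def
 proof (intro conjI ballI allI impI)
 fix S assume "finite S" "S <= topspace ?T"
 thus "EX W:range B. S <= W"
 proof (induction S)
 case (insert w S)
 then obtain k where k: "S <= B k" by blast
 obtain c x where w: "w = (c, x)" by (cases w)
 let ?K = "insert (rad c) ((%j. \<bar>p j - x j\<bar> + \<bar>x j - q j\<bar>) ` {..<m})"
 have fK: "finite ?K" by simp
 obtain n where n: "Max ?K < real n" using reals_Archimedean2 by blast
 hence nK: "r < real n" if "r:?K" for r using Max_ge[OF fK that] by linarith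
 have "rad c < rh + real n" using nK[of "rad c"] rh by simp
 moreover have "p j - real n < x j & x j < q j + real n" if "j < m" for j
 proof -
 have "\<bar>p j - x j\<bar> + \<bar>x j - q j\<bar> < real n" by (rule nK) (use that in blast)
 thus ?thesis by linarith
 qed
 ultimately have "w:B n" unfolding B_def cyl_def w using insert.prems w by (auto simp del: CR_simps)
 hence "insert w S <= B (max k n)" using k mono[of k "max k n"] mono[of n "max k n"] by auto
 thus ?case by blast
 qed blast
 qed (use oB openin_subset[OF oB] in auto)
 fix F assume F: "finite F" "F~={}" "F <= range B"
 then obtain K where K: "finite K" "F = B ` K" by (metis finite_subset_image)
 have Kn: "K~={}" using F(2) K(2) by blast
 have "\<Inter>F = B (Min K)"
 proof
 show "\<Inter>F <= B (Min K)" unfolding K(2) using Min_in[OF K(1) Kn] by blast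
 show "B (Min K) <= \<Inter>F" unfolding K(2) using mono Min_le[OF K(1)] by (intro INT_greatest) blast
 qed
 moreover have "cyl Z m rh p q Int B (Min K) = cyl Z m rh p q" using sub by blast
 ultimately show "E (cyl Z m rh p q Int \<Inter>F) (\<Inter>F)" using EB by simp
 qed
qed

end

lemma CR_strata_surj: assumes "stratified_space Z" shows "strat (CR Z n) ` cpt Z n = strata (CR Z n)"
proof -
 have s: "strat Z ` pt Z = strata Z" using assms unfolding stratified_space_def by blast
 have zero: "(%i. 0):topspace (ES n)" by (simp add: topspace_Euclidean_space)
 show ?thesis
 proof (intro equalityI subsetI)
 fix t assume "t:strata (CR Z n)"
 then consider "t = None" | a where "t = Some a" "a:strata Z" by auto
 thus "t:strat (CR Z n) ` cpt Z n"
 proof cases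
 case 1 thus ?thesis using zero by (intro image_eqI[of _ _ "(None, %i. 0)"]) (auto simp: topspace_cone)
 next
 case 2
 then obtain z where "z:pt Z" "a = strat Z z" using s by blast
 thus ?thesis using 2 zero by (intro image_eqI[of _ _ "(Some (1, z), %i. 0)"]) (auto simp: topspace_cone)
 qed
 qed (auto simp: topspace_cone s[symmetric])
qed

text \<open>Why the cone strata match: the smaller disk meets only strata met by the larger one, and
  both charts meet the same finite number of strata. So the sets of strata agree, hence so do their
  least elements.\<close>

theorem disks_equivalence:
 fixes Z :: "(real, real) strat_space"
 assumes W: "weiss_system (pts M) E" and l: "lcp M E" and Z: "conical_manifold_real Z" "compact_space (pts Z)"
 and ph: "semb (CR Z n) M ph" "semb (CR Z n) M ph'" "ph ` cpt Z n <= ph' ` cpt Z n"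
 shows "E (ph ` cpt Z n) (ph' ` cpt Z n)"
proof -
 let ?X = "pts (CR Z n)" let ?T = "topspace ?X" let ?S = "strata (CR Z n)"
 interpret weiss_system "pts M" E by (rule W)
 have Zb: "slab_base Z" "finite (strata Z)" using manifold_slab_base Z by blast+
 have Zs: "stratified_space Z" using Z(1) by (cases rule: conical_manifold_real.cases)
 have Zc: "cone_slabs Z" by (rule cone_slabs_step[OF Z Zb(1)])
 obtain g where g: "inj_on g ?S" "!!a b. a:?S ==> b:?S ==> sle (CR Z n) a b <-> sle M (g a) (g b)"
 "!!y. y:?T ==> strat M (ph y) = g (strat (CR Z n) y)" using ph(1) unfolding semb_def by blast
 obtain h where h: "inj_on h ?S" "!!a b. a:?S ==> b:?S ==> sle (CR Z n) a b <-> sle M (h a) (h b)"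
 "!!y. y:?T ==> strat M (ph' y) = h (strat (CR Z n) y)" using ph(2) unfolding semb_def by blast
 note surj = CR_strata_surj[OF Zs, of n]
 have gh: "g ` ?S <= h ` ?S"
 proof
 fix t assume "t:g ` ?S"
 then obtain s where s: "s:?S" "t = g s" by blast
 have "s:strat (CR Z n) ` ?T" unfolding surj by (rule s(1))
 then obtain y where y: "y:?T" "t = g (strat (CR Z n) y)" using s(2) by blast
 then obtain y' where y': "y':?T" "ph y = ph' y'" using ph(3) by blast
 have "t = h (strat (CR Z n) y')" using g(3)[OF y(1)] h(3)[OF y'(1)] y(2) y'(2) by simp
 thus "t:h ` ?S" using surj y'(1) by blast
 qed
 have fS: "finite ?S" using Zb(2) by simp
 have ghe: "g ` ?S = h ` ?S" by (rule card_subset_eq[OF finite_imageI[OF fS] gh]) (simp only: card_image[OF g(1)] card_image[OF h(1)])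
 have N: "None:?S" by simp
 obtain s where s: "s:?S" "h None = g s" using ghe N by blast
 obtain s' where s': "s':?S" "g None = h s'" using ghe N by blast
 \<comment> \<open>In the first chart \<open>None\<close> lies below every stratum, and in the
   second only \<open>None\<close> lies below \<open>None\<close>.\<close>
 have "sle M (g None) (g s)" using g(2)[OF N s(1)] by simp
 hence "sle (CR Z n) s' None" using h(2)[OF s'(1) N] s(2) s'(2) by simp
 hence s'N: "s' = None" by (cases s') auto
 have zero: "(%i. 0):topspace (ES n)" by (simp add: topspace_Euclidean_space)
 let ?y0 = "(None, %i. 0) :: (real \<times> real) option \<times> (nat => real)"
 have y0: "?y0:?T" using zero by (simp add: topspace_cone)
 obtain y1 where y1: "y1:?T" "ph ?y0 = ph' y1" using y0 ph(3) by blast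
 have "h (strat (CR Z n) y1) = h None" using g(3)[OF y0] h(3)[OF y1(1)] y1(2) s'(2) s'N by simp
 hence sy1: "strat (CR Z n) y1 = None" using h(1) N surj y1(1) unfolding inj_on_def by blast
 obtain x1 where x1: "y1 = (None, x1)" using sy1 by (cases y1) auto
 note c = sembD[OF ph(1)] and c' = sembD[OF ph(2)]
 have wk: "weiss_system ?X (pull_E ?X ph)" "weiss_system ?X (pull_E ?X ph')" by (rule pull_weiss_system[OF c(1-3)] pull_weiss_system[OF c'(1-3)])+
 have lk: "lcp (CR Z n) (pull_E ?X ph)" "lcp (CR Z n) (pull_E ?X ph')" by (rule lcp_pull[OF refl ph(1) l] lcp_pull[OF refl ph(2) l])+
 \<comment> \<open>The box of the larger chart is chosen inside the smaller disk, and then the box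
   of the smaller chart inside the image of that one; this gives four nested sets.\<close>
 let ?G' = "{y:?T. ph' y:ph ` ?T}"
 have "openin ?X ?G'" by (rule openin_continuous_map_preimage[OF c'(1) c(5)])
 moreover have "(None, x1):?G'" using y1 y0 unfolding x1 by (auto simp del: CR_simps intro!: image_eqI[of _ ph ?y0])
 ultimately obtain rh' ep' where b': "rh' > 0" "ep' > 0" "cyl Z n rh' (%j. x1 j - ep') (%j. x1 j + ep') <= ?G'" using apex_cyl[OF Z(2)] by blast
 let ?b' = "cyl Z n rh' (%j. x1 j - ep') (%j. x1 j + ep')"
 have y1b: "y1:?b'" using y1(1) b'(1,2) unfolding x1 cyl_def by (auto simp del: CR_simps)
 have oV: "openin (pts M) (ph' ` ?b')" by (rule c'(2)[unfolded open_map_def, rule_format, OF openin_cyl])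
 let ?G = "{y:?T. ph y:ph' ` ?b'}"
 have "openin ?X ?G" by (rule openin_continuous_map_preimage[OF c(1) oV])
 moreover have "?y0:?G" using y0 y1(2) y1b by (auto simp del: CR_simps)
 ultimately obtain rh ep where b: "rh > 0" "ep > 0" "cyl Z n rh (%j. 0 - ep) (%j. 0 + ep) <= ?G" using apex_cyl[OF Z(2), of n ?G "%i. 0"] by blast
 let ?b = "cyl Z n rh (%j. 0 - ep) (%j. 0 + ep)"
 have "pull_E ?X ph ?b ?T" by (rule cyl_exhaust[OF Zb(1) Zc wk(1) lk(1)]) (use b in auto)
 hence E1: "E (ph ` ?b) (ph ` ?T)" unfolding pull_E_def by blast
 have "pull_E ?X ph' ?b' ?T" by (rule cyl_exhaust[OF Zb(1) Zc wk(2) lk(2)]) (use b' in auto)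
 hence E2: "E (ph' ` ?b') (ph' ` ?T)" unfolding pull_E_def by blast
 have "ph ` ?b <= ph' ` ?b'" using b(3) by blast
 moreover have "ph' ` ?b' <= ph ` ?T" using b'(3) by blast
 ultimately show ?thesis using E_six[OF E1 E2 _ _ ph(3)] by blast
qed

section \<open>Restriction to open subsets and the final comparison\<close>

lemma strat_iso_trans:
 assumes "strat_iso X Y" "strat_iso Y Z" "strat X ` pt X <= strata X" shows "strat_iso X Z"
proof -
 obtain f g where f: "homeomorphic_map (pts X) (pts Y) f" "bij_betw g (strata X) (strata Y)"
 "ALL a:strata X. ALL b:strata X. sle X a b <-> sle Y (g a) (g b)" "ALL x:pt X. strat Y (f x) = g (strat X x)" using assms(1) unfolding strat_iso_def by blast
 obtain f' g' where f': "homeomorphic_map (pts Y) (pts Z) f'" "bij_betw g' (strata Y) (strata Z)"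
 "ALL a:strata Y. ALL b:strata Y. sle Y a b <-> sle Z (g' a) (g' b)" "ALL x:pt Y. strat Z (f' x) = g' (strat Y x)"
 using assms(2) unfolding strat_iso_def by blast
 have ft: "f x:pt Y" if "x:pt X" for x using homeomorphic_imp_surjective_map[OF f(1)] that by blast
 have st: "strat X x:strata X" if "x:pt X" for x using assms(3) that by blast
 have gt: "g a:strata Y" if "a:strata X" for a using f(2) that unfolding bij_betw_def by blast
 show ?thesis unfolding strat_iso_def by (rule exI[of _ "f' o f"], rule exI[of _ "g' o g"])
 (use f f' ft gt homeomorphic_map_compose[OF f(1) f'(1)] bij_betw_trans[OF f(2) f'(2)] in auto)
qed

lemma iso_of_semb:
 assumes ph: "semb Y X ph" and Y: "strat Y ` pt Y = strata Y"
 shows "strat_iso (strat_restrict X (ph ` pt Y)) Y" "strat_iso Y (strat_restrict X (ph ` pt Y))"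
proof -
 let ?T = "pt Y" let ?D = "ph ` ?T" let ?R = "strat_restrict X ?D"
 note c = sembD[OF ph]
 obtain g where g: "inj_on g (strata Y)" "ALL a:strata Y. ALL b:strata Y. sle Y a b <-> sle X (g a) (g b)"
 "ALL y:?T. strat X (ph y) = g (strat Y y)" using ph unfolding semb_def by blast
 have D: "pt X Int ?D = ?D" using c(4) by blast
 have R: "pts ?R = subtopology (pts X) ?D" "strata ?R = strat X ` ?D" "sle ?R = sle X" "strat ?R = strat X" unfolding strat_restrict_def using D by simp_all
 have sR: "strata ?R = g ` strata Y" unfolding R(2) Y[symmetric] image_image using g(3) by (intro image_cong) auto
 have bij: "bij_betw g (strata Y) (strata ?R)" unfolding sR using g(1) by (simp add: bij_betw_def)
 define py where "py = inv_into ?T ph"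
 have py: "py (ph y) = y" if "y:?T" for y unfolding py_def using c(3) that by simp
 have "homeomorphic_maps (pts Y) (pts ?R) ph py" unfolding homeomorphic_maps_def R(1)
 using inv_continuous[OF c(1-3)] c(1) py c(4) unfolding py_def[symmetric] by (auto simp: continuous_map_in_subtopology)
 hence h: "homeomorphic_map (pts Y) (pts ?R) ph" "homeomorphic_map (pts ?R) (pts Y) py" using homeomorphic_maps_map by blast+
 show "strat_iso Y ?R" unfolding strat_iso_def by (rule exI[of _ ph], rule exI[of _ g]) (use h(1) bij g R in auto)
 define g' where "g' = inv_into (strata Y) g"
 have g': "g' (g a) = a" if "a:strata Y" for a unfolding g'_def using g(1) that by simp
 have "bij_betw g' (strata ?R) (strata Y)" unfolding g'_def using bij by (rule bij_betw_inv_into)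
 moreover have "strat Y (py x) = g' (strat X x)" if "x:?D" for x
 proof -
 from that obtain y where y: "y:?T" "x = ph y" by blast
 hence "strat Y y:strata Y" unfolding Y[symmetric] by (intro imageI)
 thus ?thesis using y g(3) g' py[OF y(1)] by simp
 qed
 moreover have "sle X a b <-> sle Y (g' a) (g' b)" if "a:strata ?R" "b:strata ?R" for a b using that g(2) g' unfolding sR by auto
 ultimately show "strat_iso ?R Y" unfolding strat_iso_def by (intro exI[of _ py] exI[of _ g']) (use h(2) R D in auto)
qed

lemma stratified_restrict: assumes X: "stratified_space X" shows "stratified_space (strat_restrict X D)"
proof -
 let ?P = "strat X ` (pt X Int D)"
 have x: "reflp_on (strata X) (sle X)" "transp_on (strata X) (sle X)" "antisymp_on (strata X) (sle X)"
 "continuous_map (pts X) (alexandrov (strata X) (sle X)) (strat X)" "strat X ` pt X = strata X" using X unfolding stratified_space_def by blast+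
 have P: "?P <= strata X" using x(5) by blast
 have top: "topspace (alexandrov ?P (sle X)) = ?P"
 proof
 show "topspace (alexandrov ?P (sle X)) <= ?P" using openin_topspace[of "alexandrov ?P (sle X)"] unfolding openin_alexandrov by blast
 show "?P <= topspace (alexandrov ?P (sle X))" by (rule openin_subset) (auto simp: openin_alexandrov)
 qed
 have "continuous_map (subtopology (pts X) D) (alexandrov ?P (sle X)) (strat X)" unfolding continuous_map_def top
 proof (intro conjI allI impI)
 show "strat X:topspace (subtopology (pts X) D) \<rightarrow> ?P" by auto
 fix V assume V: "openin (alexandrov ?P (sle X)) V"
 \<comment> \<open>The upward closure of \<open>V\<close> among all strata; among the strata that
   meet \<open>D\<close> it adds nothing, since \<open>V\<close> is upward closed there.\<close>
 define V' where "V' = {b:strata X. EX a:V. sle X a b}"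
 have VP: "V <= ?P" "!!a b. a:V ==> b:?P ==> sle X a b ==> b:V" using V unfolding openin_alexandrov by blast+
 have "openin (alexandrov (strata X) (sle X)) V'" unfolding openin_alexandrov V'_def using x(2) VP(1) P unfolding transp_on_def by blast
 hence o: "openin (pts X) {y:pt X. strat X y:V'}" by (rule openin_continuous_map_preimage[OF x(4)])
 have "{y:topspace (subtopology (pts X) D). strat X y:V} = {y:pt X. strat X y:V'} Int D"
 proof (intro equalityI subsetI)
 fix y assume "y:{y:topspace (subtopology (pts X) D). strat X y:V}"
 hence y: "y:pt X" "y:D" "strat X y:V" by auto
 hence "strat X y:strata X" using x(5) by blast
 hence "strat X y:V'" using y(3) x(1) unfolding V'_def reflp_on_def by blast
 thus "y:{y:pt X. strat X y:V'} Int D" using y by blast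
 next
 fix y assume "y:{y:pt X. strat X y:V'} Int D"
 hence y: "y:pt X" "y:D" "strat X y:V'" by auto
 then obtain a where a: "a:V" "sle X a (strat X y)" unfolding V'_def by blast
 have "strat X y:V" using VP(2)[OF a(1) _ a(2)] y by blast
 thus "y:{y:topspace (subtopology (pts X) D). strat X y:V}" using y by auto
 qed
 thus "openin (subtopology (pts X) D) {y:topspace (subtopology (pts X) D). strat X y:V}" unfolding openin_subtopology using o by blast
 qed
 moreover have "reflp_on ?P (sle X)" "transp_on ?P (sle X)" "antisymp_on ?P (sle X)"
 by (rule reflp_on_subset[OF x(1) P] transp_on_subset[OF x(2) P] antisymp_on_subset[OF x(3) P])+
 ultimately show ?thesis unfolding stratified_space_def strat_restrict_def by simp
qed

lemma restrict_restrict: assumes "D <= U" shows "strat_restrict (strat_restrict X U) D = strat_restrict X D"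
proof -
 have "U Int D = D" "pt X Int U Int D = pt X Int D" using assms by blast+
 thus ?thesis unfolding strat_restrict_def by (simp add: subtopology_subtopology)
qed

lemma (in fact_algebra) eqv_weiss_system: assumes "Hausdorff_space X" shows "weiss_system X eqv"
proof
 show "Hausdorff_space X" by (rule assms)
 show "eqv U V ==> openin X U & openin X V & U <= V" for U V unfolding eqv_def by blast
 show "eqv U W ==> eqv V Y ==> U <= V ==> V <= W ==> W <= Y ==> eqv W Y" for U V W Y using eqv_two_of_six(2)[of U V W Y] unfolding eqv_def by blast
qed (rule eqv_refl eqv_trans eqv_disjoint eqv_weiss; assumption)+

theorem theoremD:
  fixes r :: "'u rel"
    and C :: "'c sset"
    and p :: "nat \<Rightarrow> 'c \<Rightarrow> fin_cell"
    and M :: "('a, 's) strat_space"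
    and A :: "('a, 'c) prefact"
  assumes "universe r"
    and "symmetric_monoidal C p"
    and "tensor_presentable r C p"
    and "conical_manifold M"
    and "enough_good_disks M"
    and "factorization_algebra C p (pts M) A"
  shows "constructible C p M A \<longleftrightarrow> locally_constructible C p M A"
proof -
 have M: "stratified_space M" "Hausdorff_space (pts M)" using assms(4) unfolding conical_manifold_def by blast+
 interpret fact_algebra C p "pts M" A by unfold_locales (rule assms(2,6))+
 have W: "weiss_system (pts M) eqv" by (rule eqv_weiss_system[OF M(2)])
 show ?thesis
 proof
 assume c: "constructible C p M A"
 let ?X = "pt M"
 have "strat_restrict M ?X = M" using M(1) unfolding strat_restrict_def stratified_space_def by simp
 moreover have "restrict_prefact (pts M) ?X A = A" unfolding restrict_prefact_def subtopology_topspace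
 using sset_homD(3)[OF A(1)] by (intro ext) (simp add: extensional_restrict)
 ultimately show "locally_constructible C p M A" unfolding locally_constructible_def constructible_factorization_algebra_def
 using c assms(6) by (intro exI[of _ "{?X}"]) simp
 next
 assume "locally_constructible C p M A"
 then obtain Uv where U: "!!U. U:Uv ==> openin (pts M) U" "\<Union>Uv = pt M"
 "!!U. U:Uv ==> constructible_factorization_algebra C p (strat_restrict M U) (restrict_prefact (pts M) U A)"
 unfolding locally_constructible_def by (elim exE conjE) (metis (no_types))
 \<comment> \<open>A member of the cover serves as the neighbourhood: two charts with the same
   source have isomorphic images, and constructibility on that member applies to them.\<close>
 have "lcp M eqv" unfolding lcp_def
 proof
 fix y assume "y:pt M"
 then obtain U where yU: "U:Uv" "y:U" using U(2) by blast
 let ?A = "restrict_prefact (pts M) U A" let ?S = "subtopology (pts M) U"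
 have pR: "pts (strat_restrict M U) = ?S" by (simp add: strat_restrict_def)
 have c: "factorization_algebra C p ?S ?A" "constructible C p (strat_restrict M U) ?A"
 using U(3)[OF yU(1)] unfolding constructible_factorization_algebra_def pR by blast+
 interpret R: fact_algebra C p ?S ?A by unfold_locales (rule assms(2) c(1))+
 have UO: "openin (pts M) U" by (rule U(1)[OF yU(1)])
 have main: "eqv (ph ` cpt Z n) (ph' ` cpt Z n)"
 if Z: "conical_manifold_real Z" "compact_space (pts Z)" and ph: "semb (CR Z n) M ph" "semb (CR Z n) M ph'"
 "ph ` cpt Z n <= ph' ` cpt Z n" "ph' ` cpt Z n <= U" for Z :: "(real, real) strat_space" and n ph ph'
 proof -
 let ?D = "ph ` cpt Z n" and ?D' = "ph' ` cpt Z n"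
 have Zs: "stratified_space Z" using Z(1) by (cases rule: conical_manifold_real.cases)
 note surj = CR_strata_surj[OF Zs, of n]
 have DU: "?D <= U" using ph(3,4) by blast
 have o: "openin (pts M) ?D" "openin (pts M) ?D'" by (rule sembD(5)[OF ph(1)] sembD(5)[OF ph(2)])+
 have oS: "openin ?S ?D" "openin ?S ?D'" using o DU ph(4) UO openin_open_subtopology by blast+
 have cd: "conical_disk (strat_restrict M (py ` cpt Z n))" if "semb (CR Z n) M py" for py
 unfolding conical_disk_def using stratified_restrict[OF M(1)] Z iso_of_semb(1)[OF that surj] by blast
 have rsub: "strat (strat_restrict M D) ` topspace (pts (strat_restrict M D)) <= strata (strat_restrict M D)" for D by (auto simp: strat_restrict_def)
 have iso: "strat_iso (strat_restrict M ?D) (strat_restrict M ?D')"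
 by (rule strat_iso_trans[OF iso_of_semb(1)[OF ph(1) surj] iso_of_semb(2)[OF ph(2) surj] rsub])
 have "eqe C1 (extension_map ?S ?A ?D ?D')" by (rule c(2)[unfolded constructible_def embedded_disk_def pR, rule_format, OF _ _ ph(3)],
 unfold restrict_restrict[OF DU] restrict_restrict[OF ph(4)])
 (intro conjI oS cd ph(1,2) iso)+
 \<comment> \<open>Inside \<open>U\<close> the restricted algebra takes the same values on
   cells.\<close>
 moreover have "extension_map ?S ?A ?D ?D' = ext ?D ?D'"
 proof -
 let ?x = "\<lambda>i\<in>{..1::nat}. if i = 0 then ?D else ?D'"
 have x: "?x:cells (inclusion_nerve ops) 1" by (rule ext_cell) (use o ph(3) in auto)
 have x': "?x:cells (inclusion_nerve R.ops) 1" by (rule R.ext_cell) (use oS ph(3) in auto)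
 show ?thesis unfolding extension_map_def values_functor_def using x x' R.unary_in[OF x'] by (simp add: restrict_prefact_def)
 qed
 ultimately show ?thesis unfolding eqv_def using o ph(3) by simp
 qed
 show "EX U. openin (pts M) U & y:U & (ALL (Z :: (real, real) strat_space) n ph ph'. conical_manifold_real Z --> compact_space (pts Z) -->
 semb (CR Z n) M ph --> semb (CR Z n) M ph' -->
 ph ` cpt Z n <= ph' ` cpt Z n --> ph' ` cpt Z n <= U -->
 eqv (ph ` cpt Z n) (ph' ` cpt Z n))" by (intro exI[of _ U] conjI allI impI UO yU(2)) (rule main)
 qed
 note lM = this
 show "constructible C p M A" unfolding constructible_def
 proof (intro allI impI)
 fix D D' assume D: "embedded_disk M D" "embedded_disk M D'" "D <= D'" "strat_iso (strat_restrict M D) (strat_restrict M D')"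
 obtain Z :: "(real, real) strat_space" and n where Z: "conical_manifold_real Z" "compact_space (pts Z)" "strat_iso (strat_restrict M D') (CR Z n)"
 using D(2) unfolding embedded_disk_def conical_disk_def by blast
 have o: "openin (pts M) D" "openin (pts M) D'" using D(1,2) unfolding embedded_disk_def by blast+
 obtain ph' where ph': "semb (CR Z n) M ph'" "ph' ` cpt Z n = D'" by (rule semb_of_iso[OF M(1) o(2) Z(3)])
 \<comment> \<open>The isomorphism between the disks lets both be charted by one and the same
   cone.\<close>
 have "strat_iso (strat_restrict M D) (CR Z n)" by (rule strat_iso_trans[OF D(4) Z(3)]) (auto simp: strat_restrict_def)
 then obtain ph where ph: "semb (CR Z n) M ph" "ph ` cpt Z n = D" by (rule semb_of_iso[OF M(1) o(1)])
 have "eqv D D'" using disks_equivalence[OF W lM Z(1,2) ph(1) ph'(1)] D(3) unfolding ph(2) ph'(2) by blast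
 thus "eqe C1 (ext D D')" unfolding eqv_def by blast
 qed
 qed
qed

end
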